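(* Let $V,Q\in L_\infty(0,1)$ be complex-valued. For all $\alpha,\beta\in[0,1]$ the operator $\mathcal{H}(\alpha,\beta)$ is $m$-sectorial and its associated sesquilinear form in $L^2(0,1)$ is $$\mathfrak{h}(\alpha,\beta)[u,v]=(u',v')_{L^2(0,1)}+(V\mathcal{R}\mathcal{T}(\alpha)\mathcal{E}u,v)_{L^2(0,1)}+(Q\mathcal{R}\mathcal{T}(-\beta)\mathcal{E}u,v)_{L^2(0,1)}$$ on the domain $\mathfrak{D}(\mathfrak{h}(\alpha,\beta))=W_2^1(0,1)$. There exists a fixed number $\Lambda$ independent of $\alpha$ and $\beta$ such that the half-plane $\{\lambda\in\mathbb{C}:\operatorname{Re}\lambda\leqslant\Lambda\}$ is contained in the resolvent set of $\mathcal{H}(\alpha,\beta)$ for all $\alpha,\beta\in[0,1]$. For each $\lambda\in\mathbb{C}$ with $\operatorname{Re}\lambda\leqslant\Lambda$ the estimates $$\|(\mathcal{H}(\alpha,\beta)-\lambda)^{-1}\|_{L^2(0,1)\to W_2^2(0,1)}\leqslant C,$$ $$\|(\mathcal{H}(\alpha_1,\beta_1)-\lambda)^{-1}-(\mathcal{H}(\alpha_2,\beta_2)-\lambda)^{-1}\|_{L^2(0,1)\to W_2^2(0,1)}\leqslant C\big(|\alpha_1-\alpha_2|^{1/2}+|\beta_1-\beta_2|^{1/2}\big)$$ hold, where $C$ are some constants independent of $\alpha,\beta,\alpha_1,\beta_1,\alpha_2,\beta_2\in[0,1]$. The operator $\mathcal{H}(\alpha,\beta)$ has a compact resolvent and its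 spectrum consists of countably many eigenvalues with the only accumulation point at infinity. These eigenvalues are continuous in $\alpha$ and $\beta$.
   Context: $W_2^k(0,1)$ denotes the usual Sobolev space. $\mathcal{E}:L^2(0,1)\to L^2(\mathbb{R})$ is the operator of continuation by zero outside $(0,1)$, $\mathcal{R}:L^2(\mathbb{R})\to L^2(0,1)$ is the operator of restriction to $(0,1)$, and for $\alpha\in[-1,1]$ the translation operator in $L^2(\mathbb{R})$ is $(\mathcal{T}(\alpha)y)(x)=y(x+\alpha)$. For $V,Q\in L_\infty(0,1)$ complex-valued and $\alpha,\beta\in[0,1]$, put $\mathcal{B}(\alpha,\beta)=V\mathcal{R}\mathcal{T}(\alpha)\mathcal{E}+Q\mathcal{R}\mathcal{T}(-\beta)\mathcal{E}$, a bounded operator in $L^2(0,1)$. The operator $\mathcal{A}y=-y''$ in $L^2(0,1)$ has domain $\mathfrak{D}(\mathcal{A})=\{y\in W_2^2(0,1):y'(0)=y'(1)=0\}$. The operator $\mathcal{H}(\alpha,\beta)=\mathcal{A}+\mathcal{B}(\alpha,\beta)$ in $L^2(0,1)$ has domain $\mathfrak{D}(\mathcal{A})$; that is, $(\mathcal{H}(\alpha,\beta)y)(x)=-y''(x)+V(x)y(x+\alpha)+Q(x)y(x-\beta)$, where $y$ is continued by zero outside $[0,1]$. $\|\cdot\|_{X\to Y}$ is the norm of a bounded operator from a Banach space $X$ to a Banach space $Y$. *)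

theory Defs
  imports "HOL-Analysis.Analysis"
begin

section \<open>Complex inner product spaces\<close>

class complex_inner = real_inner +
  fixes scaleC :: "complex \<Rightarrow> 'a \<Rightarrow> 'a"  (infixr "*\<^sub>C" 75)
    and cinner :: "'a \<Rightarrow> 'a \<Rightarrow> complex"
  assumes scaleC_add_right: "a *\<^sub>C (x + y) = a *\<^sub>C x + a *\<^sub>C y"
    and scaleC_add_left: "(a + b) *\<^sub>C x = a *\<^sub>C x + b *\<^sub>C x"
    and scaleC_scaleC: "a *\<^sub>C b *\<^sub>C x = (a * b) *\<^sub>C x"
    and scaleC_of_real: "complex_of_real r *\<^sub>C x = r *\<^sub>R x"
    and cinner_commute: "cinner x y = cnj (cinner y x)"
    and cinner_add_left: "cinner (x + y) z = cinner x z + cinner y z"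
    and cinner_scaleC_left: "cinner (a *\<^sub>C x) y = a * cinner x y"
    and inner_eq_Re_cinner: "inner x y = Re (cinner x y)"

global_interpretation complex_vector: vector_space "scaleC :: complex \<Rightarrow> 'a \<Rightarrow> 'a::complex_inner"
proof
  show "1 *\<^sub>C x = x" for x :: 'a
    using scaleC_of_real[of 1 x] by simp
qed (simp_all add: scaleC_add_right scaleC_add_left scaleC_scaleC)

section \<open>Unbounded operators and sesquilinear forms\<close>

text \<open>
  An unbounded operator is a pair of a domain \<open>D\<close> and a function \<open>T\<close>, of which only the values
  on \<open>D\<close> matter. The notions of sectoriality and accretivity are those of Kato's
  \<^emph>\<open>Perturbation Theory for Linear Operators\<close>, Sections V.3.10 and VI.1--2.
\<close>

definition linear_operator :: "'a::complex_inner set \<Rightarrow> ('a \<Rightarrow> 'a) \<Rightarrow> bool" where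
  "linear_operator D T \<longleftrightarrow> complex_vector.subspace D \<and>
     (\<forall>u\<in>D. \<forall>v\<in>D. T (u + v) = T u + T v) \<and> (\<forall>c. \<forall>u\<in>D. T (c *\<^sub>C u) = c *\<^sub>C T u)"

definition resolvent :: "'a::complex_inner set \<Rightarrow> ('a \<Rightarrow> 'a) \<Rightarrow> complex \<Rightarrow> 'a \<Rightarrow> 'a" where
  "resolvent D T z = inv_into D (\<lambda>u. T u - z *\<^sub>C u)"

definition resolvent_set :: "'a::complex_inner set \<Rightarrow> ('a \<Rightarrow> 'a) \<Rightarrow> complex set" where
  "resolvent_set D T =
     {z. bij_betw (\<lambda>u. T u - z *\<^sub>C u) D UNIV \<and> bounded_linear (resolvent D T z)}"

definition spectrum :: "'a::complex_inner set \<Rightarrow> ('a \<Rightarrow> 'a) \<Rightarrow> complex set" where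
  "spectrum D T = - resolvent_set D T"

definition eigenvalues :: "'a::complex_inner set \<Rightarrow> ('a \<Rightarrow> 'a) \<Rightarrow> complex set" where
  "eigenvalues D T = {z. \<exists>u\<in>D. u \<noteq> 0 \<and> T u = z *\<^sub>C u}"

definition compact_operator :: "('a::complex_inner \<Rightarrow> 'a) \<Rightarrow> bool" where
  "compact_operator R \<longleftrightarrow> bounded_linear R \<and> (\<forall>S. bounded S \<longrightarrow> compact (closure (R ` S)))"

definition compact_resolvent :: "'a::complex_inner set \<Rightarrow> ('a \<Rightarrow> 'a) \<Rightarrow> bool" where
  "compact_resolvent D T \<longleftrightarrow> resolvent_set D T \<noteq> {} \<and>
     (\<forall>z\<in>resolvent_set D T. compact_operator (resolvent D T z))"

definition sector :: "real \<Rightarrow> real \<Rightarrow> complex set" where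
  "sector \<gamma> \<theta> = {z. \<bar>Arg (z - complex_of_real \<gamma>)\<bar> \<le> \<theta>}"

definition sectorial :: "'a::complex_inner set \<Rightarrow> ('a \<Rightarrow> 'a) \<Rightarrow> bool" where
  "sectorial D T \<longleftrightarrow> linear_operator D T \<and>
     (\<exists>\<gamma> \<theta>. 0 \<le> \<theta> \<and> \<theta> < pi / 2 \<and> (\<forall>u\<in>D. norm u = 1 \<longrightarrow> cinner (T u) u \<in> sector \<gamma> \<theta>))"

definition m_accretive :: "'a::complex_inner set \<Rightarrow> ('a \<Rightarrow> 'a) \<Rightarrow> bool" where
  "m_accretive D T \<longleftrightarrow> linear_operator D T \<and>
     (\<forall>z. 0 < Re z \<longrightarrow> - z \<in> resolvent_set D T \<and> onorm (resolvent D T (- z)) \<le> 1 / Re z)"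

definition quasi_m_accretive :: "'a::complex_inner set \<Rightarrow> ('a \<Rightarrow> 'a) \<Rightarrow> bool" where
  "quasi_m_accretive D T \<longleftrightarrow> (\<exists>a. m_accretive D (\<lambda>u. T u + a *\<^sub>C u))"

definition m_sectorial :: "'a::complex_inner set \<Rightarrow> ('a \<Rightarrow> 'a) \<Rightarrow> bool" where
  "m_sectorial D T \<longleftrightarrow> sectorial D T \<and> quasi_m_accretive D T"

definition sesquilinear_form :: "'a::complex_inner set \<Rightarrow> ('a \<Rightarrow> 'a \<Rightarrow> complex) \<Rightarrow> bool" where
  "sesquilinear_form W h \<longleftrightarrow> complex_vector.subspace W \<and>
     (\<forall>u\<in>W. \<forall>v\<in>W. \<forall>w\<in>W. h (u + v) w = h u w + h v w \<and> h w (u + v) = h w u + h w v) \<and>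
     (\<forall>c. \<forall>u\<in>W. \<forall>v\<in>W. h (c *\<^sub>C u) v = c * h u v \<and> h u (c *\<^sub>C v) = cnj c * h u v)"

definition sectorial_form :: "'a::complex_inner set \<Rightarrow> ('a \<Rightarrow> 'a \<Rightarrow> complex) \<Rightarrow> bool" where
  "sectorial_form W h \<longleftrightarrow> sesquilinear_form W h \<and>
     (\<exists>\<gamma> \<theta>. 0 \<le> \<theta> \<and> \<theta> < pi / 2 \<and> (\<forall>u\<in>W. norm u = 1 \<longrightarrow> h u u \<in> sector \<gamma> \<theta>))"

definition closed_form :: "'a::complex_inner set \<Rightarrow> ('a \<Rightarrow> 'a \<Rightarrow> complex) \<Rightarrow> bool" where
  "closed_form W h \<longleftrightarrow>
     (\<forall>X u. (\<forall>n::nat. X n \<in> W) \<and> X \<longlonglongrightarrow> u \<and>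
        (\<forall>e>0. \<exists>N. \<forall>m\<ge>N. \<forall>n\<ge>N. cmod (h (X n - X m) (X n - X m)) < e) \<longrightarrow>
        u \<in> W \<and> (\<lambda>n. h (X n - u) (X n - u)) \<longlonglongrightarrow> 0)"

text \<open>
  The form associated with an m-sectorial operator is the unique densely defined closed sectorial
  form from which the first representation theorem recovers the operator.
\<close>

definition associated_form ::
  "'a::complex_inner set \<Rightarrow> ('a \<Rightarrow> 'a) \<Rightarrow> 'a set \<Rightarrow> ('a \<Rightarrow> 'a \<Rightarrow> complex) \<Rightarrow> bool" where
  "associated_form D T W h \<longleftrightarrow>
     sectorial_form W h \<and> closed_form W h \<and> closure W = UNIV \<and>
     D = {u \<in> W. \<exists>f. \<forall>v\<in>W. h u v = cinner f v} \<and>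
     (\<forall>u\<in>D. \<forall>v\<in>W. h u v = cinner (T u) v)"

text \<open>The kernel of the \<open>n\<close>-th power of \<open>T - z\<close>, with the natural domain of that power.\<close>

primrec iterated_kernel :: "'a::complex_inner set \<Rightarrow> ('a \<Rightarrow> 'a) \<Rightarrow> complex \<Rightarrow> nat \<Rightarrow> 'a set" where
  "iterated_kernel D T z 0 = {0}"
| "iterated_kernel D T z (Suc n) = {u \<in> D. T u - z *\<^sub>C u \<in> iterated_kernel D T z n}"

definition root_subspace :: "'a::complex_inner set \<Rightarrow> ('a \<Rightarrow> 'a) \<Rightarrow> complex \<Rightarrow> 'a set" where
  "root_subspace D T z = (\<Union>n. iterated_kernel D T z n)"

text \<open>
  \<open>has_eigenvalue_count D T U n\<close>: the set \<open>U\<close> contains exactly \<open>n\<close> eigenvalues, counted with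
  algebraic multiplicity. Finiteness is required explicitly because \<open>complex_vector.dim\<close> and sums
  take the value 0 in the infinite case.
\<close>

definition has_eigenvalue_count ::
  "'a::complex_inner set \<Rightarrow> ('a \<Rightarrow> 'a) \<Rightarrow> complex set \<Rightarrow> nat \<Rightarrow> bool" where
  "has_eigenvalue_count D T U n \<longleftrightarrow>
     finite (eigenvalues D T \<inter> U) \<and>
     (\<forall>z\<in>eigenvalues D T \<inter> U. \<exists>S. finite S \<and> root_subspace D T z \<subseteq> complex_vector.span S) \<and>
     n = (\<Sum>z\<in>eigenvalues D T \<inter> U. complex_vector.dim (root_subspace D T z))"

text \<open>
  Continuity of the eigenvalues of a family of operators in the usual sense of perturbation theory:
  if no eigenvalue at the parameter \<open>p\<close> lies on the boundary of a disc, then the same is true for all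
  parameters near \<open>p\<close>, and the number of eigenvalues in the disc, counted with algebraic
  multiplicity, is the same. (An enumeration by single-valued continuous functions need not exist
  for nonreal eigenvalues depending on two parameters.)
\<close>

definition eigenvalues_continuous_on ::
  "'p::metric_space set \<Rightarrow> ('p \<Rightarrow> 'a::complex_inner set) \<Rightarrow> ('p \<Rightarrow> 'a \<Rightarrow> 'a) \<Rightarrow> bool" where
  "eigenvalues_continuous_on P D T \<longleftrightarrow>
     (\<forall>p\<in>P. \<forall>c r. 0 < r \<and> eigenvalues (D p) (T p) \<inter> sphere c r = {} \<longrightarrow>
        (\<exists>n. has_eigenvalue_count (D p) (T p) (ball c r) n \<and>
          (\<forall>\<^sub>F q in at p within P. eigenvalues (D q) (T q) \<inter> sphere c r = {} \<and>
             has_eigenvalue_count (D q) (T q) (ball c r) n)))"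

section \<open>The spaces \<open>L\<^sup>2\<close> and \<open>L\<^sup>\<infinity>\<close>\<close>

text \<open>
  The type parameter of \<open>L2\<close> and \<open>Linf\<close> only serves to name an open subset of the real line:
  \<open>real L2\<close> is the space over the whole line, \<open>unit_interval L2\<close> the one over the interval (0,1).
\<close>

class region =
  fixes region :: "'a itself \<Rightarrow> real set"
  assumes open_region: "open (region TYPE('a))"

instantiation real :: region
begin
definition region_real :: "real itself \<Rightarrow> real set" where "region_real _ = UNIV"
instance by standard (simp add: region_real_def)
end

typedef unit_interval = "{0<..<1::real}"
  by (rule exI[of _ "1/2"]) simp

instantiation unit_interval :: region
begin
definition region_unit_interval :: "unit_interval itself \<Rightarrow> real set"
  where "region_unit_interval _ = {0<..<1}"
instance by standard (simp add: region_unit_interval_def)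
end

abbreviation region_measure :: "'r::region itself \<Rightarrow> real measure" where
  "region_measure r \<equiv> lebesgue_on (region r)"

definition square_integrable :: "'r::region itself \<Rightarrow> (real \<Rightarrow> complex) \<Rightarrow> bool" where
  "square_integrable r f \<longleftrightarrow> f \<in> borel_measurable (region_measure r) \<and>
     integrable (region_measure r) (\<lambda>x. (cmod (f x))\<^sup>2)"

definition L2_rel :: "'r::region itself \<Rightarrow> (real \<Rightarrow> complex) \<Rightarrow> (real \<Rightarrow> complex) \<Rightarrow> bool" where
  "L2_rel r f g \<longleftrightarrow> square_integrable r f \<and> square_integrable r g \<and>
     (AE x in region_measure r. f x = g x)"

definition essentially_bounded :: "'r::region itself \<Rightarrow> (real \<Rightarrow> complex) \<Rightarrow> bool" where
  "essentially_bounded r f \<longleftrightarrow> f \<in> borel_measurable (region_measure r) \<and>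
     (\<exists>K. AE x in region_measure r. cmod (f x) \<le> K)"

definition Linf_rel :: "'r::region itself \<Rightarrow> (real \<Rightarrow> complex) \<Rightarrow> (real \<Rightarrow> complex) \<Rightarrow> bool" where
  "Linf_rel r f g \<longleftrightarrow> essentially_bounded r f \<and> essentially_bounded r g \<and>
     (AE x in region_measure r. f x = g x)"

lemma square_integrable_zero: "square_integrable r (\<lambda>_. 0)"
  by (simp add: square_integrable_def)

lemma essentially_bounded_zero: "essentially_bounded r (\<lambda>_. 0)"
  by (auto simp: essentially_bounded_def intro!: exI[of _ 0])

lemma part_equivp_L2_rel: "part_equivp (L2_rel (r :: 'r::region itself))"
proof (rule part_equivpI)
  show "\<exists>f. L2_rel r f f"
    using square_integrable_zero by (auto simp: L2_rel_def)
  show "symp (L2_rel r)"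
    by (auto simp: symp_def L2_rel_def elim: AE_mp)
  show "transp (L2_rel r)"
    unfolding transp_def L2_rel_def by (auto elim: AE_mp)
qed

lemma part_equivp_Linf_rel: "part_equivp (Linf_rel (r :: 'r::region itself))"
proof (rule part_equivpI)
  show "\<exists>f. Linf_rel r f f"
    using essentially_bounded_zero by (auto simp: Linf_rel_def)
  show "symp (Linf_rel r)"
    by (auto simp: symp_def Linf_rel_def elim: AE_mp)
  show "transp (Linf_rel r)"
    unfolding transp_def Linf_rel_def by (auto elim: AE_mp)
qed

text \<open>
  The quotients are set up by hand because a partial \<open>quotient_type\<close> does not support
  a phantom type parameter.
\<close>

typedef (overloaded) 'r L2 =
  "{S. \<exists>f. square_integrable TYPE('r::region) f \<and> S = {g. L2_rel TYPE('r) f g}}"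
  using square_integrable_zero by blast

definition abs_L2 :: "(real \<Rightarrow> complex) \<Rightarrow> 'r::region L2" where
  "abs_L2 f = Abs_L2 {g. L2_rel TYPE('r) f g}"

definition rep_L2 :: "'r::region L2 \<Rightarrow> real \<Rightarrow> complex" where
  "rep_L2 u = (SOME f. f \<in> Rep_L2 u)"

definition cr_L2 :: "(real \<Rightarrow> complex) \<Rightarrow> 'r::region L2 \<Rightarrow> bool" where
  "cr_L2 f u \<longleftrightarrow> L2_rel TYPE('r) f f \<and> abs_L2 f = u"

lemma Quotient_L2: "Quotient (L2_rel TYPE('r::region)) abs_L2 rep_L2 (cr_L2 :: _ \<Rightarrow> 'r L2 \<Rightarrow> bool)"
proof -
  let ?R = "L2_rel TYPE('r)"
  have sym: "?R f g \<Longrightarrow> ?R g f" for f g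
    by (rule part_equivp_symp[OF part_equivp_L2_rel])
  have trans: "?R f g \<Longrightarrow> ?R g h \<Longrightarrow> ?R f h" for f g h
    by (rule part_equivp_transp[OF part_equivp_L2_rel])
  have refl_iff: "square_integrable TYPE('r) f \<longleftrightarrow> ?R f f" for f
    by (simp add: L2_rel_def)
  have rep: "?R (rep_L2 u) (rep_L2 u) \<and> Rep_L2 u = {g. ?R (rep_L2 u) g}" for u :: "'r L2"
  proof -
    obtain f where f: "?R f f" "Rep_L2 u = {g. ?R f g}"
      using Rep_L2[of u] by (auto simp: refl_iff)
    have "rep_L2 u \<in> Rep_L2 u"
      unfolding rep_L2_def by (rule someI[of _ f]) (simp add: f)
    then have fr: "?R f (rep_L2 u)"
      using f by simp
    have "?R (rep_L2 u) (rep_L2 u)"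
      by (rule trans[OF sym[OF fr] fr])
    moreover have "Rep_L2 u = {g. ?R (rep_L2 u) g}"
      unfolding f(2) using trans[OF fr] trans[OF sym[OF fr]] by auto
    ultimately show ?thesis by blast
  qed
  have abs: "(abs_L2 f :: 'r L2) = abs_L2 g \<longleftrightarrow> ?R f g" if "?R f f" "?R g g" for f g
  proof -
    have "(abs_L2 f :: 'r L2) = abs_L2 g \<longleftrightarrow> {h. ?R f h} = {h. ?R g h}"
      unfolding abs_L2_def by (rule Abs_L2_inject) (use that refl_iff in auto)
    also have "\<dots> \<longleftrightarrow> ?R f g"
      using that by (auto dest: sym trans)
    finally show ?thesis .
  qed
  show ?thesis
    unfolding Quotient_def
  proof (intro conjI allI)
    show "abs_L2 (rep_L2 u) = u" for u :: "'r L2"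
      unfolding abs_L2_def using rep[of u] Rep_L2_inverse[of u] by simp
    show "?R (rep_L2 u) (rep_L2 u)" for u :: "'r L2"
      using rep by simp
    show "?R f g \<longleftrightarrow> ?R f f \<and> ?R g g \<and> (abs_L2 f :: 'r L2) = abs_L2 g" for f g
      using abs[of f g] by (auto dest: sym trans)
  qed (auto simp: cr_L2_def fun_eq_iff)
qed

setup_lifting Quotient_L2

typedef (overloaded) 'r Linf =
  "{S. \<exists>f. essentially_bounded TYPE('r::region) f \<and> S = {g. Linf_rel TYPE('r) f g}}"
  using essentially_bounded_zero by blast

definition abs_Linf :: "(real \<Rightarrow> complex) \<Rightarrow> 'r::region Linf" where
  "abs_Linf f = Abs_Linf {g. Linf_rel TYPE('r) f g}"

definition rep_Linf :: "'r::region Linf \<Rightarrow> real \<Rightarrow> complex" where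
  "rep_Linf u = (SOME f. f \<in> Rep_Linf u)"

definition cr_Linf :: "(real \<Rightarrow> complex) \<Rightarrow> 'r::region Linf \<Rightarrow> bool" where
  "cr_Linf f u \<longleftrightarrow> Linf_rel TYPE('r) f f \<and> abs_Linf f = u"

lemma Quotient_Linf: "Quotient (Linf_rel TYPE('r::region)) abs_Linf rep_Linf (cr_Linf :: _ \<Rightarrow> 'r Linf \<Rightarrow> bool)"
proof -
  let ?R = "Linf_rel TYPE('r)"
  have sym: "?R f g \<Longrightarrow> ?R g f" for f g
    by (rule part_equivp_symp[OF part_equivp_Linf_rel])
  have trans: "?R f g \<Longrightarrow> ?R g h \<Longrightarrow> ?R f h" for f g h
    by (rule part_equivp_transp[OF part_equivp_Linf_rel])
  have refl_iff: "essentially_bounded TYPE('r) f \<longleftrightarrow> ?R f f" for f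
    by (simp add: Linf_rel_def)
  have rep: "?R (rep_Linf u) (rep_Linf u) \<and> Rep_Linf u = {g. ?R (rep_Linf u) g}" for u :: "'r Linf"
  proof -
    obtain f where f: "?R f f" "Rep_Linf u = {g. ?R f g}"
      using Rep_Linf[of u] by (auto simp: refl_iff)
    have "rep_Linf u \<in> Rep_Linf u"
      unfolding rep_Linf_def by (rule someI[of _ f]) (simp add: f)
    then have fr: "?R f (rep_Linf u)"
      using f by simp
    have "?R (rep_Linf u) (rep_Linf u)"
      by (rule trans[OF sym[OF fr] fr])
    moreover have "Rep_Linf u = {g. ?R (rep_Linf u) g}"
      unfolding f(2) using trans[OF fr] trans[OF sym[OF fr]] by auto
    ultimately show ?thesis by blast
  qed
  have abs: "(abs_Linf f :: 'r Linf) = abs_Linf g \<longleftrightarrow> ?R f g" if "?R f f" "?R g g" for f g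
  proof -
    have "(abs_Linf f :: 'r Linf) = abs_Linf g \<longleftrightarrow> {h. ?R f h} = {h. ?R g h}"
      unfolding abs_Linf_def by (rule Abs_Linf_inject) (use that refl_iff in auto)
    also have "\<dots> \<longleftrightarrow> ?R f g"
      using that by (auto dest: sym trans)
    finally show ?thesis .
  qed
  show ?thesis
    unfolding Quotient_def
  proof (intro conjI allI)
    show "abs_Linf (rep_Linf u) = u" for u :: "'r Linf"
      unfolding abs_Linf_def using rep[of u] Rep_Linf_inverse[of u] by simp
    show "?R (rep_Linf u) (rep_Linf u)" for u :: "'r Linf"
      using rep by simp
    show "?R f g \<longleftrightarrow> ?R f f \<and> ?R g g \<and> (abs_Linf f :: 'r Linf) = abs_Linf g" for f g
      using abs[of f g] by (auto dest: sym trans)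
  qed (auto simp: cr_Linf_def fun_eq_iff)
qed

setup_lifting Quotient_Linf

lemma square_integrable_add:
  assumes "square_integrable r f" "square_integrable r g"
  shows "square_integrable r (\<lambda>x. f x + g x)"
proof -
  have *: "(cmod (a + b))\<^sup>2 \<le> 2 * (cmod a)\<^sup>2 + 2 * (cmod b)\<^sup>2" for a b
  proof -
    have "(cmod (a + b))\<^sup>2 \<le> (cmod a + cmod b)\<^sup>2"
      by (simp add: norm_triangle_ineq power_mono)
    also have "\<dots> \<le> 2 * (cmod a)\<^sup>2 + 2 * (cmod b)\<^sup>2"
      using zero_le_power2[of "cmod a - cmod b"] by (simp add: power2_eq_square algebra_simps)
    finally show ?thesis .
  qed
  have [measurable]: "f \<in> borel_measurable (region_measure r)" "g \<in> borel_measurable (region_measure r)"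
    using assms by (auto simp: square_integrable_def)
  have "integrable (region_measure r) (\<lambda>x. 2 * (cmod (f x))\<^sup>2 + 2 * (cmod (g x))\<^sup>2)"
    using assms by (auto simp: square_integrable_def)
  then have "integrable (region_measure r) (\<lambda>x. (cmod (f x + g x))\<^sup>2)"
    by (rule Bochner_Integration.integrable_bound) (use * in auto)
  then show ?thesis
    by (simp add: square_integrable_def)
qed

lemma square_integrable_mult_bounded:
  assumes "essentially_bounded r v" "square_integrable r f"
  shows "square_integrable r (\<lambda>x. v x * f x)"
proof -
  obtain K where K: "AE x in region_measure r. cmod (v x) \<le> K"
    using assms by (auto simp: essentially_bounded_def)
  have [measurable]: "f \<in> borel_measurable (region_measure r)" "v \<in> borel_measurable (region_measure r)"
    using assms by (auto simp: square_integrable_def essentially_bounded_def)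
  have "integrable (region_measure r) (\<lambda>x. K\<^sup>2 * (cmod (f x))\<^sup>2)"
    using assms by (auto simp: square_integrable_def)
  then have "integrable (region_measure r) (\<lambda>x. (cmod (v x * f x))\<^sup>2)"
  proof (rule Bochner_Integration.integrable_bound)
    show "AE x in region_measure r. norm ((cmod (v x * f x))\<^sup>2) \<le> norm (K\<^sup>2 * (cmod (f x))\<^sup>2)"
      using K by eventually_elim (auto simp: norm_mult power_mult_distrib intro!: mult_right_mono power_mono)
  qed measurable
  then show ?thesis
    by (simp add: square_integrable_def)
qed

lemma square_integrable_cmult:
  assumes "square_integrable r f"
  shows "square_integrable r (\<lambda>x. c * f x)"
proof (rule square_integrable_mult_bounded[OF _ assms])
  show "essentially_bounded r (\<lambda>_. c)"
    by (auto simp: essentially_bounded_def intro!: exI[of _ "cmod c"])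
qed

lemma square_integrable_uminus: "square_integrable r f \<Longrightarrow> square_integrable r (\<lambda>x. - f x)"
  using square_integrable_cmult[of r f "-1"] by simp

lemma square_integrable_diff:
  "square_integrable r f \<Longrightarrow> square_integrable r g \<Longrightarrow> square_integrable r (\<lambda>x. f x - g x)"
  using square_integrable_add[OF _ square_integrable_uminus, of r f g] by simp

lemma integrable_cnj_mult:
  assumes "square_integrable r f" "square_integrable r g"
  shows "integrable (region_measure r) (\<lambda>x. f x * cnj (g x))"
proof -
  have *: "a * b \<le> a\<^sup>2 + b\<^sup>2" if "0 \<le> a" "0 \<le> b" for a b :: real
    using sum_squares_bound[of a b] mult_nonneg_nonneg[OF that] by linarith
  have [measurable]: "f \<in> borel_measurable (region_measure r)" "g \<in> borel_measurable (region_measure r)"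
    using assms by (auto simp: square_integrable_def)
  have [measurable]: "(\<lambda>x. cnj (g x)) \<in> borel_measurable (region_measure r)"
    by (rule measurable_compose[OF _ borel_measurable_continuous_onI]) (auto intro!: continuous_intros)
  have "integrable (region_measure r) (\<lambda>x. (cmod (f x))\<^sup>2 + (cmod (g x))\<^sup>2)"
    using assms by (auto simp: square_integrable_def)
  then show ?thesis
    by (rule Bochner_Integration.integrable_bound) (auto simp: norm_mult *)
qed

instantiation L2 :: (region) complex_inner
begin

lift_definition zero_L2 :: "'a L2" is "\<lambda>_. 0"
  by (simp add: L2_rel_def square_integrable_zero)

lift_definition plus_L2 :: "'a L2 \<Rightarrow> 'a L2 \<Rightarrow> 'a L2" is "\<lambda>f g x. f x + g x"
  by (auto simp: L2_rel_def intro!: square_integrable_add)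

lift_definition uminus_L2 :: "'a L2 \<Rightarrow> 'a L2" is "\<lambda>f x. - f x"
  by (auto simp: L2_rel_def intro!: square_integrable_uminus)

lift_definition minus_L2 :: "'a L2 \<Rightarrow> 'a L2 \<Rightarrow> 'a L2" is "\<lambda>f g x. f x - g x"
  by (auto simp: L2_rel_def intro!: square_integrable_diff)

lift_definition scaleC_L2 :: "complex \<Rightarrow> 'a L2 \<Rightarrow> 'a L2" is "\<lambda>c f x. c * f x"
  by (auto simp: L2_rel_def intro!: square_integrable_cmult)

lift_definition cinner_L2 :: "'a L2 \<Rightarrow> 'a L2 \<Rightarrow> complex"
  is "\<lambda>f g. integral\<^sup>L (region_measure TYPE('a)) (\<lambda>x. f x * cnj (g x))"
proof -
  fix f f' g g'
  assume *: "L2_rel TYPE('a) f f'" "L2_rel TYPE('a) g g'"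
  show "(\<integral>x. f x * cnj (g x) \<partial>region_measure TYPE('a)) = (\<integral>x. f' x * cnj (g' x) \<partial>region_measure TYPE('a))"
  proof (rule integral_cong_AE)
    show "AE x in region_measure TYPE('a). f x * cnj (g x) = f' x * cnj (g' x)"
      using * by (auto simp: L2_rel_def)
  qed (use * in \<open>auto simp: L2_rel_def intro!: borel_measurable_integrable integrable_cnj_mult\<close>)
qed

definition scaleR_L2 :: "real \<Rightarrow> 'a L2 \<Rightarrow> 'a L2" where "scaleR_L2 c u = complex_of_real c *\<^sub>C u"
definition inner_L2 :: "'a L2 \<Rightarrow> 'a L2 \<Rightarrow> real" where "inner_L2 u v = Re (cinner u v)"
definition norm_L2 :: "'a L2 \<Rightarrow> real" where "norm_L2 u = sqrt (inner u u)"
definition sgn_L2 :: "'a L2 \<Rightarrow> 'a L2" where "sgn_L2 u = inverse (norm u) *\<^sub>R u"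
definition dist_L2 :: "'a L2 \<Rightarrow> 'a L2 \<Rightarrow> real" where "dist_L2 u v = norm (u - v)"
definition uniformity_L2 :: "('a L2 \<times> 'a L2) filter"
  where "uniformity_L2 = (INF e\<in>{0<..}. principal {(u, v). dist u v < e})"
definition open_L2 :: "'a L2 set \<Rightarrow> bool"
  where "open_L2 U \<longleftrightarrow> (\<forall>u\<in>U. eventually (\<lambda>(u', v). u' = u \<longrightarrow> v \<in> U) uniformity)"

instance
proof
  fix u v w :: "'a L2" and a b :: complex and c d :: real
  show add_assoc: "u + v + w = u + (v + w)"
    by transfer (auto simp: L2_rel_def add.assoc intro!: square_integrable_add)
  show "u + v = v + u"
    by transfer (auto simp: L2_rel_def add.commute intro!: square_integrable_add)
  show "0 + u = u"
    by transfer (auto simp: L2_rel_def)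
  show "- u + u = 0"
    by transfer (auto simp: L2_rel_def square_integrable_zero)
  show "u - v = u + - v"
    by transfer (auto simp: L2_rel_def intro!: square_integrable_diff)
  show C1: "a *\<^sub>C (u + v) = a *\<^sub>C u + a *\<^sub>C v" for a and u v :: "'a L2"
    by transfer (auto simp: L2_rel_def ring_distribs intro!: square_integrable_add square_integrable_cmult)
  show C2: "(a + b) *\<^sub>C u = a *\<^sub>C u + b *\<^sub>C u" for a b and u :: "'a L2"
    by transfer (auto simp: L2_rel_def ring_distribs intro!: square_integrable_add square_integrable_cmult)
  show C3: "a *\<^sub>C b *\<^sub>C u = (a * b) *\<^sub>C u" for a b and u :: "'a L2"
    by transfer (auto simp: L2_rel_def mult.assoc intro!: square_integrable_cmult)
  show "complex_of_real c *\<^sub>C u = c *\<^sub>R u"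
    by (simp add: scaleR_L2_def)
  show "c *\<^sub>R (u + v) = c *\<^sub>R u + c *\<^sub>R v" "(c + d) *\<^sub>R u = c *\<^sub>R u + d *\<^sub>R u"
    "c *\<^sub>R d *\<^sub>R u = (c * d) *\<^sub>R u"
    by (simp_all add: scaleR_L2_def C1 C2 C3)
  show "1 *\<^sub>R u = u"
    unfolding scaleR_L2_def by transfer (auto simp: L2_rel_def)
  show I1: "cinner u v = cnj (cinner v u)" for u v :: "'a L2"
    by transfer (simp add: mult.commute flip: Bochner_Integration.integral_cnj)
  show I2: "cinner (u + v) w = cinner u w + cinner v w" for u v w :: "'a L2"
    by transfer (simp add: L2_rel_def ring_distribs integrable_cnj_mult)
  show I3: "cinner (a *\<^sub>C u) v = a * cinner u v" for a and u v :: "'a L2"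
    by transfer (simp add: mult.assoc)
  show "inner u v = Re (cinner u v)"
    by (simp add: inner_L2_def)
  show "inner u v = inner v u"
    unfolding inner_L2_def by (subst I1) simp
  show "inner (u + v) w = inner u w + inner v w"
    by (simp add: inner_L2_def I2)
  show "inner (c *\<^sub>R u) v = c * inner u v"
    by (simp add: inner_L2_def scaleR_L2_def I3)
  have *: "Re (\<integral>x. f x * cnj (f x) \<partial>region_measure TYPE('a)) = (\<integral>x. (cmod (f x))\<^sup>2 \<partial>region_measure TYPE('a))"
    if "square_integrable TYPE('a) f" for f
  proof -
    have "(\<integral>x. f x * cnj (f x) \<partial>region_measure TYPE('a)) =
        (\<integral>x. complex_of_real ((cmod (f x))\<^sup>2) \<partial>region_measure TYPE('a))"
      by (simp only: complex_norm_square)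
    also have "\<dots> = complex_of_real (\<integral>x. (cmod (f x))\<^sup>2 \<partial>region_measure TYPE('a))"
      by (rule integral_complex_of_real)
    finally show ?thesis by simp
  qed
  show "0 \<le> inner u u"
    unfolding inner_L2_def by transfer (simp add: L2_rel_def *)
  show "inner u u = 0 \<longleftrightarrow> u = 0"
    unfolding inner_L2_def
  proof transfer
    fix f assume f: "L2_rel TYPE('a) f f"
    then have sq: "square_integrable TYPE('a) f" by (simp add: L2_rel_def)
    have "(\<integral>x. (cmod (f x))\<^sup>2 \<partial>region_measure TYPE('a)) = 0 \<longleftrightarrow>
        (AE x in region_measure TYPE('a). (cmod (f x))\<^sup>2 = 0)"
      using sq by (intro integral_nonneg_eq_0_iff_AE) (auto simp: square_integrable_def)
    then show "Re (\<integral>x. f x * cnj (f x) \<partial>region_measure TYPE('a)) = 0 \<longleftrightarrow> L2_rel TYPE('a) f (\<lambda>_. 0)"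
      using sq by (simp add: * L2_rel_def square_integrable_zero)
  qed
qed (simp_all add: norm_L2_def sgn_L2_def dist_L2_def uniformity_L2_def open_L2_def)

end

section \<open>Multiplication, continuation by zero, restriction and translation\<close>

lift_definition mult_op :: "'r::region Linf \<Rightarrow> 'r L2 \<Rightarrow> 'r L2" is "\<lambda>v f x. v x * f x"
  by (auto simp: L2_rel_def Linf_rel_def intro!: square_integrable_mult_bounded)

lemma measurable_continuation:
  fixes f :: "real \<Rightarrow> complex"
  assumes "f \<in> borel_measurable (lebesgue_on {0<..<1})"
  shows "(\<lambda>x. if x \<in> {0<..<1} then f x else 0) \<in> borel_measurable lebesgue"
  using assms by (rule borel_measurable_if_I) simp

lift_definition continuation :: "unit_interval L2 \<Rightarrow> real L2"
  is "\<lambda>f x. if x \<in> {0<..<1} then f x else 0"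
proof -
  have sq: "square_integrable TYPE(real) (\<lambda>x. if x \<in> {0<..<1} then f x else 0)"
    if "square_integrable TYPE(unit_interval) f" for f
  proof -
    have "integrable lebesgue (\<lambda>x. indicator {0<..<1} x *\<^sub>R (cmod (f x))\<^sup>2)"
      using that by (simp add: square_integrable_def region_unit_interval_def integrable_restrict_space)
    moreover have "(\<lambda>x. indicator {0<..<1} x *\<^sub>R (cmod (f x))\<^sup>2) =
        (\<lambda>x. (cmod (if x \<in> {0<..<1} then f x else 0))\<^sup>2)"
      by (auto simp: indicator_def)
    ultimately show ?thesis
      using that measurable_continuation[of f]
      by (simp add: square_integrable_def region_unit_interval_def region_real_def lebesgue_on_UNIV_eq)
  qed
  fix f g assume "L2_rel TYPE(unit_interval) f g"
  then show "L2_rel TYPE(real) (\<lambda>x. if x \<in> {0<..<1} then f x else 0) (\<lambda>x. if x \<in> {0<..<1} then g x else 0)"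
    using sq by (auto simp: L2_rel_def region_unit_interval_def region_real_def lebesgue_on_UNIV_eq
        AE_restrict_space_iff elim: AE_mp)
qed

lift_definition restriction :: "real L2 \<Rightarrow> unit_interval L2" is "\<lambda>f. f"
proof -
  have sq: "square_integrable TYPE(unit_interval) f" if "square_integrable TYPE(real) f" for f
  proof -
    have "integrable lebesgue (\<lambda>x. indicator {0<..<1} x *\<^sub>R (cmod (f x))\<^sup>2)"
      using that by (intro integrable_mult_indicator)
        (auto simp: square_integrable_def region_real_def lebesgue_on_UNIV_eq)
    then show ?thesis
      using that by (auto simp: square_integrable_def region_unit_interval_def region_real_def
          lebesgue_on_UNIV_eq integrable_restrict_space intro: measurable_restrict_space1)
  qed
  fix f g assume "L2_rel TYPE(real) f g"
  then show "L2_rel TYPE(unit_interval) f g"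
    using sq by (auto simp: L2_rel_def region_unit_interval_def region_real_def lebesgue_on_UNIV_eq
        AE_restrict_space_iff elim: AE_mp)
qed

lemma measurable_translate: "(\<lambda>x::real. x + a) \<in> lebesgue \<rightarrow>\<^sub>M lebesgue"
  and distr_translate: "distr lebesgue lebesgue (\<lambda>x::real. x + a) = lebesgue"
proof -
  show "(\<lambda>x::real. x + a) \<in> lebesgue \<rightarrow>\<^sub>M lebesgue"
    using lebesgue_affine_measurable[of "\<lambda>_::real. 1" a] by (simp add: add.commute)
  show "distr lebesgue lebesgue (\<lambda>x::real. x + a) = lebesgue"
    using lebesgue_affine_euclidean[of "\<lambda>_::real. 1" a] by (simp add: add.commute density_1)
qed

lift_definition translation :: "real \<Rightarrow> real L2 \<Rightarrow> real L2" is "\<lambda>a f x. f (x + a)"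
proof -
  fix a :: real
  have sq: "square_integrable TYPE(real) (\<lambda>x. f (x + a))" if "square_integrable TYPE(real) f" for f
  proof -
    have f: "f \<in> borel_measurable lebesgue" "integrable lebesgue (\<lambda>x. (cmod (f x))\<^sup>2)"
      using that by (auto simp: square_integrable_def region_real_def lebesgue_on_UNIV_eq)
    have "integrable (distr lebesgue lebesgue (\<lambda>x. x + a)) (\<lambda>x. (cmod (f x))\<^sup>2)"
      using f by (simp add: distr_translate)
    then have "integrable lebesgue (\<lambda>x. (cmod (f (x + a)))\<^sup>2)"
      by (rule integrable_distr[OF measurable_translate])
    then show ?thesis
      using measurable_compose[OF measurable_translate f(1)]
      by (simp add: square_integrable_def region_real_def lebesgue_on_UNIV_eq)
  qed
  fix f g assume fg: "L2_rel TYPE(real) f g"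
  then have "AE x in distr lebesgue lebesgue (\<lambda>x. x + a). f x = g x"
    unfolding distr_translate L2_rel_def region_real_def lebesgue_on_UNIV_eq by blast
  then have "AE x in lebesgue. f (x + a) = g (x + a)"
    by (rule AE_distrD[OF measurable_translate])
  then show "L2_rel TYPE(real) (\<lambda>x. f (x + a)) (\<lambda>x. g (x + a))"
    using fg sq unfolding L2_rel_def region_real_def lebesgue_on_UNIV_eq by blast
qed

section \<open>Sobolev spaces\<close>

definition test_function :: "real set \<Rightarrow> (real \<Rightarrow> real) \<Rightarrow> bool" where
  "test_function U \<phi> \<longleftrightarrow> (\<forall>n. (deriv ^^ n) \<phi> differentiable_on UNIV) \<and>
     (\<exists>K. compact K \<and> K \<subseteq> U \<and> (\<forall>x. x \<notin> K \<longrightarrow> \<phi> x = 0))"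

lift_definition has_weak_derivative :: "'r::region L2 \<Rightarrow> 'r L2 \<Rightarrow> bool"
  is "\<lambda>f g. \<forall>\<phi>. test_function (region TYPE('r)) \<phi> \<longrightarrow>
    (\<integral>x. f x * complex_of_real (deriv \<phi> x) \<partial>region_measure TYPE('r)) =
    - (\<integral>x. g x * complex_of_real (\<phi> x) \<partial>region_measure TYPE('r))"
proof -
  have int: "(\<integral>x. f x * complex_of_real (\<phi> x) \<partial>region_measure TYPE('r)) =
      (\<integral>x. f' x * complex_of_real (\<phi> x) \<partial>region_measure TYPE('r))"
    if "L2_rel TYPE('r) f f'" "\<phi> differentiable_on UNIV" for f f' and \<phi> :: "real \<Rightarrow> real"
  proof (rule integral_cong_AE)
    have "\<phi> \<in> borel_measurable borel"
      using differentiable_imp_continuous_on[OF that(2)] by (rule borel_measurable_continuous_onI)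
    then have "\<phi> \<in> borel_measurable lebesgue"
      by (simp add: measurable_completion)
    then have [measurable]: "\<phi> \<in> borel_measurable (region_measure TYPE('r))"
      by (rule measurable_restrict_space1)
    have [measurable]: "f \<in> borel_measurable (region_measure TYPE('r))"
      "f' \<in> borel_measurable (region_measure TYPE('r))"
      using that by (auto simp: L2_rel_def square_integrable_def)
    show "(\<lambda>x. f x * complex_of_real (\<phi> x)) \<in> borel_measurable (region_measure TYPE('r))"
      "(\<lambda>x. f' x * complex_of_real (\<phi> x)) \<in> borel_measurable (region_measure TYPE('r))"
      by measurable
    show "AE x in region_measure TYPE('r). f x * complex_of_real (\<phi> x) = f' x * complex_of_real (\<phi> x)"
      using that by (auto simp: L2_rel_def)
  qed
  have D: "\<phi> differentiable_on UNIV" "deriv \<phi> differentiable_on UNIV"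
    if "test_function (region TYPE('r)) \<phi>" for \<phi>
  proof -
    have *: "(deriv ^^ n) \<phi> differentiable_on UNIV" for n
      using that by (simp add: test_function_def)
    show "\<phi> differentiable_on UNIV" "deriv \<phi> differentiable_on UNIV"
      using *[of 0] *[of 1] by simp_all
  qed
  fix f f' g g'
  assume "L2_rel TYPE('r) f f'" "L2_rel TYPE('r) g g'"
  then show "(\<forall>\<phi>. test_function (region TYPE('r)) \<phi> \<longrightarrow>
      (\<integral>x. f x * complex_of_real (deriv \<phi> x) \<partial>region_measure TYPE('r)) =
      - (\<integral>x. g x * complex_of_real (\<phi> x) \<partial>region_measure TYPE('r))) \<longleftrightarrow>
    (\<forall>\<phi>. test_function (region TYPE('r)) \<phi> \<longrightarrow>
      (\<integral>x. f' x * complex_of_real (deriv \<phi> x) \<partial>region_measure TYPE('r)) =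
      - (\<integral>x. g' x * complex_of_real (\<phi> x) \<partial>region_measure TYPE('r)))"
    using int D by (intro all_cong) simp
qed

definition weak_deriv :: "'r::region L2 \<Rightarrow> 'r L2" where
  "weak_deriv u = (THE w. has_weak_derivative u w)"

text \<open>\<open>sobolev k\<close> and \<open>sobolev_norm k\<close> are the space \<open>W\<close> with lower index 2 and upper index \<open>k\<close>, and its norm.\<close>

definition sobolev :: "nat \<Rightarrow> 'r::region L2 set" where
  "sobolev k = {u. \<forall>j<k. \<exists>w. has_weak_derivative ((weak_deriv ^^ j) u) w}"

definition sobolev_norm :: "nat \<Rightarrow> 'r::region L2 \<Rightarrow> real" where
  "sobolev_norm k u = sqrt (\<Sum>j\<le>k. (norm ((weak_deriv ^^ j) u))\<^sup>2)"

definition bounded_into_sobolev :: "nat \<Rightarrow> ('r::region L2 \<Rightarrow> 'r L2) \<Rightarrow> bool" where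
  "bounded_into_sobolev k R \<longleftrightarrow> linear R \<and> range R \<subseteq> sobolev k \<and>
     (\<exists>K. \<forall>f. sobolev_norm k (R f) \<le> K * norm f)"

text \<open>Operator norm from \<open>L2\<close> to \<open>sobolev k\<close>, the analogue of \<^const>\<open>onorm\<close>;
  meaningful if \<open>bounded_into_sobolev k R\<close>.\<close>

definition onorm_sobolev :: "nat \<Rightarrow> ('r::region L2 \<Rightarrow> 'r L2) \<Rightarrow> real" where
  "onorm_sobolev k R = (SUP f. sobolev_norm k (R f) / norm f)"

text \<open>Boundary values are those of the representative that is continuous on the closed interval.\<close>

lift_definition has_boundary_value :: "unit_interval L2 \<Rightarrow> real \<Rightarrow> complex \<Rightarrow> bool"
  is "\<lambda>f a c. \<exists>g. continuous_on {0..1} g \<and> (AE x in region_measure TYPE(unit_interval). f x = g x) \<and> g a = c"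
proof -
  fix f f'
  assume "L2_rel TYPE(unit_interval) f f'"
  then have "AE x in region_measure TYPE(unit_interval). f x = f' x"
    by (simp add: L2_rel_def)
  then have "(AE x in region_measure TYPE(unit_interval). f x = g x) \<longleftrightarrow>
      (AE x in region_measure TYPE(unit_interval). f' x = g x)" for g
    by (auto elim: AE_mp)
  then show "(\<lambda>a c. \<exists>g. continuous_on {0..1} g \<and> (AE x in region_measure TYPE(unit_interval). f x = g x) \<and> g a = c) =
      (\<lambda>a c. \<exists>g. continuous_on {0..1} g \<and> (AE x in region_measure TYPE(unit_interval). f' x = g x) \<and> g a = c)"
    by simp
qed

section \<open>The operator with translations\<close>

definition B_op :: "unit_interval Linf \<Rightarrow> unit_interval Linf \<Rightarrow> real \<Rightarrow> real
    \<Rightarrow> unit_interval L2 \<Rightarrow> unit_interval L2" where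
  "B_op V Q \<alpha> \<beta> u =
     mult_op V (restriction (translation \<alpha> (continuation u))) +
     mult_op Q (restriction (translation (- \<beta>) (continuation u)))"

definition dom_A :: "unit_interval L2 set" where
  "dom_A = {y \<in> sobolev 2. has_boundary_value (weak_deriv y) 0 0 \<and> has_boundary_value (weak_deriv y) 1 0}"

definition A_op :: "unit_interval L2 \<Rightarrow> unit_interval L2" where
  "A_op y = - weak_deriv (weak_deriv y)"

definition H_op :: "unit_interval Linf \<Rightarrow> unit_interval Linf \<Rightarrow> real \<Rightarrow> real
    \<Rightarrow> unit_interval L2 \<Rightarrow> unit_interval L2" where
  "H_op V Q \<alpha> \<beta> y = A_op y + B_op V Q \<alpha> \<beta> y"

definition h_form :: "unit_interval Linf \<Rightarrow> unit_interval Linf \<Rightarrow> real \<Rightarrow> real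
    \<Rightarrow> unit_interval L2 \<Rightarrow> unit_interval L2 \<Rightarrow> complex" where
  "h_form V Q \<alpha> \<beta> u v =
     cinner (weak_deriv u) (weak_deriv v) +
     cinner (mult_op V (restriction (translation \<alpha> (continuation u)))) v +
     cinner (mult_op Q (restriction (translation (- \<beta>) (continuation u)))) v"

end

theory Submission
  imports Defs "HOL-Complex_Analysis.Residue_Theorem" "Jordan_Normal_Form.Schur_Decomposition"
begin

text \<open>
  The functions 1 and \<open>sqrt 2 * cos (n * pi * x)\<close> are an orthonormal basis of the space \<open>L\<^sup>2\<close> over the
  unit interval. In this basis \<open>A\<close> is diagonal with eigenvalues \<open>(n * pi)\<^sup>2\<close>, and its domain, boundary
  conditions included, consists of the functions whose coefficients can be multiplied by them
  (\<open>dom_A_iff\<close>). The operator \<open>H\<close> differs from \<open>A\<close> by an operator \<open>B\<close> whose norm has a bound \<open>M\<close>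
  independent of the shifts, since shifts do not increase the norm (\<open>B_op_properties\<close>). Most of the
  theorem holds for all bounded perturbations of such diagonal operators in a Hilbert space.

  \<^emph>\<open>Sectoriality and the half-plane.\<close> As \<open>A\<close> is nonnegative, the numerical range of \<open>H\<close> lies within
  distance \<open>M\<close> of the nonnegative real axis, and \<open>H - z\<close> can be inverted by a fixed point argument if
  \<open>Re z < - M\<close> (\<open>m_sectorial\<close>, \<open>half_plane\<close>). The form is identified by testing it with the basis
  functions (\<open>associated_form_sobolev_1\<close>).

  \<^emph>\<open>The spectrum.\<close> The gaps between the eigenvalues of \<open>A\<close> grow linearly, hence faster than \<open>sqrt N\<close>. If
  the gap below \<open>\<mu> N\<close> is large compared with \<open>M * (1 + sqrt N)\<close>, then \<open>H\<close> has an invariant subspace \<open>G\<close> of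
  dimension \<open>N\<close> near the span of the first \<open>N\<close> basis vectors: it is the graph of a solution of a Riccati
  equation, and the equation is a fixed point problem for a contraction (\<open>riccati_fixed_point\<close>). Modulo
  \<open>G\<close>, the operator \<open>H\<close> is a perturbation of the part of \<open>A\<close> above the gap, so \<open>H - z\<close> is invertible modulo
  \<open>G\<close> for all \<open>z\<close> in a half-plane to the left of \<open>\<mu> N\<close>. In this half-plane the spectrum, the eigenvalues
  and the root subspaces of \<open>H\<close> are those of the \<open>N\<close> by \<open>N\<close> matrix of \<open>H\<close> on \<open>G\<close>
  (\<open>preimage_of_G\<close>, \<open>dim_root_subspace\<close>, \<open>not_eigenvalue_in_resolvent_set\<close>), and algebraic
  multiplicities are orders of roots of its characteristic polynomial. The half-planes exhaust the
  complex plane as \<open>N\<close> grows. This replaces the Riesz projections and the analytic Fredholm theory by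
  linear algebra.

  \<^emph>\<open>Continuity of the eigenvalues.\<close> The fixed point depends continuously on \<open>B\<close> in the strong operator
  topology, hence so does the characteristic polynomial, and the theorem of Rouche shows that the number
  of its roots in a disc is locally constant (\<open>eigenvalues_continuous\<close>). Strong continuity is all
  that is available: as an operator in \<open>L\<^sup>2\<close>, a shift does not depend on its length continuously in norm.

  \<^emph>\<open>The difference of the resolvents.\<close> If \<open>u\<close> has a weak derivative in \<open>L\<^sup>2\<close>, then \<open>u\<close> is bounded and Hoelder
  continuous with exponent 1/2. Two shifts of \<open>u\<close> therefore differ, in \<open>L\<^sup>2\<close>, by a multiple of
  \<open>sqrt \<bar>a - b\<bar>\<close>: this is the Hoelder estimate where both are defined by values of \<open>u\<close>, and elsewhere the
  measure of the set is small (\<open>shift_difference\<close>). The estimate for the resolvents follows by the second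
  resolvent identity (\<open>resolvent_diff\<close>), as resolvents map into such functions.
\<close>

section \<open>Complex inner product spaces\<close>

lemma scaleC_one [simp]: "(1::complex) *\<^sub>C (x::'a::complex_inner) = x"
  by (rule complex_vector.scale_one)

lemma cinner_scaleC_right: "cinner x (a *\<^sub>C y) = cnj a * cinner x (y::'a::complex_inner)"
  by (subst cinner_commute) (simp add: cinner_scaleC_left flip: cinner_commute)

lemma cinner_add_right: "cinner x (y + z) = cinner x y + cinner x (z::'a::complex_inner)"
  by (subst cinner_commute) (simp add: cinner_add_left flip: cinner_commute)

lemma cinner_zero_left [simp]: "cinner 0 (x::'a::complex_inner) = 0"
  using cinner_add_left[of 0 0 x] by simp

lemma cinner_zero_right [simp]: "cinner (x::'a::complex_inner) 0 = 0"
  using cinner_add_right[of x 0 0] by simp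

lemma cinner_minus_left: "cinner (- x) y = - cinner x (y::'a::complex_inner)"
  using cinner_add_left[of x "-x" y] by (simp add: eq_neg_iff_add_eq_0 add.commute)

lemma cinner_minus_right: "cinner x (- y) = - cinner x (y::'a::complex_inner)"
  using cinner_add_right[of x y "-y"] by (simp add: eq_neg_iff_add_eq_0 add.commute)

lemma cinner_diff_left: "cinner (x - y) z = cinner x z - cinner y (z::'a::complex_inner)"
  using cinner_add_left[of x "-y" z] by (simp add: cinner_minus_left)

lemma cinner_diff_right: "cinner x (y - z) = cinner x y - cinner x (z::'a::complex_inner)"
  using cinner_add_right[of x y "-z"] by (simp add: cinner_minus_right)

lemma cinner_sum_left: "cinner (\<Sum>i\<in>I. f i) y = (\<Sum>i\<in>I. cinner (f i) (y::'a::complex_inner))"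
  by (induction I rule: infinite_finite_induct) (simp_all add: cinner_add_left)

lemma cinner_sum_right: "cinner y (\<Sum>i\<in>I. f i) = (\<Sum>i\<in>I. cinner (y::'a::complex_inner) (f i))"
  by (induction I rule: infinite_finite_induct) (simp_all add: cinner_add_right)

lemma cinner_self: "cinner x x = complex_of_real ((norm (x::'a::complex_inner))\<^sup>2)"
proof (rule complex_eqI)
  show "Re (cinner x x) = Re (complex_of_real ((norm x)\<^sup>2))"
    by (simp add: power2_norm_eq_inner flip: inner_eq_Re_cinner)
  have "cinner x x = cnj (cinner x x)"
    by (rule cinner_commute)
  then have "Im (cinner x x) = - Im (cinner x x)"
    by (metis cnj.simps(2))
  then show "Im (cinner x x) = Im (complex_of_real ((norm x)\<^sup>2))" by simp
qed

lemma mult_cnj_cmod: "c * cnj c = (complex_of_real (cmod c))\<^sup>2"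
  using complex_norm_square[of c] by simp

lemma cnj_mult_cmod: "cnj c * c = (complex_of_real (cmod c))\<^sup>2"
  using mult_cnj_cmod[of c] by (simp add: mult.commute)

lemma mult_if_one: "a * (if P then 1 else 0) = (if P then a else (0::complex))"
  by simp

lemma norm_scaleC: "norm (c *\<^sub>C x) = cmod c * norm (x::'a::complex_inner)"
proof -
  have "complex_of_real ((norm (c *\<^sub>C x))\<^sup>2) = complex_of_real ((cmod c * norm x)\<^sup>2)"
    unfolding cinner_self[symmetric] cinner_scaleC_left cinner_scaleC_right
    unfolding cinner_self mult.assoc[symmetric] by (simp add: power_mult_distrib mult_cnj_cmod cnj_mult_cmod)
  then have "(norm (c *\<^sub>C x))\<^sup>2 = (cmod c * norm x)\<^sup>2"
    by (simp only: of_real_eq_iff)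
  then show ?thesis
    by (simp add: power2_eq_iff_nonneg)
qed

lemma cinner_Cauchy_Schwarz: "cmod (cinner x y) \<le> norm x * norm (y::'a::complex_inner)"
proof (cases "cinner x y = 0")
  case False
  \<comment> \<open>rotate \<open>x\<close> so that the inner product becomes real and use the real inequality\<close>
  define c where "c = cnj (sgn (cinner x y))"
  have c: "cmod c = 1"
    using False by (simp add: c_def norm_sgn)
  have "cnj (cinner x y) * cinner x y = complex_of_real (cmod (cinner x y)) * complex_of_real (cmod (cinner x y))"
    by (metis complex_norm_square mult.commute of_real_mult power2_eq_square)
  then have "c * cinner x y = complex_of_real (cmod (cinner x y))"
    using False by (simp add: c_def sgn_eq)
  then have "cmod (cinner x y) = inner (c *\<^sub>C x) y"
    by (simp add: inner_eq_Re_cinner cinner_scaleC_left)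
  also have "\<dots> \<le> norm (c *\<^sub>C x) * norm y"
    by (rule norm_cauchy_schwarz)
  finally show ?thesis
    by (simp add: norm_scaleC c)
qed simp

lemma bounded_linear_cinner_left: "bounded_linear (\<lambda>x. cinner x (y::'a::complex_inner))"
proof (rule bounded_linear_intro[where K = "norm y"])
  show "cinner (r *\<^sub>R x) y = r *\<^sub>R cinner x y" for r x
    by (simp add: cinner_scaleC_left scaleR_conv_of_real flip: scaleC_of_real)
qed (use cinner_Cauchy_Schwarz in \<open>auto simp: cinner_add_left\<close>)

lemma bounded_linear_cinner_right: "bounded_linear (\<lambda>y. cinner (x::'a::complex_inner) y)"
proof (rule bounded_linear_intro[where K = "norm x"])
  show "cinner x (r *\<^sub>R y) = r *\<^sub>R cinner x y" for r y
    by (simp add: cinner_scaleC_right scaleR_conv_of_real flip: scaleC_of_real)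
  show "norm (cinner x y) \<le> norm y * norm x" for y
    using cinner_Cauchy_Schwarz[of x y] by (simp add: mult.commute)
qed (simp add: cinner_add_right)

lemma bounded_linear_scaleC_left: "bounded_linear (\<lambda>c. c *\<^sub>C (x::'a::complex_inner))"
proof (rule bounded_linear_intro[where K = "norm x"])
  show "(r *\<^sub>R c) *\<^sub>C x = r *\<^sub>R c *\<^sub>C x" for r c
    by (simp add: scaleC_scaleC scaleR_conv_of_real flip: scaleC_of_real)
qed (simp_all add: scaleC_add_left norm_scaleC)

section \<open>Orthonormal bases\<close>

locale orthonormal =
  fixes e :: "nat \<Rightarrow> 'a::{complex_inner, banach}"
  assumes cinner_basis: "cinner (e m) (e n) = (if m = n then 1 else 0)"
begin

definition coef :: "nat \<Rightarrow> 'a \<Rightarrow> complex" where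
  "coef n u = cinner u (e n)"

lemma coef_add [simp]: "coef n (u + v) = coef n u + coef n v"
  and coef_diff [simp]: "coef n (u - v) = coef n u - coef n v"
  and coef_minus [simp]: "coef n (- u) = - coef n u"
  and coef_zero [simp]: "coef n 0 = 0"
  and coef_scaleC [simp]: "coef n (c *\<^sub>C u) = c * coef n u"
  and coef_sum [simp]: "coef n (\<Sum>i\<in>I. f i) = (\<Sum>i\<in>I. coef n (f i))"
  and coef_basis [simp]: "coef n (e m) = (if m = n then 1 else 0)"
  by (simp_all add: coef_def cinner_add_left cinner_diff_left cinner_minus_left cinner_scaleC_left
      cinner_sum_left cinner_basis)

lemma norm_basis [simp]: "norm (e n) = 1"
proof -
  have "complex_of_real ((norm (e n))\<^sup>2) = complex_of_real 1"
    unfolding cinner_self[symmetric] by (simp add: cinner_basis)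
  then show ?thesis
    unfolding of_real_eq_iff power2_eq_1_iff using norm_ge_zero[of "e n"] by linarith
qed

lemma cmod_coef_le: "cmod (coef n u) \<le> norm u"
  using cinner_Cauchy_Schwarz[of u "e n"] by (simp add: coef_def)

lemma tendsto_coef [tendsto_intros]: "(f \<longlongrightarrow> u) F \<Longrightarrow> ((\<lambda>x. coef n (f x)) \<longlongrightarrow> coef n u) F"
  unfolding coef_def by (rule bounded_linear.tendsto[OF bounded_linear_cinner_left])

lemma norm_sum_basis:
  assumes "finite I"
  shows "(norm (\<Sum>i\<in>I. a i *\<^sub>C e i))\<^sup>2 = (\<Sum>i\<in>I. (cmod (a i))\<^sup>2)"
proof -
  have "complex_of_real ((norm (\<Sum>i\<in>I. a i *\<^sub>C e i))\<^sup>2) = complex_of_real (\<Sum>i\<in>I. (cmod (a i))\<^sup>2)"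
    unfolding cinner_self[symmetric] using assms
    by (simp add: cinner_sum_left cinner_sum_right cinner_scaleC_left cinner_scaleC_right cinner_basis
        mult_if_one mult_cnj_cmod cnj_mult_cmod)
  then show ?thesis
    by (simp only: of_real_eq_iff)
qed

lemma norm_diff_partial_sum:
  assumes "finite I"
  shows "(norm (u - (\<Sum>i\<in>I. coef i u *\<^sub>C e i)))\<^sup>2 = (norm u)\<^sup>2 - (\<Sum>i\<in>I. (cmod (coef i u))\<^sup>2)"
proof -
  let ?s = "\<Sum>i\<in>I. coef i u *\<^sub>C e i"
  have 1: "cinner u ?s = complex_of_real (\<Sum>i\<in>I. (cmod (coef i u))\<^sup>2)"
    by (simp add: cinner_sum_right cinner_scaleC_right mult_cnj_cmod mult.commute flip: coef_def)
  then have 2: "cinner ?s u = complex_of_real (\<Sum>i\<in>I. (cmod (coef i u))\<^sup>2)"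
    by (subst cinner_commute) simp
  have "complex_of_real ((norm (u - ?s))\<^sup>2) = complex_of_real ((norm u)\<^sup>2 - (\<Sum>i\<in>I. (cmod (coef i u))\<^sup>2))"
    unfolding cinner_self[symmetric] cinner_diff_left cinner_diff_right 1 2
    unfolding cinner_self norm_sum_basis[OF assms] by simp
  then show ?thesis
    by (simp only: of_real_eq_iff)
qed

lemma norm_diff_partial_sum_le:
  assumes "finite I"
  shows "norm (u - (\<Sum>i\<in>I. coef i u *\<^sub>C e i)) \<le> norm u"
proof (rule power2_le_imp_le)
  show "(norm (u - (\<Sum>i\<in>I. coef i u *\<^sub>C e i)))\<^sup>2 \<le> (norm u)\<^sup>2"
    unfolding norm_diff_partial_sum[OF assms] by (simp add: sum_nonneg)
qed simp

lemma Bessel_finite: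
  assumes "finite I"
  shows "(\<Sum>i\<in>I. (cmod (coef i u))\<^sup>2) \<le> (norm u)\<^sup>2"
  using norm_diff_partial_sum[OF assms, of u] zero_le_power2[of "norm (u - (\<Sum>i\<in>I. coef i u *\<^sub>C e i))"]
  by linarith

lemma Bessel_summable: "summable (\<lambda>n. (cmod (coef n u))\<^sup>2)"
  by (rule summableI_nonneg_bounded[where x = "(norm u)\<^sup>2"]) (auto simp: Bessel_finite)

text \<open>
  Summing \<open>N\<close> coefficients without squaring them costs a factor \<open>sqrt N\<close>. All later conditions on the
  growth of eigenvalues go back to this estimate.
\<close>

lemma sum_cmod_coef_le: "(\<Sum>i<N. cmod (coef i u)) \<le> sqrt (real N) * norm u"
proof -
  have "(\<Sum>i<N. cmod (coef i u) * 1)\<^sup>2 \<le> (\<Sum>i<N. (cmod (coef i u))\<^sup>2) * (\<Sum>i<N. 1\<^sup>2)"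
    by (rule Cauchy_Schwarz_ineq_sum)
  also have "\<dots> \<le> (norm u)\<^sup>2 * real N"
    using Bessel_finite[of "{..<N}" u] by (intro mult_mono) auto
  also have "\<dots> = (sqrt (real N) * norm u)\<^sup>2"
    by (simp add: power_mult_distrib)
  finally show ?thesis
    by (simp add: power2_le_iff_abs_le sum_nonneg)
qed

lemma summable_sum_basis:
  assumes "summable (\<lambda>n. (cmod (a n))\<^sup>2)"
  shows "summable (\<lambda>n. a n *\<^sub>C e n)"
proof (unfold summable_Cauchy, intro allI impI)
  fix \<epsilon> :: real assume "0 < \<epsilon>"
  then obtain N where N: "\<forall>m\<ge>N. \<forall>n. norm (\<Sum>i = m..<n. (cmod (a i))\<^sup>2) < \<epsilon>\<^sup>2"
    using assms unfolding summable_Cauchy by (meson zero_less_power)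
  have "norm (\<Sum>i = m..<n. a i *\<^sub>C e i) < \<epsilon>" if "N \<le> m" for m n
  proof -
    have "(norm (\<Sum>i = m..<n. a i *\<^sub>C e i))\<^sup>2 < \<epsilon>\<^sup>2"
      using N[rule_format, OF that, of n] by (simp add: norm_sum_basis)
    then show ?thesis
      using \<open>0 < \<epsilon>\<close> by (intro power_less_imp_less_base[of _ 2 \<epsilon>]) simp_all
  qed
  then show "\<exists>N. \<forall>m\<ge>N. \<forall>n. norm (\<Sum>i = m..<n. a i *\<^sub>C e i) < \<epsilon>"
    by blast
qed

lemma sums_coef:
  assumes "(\<lambda>i. a i *\<^sub>C e i) sums u"
  shows "coef n u = a n"
proof -
  have "(\<lambda>k. coef n (\<Sum>i<k. a i *\<^sub>C e i)) \<longlonglongrightarrow> coef n u"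
    using assms unfolding sums_def by (rule tendsto_coef)
  moreover have "(\<lambda>k. coef n (\<Sum>i<k. a i *\<^sub>C e i)) \<longlonglongrightarrow> a n"
    by (rule tendsto_eventually) (auto simp: eventually_sequentially mult_if_one intro!: exI[of _ "Suc n"])
  ultimately show ?thesis
    by (rule LIMSEQ_unique)
qed

lemma Riesz_Fischer:
  assumes "summable (\<lambda>n. (cmod (a n))\<^sup>2)"
  obtains u where "\<And>n. coef n u = a n" "(\<lambda>n. a n *\<^sub>C e n) sums u"
  using sums_coef summable_sums[OF summable_sum_basis[OF assms]] by metis

end

locale orthonormal_basis = orthonormal +
  assumes complete_basis: "(\<And>n. cinner u (e n) = 0) \<Longrightarrow> u = 0"
begin

lemma coef_eqI:
  assumes "\<And>n. coef n u = coef n v"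
  shows "u = v"
  using complete_basis[of "u - v"] assms by (simp add: coef_def cinner_diff_left)

lemma sums_basis: "(\<lambda>n. coef n u *\<^sub>C e n) sums u"
proof -
  obtain v where v: "\<And>n. coef n v = coef n u" "(\<lambda>n. coef n u *\<^sub>C e n) sums v"
    using Riesz_Fischer[OF Bessel_summable[of u]] by metis
  then have "v = u" by (intro coef_eqI) simp
  then show ?thesis using v by simp
qed

lemma Parseval: "(\<lambda>n. (cmod (coef n u))\<^sup>2) sums (norm u)\<^sup>2"
proof -
  have "(\<lambda>k. norm (\<Sum>i<k. coef i u *\<^sub>C e i)) \<longlonglongrightarrow> norm u"
    using sums_basis unfolding sums_def by (rule tendsto_norm)
  then have "(\<lambda>k. (norm (\<Sum>i<k. coef i u *\<^sub>C e i))\<^sup>2) \<longlonglongrightarrow> (norm u)\<^sup>2"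
    by (rule tendsto_power)
  then show ?thesis
    unfolding sums_def by (simp add: norm_sum_basis)
qed

lemma norm_le_by_coef:
  assumes "\<And>n. cmod (coef n u) \<le> K * cmod (coef n v)" "0 \<le> K"
  shows "norm u \<le> K * norm v"
proof -
  have "(norm u)\<^sup>2 \<le> K\<^sup>2 * (norm v)\<^sup>2"
  proof (rule sums_le[OF _ Parseval sums_mult[OF Parseval]])
    show "(cmod (coef n u))\<^sup>2 \<le> K\<^sup>2 * (cmod (coef n v))\<^sup>2" for n
      using power_mono[OF assms(1)[of n], of 2] by (simp add: power_mult_distrib)
  qed
  then have "(norm u)\<^sup>2 \<le> (K * norm v)\<^sup>2"
    by (simp add: power_mult_distrib)
  then show ?thesis
    by (rule power2_le_imp_le) (use assms(2) in simp)
qed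

text \<open>The operator that multiplies the \<open>n\<close>-th coefficient by \<open>g n\<close>.\<close>

definition diag :: "(nat \<Rightarrow> complex) \<Rightarrow> 'a \<Rightarrow> 'a" where
  "diag g u = (SOME v. \<forall>n. coef n v = g n * coef n u)"

lemma summable_diag:
  assumes "\<And>n. cmod (g n) \<le> K"
  shows "summable (\<lambda>n. (cmod (g n * coef n u))\<^sup>2)"
proof (rule summable_comparison_test[OF _ summable_mult[OF Bessel_summable, of "K\<^sup>2" u]])
  have "(cmod (g n))\<^sup>2 \<le> K\<^sup>2" for n
    by (intro power_mono assms) simp
  then show "\<exists>N. \<forall>n\<ge>N. norm ((cmod (g n * coef n u))\<^sup>2) \<le> K\<^sup>2 * (cmod (coef n u))\<^sup>2"
    by (auto simp: norm_mult power_mult_distrib intro!: mult_right_mono)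
qed

lemma coef_diag:
  assumes "\<And>n. cmod (g n) \<le> K"
  shows "coef n (diag g u) = g n * coef n u"
proof -
  have "\<exists>v. \<forall>n. coef n v = g n * coef n u"
    using Riesz_Fischer[OF summable_diag[of g K u]] assms by blast
  then have "\<forall>n. coef n (diag g u) = g n * coef n u"
    unfolding diag_def by (rule someI_ex)
  then show ?thesis by simp
qed

lemma norm_diag_le:
  assumes "\<And>n. cmod (g n) \<le> K"
  shows "norm (diag g u) \<le> K * norm u"
proof (rule norm_le_by_coef)
  show "0 \<le> K" using assms[of 0] norm_ge_zero[of "g 0"] by linarith
  show "cmod (coef n (diag g u)) \<le> K * cmod (coef n u)" for n
    using assms[of n] by (simp add: coef_diag[OF assms] norm_mult mult_right_mono)
qed

lemma diag_diff:
  assumes "\<And>n. cmod (g n) \<le> K"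
  shows "diag g (u - v) = diag g u - diag g v"
  by (rule coef_eqI) (simp add: coef_diag[OF assms] algebra_simps)

end

section \<open>Operators in triangular form\<close>

lemma linear_operatorD:
  assumes "linear_operator D T"
  shows "complex_vector.subspace D"
    and "\<And>u v. u \<in> D \<Longrightarrow> v \<in> D \<Longrightarrow> T (u + v) = T u + T v"
    and "\<And>c u. u \<in> D \<Longrightarrow> T (c *\<^sub>C u) = c *\<^sub>C T u"
  using assms by (auto simp: linear_operator_def)

lemma linear_operator_diff:
  assumes T: "linear_operator D T" and "u \<in> D" "v \<in> D"
  shows "T (u - v) = T u - T v"
proof -
  have "T (- v) = - T v" "- v \<in> D"
    using linear_operatorD(3)[OF T \<open>v \<in> D\<close>, of "-1"] complex_vector.subspace_neg linear_operatorD(1)[OF T] assms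
    by auto
  then have "T (u + - v) = T u + - T v"
    using linear_operatorD(2)[OF T \<open>u \<in> D\<close>] by metis
  then show ?thesis
    by simp
qed

lemma linear_operator_zero:
  assumes "linear_operator D T"
  shows "T 0 = 0"
  using linear_operatorD(3)[OF assms, of 0 0] complex_vector.subspace_0[OF linear_operatorD(1)[OF assms]]
  by simp

lemma linear_operator_sum:
  assumes T: "linear_operator D T" and "\<And>i. i \<in> I \<Longrightarrow> u i \<in> D"
  shows "T (\<Sum>i\<in>I. a i *\<^sub>C u i) = (\<Sum>i\<in>I. a i *\<^sub>C T (u i))"
  using assms(2)
proof (induction I rule: infinite_finite_induct)
  case (insert i I)
  have "(\<Sum>i\<in>I. a i *\<^sub>C u i) \<in> D"
    using insert.prems
    by (intro complex_vector.subspace_sum complex_vector.subspace_scale linear_operatorD(1)[OF T]) auto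
  then show ?case
    using insert linear_operatorD[OF T] by (simp add: complex_vector.subspace_scale)
qed (simp_all add: linear_operator_zero[OF T])

lemma linear_operator_shift:
  assumes "linear_operator D T"
  shows "linear_operator D (\<lambda>u. T u + a *\<^sub>C u)"
  using assms unfolding linear_operator_def
  by (auto simp: scaleC_add_right scaleC_scaleC mult.commute)

text \<open>
  With respect to \<open>v\<close> the operator \<open>T\<close> is upper triangular, with diagonal \<open>t\<close>; the second
  condition makes \<open>v 0, \<dots>, v (n - 1)\<close> linearly independent.
\<close>

definition flag :: "'a::complex_inner set \<Rightarrow> ('a \<Rightarrow> 'a) \<Rightarrow> (nat \<Rightarrow> 'a) \<Rightarrow> (nat \<Rightarrow> complex) \<Rightarrow> nat \<Rightarrow> bool" where
  "flag D T v t n \<longleftrightarrow> (\<forall>i<n. v i \<in> D \<and> v i \<notin> complex_vector.span (v ` {..<i}) \<and>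
     T (v i) - t i *\<^sub>C v i \<in> complex_vector.span (v ` {..<i}))"

lemma flag_mono: "flag D T v t n \<Longrightarrow> m \<le> n \<Longrightarrow> flag D T v t m"
  by (simp add: flag_def)

lemma span_lessThan_Suc_iff:
  "u \<in> complex_vector.span (v ` {..<Suc i}) \<longleftrightarrow>
     (\<exists>c. \<exists>w \<in> complex_vector.span (v ` {..<i}). u = c *\<^sub>C v i + (w::'a::complex_inner))"
  unfolding lessThan_Suc image_insert complex_vector.span_breakdown_eq
  by (metis add_diff_cancel_left' add.commute diff_add_cancel)

lemma flag_span_subset_domain:
  assumes "linear_operator D T" "flag D T v t n"
  shows "complex_vector.span (v ` {..<n}) \<subseteq> D"
  using assms by (intro complex_vector.span_minimal) (auto simp: flag_def linear_operator_def)

lemma flag_apply: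
  assumes T: "linear_operator D T" and fl: "flag D T v t (Suc i)"
    and w: "w \<in> complex_vector.span (v ` {..<i})"
    and inv: "T w - z *\<^sub>C w \<in> complex_vector.span (v ` {..<i})"
  shows "T (c *\<^sub>C v i + w) - z *\<^sub>C (c *\<^sub>C v i + w) - (c * (t i - z)) *\<^sub>C v i
    \<in> complex_vector.span (v ` {..<i})"
proof -
  have D: "v i \<in> D" "w \<in> D"
    using fl w flag_span_subset_domain[OF T flag_mono[OF fl, of i]] by (auto simp: flag_def)
  have "T (c *\<^sub>C v i + w) - z *\<^sub>C (c *\<^sub>C v i + w) - (c * (t i - z)) *\<^sub>C v i
      = c *\<^sub>C (T (v i) - t i *\<^sub>C v i) + (T w - z *\<^sub>C w)"
    using D linear_operatorD[OF T] complex_vector.subspace_scale[of D "v i" c]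
    by (simp add: complex_vector.scale_right_distrib complex_vector.scale_right_diff_distrib
        complex_vector.scale_left_diff_distrib scaleC_scaleC algebra_simps)
  also have "\<dots> \<in> complex_vector.span (v ` {..<i})"
    using fl inv by (auto simp: flag_def intro!: complex_vector.span_add complex_vector.span_scale)
  finally show ?thesis .
qed

lemma flag_invariant:
  assumes T: "linear_operator D T" and "flag D T v t n" "u \<in> complex_vector.span (v ` {..<n})"
  shows "T u - z *\<^sub>C u \<in> complex_vector.span (v ` {..<n})"
  using assms(2,3)
proof (induction n arbitrary: u)
  case 0
  then show ?case by (simp add: linear_operator_zero[OF T])
next
  case (Suc i)
  obtain c w where u: "u = c *\<^sub>C v i + w" and w: "w \<in> complex_vector.span (v ` {..<i})"
    using Suc.prems(2) unfolding span_lessThan_Suc_iff by blast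
  have "T u - z *\<^sub>C u - (c * (t i - z)) *\<^sub>C v i \<in> complex_vector.span (v ` {..<i})"
    unfolding u using Suc.prems(1) w Suc.IH[OF flag_mono[OF Suc.prems(1)] w] by (intro flag_apply[OF T]) auto
  then show ?case
    unfolding span_lessThan_Suc_iff by (metis add.commute diff_add_cancel)
qed

text \<open>
  The component of \<open>u\<close> along \<open>v i\<close> is multiplied by \<open>t i - z\<close>, so it must already be zero.
\<close>

lemma flag_kernel_step:
  assumes T: "linear_operator D T" and fl: "flag D T v t (Suc i)" and ti: "t i \<noteq> z"
    and u: "u \<in> complex_vector.span (v ` {..<Suc i})" "T u - z *\<^sub>C u \<in> complex_vector.span (v ` {..<i})"
  shows "u \<in> complex_vector.span (v ` {..<i})"
proof -
  obtain c w where cw: "u = c *\<^sub>C v i + w" and w: "w \<in> complex_vector.span (v ` {..<i})"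
    using u(1) unfolding span_lessThan_Suc_iff by blast
  have "T u - z *\<^sub>C u - (c * (t i - z)) *\<^sub>C v i \<in> complex_vector.span (v ` {..<i})"
    unfolding cw using fl w flag_invariant[OF T flag_mono[OF fl] w] by (intro flag_apply[OF T]) auto
  then have "(T u - z *\<^sub>C u) - (T u - z *\<^sub>C u - (c * (t i - z)) *\<^sub>C v i) \<in> complex_vector.span (v ` {..<i})"
    using u(2) by (rule complex_vector.span_diff[rotated])
  then have *: "(c * (t i - z)) *\<^sub>C v i \<in> complex_vector.span (v ` {..<i})"
    by simp
  have "c = 0"
  proof (rule ccontr)
    assume "c \<noteq> 0"
    then have "inverse (c * (t i - z)) * (c * (t i - z)) = 1"
      using ti by (intro left_inverse) simp
    then have "inverse (c * (t i - z)) *\<^sub>C (c * (t i - z)) *\<^sub>C v i = v i"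
      unfolding scaleC_scaleC by simp
    then have "v i \<in> complex_vector.span (v ` {..<i})"
      using complex_vector.span_scale[OF *, of "inverse (c * (t i - z))"] by simp
    then show False
      using fl by (simp add: flag_def)
  qed
  then show ?thesis
    using cw w by simp
qed

lemma flag_iterated_kernel_subset:
  assumes T: "linear_operator D T" and "flag D T v t n" "m \<le> n" "\<And>i. m \<le> i \<Longrightarrow> i < n \<Longrightarrow> t i \<noteq> z"
  shows "complex_vector.span (v ` {..<n}) \<inter> iterated_kernel D T z k \<subseteq> complex_vector.span (v ` {..<m})"
  using assms(3,2,4)
proof (induction n rule: dec_induct)
  case (step i)
  have "u \<in> complex_vector.span (v ` {..<i})"
    if "u \<in> complex_vector.span (v ` {..<Suc i})" "u \<in> iterated_kernel D T z k" for u
    using that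
  proof (induction k arbitrary: u)
    case 0
    then show ?case by (simp add: complex_vector.span_zero)
  next
    case (Suc k)
    then have "T u - z *\<^sub>C u \<in> complex_vector.span (v ` {..<i})"
      using flag_invariant[OF T step.prems(1) Suc.prems(1)] by auto
    moreover have "t i \<noteq> z"
      using step.hyps step.prems(2)[of i] by simp
    ultimately show ?case
      using flag_kernel_step[OF T step.prems(1)] Suc.prems(1) by blast
  qed
  moreover have "complex_vector.span (v ` {..<i}) \<inter> iterated_kernel D T z k \<subseteq> complex_vector.span (v ` {..<m})"
    using step.prems(2) by (intro step.IH flag_mono[OF step.prems(1)]) simp_all
  ultimately show ?case
    by blast
qed auto

lemma flag_span_subset_iterated_kernel:
  assumes T: "linear_operator D T" and "flag D T v t m" "\<And>i. i < m \<Longrightarrow> t i = z"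
  shows "complex_vector.span (v ` {..<m}) \<subseteq> iterated_kernel D T z m"
  using assms(2,3)
proof (induction m)
  case (Suc i)
  show ?case
  proof
    fix u assume u: "u \<in> complex_vector.span (v ` {..<Suc i})"
    obtain c w where cw: "u = c *\<^sub>C v i + w" and w: "w \<in> complex_vector.span (v ` {..<i})"
      using u unfolding span_lessThan_Suc_iff by blast
    have "t i = z"
      using Suc.prems(2)[of i] by simp
    moreover have "T w - z *\<^sub>C w \<in> complex_vector.span (v ` {..<i})"
      using flag_mono[OF Suc.prems(1), of i] w by (intro flag_invariant[OF T]) simp_all
    then have "T u - z *\<^sub>C u - (c * (t i - z)) *\<^sub>C v i \<in> complex_vector.span (v ` {..<i})"
      unfolding cw by (rule flag_apply[OF T Suc.prems(1) w])
    ultimately have "T u - z *\<^sub>C u \<in> complex_vector.span (v ` {..<i})"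
      by simp
    moreover have "complex_vector.span (v ` {..<i}) \<subseteq> iterated_kernel D T z i"
      using Suc.prems(2) by (intro Suc.IH flag_mono[OF Suc.prems(1)]) simp_all
    ultimately show "u \<in> iterated_kernel D T z (Suc i)"
      using u flag_span_subset_domain[OF T Suc.prems(1)] by auto
  qed
qed simp

lemma flag_independent:
  assumes "flag D T v t n"
  shows "complex_vector.independent (v ` {..<n}) \<and> card (v ` {..<n}) = n"
  using assms
proof (induction n)
  case (Suc n)
  then have "complex_vector.independent (v ` {..<n}) \<and> card (v ` {..<n}) = n"
    using flag_mono[OF Suc.prems] by simp
  moreover have "v n \<notin> complex_vector.span (v ` {..<n})"
    using Suc.prems by (simp add: flag_def)
  moreover from this have "v n \<notin> v ` {..<n}"
    using complex_vector.span_base[of "v n" "v ` {..<n}"] by blast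
  ultimately show ?case
    by (simp add: lessThan_Suc complex_vector.independent_insert)
qed (simp add: complex_vector.independent_empty)

lemma flag_dim:
  assumes "flag D T v t n"
  shows "complex_vector.dim (complex_vector.span (v ` {..<n})) = n"
  using flag_independent[OF assms] by (simp add: complex_vector.dim_eq_card_independent)

text \<open>
  If the diagonal entries equal to \<open>z\<close> come first, the root subspace for \<open>z\<close> is spanned by the
  corresponding vectors: \<open>T - z\<close> is nilpotent on their span, and has nonzero diagonal entries outside.
\<close>

lemma flag_root_subspace:
  assumes T: "linear_operator D T" and fl: "flag D T v t n" and "m \<le> n"
    and "\<And>i. i < m \<Longrightarrow> t i = z" "\<And>i. m \<le> i \<Longrightarrow> i < n \<Longrightarrow> t i \<noteq> z"
    and "root_subspace D T z \<subseteq> complex_vector.span (v ` {..<n})"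
  shows "root_subspace D T z = complex_vector.span (v ` {..<m})"
    and "complex_vector.dim (root_subspace D T z) = m"
proof -
  show *: "root_subspace D T z = complex_vector.span (v ` {..<m})"
  proof
    show "root_subspace D T z \<subseteq> complex_vector.span (v ` {..<m})"
      using assms(6) flag_iterated_kernel_subset[OF T fl \<open>m \<le> n\<close> assms(5)]
      unfolding root_subspace_def by blast
    show "complex_vector.span (v ` {..<m}) \<subseteq> root_subspace D T z"
      using flag_span_subset_iterated_kernel[OF T flag_mono[OF fl \<open>m \<le> n\<close>] assms(4)]
      unfolding root_subspace_def by blast
  qed
  show "complex_vector.dim (root_subspace D T z) = m"
    unfolding * by (rule flag_dim[OF flag_mono[OF fl \<open>m \<le> n\<close>]])
qed

text \<open>
  Back substitution.
\<close>

lemma flag_surj: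
  assumes T: "linear_operator D T" and "flag D T v t n" "\<And>i. i < n \<Longrightarrow> t i \<noteq> z"
    and "g \<in> complex_vector.span (v ` {..<n})"
  shows "\<exists>u \<in> complex_vector.span (v ` {..<n}). T u - z *\<^sub>C u = g"
  using assms(2-)
proof (induction n arbitrary: g)
  case 0
  then show ?case using linear_operator_zero[OF T] by simp
next
  case (Suc i)
  let ?S = "complex_vector.span (v ` {..<i})"
  obtain c w where g: "g = c *\<^sub>C v i + w" and w: "w \<in> ?S"
    using Suc.prems(3) unfolding span_lessThan_Suc_iff by blast
  let ?a = "c / (t i - z)"
  have ti: "t i - z \<noteq> 0" using Suc.prems(2)[of i] by simp
  have "T (?a *\<^sub>C v i + 0) - z *\<^sub>C (?a *\<^sub>C v i + 0) - (?a * (t i - z)) *\<^sub>C v i \<in> ?S"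
    using linear_operator_zero[OF T]
    by (intro flag_apply[OF T Suc.prems(1)]) (simp_all add: complex_vector.span_zero)
  then have "T (?a *\<^sub>C v i) - z *\<^sub>C ?a *\<^sub>C v i - c *\<^sub>C v i \<in> ?S"
    using ti by simp
  with w have "w - (T (?a *\<^sub>C v i) - z *\<^sub>C ?a *\<^sub>C v i - c *\<^sub>C v i) \<in> ?S"
    by (rule complex_vector.span_diff)
  then have "\<exists>u\<in>?S. T u - z *\<^sub>C u = w - (T (?a *\<^sub>C v i) - z *\<^sub>C ?a *\<^sub>C v i - c *\<^sub>C v i)"
    using Suc.prems(2) by (intro Suc.IH flag_mono[OF Suc.prems(1)]) simp_all
  then obtain u where u: "u \<in> ?S" "T u - z *\<^sub>C u = w - (T (?a *\<^sub>C v i) - z *\<^sub>C ?a *\<^sub>C v i - c *\<^sub>C v i)"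
    by blast
  have D: "u \<in> D" "?a *\<^sub>C v i \<in> D"
    using u(1) flag_span_subset_domain[OF T flag_mono[OF Suc.prems(1), of i]] Suc.prems(1)
      linear_operatorD(1)[OF T] by (auto simp: flag_def intro: complex_vector.subspace_scale)
  have "T (?a *\<^sub>C v i + u) - z *\<^sub>C (?a *\<^sub>C v i + u) = g"
    using u(2) g D linear_operatorD(2)[OF T D(2,1)] by (simp add: scaleC_add_right algebra_simps)
  moreover have "?a *\<^sub>C v i + u \<in> complex_vector.span (v ` {..<Suc i})"
    using u(1) unfolding span_lessThan_Suc_iff by blast
  ultimately show ?case by blast
qed

text \<open>
  The first position \<open>j\<close> with the diagonal entry \<open>t i\<close> yields an eigenvector: on the span of the earlier
  vectors \<open>T - t i\<close> is surjective, so \<open>v j\<close> can be corrected there.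
\<close>

lemma flag_eigenvalue:
  assumes T: "linear_operator D T" and fl: "flag D T v t n" and "i < n"
  shows "t i \<in> eigenvalues D T"
proof -
  define j where "j = (LEAST j. t j = t i)"
  have j: "t j = t i" "j \<le> i" "\<And>k. k < j \<Longrightarrow> t k \<noteq> t i"
    unfolding j_def by (auto intro: LeastI Least_le dest: not_less_Least)
  have flj: "flag D T v t j" "flag D T v t (Suc j)"
    using flag_mono[OF fl] j \<open>i < n\<close> by auto
  have vj: "v j \<in> D" "v j \<notin> complex_vector.span (v ` {..<j})"
    "T (v j) - t i *\<^sub>C v j \<in> complex_vector.span (v ` {..<j})"
    using flj(2) j(1) by (auto simp: flag_def)
  obtain w where w: "w \<in> complex_vector.span (v ` {..<j})" "T w - t i *\<^sub>C w = T (v j) - t i *\<^sub>C v j"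
    using flag_surj[OF T flj(1) j(3) vj(3)] by blast
  have D: "w \<in> D" using w(1) flag_span_subset_domain[OF T flj(1)] by blast
  have "T (v j - w) = t i *\<^sub>C (v j - w)"
    unfolding linear_operator_diff[OF T vj(1) D] using w(2)
    by (simp add: complex_vector.scale_right_diff_distrib algebra_simps)
  moreover have "v j - w \<noteq> 0" "v j - w \<in> D"
    using vj w(1) D complex_vector.subspace_diff[OF linear_operatorD(1)[OF T]] by auto
  ultimately show ?thesis
    unfolding eigenvalues_def by blast
qed

lemma flag_injective:
  assumes T: "linear_operator D T" and fl: "flag D T v t n" and "\<And>i. i < n \<Longrightarrow> t i \<noteq> z"
    and u: "u \<in> complex_vector.span (v ` {..<n})" "T u = z *\<^sub>C u"
  shows "u = 0"
proof -
  have "u \<in> iterated_kernel D T z 1"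
    using u flag_span_subset_domain[OF T fl] by auto
  moreover have "complex_vector.span (v ` {..<n}) \<inter> iterated_kernel D T z 1 \<subseteq> complex_vector.span (v ` {..<0})"
    using assms(3) by (intro flag_iterated_kernel_subset[OF T fl]) simp_all
  ultimately show ?thesis
    using u(1) by auto
qed

lemma independent_lessThan_image:
  assumes "complex_vector.independent (v ` {..<n})" "card (v ` {..<n}) = n" "i < n"
  shows "(v::nat \<Rightarrow> 'a::complex_inner) i \<notin> complex_vector.span (v ` {..<i})"
proof
  assume "v i \<in> complex_vector.span (v ` {..<i})"
  moreover have "inj_on v {..<n}"
    using assms(2) by (simp add: eq_card_imp_inj_on)
  then have "v ` {..<i} \<subseteq> v ` {..<n} - {v i}"
    using assms(3) by (auto dest: inj_onD)
  ultimately have "v i \<in> complex_vector.span (v ` {..<n} - {v i})"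
    using complex_vector.span_mono by blast
  then show False
    using assms(1,3) unfolding complex_vector.dependent_def by blast
qed

text \<open>
  Schur triangularisation of the matrix of \<open>T\<close> on an invariant finite-dimensional subspace. The
  order \<open>ts\<close> of the eigenvalues is arbitrary.
\<close>

lemma flag_exists:
  fixes y :: "nat \<Rightarrow> 'a::complex_inner" and m :: "nat \<Rightarrow> nat \<Rightarrow> complex"
  assumes T: "linear_operator D T" and yD: "\<And>k. k < n \<Longrightarrow> y k \<in> D"
    and Ty: "\<And>k. k < n \<Longrightarrow> T (y k) = (\<Sum>j<n. m j k *\<^sub>C y j)"
    and ind: "complex_vector.independent (y ` {..<n})" "card (y ` {..<n}) = n"
    and ts: "char_poly (mat n n (\<lambda>(i, j). m i j)) = (\<Prod>a\<leftarrow>ts. [:- a, 1:])"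
  obtains v where "flag D T v (\<lambda>i. ts ! i) n"
    and "complex_vector.span (v ` {..<n}) = complex_vector.span (y ` {..<n})"
proof -
  let ?M = "mat n n (\<lambda>(i, j). m i j)"
  obtain B P Q where "schur_decomposition ?M ts = (B, P, Q)"
    by (cases "schur_decomposition ?M ts") auto
  have M: "?M \<in> carrier_mat n n" by simp
  from schur_decomposition[OF M ts \<open>schur_decomposition ?M ts = (B, P, Q)\<close>]
  have sim: "similar_mat_wit ?M B P Q" and ut: "upper_triangular B" and dg: "diag_mat B = ts"
    by auto
  have car: "B \<in> carrier_mat n n" "P \<in> carrier_mat n n" "Q \<in> carrier_mat n n"
    and PQ: "P * Q = 1\<^sub>m n" "Q * P = 1\<^sub>m n" and MB: "?M = P * B * Q"
    using similar_mat_witD2[OF M sim] by auto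
  have "?M * P = P * B"
    unfolding MB using car PQ by (simp add: assoc_mult_mat[of _ n n _ n _ n])
  then have MP: "(\<Sum>k<n. m j k * P $$ (k, i)) = (\<Sum>l<n. P $$ (j, l) * B $$ (l, i))"
    if "i < n" "j < n" for i j
  proof -
    have "(?M * P) $$ (j, i) = (\<Sum>k<n. m j k * P $$ (k, i))"
      using that car by (simp add: scalar_prod_def lessThan_atLeast0)
    moreover have "(P * B) $$ (j, i) = (\<Sum>l<n. P $$ (j, l) * B $$ (l, i))"
      using that car by (simp add: scalar_prod_def lessThan_atLeast0)
    ultimately show ?thesis using \<open>?M * P = P * B\<close> by simp
  qed
  have PQ': "(\<Sum>i<n. P $$ (j, i) * Q $$ (i, k)) = (if j = k then 1 else 0)" if "j < n" "k < n" for j k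
  proof -
    have "(P * Q) $$ (j, k) = (\<Sum>i<n. P $$ (j, i) * Q $$ (i, k))"
      using that car by (simp add: scalar_prod_def lessThan_atLeast0)
    then show ?thesis using PQ that by simp
  qed
  define v where "v i = (\<Sum>k<n. P $$ (k, i) *\<^sub>C y k)" for i
  have vD: "v i \<in> D" for i
    unfolding v_def using yD
    by (intro complex_vector.subspace_sum complex_vector.subspace_scale linear_operatorD(1)[OF T]) auto
  have Tv: "T (v i) = (\<Sum>l<n. B $$ (l, i) *\<^sub>C v l)" if "i < n" for i
  proof -
    have "T (v i) = (\<Sum>k<n. \<Sum>j<n. (m j k * P $$ (k, i)) *\<^sub>C y j)"
      unfolding v_def using yD
      by (subst linear_operator_sum[OF T]) (auto simp: Ty complex_vector.scale_sum_right scaleC_scaleC mult.commute)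
    also have "\<dots> = (\<Sum>j<n. (\<Sum>k<n. m j k * P $$ (k, i)) *\<^sub>C y j)"
      by (subst sum.swap) (simp add: complex_vector.scale_sum_left)
    also have "\<dots> = (\<Sum>j<n. \<Sum>l<n. (P $$ (j, l) * B $$ (l, i)) *\<^sub>C y j)"
      using that by (simp add: MP complex_vector.scale_sum_left)
    also have "\<dots> = (\<Sum>l<n. B $$ (l, i) *\<^sub>C v l)"
      unfolding v_def by (subst sum.swap) (simp add: complex_vector.scale_sum_right scaleC_scaleC mult.commute)
    finally show ?thesis .
  qed
  have Qv: "y k = (\<Sum>i<n. Q $$ (i, k) *\<^sub>C v i)" if "k < n" for k
  proof -
    have "(\<Sum>i<n. Q $$ (i, k) *\<^sub>C v i) = (\<Sum>i<n. \<Sum>j<n. (P $$ (j, i) * Q $$ (i, k)) *\<^sub>C y j)"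
      by (simp add: v_def complex_vector.scale_sum_right scaleC_scaleC mult.commute)
    also have "\<dots> = (\<Sum>j<n. (\<Sum>i<n. P $$ (j, i) * Q $$ (i, k)) *\<^sub>C y j)"
      by (subst sum.swap) (simp add: complex_vector.scale_sum_left)
    also have "\<dots> = (\<Sum>j<n. (if j = k then 1 else 0) *\<^sub>C y j)"
      using that by (intro sum.cong) (simp_all add: PQ')
    also have "\<dots> = y k"
      using that by (subst sum.remove[of _ k]) (auto intro!: sum.neutral)
    finally show ?thesis ..
  qed
  have span: "complex_vector.span (v ` {..<n}) = complex_vector.span (y ` {..<n})"
  proof (intro antisym complex_vector.span_minimal complex_vector.subspace_span image_subsetI)
    show "v i \<in> complex_vector.span (y ` {..<n})" for i
      unfolding v_def by (intro complex_vector.span_sum complex_vector.span_scale complex_vector.span_base) auto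
    show "y k \<in> complex_vector.span (v ` {..<n})" if "k \<in> {..<n}" for k
      using that unfolding Qv[OF that[unfolded lessThan_iff]]
      by (intro complex_vector.span_sum complex_vector.span_scale complex_vector.span_base) auto
  qed
  have dim: "complex_vector.dim (complex_vector.span (v ` {..<n})) = n"
    unfolding span using ind by (simp add: complex_vector.dim_eq_card_independent)
  have card_v: "card (v ` {..<n}) = n"
    using complex_vector.dim_le_card[of "complex_vector.span (v ` {..<n})" "v ` {..<n}"]
      card_image_le[of "{..<n}" v] dim by simp
  have "complex_vector.independent (v ` {..<n})"
  proof
    assume "complex_vector.dependent (v ` {..<n})"
    then obtain a where a: "a \<in> v ` {..<n}" "a \<in> complex_vector.span (v ` {..<n} - {a})"
      unfolding complex_vector.dependent_def by blast
    then have "complex_vector.span (v ` {..<n}) \<subseteq> complex_vector.span (v ` {..<n} - {a})"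
      by (metis complex_vector.span_redundant insert_Diff_single insert_absorb order_refl)
    then have "n \<le> card (v ` {..<n} - {a})"
      using complex_vector.dim_le_card[of "complex_vector.span (v ` {..<n})" "v ` {..<n} - {a}"] dim by simp
    also have "\<dots> < card (v ` {..<n})"
      using a(1) by (intro psubset_card_mono) auto
    finally show False using card_v by simp
  qed
  note v_notin = independent_lessThan_image[OF this card_v]
  have "flag D T v (\<lambda>i. ts ! i) n"
    unfolding flag_def
  proof (intro allI impI conjI vD v_notin)
    fix i assume "i < n"
    have "T (v i) = (\<Sum>l<Suc i. B $$ (l, i) *\<^sub>C v l)"
      unfolding Tv[OF \<open>i < n\<close>] using \<open>i < n\<close> ut car
      by (intro sum.mono_neutral_right) (auto simp: upper_triangular_def)
    moreover have "B $$ (i, i) = ts ! i"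
      using dg car \<open>i < n\<close> by (auto simp: diag_mat_def)
    ultimately have "T (v i) - ts ! i *\<^sub>C v i = (\<Sum>l<i. B $$ (l, i) *\<^sub>C v l)"
      by simp
    then show "T (v i) - ts ! i *\<^sub>C v i \<in> complex_vector.span (v ` {..<i})"
      by (auto intro!: complex_vector.span_sum complex_vector.span_scale intro: complex_vector.span_base)
  qed
  then show thesis
    using span by (rule that)
qed

section \<open>Roots of polynomials that depend continuously on a parameter\<close>

lemma zorder_poly:
  assumes "p \<noteq> 0"
  shows "zorder (poly p) z = int (Polynomial.order z p)"
proof -
  obtain q where q: "p = [:- z, 1:] ^ Polynomial.order z p * q" "\<not> [:- z, 1:] dvd q"
    using order_decomp[OF assms] by blast
  show ?thesis
  proof (rule zorder_eqI[of UNIV])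
    show "poly q z \<noteq> 0"
      using q(2) by (simp add: poly_eq_0_iff_dvd)
    show "poly p w = poly q w * (w - z) powi int (Polynomial.order z p)" for w
      by (subst q(1)) (simp add: poly_power mult.commute)
  qed (auto intro: holomorphic_intros)
qed

definition root_count :: "complex poly \<Rightarrow> complex set \<Rightarrow> nat" where
  "root_count p U = (\<Sum>z | poly p z = 0 \<and> z \<in> U. Polynomial.order z p)"

text \<open>
  The theorem of Rouche compares zeros weighted with winding numbers; for a circle these are 1 inside and
  0 outside.
\<close>

lemma Rouche_root_count:
  assumes "0 < r" and less: "\<And>z. z \<in> sphere c r \<Longrightarrow> cmod (poly p z - poly q z) < cmod (poly q z)"
  shows "root_count p (ball c r) = root_count q (ball c r)"
proof -
  have "c + of_real r \<in> sphere c r"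
    using \<open>0 < r\<close> by (simp add: dist_norm)
  from less[OF this] have nz: "p \<noteq> 0" "q \<noteq> 0"
    by auto
  have path: "path_image (circlepath c r) = sphere c r"
    using \<open>0 < r\<close> by simp
  have sum_eq: "(\<Sum>z | poly f z = 0. winding_number (circlepath c r) z * zorder (poly f) z)
      = complex_of_nat (root_count f (ball c r))"
    if "f \<noteq> 0" "\<And>z. z \<in> sphere c r \<Longrightarrow> poly f z \<noteq> 0" for f
  proof -
    have "(\<Sum>z | poly f z = 0. winding_number (circlepath c r) z * zorder (poly f) z)
      = (\<Sum>z | poly f z = 0 \<and> z \<in> ball c r. winding_number (circlepath c r) z * zorder (poly f) z)"
    proof (rule sum.mono_neutral_right)
      show "\<forall>z\<in>{z. poly f z = 0} - {z. poly f z = 0 \<and> z \<in> ball c r}.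
          winding_number (circlepath c r) z * zorder (poly f) z = 0"
      proof
        fix z assume "z \<in> {z. poly f z = 0} - {z. poly f z = 0 \<and> z \<in> ball c r}"
        then have "z \<notin> cball c r"
          using that(2)[of z] by (auto simp: dist_norm)
        then have "winding_number (circlepath c r) z = 0"
          using \<open>0 < r\<close> by (intro winding_number_zero_outside[of _ "cball c r"]) (auto simp: path)
        then show "winding_number (circlepath c r) z * zorder (poly f) z = 0" by simp
      qed
    qed (use poly_roots_finite[OF that(1)] in auto)
    also have "\<dots> = (\<Sum>z | poly f z = 0 \<and> z \<in> ball c r. complex_of_nat (Polynomial.order z f))"
      using that(1) by (intro sum.cong)
        (auto simp: zorder_poly winding_number_circlepath dist_norm norm_minus_commute)
    finally show ?thesis
      by (simp add: root_count_def)
  qed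
  have "(\<Sum>z\<in>{z\<in>UNIV. poly q z + poly (p - q) z = 0}. winding_number (circlepath c r) z * zorder (\<lambda>z. poly q z + poly (p - q) z) z)
      = (\<Sum>z\<in>{z\<in>UNIV. poly q z = 0}. winding_number (circlepath c r) z * zorder (poly q) z)"
    using less path poly_roots_finite[OF nz(1)] poly_roots_finite[OF nz(2)]
    by (intro Rouche_theorem) (auto intro!: holomorphic_intros)
  then have "(\<Sum>z | poly p z = 0. winding_number (circlepath c r) z * zorder (poly p) z)
      = (\<Sum>z | poly q z = 0. winding_number (circlepath c r) z * zorder (poly q) z)"
    by simp
  moreover have "poly p z \<noteq> 0" "poly q z \<noteq> 0" if "z \<in> sphere c r" for z
    using less[OF that] by auto
  ultimately have "complex_of_nat (root_count p (ball c r)) = complex_of_nat (root_count q (ball c r))"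
    using sum_eq[OF nz(1)] sum_eq[OF nz(2)] by simp
  then show ?thesis
    by (simp only: of_nat_eq_iff)
qed

text \<open>
  For polynomials of bounded degree this is locally uniform convergence. In the coefficientwise form it
  is visibly compatible with sums and products, and hence with the Leibniz formula for determinants.
\<close>

definition coeffs_tendsto :: "('p \<Rightarrow> complex poly) \<Rightarrow> complex poly \<Rightarrow> 'p filter \<Rightarrow> bool" where
  "coeffs_tendsto P p F \<longleftrightarrow> (\<forall>i. ((\<lambda>x. coeff (P x) i) \<longlongrightarrow> coeff p i) F)"

lemma coeffs_tendsto_const: "coeffs_tendsto (\<lambda>_. p) p F"
  by (simp add: coeffs_tendsto_def)

lemma coeffs_tendsto_pCons:
  "(a \<longlongrightarrow> b) F \<Longrightarrow> coeffs_tendsto P p F \<Longrightarrow> coeffs_tendsto (\<lambda>x. pCons (a x) (P x)) (pCons b p) F"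
  by (auto simp: coeffs_tendsto_def coeff_pCons split: nat.split)

lemma coeffs_tendsto_add:
  "coeffs_tendsto P p F \<Longrightarrow> coeffs_tendsto Q q F \<Longrightarrow> coeffs_tendsto (\<lambda>x. P x + Q x) (p + q) F"
  by (auto simp: coeffs_tendsto_def intro!: tendsto_intros)

lemma coeffs_tendsto_mult:
  "coeffs_tendsto P p F \<Longrightarrow> coeffs_tendsto Q q F \<Longrightarrow> coeffs_tendsto (\<lambda>x. P x * Q x) (p * q) F"
  by (auto simp: coeffs_tendsto_def coeff_mult intro!: tendsto_intros)

lemma coeffs_tendsto_sum:
  "(\<And>i. i \<in> I \<Longrightarrow> coeffs_tendsto (P i) (p i) F) \<Longrightarrow> coeffs_tendsto (\<lambda>x. \<Sum>i\<in>I. P i x) (\<Sum>i\<in>I. p i) F"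
  by (induction I rule: infinite_finite_induct) (auto intro: coeffs_tendsto_const coeffs_tendsto_add)

lemma coeffs_tendsto_prod:
  "(\<And>i. i \<in> I \<Longrightarrow> coeffs_tendsto (P i) (p i) F) \<Longrightarrow> coeffs_tendsto (\<lambda>x. \<Prod>i\<in>I. P i x) (\<Prod>i\<in>I. p i) F"
  by (induction I rule: infinite_finite_induct) (auto intro: coeffs_tendsto_const coeffs_tendsto_mult)

lemma coeffs_tendsto_char_poly:
  assumes "\<And>i j. i < n \<Longrightarrow> j < n \<Longrightarrow> ((\<lambda>x. M x i j) \<longlongrightarrow> m i j) F"
  shows "coeffs_tendsto (\<lambda>x. char_poly (mat n n (\<lambda>(i, j). M x i j))) (char_poly (mat n n (\<lambda>(i, j). m i j))) F"
proof -
  have *: "char_poly (mat n n (\<lambda>(i, j). a i j)) =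
      (\<Sum>p | p permutes {0..<n}. signof p *
        (\<Prod>i = 0..<n. (if i = p i then [:- a i (p i), 1:] else [:- a i (p i):])))" for a :: "nat \<Rightarrow> nat \<Rightarrow> complex"
    unfolding char_poly_def
    by (subst det_def'[of _ n]) (auto simp: char_poly_matrix_def intro!: sum.cong prod.cong arg_cong2[where f = "(*)"])
  show ?thesis
    unfolding *
  proof (intro coeffs_tendsto_sum coeffs_tendsto_mult coeffs_tendsto_const coeffs_tendsto_prod)
    fix p i assume "p \<in> {p. p permutes {0..<n}}" "i \<in> {0..<n}"
    then have "p i < n" "i < n"
      using permutes_in_image[of p "{0..<n}" i] by auto
    then show "coeffs_tendsto (\<lambda>x. if i = p i then [:- M x i (p i), 1:] else [:- M x i (p i):])
        (if i = p i then [:- m i (p i), 1:] else [:- m i (p i):]) F"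
      using assms by (auto intro!: coeffs_tendsto_pCons coeffs_tendsto_const tendsto_intros)
  qed
qed

text \<open>
  On the circle the modulus of \<open>p\<close> has a positive minimum, while \<open>P x\<close> converges to \<open>p\<close> uniformly.
\<close>

lemma root_count_continuous:
  assumes P: "coeffs_tendsto P p F" and deg: "\<And>x. degree (P x) \<le> n" "degree p \<le> n"
    and "0 < r" and roots: "\<And>z. z \<in> sphere c r \<Longrightarrow> poly p z \<noteq> 0"
  shows "\<forall>\<^sub>F x in F. (\<forall>z\<in>sphere c r. poly (P x) z \<noteq> 0) \<and>
    root_count (P x) (ball c r) = root_count p (ball c r)"
proof -
  have "c + of_real r \<in> sphere c r"
    using \<open>0 < r\<close> by (simp add: dist_norm)
  then have "sphere c r \<noteq> {}" by blast
  have "continuous_on (sphere c r) (\<lambda>z. cmod (poly p z))"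
    by (intro continuous_intros)
  then obtain z0 where z0: "z0 \<in> sphere c r" "\<And>z. z \<in> sphere c r \<Longrightarrow> cmod (poly p z0) \<le> cmod (poly p z)"
    using continuous_attains_inf[OF compact_sphere \<open>sphere c r \<noteq> {}\<close>] by blast
  define \<epsilon> where "\<epsilon> = cmod (poly p z0)"
  have "0 < \<epsilon>" using roots[OF z0(1)] by (simp add: \<epsilon>_def)
  let ?R = "cmod c + r"
  have "((\<lambda>x. \<Sum>i\<le>n. cmod (coeff (P x) i - coeff p i) * ?R ^ i) \<longlongrightarrow> (\<Sum>i\<le>n. cmod (coeff p i - coeff p i) * ?R ^ i)) F"
    using P by (intro tendsto_intros) (auto simp: coeffs_tendsto_def)
  then have "((\<lambda>x. \<Sum>i\<le>n. cmod (coeff (P x) i - coeff p i) * ?R ^ i) \<longlongrightarrow> 0) F"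
    by simp
  then have "\<forall>\<^sub>F x in F. (\<Sum>i\<le>n. cmod (coeff (P x) i - coeff p i) * ?R ^ i) < \<epsilon>"
    using \<open>0 < \<epsilon>\<close> by (rule order_tendstoD)
  then show ?thesis
  proof eventually_elim
    fix x assume x: "(\<Sum>i\<le>n. cmod (coeff (P x) i - coeff p i) * ?R ^ i) < \<epsilon>"
    have less: "cmod (poly (P x) z - poly p z) < cmod (poly p z)" if z: "z \<in> sphere c r" for z
    proof -
      have "cmod z \<le> ?R"
        using z norm_triangle_ineq2[of z c] by (simp add: dist_norm norm_minus_commute)
      have "degree (P x - p) \<le> n"
        using deg degree_diff_le by blast
      then have "poly (P x) z - poly p z = (\<Sum>i\<le>n. coeff (P x - p) i * z ^ i)"
        by (simp only: poly_diff[symmetric] poly_altdef[of "P x - p"]) (intro sum.mono_neutral_left, auto intro!: le_degree)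
      also have "cmod \<dots> \<le> (\<Sum>i\<le>n. cmod (coeff (P x) i - coeff p i) * ?R ^ i)"
        using \<open>cmod z \<le> ?R\<close>
        by (intro order_trans[OF norm_sum] sum_mono) (auto simp: norm_mult norm_power intro!: mult_left_mono power_mono)
      also note x
      also have "\<epsilon> \<le> cmod (poly p z)"
        unfolding \<epsilon>_def using z by (rule z0)
      finally show ?thesis .
    qed
    then have "poly (P x) z \<noteq> 0" if "z \<in> sphere c r" for z
      using that by force
    then show "(\<forall>z\<in>sphere c r. poly (P x) z \<noteq> 0) \<and> root_count (P x) (ball c r) = root_count p (ball c r)"
      using Rouche_root_count[OF \<open>0 < r\<close> less] by blast
  qed
qed

section \<open>Bounded perturbations of a diagonal operator\<close>

lemma real_arctan_abs_le_pi4: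
  assumes "\<bar>t\<bar> \<le> 1"
  shows "\<bar>arctan t\<bar> \<le> pi / 4"
  using assms arctan_le_iff[of t 1] arctan_le_iff[of "-1" t] by (simp add: arctan_one arctan_minus abs_le_iff)

text \<open>
  Seen from the vertex \<open>- 2 * K - 1\<close> the real part is at least \<open>K + 1\<close>, which exceeds the imaginary part.
\<close>

lemma nonneg_plus_bounded_in_sector:
  assumes "0 \<le> a" "cmod b \<le> K"
  shows "complex_of_real a + b \<in> sector (- 2 * K - 1) (pi / 4)"
proof -
  let ?z = "complex_of_real a + b - complex_of_real (- 2 * K - 1)"
  have "\<bar>Re b\<bar> \<le> K" "\<bar>Im b\<bar> \<le> K"
    using assms(2) abs_Re_le_cmod[of b] abs_Im_le_cmod[of b] by linarith+
  then have Re: "Re ?z \<ge> K + 1" and Im: "\<bar>Im ?z\<bar> \<le> K" and "0 \<le> K"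
    using assms by auto
  then have "0 < Re ?z" by linarith
  then have "\<bar>Im ?z / Re ?z\<bar> \<le> 1"
    unfolding abs_divide using Re Im by (subst pos_divide_le_eq) auto
  then have "\<bar>Arg ?z\<bar> \<le> pi / 4"
    unfolding arg_conv_arctan[OF \<open>0 < Re ?z\<close>] by (rule real_arctan_abs_le_pi4)
  then show ?thesis
    by (simp add: sector_def)
qed

lemma resolvent_setI:
  assumes T: "linear_operator D T" and "0 \<le> K"
    and surj: "\<And>f. \<exists>u\<in>D. T u - z *\<^sub>C u = f"
    and bound: "\<And>u. u \<in> D \<Longrightarrow> norm u \<le> K * norm (T u - z *\<^sub>C u)"
  shows "z \<in> resolvent_set D T" "onorm (resolvent D T z) \<le> K"
proof -
  let ?f = "\<lambda>u. T u - z *\<^sub>C u" and ?R = "resolvent D T z"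
  note D = linear_operatorD(1)[OF T]
  have diff: "?f (u - v) = ?f u - ?f v" if "u \<in> D" "v \<in> D" for u v
    using linear_operator_diff[OF T that] by (simp add: complex_vector.scale_right_diff_distrib)
  have add: "?f (u + v) = ?f u + ?f v" if "u \<in> D" "v \<in> D" for u v
    using linear_operatorD(2)[OF T that] by (simp add: scaleC_add_right)
  have inj: "inj_on ?f D"
  proof (rule inj_onI)
    fix u v assume uv: "u \<in> D" "v \<in> D" "?f u = ?f v"
    then have "norm (u - v) \<le> K * norm (?f (u - v))"
      by (intro bound complex_vector.subspace_diff[OF D])
    then show "u = v"
      using diff[OF uv(1,2)] uv(3) by simp
  qed
  have "f \<in> ?f ` D" for f
  proof -
    obtain u where "u \<in> D" "?f u = f"
      using surj[of f] by blast
    then show ?thesis by (intro image_eqI[of _ _ u]) simp_all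
  qed
  then have img: "?f ` D = UNIV"
    by blast
  then have bij: "bij_betw ?f D UNIV"
    using inj by (simp add: bij_betw_def)
  have R: "?R f \<in> D" "?f (?R f) = f" for f
    unfolding resolvent_def using img by (auto intro: inv_into_into f_inv_into_f)
  have eqI: "?R f = u" if "u \<in> D" "?f u = f" for u f
    using inj that unfolding resolvent_def by (simp add: inv_into_f_eq)
  have norm: "norm (?R f) \<le> K * norm f" for f
    using bound[OF R(1), of f] R(2)[of f] by simp
  have "bounded_linear ?R"
  proof (rule bounded_linear_intro[where K = K])
    show "?R (f + g) = ?R f + ?R g" for f g
      using R[of f] R[of g] add by (intro eqI complex_vector.subspace_add[OF D]) auto
    show "?R (r *\<^sub>R f) = r *\<^sub>R ?R f" for r f
    proof -
      have "T (complex_of_real r *\<^sub>C ?R f) - z *\<^sub>C complex_of_real r *\<^sub>C ?R f = complex_of_real r *\<^sub>C ?f (?R f)"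
        using R(1) linear_operatorD(3)[OF T]
        by (simp add: complex_vector.scale_right_diff_distrib scaleC_scaleC mult.commute)
      then have "?R (complex_of_real r *\<^sub>C f) = complex_of_real r *\<^sub>C ?R f"
        using R by (intro eqI complex_vector.subspace_scale[OF D]) simp_all
      then show ?thesis by (simp add: scaleC_of_real)
    qed
  qed (use norm in \<open>simp add: mult.commute\<close>)
  with bij show "z \<in> resolvent_set D T"
    by (simp add: resolvent_set_def)
  show "onorm ?R \<le> K"
    using norm by (intro onorm_bound \<open>0 \<le> K\<close>)
qed

lemma resolvent_in_domain: "z \<in> resolvent_set D T \<Longrightarrow> resolvent D T z f \<in> D"
  unfolding resolvent_set_def resolvent_def bij_betw_def by (auto intro: inv_into_into)

lemma resolvent_right_inverse:
  "z \<in> resolvent_set D T \<Longrightarrow> T (resolvent D T z f) - z *\<^sub>C resolvent D T z f = f"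
  unfolding resolvent_set_def resolvent_def bij_betw_def
  using f_inv_into_f[of f "\<lambda>u. T u - z *\<^sub>C u" D] by auto

lemma resolvent_left_inverse:
  "z \<in> resolvent_set D T \<Longrightarrow> u \<in> D \<Longrightarrow> resolvent D T z (T u - z *\<^sub>C u) = u"
  unfolding resolvent_set_def resolvent_def bij_betw_def by (auto intro: inv_into_f_f)

lemma bounded_linear_resolvent: "z \<in> resolvent_set D T \<Longrightarrow> bounded_linear (resolvent D T z)"
  by (simp add: resolvent_set_def)

text \<open>
  The eigenvalues \<open>\<mu> n\<close> of \<open>A\<close> have gaps that grow faster than every multiple of \<open>sqrt n\<close>. This is what
  makes bounded perturbations of arbitrary size small, compared with a gap that lies high enough.
  The perturbed operator will be compared with the part of \<open>A\<close> above such a gap.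
\<close>

locale diagonal_operator = orthonormal_basis e for e :: "nat \<Rightarrow> 'a::{complex_inner, banach}" +
  fixes \<mu> :: "nat \<Rightarrow> real" and D :: "'a set" and A :: "'a \<Rightarrow> 'a"
  assumes mu_nonneg: "0 \<le> \<mu> n"
    and mono_mu: "mono \<mu>"
    and gap: "\<forall>\<^sub>F N in sequentially. K * (1 + sqrt (real N)) \<le> \<mu> N - \<mu> (N - 1)"
    and domain_iff: "u \<in> D \<longleftrightarrow> summable (\<lambda>n. (\<mu> n * cmod (coef n u))\<^sup>2)"
    and coef_A [simp]: "u \<in> D \<Longrightarrow> coef n (A u) = complex_of_real (\<mu> n) * coef n u"
begin

lemma domain_iff_image: "u \<in> D \<longleftrightarrow> (\<exists>v. \<forall>n. coef n v = complex_of_real (\<mu> n) * coef n u)"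
proof
  assume "\<exists>v. \<forall>n. coef n v = complex_of_real (\<mu> n) * coef n u"
  then obtain v where "\<And>n. coef n v = complex_of_real (\<mu> n) * coef n u" by blast
  then show "u \<in> D"
    using Bessel_summable[of v] mu_nonneg by (simp add: domain_iff norm_mult)
qed (auto intro: exI[of _ "A u"])

lemma linear_operator_A: "linear_operator D A"
  unfolding linear_operator_def complex_vector.subspace_def
proof (intro conjI ballI allI)
  show "0 \<in> D"
    by (simp add: domain_iff)
  show *: "u + v \<in> D" if "u \<in> D" "v \<in> D" for u v
    unfolding domain_iff_image using that by (intro exI[of _ "A u + A v"]) (simp add: distrib_left)
  show **: "c *\<^sub>C u \<in> D" if "u \<in> D" for c u
    unfolding domain_iff_image using that by (intro exI[of _ "c *\<^sub>C A u"]) simp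
  show "A (u + v) = A u + A v" if "u \<in> D" "v \<in> D" for u v
    using that * by (intro coef_eqI) (simp add: distrib_left)
  show "A (c *\<^sub>C u) = c *\<^sub>C A u" if "u \<in> D" for c u
    using that ** by (intro coef_eqI) simp
qed

lemma subspace_domain: "complex_vector.subspace D"
  by (rule linear_operatorD(1)[OF linear_operator_A])

lemma basis_in_domain [simp]: "e n \<in> D"
  unfolding domain_iff_image by (intro exI[of _ "complex_of_real (\<mu> n) *\<^sub>C e n"]) simp

lemma cinner_A_self:
  assumes "u \<in> D"
  obtains a where "0 \<le> a" "cinner (A u) u = complex_of_real a"
proof -
  have "(\<lambda>k. cinner (A u) (\<Sum>n<k. coef n u *\<^sub>C e n)) \<longlonglongrightarrow> cinner (A u) u"
    using sums_basis[of u] unfolding sums_def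
    by (rule bounded_linear.tendsto[OF bounded_linear_cinner_right])
  moreover have "cinner (A u) (\<Sum>n<k. coef n u *\<^sub>C e n) = complex_of_real (\<Sum>n<k. \<mu> n * (cmod (coef n u))\<^sup>2)" for k
    using assms by (simp add: cinner_sum_right cinner_scaleC_right coef_def[symmetric] mult_ac
        flip: cnj_mult_cmod)
  ultimately have *: "(\<lambda>k. complex_of_real (\<Sum>n<k. \<mu> n * (cmod (coef n u))\<^sup>2)) \<longlonglongrightarrow> cinner (A u) u"
    by simp
  then have Re: "(\<lambda>k. (\<Sum>n<k. \<mu> n * (cmod (coef n u))\<^sup>2)) \<longlonglongrightarrow> Re (cinner (A u) u)"
    and Im: "(\<lambda>k. 0::real) \<longlonglongrightarrow> Im (cinner (A u) u)"
    using tendsto_Re[OF *] tendsto_Im[OF *] by simp_all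
  have "0 \<le> Re (cinner (A u) u)"
    by (rule LIMSEQ_le_const[OF Re]) (auto intro!: sum_nonneg mult_nonneg_nonneg mu_nonneg)
  moreover have "Im (cinner (A u) u) = 0"
    using Im LIMSEQ_unique tendsto_const by blast
  ultimately show thesis
    by (intro that[of "Re (cinner (A u) u)"]) (simp_all add: complex_eq_iff)
qed

lemma tail_estimate:
  assumes low: "\<And>n. n < N \<Longrightarrow> coef n w = 0"
    and high: "\<And>n. N \<le> n \<Longrightarrow> (complex_of_real (\<mu> n) - z) * coef n w = coef n f"
    and z: "Re z < \<mu> N"
  shows "(\<mu> N - Re z) * norm w \<le> norm f"
proof -
  have "norm w \<le> inverse (\<mu> N - Re z) * norm f"
  proof (rule norm_le_by_coef)
    show "0 \<le> inverse (\<mu> N - Re z)" using z by simp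
    show "cmod (coef n w) \<le> inverse (\<mu> N - Re z) * cmod (coef n f)" for n
    proof (cases "n < N")
      case False
      then have "\<mu> N - Re z \<le> \<mu> n - Re z"
        using mono_mu by (simp add: monoD)
      also have "\<dots> \<le> cmod (complex_of_real (\<mu> n) - z)"
        using complex_Re_le_cmod[of "complex_of_real (\<mu> n) - z"] by simp
      finally have "(\<mu> N - Re z) * cmod (coef n w) \<le> cmod (coef n f)"
        using False by (simp add: high[symmetric] norm_mult mult_right_mono)
      then show ?thesis
        using z by (simp add: divide_simps mult.commute)
    qed (use low z in simp)
  qed
  then show ?thesis
    using z by (simp add: divide_simps mult.commute)
qed

text \<open>
  Above the first \<open>N\<close> coefficients \<open>A - z\<close> is bounded below by \<open>\<mu> N - Re z\<close>, so a perturbation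
  of smaller norm does not destroy invertibility there.
\<close>

lemma tail_solvable:
  assumes C_diff: "\<And>u v. C (u - v) = C u - C v" and C_bound: "\<And>u. norm (C u) \<le> c * norm u"
    and c: "c < \<mu> N - Re z" and "0 \<le> c"
  obtains w where "w \<in> D" "\<And>n. n < N \<Longrightarrow> coef n w = 0"
    "\<And>n. N \<le> n \<Longrightarrow> coef n (A w + C w - z *\<^sub>C w) = coef n f"
proof -
  define g where "g n = (if n < N then 0 else 1 / (complex_of_real (\<mu> n) - z))" for n
  define K where "K = 1 / (\<mu> N - Re z)"
  have pos: "0 < \<mu> N - Re z" using c \<open>0 \<le> c\<close> by linarith
  have ne: "complex_of_real (\<mu> n) - z \<noteq> 0" "cmod (1 / (complex_of_real (\<mu> n) - z)) \<le> K" if "N \<le> n" for n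
  proof -
    have "\<mu> N - Re z \<le> \<mu> n - Re z"
      using that mono_mu by (simp add: monoD)
    also have "\<dots> \<le> cmod (complex_of_real (\<mu> n) - z)"
      using complex_Re_le_cmod[of "complex_of_real (\<mu> n) - z"] by simp
    finally have *: "\<mu> N - Re z \<le> cmod (complex_of_real (\<mu> n) - z)" .
    then show "complex_of_real (\<mu> n) - z \<noteq> 0" using pos by force
    show "cmod (1 / (complex_of_real (\<mu> n) - z)) \<le> K"
      unfolding K_def norm_divide using * pos by (intro frac_le) auto
  qed
  have "0 \<le> K" using pos by (simp add: K_def)
  have g: "cmod (g n) \<le> K" for n
    using ne(2)[of n] \<open>0 \<le> K\<close> by (simp add: g_def)
  have coef_g: "coef n (diag g u) = g n * coef n u" for n u
    by (rule coef_diag) (rule g)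
  define \<Phi> where "\<Phi> w = diag g (f - C w)" for w
  have "\<exists>!w\<in>UNIV. \<Phi> w = w"
  proof (rule Banach_fix[of UNIV "K * c"])
    show "0 \<le> K * c" using \<open>0 \<le> K\<close> \<open>0 \<le> c\<close> by simp
    show "K * c < 1" using c pos by (simp add: K_def)
    show "dist (\<Phi> x) (\<Phi> y) \<le> K * c * dist x y" for x y
    proof -
      have "\<Phi> x - \<Phi> y = diag g (C (y - x))"
        unfolding \<Phi>_def by (subst diag_diff[symmetric]) (use g in \<open>simp_all add: C_diff\<close>)
      then have "norm (\<Phi> x - \<Phi> y) \<le> K * norm (C (y - x))"
        using norm_diag_le[of g K] g by simp
      also have "\<dots> \<le> K * (c * norm (y - x))"
        using \<open>0 \<le> K\<close> by (intro mult_left_mono C_bound)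
      finally show ?thesis
        by (simp add: dist_norm norm_minus_commute mult.assoc)
    qed
  qed (auto simp: complete_UNIV)
  then obtain w where w: "\<Phi> w = w" by blast
  have coef_w: "coef n w = g n * coef n (f - C w)" for n
    using coef_g[of n "f - C w"] w by (simp add: \<Phi>_def)
  have 1: "(complex_of_real (\<mu> n) - z) * coef n w = coef n (f - C w)" if "N \<le> n" for n
    using coef_w[of n] ne(1)[OF that] that by (simp add: g_def)
  define h where "h n = (if n < N then 0 else 1 :: complex)" for n
  have coef_h: "coef n (diag h u) = h n * coef n u" for n u
    by (rule coef_diag[where K = 1]) (simp add: h_def)
  have "w \<in> D"
    unfolding domain_iff_image
  proof (intro exI allI)
    show "coef n (diag h (f - C w) + z *\<^sub>C w) = complex_of_real (\<mu> n) * coef n w" for n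
    proof (cases "n < N")
      case True
      then show ?thesis using coef_w[of n] by (simp add: coef_h h_def g_def)
    next
      case False
      then show ?thesis using 1[of n] by (simp add: coef_h h_def algebra_simps)
    qed
  qed
  then show thesis
  proof (rule that)
    show "coef n w = 0" if "n < N" for n
      using coef_w[of n] that by (simp add: g_def)
    show "coef n (A w + C w - z *\<^sub>C w) = coef n f" if "N \<le> n" for n
      using 1[OF that] \<open>w \<in> D\<close> by (simp add: algebra_simps)
  qed
qed

end

locale perturbed_diagonal = diagonal_operator +
  fixes B :: "'a \<Rightarrow> 'a" and M :: real
  assumes B_add: "B (u + v) = B u + B v"
    and B_scaleC: "B (c *\<^sub>C u) = c *\<^sub>C B u"
    and B_bound: "norm (B u) \<le> M * norm u"
begin

abbreviation H :: "'a \<Rightarrow> 'a" where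
  "H u \<equiv> A u + B u"

lemma M_nonneg: "0 \<le> M"
  using order_trans[OF norm_ge_zero B_bound[of "e 0"]] by simp

lemma B_zero [simp]: "B 0 = 0"
  using B_scaleC[of 0 0] by simp

lemma B_diff: "B (u - v) = B u - B v"
  using B_add[of "u - v" v] by simp

lemma linear_operator_H: "linear_operator D H"
  using linear_operator_A unfolding linear_operator_def
  by (auto simp: B_add B_scaleC scaleC_add_right)

text \<open>
  The case \<open>N = 0\<close> of the results on tails.
\<close>

lemma half_plane:
  assumes "Re z < - M"
  shows "z \<in> resolvent_set D H" "onorm (resolvent D H z) \<le> 1 / (- Re z - M)"
    and "u \<in> D \<Longrightarrow> norm u \<le> 1 / (- Re z - M) * norm (H u - z *\<^sub>C u)"
proof -
  have *: "norm u \<le> 1 / (- Re z - M) * norm (H u - z *\<^sub>C u)" if "u \<in> D" for u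
  proof -
    let ?f = "H u - z *\<^sub>C u"
    have "- Re z * norm u \<le> (\<mu> 0 - Re z) * norm u"
      using mu_nonneg[of 0] by (intro mult_right_mono) auto
    also have "\<dots> \<le> norm (?f - B u)"
      using mu_nonneg[of 0] assms M_nonneg that by (intro tail_estimate) (auto simp: algebra_simps)
    also have "\<dots> \<le> norm ?f + M * norm u"
      using norm_triangle_ineq4[of ?f "B u"] B_bound[of u] by linarith
    finally have "(- Re z - M) * norm u \<le> norm ?f"
      by (simp add: algebra_simps)
    then show ?thesis
      using assms by (simp add: field_simps)
  qed
  then show "u \<in> D \<Longrightarrow> norm u \<le> 1 / (- Re z - M) * norm (H u - z *\<^sub>C u)" .
  have "\<exists>u\<in>D. H u - z *\<^sub>C u = f" for f
  proof -
    have "M < \<mu> 0 - Re z" using mu_nonneg[of 0] assms by linarith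
    then obtain w where "w \<in> D" "\<And>n. coef n (A w + B w - z *\<^sub>C w) = coef n f"
      by (rule tail_solvable[of B M 0 z f, OF B_diff B_bound _ M_nonneg]) auto
    then show ?thesis using coef_eqI by blast
  qed
  from resolvent_setI[OF linear_operator_H _ this *]
  show "z \<in> resolvent_set D H" "onorm (resolvent D H z) \<le> 1 / (- Re z - M)"
    using assms by auto
qed

text \<open>
  The numerical range lies within distance \<open>M\<close> of the nonnegative real axis, since \<open>A\<close> is nonnegative.
\<close>

lemma m_sectorial: "m_sectorial D H"
  unfolding m_sectorial_def
proof
  have "cinner (H u) u \<in> sector (- 2 * M - 1) (pi / 4)" if u: "u \<in> D" "norm u = 1" for u
  proof -
    obtain a where "0 \<le> a" "cinner (A u) u = complex_of_real a"
      using cinner_A_self[OF u(1)] by blast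
    moreover have "cmod (cinner (B u) u) \<le> M"
      using cinner_Cauchy_Schwarz[of "B u" u] B_bound[of u] u by simp
    ultimately show ?thesis
      using nonneg_plus_bounded_in_sector by (simp add: cinner_add_left)
  qed
  then show "sectorial D H"
    unfolding sectorial_def using linear_operator_H pi_gt_zero
    by (intro conjI exI[of _ "- 2 * M - 1"] exI[of _ "pi / 4"]) auto
  have shift: "resolvent D (\<lambda>u. H u + complex_of_real M *\<^sub>C u) (- z) = resolvent D H (- z - complex_of_real M)"
    "- z \<in> resolvent_set D (\<lambda>u. H u + complex_of_real M *\<^sub>C u) \<longleftrightarrow> - z - complex_of_real M \<in> resolvent_set D H" for z
  proof -
    have *: "(\<lambda>u. H u + complex_of_real M *\<^sub>C u - (- z) *\<^sub>C u) = (\<lambda>u. H u - (- z - complex_of_real M) *\<^sub>C u)"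
      by (rule ext) (simp add: complex_vector.scale_left_diff_distrib algebra_simps)
    show **: "resolvent D (\<lambda>u. H u + complex_of_real M *\<^sub>C u) (- z) = resolvent D H (- z - complex_of_real M)"
      unfolding resolvent_def * ..
    show "- z \<in> resolvent_set D (\<lambda>u. H u + complex_of_real M *\<^sub>C u) \<longleftrightarrow> - z - complex_of_real M \<in> resolvent_set D H"
      unfolding resolvent_set_def mem_Collect_eq ** * ..
  qed
  have "m_accretive D (\<lambda>u. H u + complex_of_real M *\<^sub>C u)"
    unfolding m_accretive_def shift
  proof (intro conjI allI impI)
    fix z :: complex assume "0 < Re z"
    then have z: "Re (- z - complex_of_real M) < - M" by simp
    show "- z - complex_of_real M \<in> resolvent_set D H" by (rule half_plane(1)[OF z])
    show "onorm (resolvent D H (- z - complex_of_real M)) \<le> 1 / Re z"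
      using half_plane(2)[OF z] by simp
  qed (rule linear_operator_shift[OF linear_operator_H])
  then show "quasi_m_accretive D H"
    unfolding quasi_m_accretive_def by blast
qed

text \<open>
  The graph norms of \<open>H\<close> and \<open>A\<close> are equivalent, so that compactness of the resolvent and Sobolev
  estimates reduce to statements on \<open>A\<close>.
\<close>

lemma norm_A_le:
  assumes "u \<in> D"
  shows "norm (A u) \<le> norm (H u - z *\<^sub>C u) + (cmod z + M) * norm u"
proof -
  have "A u = (H u - z *\<^sub>C u) + (z *\<^sub>C u - B u)"
    by simp
  then have "norm (A u) \<le> norm (H u - z *\<^sub>C u) + norm (z *\<^sub>C u - B u)"
    by (metis norm_triangle_ineq)
  also have "norm (z *\<^sub>C u - B u) \<le> cmod z * norm u + M * norm u"
    using norm_triangle_ineq4[of "z *\<^sub>C u" "B u"] B_bound[of u] by (simp add: norm_scaleC)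
  finally show ?thesis by (simp add: algebra_simps)
qed

end

context diagonal_operator begin

lemma mu_at_top: "filterlim \<mu> at_top sequentially"
  unfolding filterlim_at_top
proof
  fix Z :: real
  show "\<forall>\<^sub>F N in sequentially. Z \<le> \<mu> N"
    using gap[of "\<bar>Z\<bar>"]
  proof eventually_elim
    fix N assume "\<bar>Z\<bar> * (1 + sqrt (real N)) \<le> \<mu> N - \<mu> (N - 1)"
    moreover have "\<bar>Z\<bar> * 1 \<le> \<bar>Z\<bar> * (1 + sqrt (real N))"
      by (intro mult_left_mono) auto
    ultimately show "Z \<le> \<mu> N"
      using mu_nonneg[of "N - 1"] by linarith
  qed
qed

text \<open>
  The coefficients from \<open>N\<close> on contribute at most \<open>K / \<mu> N\<close> to the norm, and the first \<open>N\<close> coefficients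
  range over a compact set.
\<close>

lemma compact_closure_graph_bounded:
  assumes "S \<subseteq> D" and S: "\<And>u. u \<in> S \<Longrightarrow> norm u \<le> K \<and> norm (A u) \<le> K"
  shows "compact (closure S)"
proof -
  have "0 \<le> max K 0" by simp
  have totally: "\<exists>k. finite k \<and> S \<subseteq> (\<Union>x\<in>k. ball x \<epsilon>)" if "0 < \<epsilon>" for \<epsilon>
  proof -
    have "\<forall>\<^sub>F N in sequentially. 2 * max K 0 / \<epsilon> + 1 \<le> \<mu> N"
      using mu_at_top by (simp add: filterlim_at_top)
    then obtain N where N: "2 * max K 0 / \<epsilon> + 1 \<le> \<mu> N"
      by (auto simp: eventually_sequentially)
    moreover have "0 \<le> 2 * max K 0 / \<epsilon>"
      using \<open>0 < \<epsilon>\<close> by simp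
    ultimately have "0 < \<mu> N" by linarith
    define P where "P u = (\<Sum>n<N. coef n u *\<^sub>C e n)" for u
    have tail: "norm (u - P u) < \<epsilon> / 2" if "u \<in> S" for u
    proof -
      have "(\<mu> N - Re 0) * norm (u - P u) \<le> norm (A u - P (A u))"
        using \<open>S \<subseteq> D\<close> that \<open>0 < \<mu> N\<close> by (intro tail_estimate) (auto simp: P_def mult_if_one)
      also have "norm (A u - P (A u)) \<le> norm (A u)"
        unfolding P_def by (rule norm_diff_partial_sum_le) simp
      also have "norm (A u) \<le> max K 0"
        using S[OF that] by linarith
      also have "max K 0 < \<mu> N * (\<epsilon> / 2)"
        using N \<open>0 < \<epsilon>\<close> by (simp add: field_simps)
      finally show ?thesis
        using \<open>0 < \<mu> N\<close> by simp
    qed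
    define Q :: "(nat \<Rightarrow> complex) \<Rightarrow> 'a" where "Q a = (\<Sum>n<N. a n *\<^sub>C e n)" for a
    have "\<exists>k. finite k \<and> Q ` {a. \<forall>n<N. cmod (a n) \<le> max K 0} \<subseteq> (\<Union>x\<in>k. ball x (\<epsilon> / 2))"
    proof -
      have "compact (Q ` {a. \<forall>n<N. cmod (a n) \<le> max K 0})"
        unfolding Q_def
      proof (induction N)
        case 0
        have "(\<lambda>a::nat \<Rightarrow> complex. \<Sum>n<0. a n *\<^sub>C e n) ` {a. \<forall>n<0. cmod (a n) \<le> max K 0} = {0}"
          by auto
        then show ?case by simp
      next
        case (Suc N)
        have "compact ((\<lambda>c. c *\<^sub>C e N) ` cball 0 (max K 0))"
          by (intro compact_continuous_image linear_continuous_on bounded_linear_scaleC_left compact_cball)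
        then have "compact {x + y | x y. x \<in> (\<lambda>a. \<Sum>n<N. a n *\<^sub>C e n) ` {a. \<forall>n<N. cmod (a n) \<le> max K 0} \<and>
            y \<in> (\<lambda>c. c *\<^sub>C e N) ` cball 0 (max K 0)}"
          by (rule compact_sums[OF Suc.IH])
        also have "{x + y | x y. x \<in> (\<lambda>a. \<Sum>n<N. a n *\<^sub>C e n) ` {a. \<forall>n<N. cmod (a n) \<le> max K 0} \<and>
            y \<in> (\<lambda>c. c *\<^sub>C e N) ` cball 0 (max K 0)} =
          (\<lambda>a. \<Sum>n<Suc N. a n *\<^sub>C e n) ` {a. \<forall>n<Suc N. cmod (a n) \<le> max K 0}" (is "?L = ?R")
        proof
          show "?R \<subseteq> ?L"
          proof
            fix x assume "x \<in> ?R"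
            then obtain a where a: "\<forall>n<Suc N. cmod (a n) \<le> max K 0" "x = (\<Sum>n<Suc N. a n *\<^sub>C e n)"
              by blast
            then have "x = (\<Sum>n<N. a n *\<^sub>C e n) + a N *\<^sub>C e N" "a N \<in> cball 0 (max K 0)"
              "a \<in> {a. \<forall>n<N. cmod (a n) \<le> max K 0}"
              by (simp_all add: dist_norm)
            then show "x \<in> ?L" by blast
          qed
          show "?L \<subseteq> ?R"
          proof
            fix x assume "x \<in> ?L"
            then obtain p q where "x = p + q" "q \<in> (\<lambda>c. c *\<^sub>C e N) ` cball 0 (max K 0)"
              "p \<in> (\<lambda>a. \<Sum>n<N. a n *\<^sub>C e n) ` {a. \<forall>n<N. cmod (a n) \<le> max K 0}"
              by blast
            then obtain a c where a: "\<forall>n<N. cmod (a n) \<le> max K 0" "c \<in> cball 0 (max K 0)"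
              and x: "x = (\<Sum>n<N. a n *\<^sub>C e n) + c *\<^sub>C e N"
              by blast
            have "(\<Sum>n<N. (a(N := c)) n *\<^sub>C e n) = (\<Sum>n<N. a n *\<^sub>C e n)"
              by (rule sum.cong) auto
            then have "x = (\<Sum>n<Suc N. (a(N := c)) n *\<^sub>C e n)"
              unfolding x by simp
            moreover have "\<forall>n<Suc N. cmod ((a(N := c)) n) \<le> max K 0"
              using a by (simp add: less_Suc_eq dist_norm)
            ultimately show "x \<in> ?R" by blast
          qed
        qed
        finally show ?case .
      qed
      then show ?thesis
        using compact_eq_totally_bounded[of "Q ` {a. \<forall>n<N. cmod (a n) \<le> max K 0}"] \<open>0 < \<epsilon>\<close> half_gt_zero by blast
    qed
    then obtain k where k: "finite k" "Q ` {a. \<forall>n<N. cmod (a n) \<le> max K 0} \<subseteq> (\<Union>x\<in>k. ball x (\<epsilon> / 2))"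
      by blast
    have "u \<in> (\<Union>x\<in>k. ball x \<epsilon>)" if "u \<in> S" for u
    proof -
      have "P u = Q (\<lambda>n. coef n u)" by (simp add: P_def Q_def)
      moreover have "\<forall>n<N. cmod (coef n u) \<le> max K 0"
        using S[OF that] by (auto intro!: order_trans[OF cmod_coef_le])
      ultimately obtain x where "x \<in> k" "dist x (P u) < \<epsilon> / 2"
        using k(2) by auto
      moreover have "dist (P u) u < \<epsilon> / 2"
        using tail[OF that] by (simp add: dist_norm norm_minus_commute)
      ultimately show ?thesis
        using dist_triangle_half_l[of x "P u" \<epsilon> u] by (auto intro!: bexI[of _ x] simp: dist_commute)
    qed
    then show ?thesis using k(1) by blast
  qed
  have "\<exists>k. finite k \<and> closure S \<subseteq> (\<Union>x\<in>k. ball x \<epsilon>)" if eps: "0 < \<epsilon>" for \<epsilon>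
  proof -
    obtain k where k: "finite k" "S \<subseteq> (\<Union>x\<in>k. ball x (\<epsilon> / 2))"
      using totally[OF half_gt_zero[OF eps]] by blast
    have "closed (\<Union>x\<in>k. cball x (\<epsilon> / 2))"
      using k(1) by (intro closed_UN) auto
    moreover have "S \<subseteq> (\<Union>x\<in>k. cball x (\<epsilon> / 2))"
      using k(2) ball_subset_cball by blast
    ultimately have "closure S \<subseteq> (\<Union>x\<in>k. cball x (\<epsilon> / 2))"
      by (simp add: closure_minimal)
    also have "\<dots> \<subseteq> (\<Union>x\<in>k. ball x \<epsilon>)"
      using eps by (intro UN_mono) (auto simp: cball_def ball_def)
    finally show ?thesis using k(1) by blast
  qed
  moreover have "complete (closure S)"
    by (simp add: complete_eq_closed)
  ultimately show ?thesis
    by (simp add: compact_eq_totally_bounded)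
qed

end

lemma (in perturbed_diagonal) compact_resolvent: "compact_resolvent D H"
  unfolding compact_resolvent_def compact_operator_def
proof (intro conjI ballI allI impI)
  show "resolvent_set D H \<noteq> {}"
    using half_plane(1)[of "complex_of_real (- M - 1)"] by auto
  fix z assume z: "z \<in> resolvent_set D H"
  let ?R = "resolvent D H z"
  show "bounded_linear ?R" by (rule bounded_linear_resolvent[OF z])
  then obtain C where C: "\<And>f. norm (?R f) \<le> norm f * C" "0 < C"
    using bounded_linear.pos_bounded by blast
  fix S :: "'a set" assume "bounded S"
  then obtain b where b: "\<And>f. f \<in> S \<Longrightarrow> norm f \<le> b"
    by (auto simp: bounded_iff)
  show "compact (closure (?R ` S))"
  proof (rule compact_closure_graph_bounded[where K = "max (b * C) (b + (cmod z + M) * (b * C))"])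
    show "?R ` S \<subseteq> D" using resolvent_in_domain[OF z] by blast
    fix u assume "u \<in> ?R ` S"
    then obtain f where f: "f \<in> S" "u = ?R f" by blast
    have 1: "norm u \<le> b * C"
      unfolding f(2) using C(1)[of f] b[OF f(1)] C(2) by (meson mult_right_mono order_less_imp_le order_trans)
    have "norm (A u) \<le> norm (H u - z *\<^sub>C u) + (cmod z + M) * norm u"
      unfolding f(2) by (rule norm_A_le[OF resolvent_in_domain[OF z]])
    also have "H u - z *\<^sub>C u = f"
      unfolding f(2) by (rule resolvent_right_inverse[OF z])
    also have "norm f + (cmod z + M) * norm u \<le> b + (cmod z + M) * (b * C)"
      using b[OF f(1)] 1 M_nonneg by (intro add_mono mult_left_mono) auto
    finally show "norm u \<le> max (b * C) (b + (cmod z + M) * (b * C)) \<and>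
        norm (A u) \<le> max (b * C) (b + (cmod z + M) * (b * C))"
      using 1 by auto
  qed
qed

section \<open>Invariant subspaces close to the lowest eigenspaces\<close>

lemma (in orthonormal) norm_sum_coef_le:
  assumes "\<And>j. j < N \<Longrightarrow> norm (x j) \<le> s" "0 \<le> s"
  shows "norm (\<Sum>j<N. coef j u *\<^sub>C x j) \<le> s * sqrt (real N) * norm u"
proof -
  have "norm (\<Sum>j<N. coef j u *\<^sub>C x j) \<le> (\<Sum>j<N. cmod (coef j u) * s)"
    using assms by (intro sum_norm_le) (auto simp: norm_scaleC intro: mult_left_mono)
  also have "\<dots> = (\<Sum>j<N. cmod (coef j u)) * s"
    by (simp add: sum_distrib_right)
  also have "\<dots> \<le> sqrt (real N) * norm u * s"
    using assms(2) by (intro mult_right_mono sum_cmod_coef_le)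
  finally show ?thesis by (simp add: mult_ac)
qed

context diagonal_operator begin

text \<open>
  The vectors \<open>y k = e k + x k\<close>, \<open>k < N\<close>, with \<open>x k\<close> orthogonal to \<open>e 0, \<dots>, e (N - 1)\<close>, span a
  subspace invariant under \<open>A + B\<close> iff \<open>x\<close> is a fixed point of this map (a Riccati equation, written in
  columns): the coefficients below \<open>N\<close> of \<open>(A + B) (y k)\<close> determine the only possible combination
  of \<open>y 0, \<dots>, y (N - 1)\<close>, and the fixed point equation compares the coefficients from \<open>N\<close> on.
\<close>

definition riccati_rhs :: "('a \<Rightarrow> 'a) \<Rightarrow> nat \<Rightarrow> (nat \<Rightarrow> 'a) \<Rightarrow> nat \<Rightarrow> 'a" where
  "riccati_rhs B N x k = (\<Sum>j<N. coef j (B (e k + x k)) *\<^sub>C x j) - B (e k + x k)"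

definition riccati :: "('a \<Rightarrow> 'a) \<Rightarrow> nat \<Rightarrow> (nat \<Rightarrow> 'a) \<Rightarrow> nat \<Rightarrow> 'a" where
  "riccati B N x k =
     diag (\<lambda>n. if n < N then 0 else 1 / complex_of_real (\<mu> n - \<mu> k)) (riccati_rhs B N x k)"

text \<open>
  The factor \<open>6 * M\<close> makes \<open>riccati\<close> contract distances by one half on the unit ball; the summand 6 makes
  the gap positive also when \<open>M = 0\<close>.
\<close>

definition wide_gap :: "real \<Rightarrow> nat \<Rightarrow> bool" where
  "wide_gap M N \<longleftrightarrow> 0 < N \<and> (6 * M + 6) * (1 + sqrt (real N)) \<le> \<mu> N - \<mu> (N - 1)"

lemma eventually_wide_gap: "\<forall>\<^sub>F N in sequentially. wide_gap M N"
  unfolding wide_gap_def using gap[of "6 * M + 6"] eventually_gt_at_top[of 0] by eventually_elim simp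

lemma wide_gap_pos:
  assumes "wide_gap M N" "0 \<le> M"
  shows "0 < \<mu> N - \<mu> (N - 1)"
    and "M * (1 + 3 * sqrt (real N)) / (\<mu> N - \<mu> (N - 1)) \<le> 1 / 2"
proof -
  have g: "(6 * M + 6) * (1 + sqrt (real N)) \<le> \<mu> N - \<mu> (N - 1)"
    using assms by (simp add: wide_gap_def)
  moreover have "0 < (6 * M + 6) * (1 + sqrt (real N))"
    using assms by (intro mult_pos_pos) (auto simp: add_pos_nonneg)
  ultimately show pos: "0 < \<mu> N - \<mu> (N - 1)" by linarith
  have "2 * (M * (1 + 3 * sqrt (real N))) \<le> (6 * M + 6) * (1 + sqrt (real N))"
    using assms by (simp add: algebra_simps)
  then show "M * (1 + 3 * sqrt (real N)) / (\<mu> N - \<mu> (N - 1)) \<le> 1 / 2"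
    using g pos by (simp add: divide_simps)
qed

text \<open>
  For \<open>k < N \<le> n\<close> the eigenvalues \<open>\<mu> k\<close> and \<open>\<mu> n\<close> lie on different sides of the gap.
\<close>

lemma riccati_symbol:
  assumes gap: "0 < \<mu> N - \<mu> (N - 1)" and "k < N"
  shows "cmod (if n < N then 0 else 1 / complex_of_real (\<mu> n - \<mu> k)) \<le> 1 / (\<mu> N - \<mu> (N - 1))"
proof (cases "n < N")
  case False
  have "\<mu> N \<le> \<mu> n" "\<mu> k \<le> \<mu> (N - 1)"
    using mono_mu False \<open>k < N\<close> by (auto simp: monoD)
  then have "\<mu> N - \<mu> (N - 1) \<le> \<bar>\<mu> n - \<mu> k\<bar>" by linarith
  then show ?thesis
    using gap False by (simp add: norm_divide frac_le flip: of_real_diff)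
qed (use gap in simp)

lemma coef_riccati:
  assumes "0 < \<mu> N - \<mu> (N - 1)" "k < N"
  shows "coef n (riccati B N x k) =
    (if n < N then 0 else 1 / complex_of_real (\<mu> n - \<mu> k)) * coef n (riccati_rhs B N x k)"
  unfolding riccati_def by (rule coef_diag) (rule riccati_symbol[OF assms])

lemma norm_riccati_diff:
  assumes "0 < \<mu> N - \<mu> (N - 1)" "k < N"
  shows "norm (riccati B N x k - riccati B' N x' k)
    \<le> norm (riccati_rhs B N x k - riccati_rhs B' N x' k) / (\<mu> N - \<mu> (N - 1))"
proof -
  let ?g = "\<lambda>n. if n < N then 0 else 1 / complex_of_real (\<mu> n - \<mu> k)"
  have g: "cmod (?g n) \<le> 1 / (\<mu> N - \<mu> (N - 1))" for n
    by (rule riccati_symbol[OF assms])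
  have "riccati B N x k - riccati B' N x' k = diag ?g (riccati_rhs B N x k - riccati_rhs B' N x' k)"
    unfolding riccati_def by (rule diag_diff[symmetric]) (rule g)
  also have "norm \<dots> \<le> 1 / (\<mu> N - \<mu> (N - 1)) * norm (riccati_rhs B N x k - riccati_rhs B' N x' k)"
    by (rule norm_diag_le) (rule g)
  finally show ?thesis by simp
qed

end

context perturbed_diagonal begin

lemma riccati_rhs_lipschitz:
  assumes "k < N"
    and x: "\<And>j. j < N \<Longrightarrow> norm (x j) \<le> 1" and x': "\<And>j. j < N \<Longrightarrow> norm (x' j) \<le> 1"
    and d: "\<And>j. j < N \<Longrightarrow> norm (x j - x' j) \<le> d"
  shows "norm (riccati_rhs B N x k - riccati_rhs B N x' k) \<le> M * (1 + 3 * sqrt (real N)) * d"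
proof -
  have "0 \<le> d" by (rule order_trans[OF norm_ge_zero d[OF \<open>k < N\<close>]])
  define y y' where "y = e k + x k" and "y' = e k + x' k"
  have B1: "norm (B (y - y')) \<le> M * d"
    using order_trans[OF B_bound mult_left_mono[OF d[OF \<open>k < N\<close>] M_nonneg]] by (simp add: y_def y'_def)
  have "norm y' \<le> 2"
    unfolding y'_def using norm_triangle_ineq[of "e k" "x' k"] x'[OF \<open>k < N\<close>] by simp
  then have B2: "norm (B y') \<le> M * 2"
    by (intro order_trans[OF B_bound] mult_left_mono M_nonneg)
  have "riccati_rhs B N x k - riccati_rhs B N x' k =
      (\<Sum>j<N. coef j (B (y - y')) *\<^sub>C x j) + (\<Sum>j<N. coef j (B y') *\<^sub>C (x j - x' j)) - B (y - y')"
    unfolding riccati_rhs_def y_def[symmetric] y'_def[symmetric] B_diff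
    by (simp add: complex_vector.scale_left_diff_distrib complex_vector.scale_right_diff_distrib
        sum.distrib sum_subtractf)
  also have "norm \<dots> \<le> norm (\<Sum>j<N. coef j (B (y - y')) *\<^sub>C x j) +
      norm (\<Sum>j<N. coef j (B y') *\<^sub>C (x j - x' j)) + norm (B (y - y'))"
    by (intro order_trans[OF norm_triangle_ineq4] add_right_mono norm_triangle_ineq)
  also have "norm (\<Sum>j<N. coef j (B (y - y')) *\<^sub>C x j) \<le> 1 * sqrt (real N) * norm (B (y - y'))"
    by (rule norm_sum_coef_le) (use x in auto)
  also have "1 * sqrt (real N) * norm (B (y - y')) \<le> sqrt (real N) * (M * d)"
    using B1 by (simp add: mult_left_mono)
  also have "norm (\<Sum>j<N. coef j (B y') *\<^sub>C (x j - x' j)) \<le> d * sqrt (real N) * norm (B y')"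
    by (rule norm_sum_coef_le) (use d \<open>0 \<le> d\<close> in auto)
  also have "d * sqrt (real N) * norm (B y') \<le> d * sqrt (real N) * (M * 2)"
    using B2 \<open>0 \<le> d\<close> by (intro mult_left_mono) auto
  also note B1
  finally show ?thesis
    by (simp add: algebra_simps)
qed

lemma riccati_contraction:
  assumes N: "wide_gap M N" and "k < N"
    and "\<And>j. j < N \<Longrightarrow> norm (x j) \<le> 1" "\<And>j. j < N \<Longrightarrow> norm (x' j) \<le> 1"
    and d: "\<And>j. j < N \<Longrightarrow> norm (x j - x' j) \<le> d"
  shows "norm (riccati B N x k - riccati B N x' k) \<le> d / 2"
proof -
  note gap = wide_gap_pos[OF N M_nonneg]
  have "0 \<le> d" by (rule order_trans[OF norm_ge_zero d[OF \<open>k < N\<close>]])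
  have "norm (riccati B N x k - riccati B N x' k) \<le> M * (1 + 3 * sqrt (real N)) * d / (\<mu> N - \<mu> (N - 1))"
    using gap(1) by (intro order_trans[OF norm_riccati_diff[OF gap(1) \<open>k < N\<close>]] divide_right_mono
        riccati_rhs_lipschitz assms) auto
  also have "\<dots> = M * (1 + 3 * sqrt (real N)) / (\<mu> N - \<mu> (N - 1)) * d"
    by simp
  also have "\<dots> \<le> 1 / 2 * d"
    using gap(2) \<open>0 \<le> d\<close> by (rule mult_right_mono)
  finally show ?thesis by simp
qed

lemma norm_riccati_zero:
  assumes N: "wide_gap M N" and "k < N"
  shows "norm (riccati B N (\<lambda>_. 0) k) \<le> 1 / 2"
proof -
  note gap = wide_gap_pos[OF N M_nonneg]
  have "riccati (\<lambda>_. 0) N (\<lambda>_. 0) k = 0"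
    by (rule coef_eqI) (simp add: coef_riccati[OF gap(1) \<open>k < N\<close>] riccati_rhs_def)
  then have "norm (riccati B N (\<lambda>_. 0) k) \<le> norm (riccati_rhs B N (\<lambda>_. 0) k) / (\<mu> N - \<mu> (N - 1))"
    using norm_riccati_diff[OF gap(1) \<open>k < N\<close>, of B "\<lambda>_. 0" "\<lambda>_. 0" "\<lambda>_. 0"] by (simp add: riccati_rhs_def)
  also have "norm (riccati_rhs B N (\<lambda>_. 0) k) \<le> M * (1 + 3 * sqrt (real N))"
  proof -
    have "norm (riccati_rhs B N (\<lambda>_. 0) k) \<le> M * 1"
      using B_bound[of "e k"] by (simp add: riccati_rhs_def)
    also have "\<dots> \<le> M * (1 + 3 * sqrt (real N))"
      by (intro mult_left_mono M_nonneg) simp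
    finally show ?thesis .
  qed
  then have "norm (riccati_rhs B N (\<lambda>_. 0) k) / (\<mu> N - \<mu> (N - 1)) \<le> M * (1 + 3 * sqrt (real N)) / (\<mu> N - \<mu> (N - 1))"
    using gap(1) by (intro divide_right_mono) auto
  also note gap(2)
  finally show ?thesis by simp
qed

text \<open>
  The iteration starting from 0 makes a first step of length at most 1/2 and then halves its steps, so it
  never leaves the unit ball, where the contraction estimate is valid.
\<close>

lemma riccati_fixed_point:
  assumes N: "wide_gap M N"
  obtains x where "\<And>k. k < N \<Longrightarrow> riccati B N x k = x k" "\<And>k. k < N \<Longrightarrow> norm (x k) \<le> 1"
proof -
  define X where "X i = ((riccati B N) ^^ i) (\<lambda>_. 0)" for i
  have X: "(\<forall>k<N. norm (X i k) \<le> 1 - (1 / 2) ^ i) \<and> (\<forall>k<N. norm (X (Suc i) k - X i k) \<le> (1 / 2) ^ Suc i)" for i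
  proof (induction i)
    case 0
    then show ?case
      using norm_riccati_zero[OF N] by (simp add: X_def)
  next
    case (Suc i)
    have *: "norm (X (Suc i) k) \<le> 1 - (1 / 2) ^ Suc i" if "k < N" for k
    proof -
      have "norm (X (Suc i) k) \<le> norm (X i k) + norm (X (Suc i) k - X i k)"
        by (rule norm_triangle_sub)
      also have "\<dots> \<le> (1 - (1 / 2) ^ i) + (1 / 2) ^ Suc i"
        using Suc.IH that by (intro add_mono) simp_all
      finally show ?thesis by simp
    qed
    have le1: "norm (X j k) \<le> 1" if "k < N" "j = i \<or> j = Suc i" for j k
    proof -
      have "norm (X j k) \<le> 1 - (1 / 2) ^ j"
        using that * Suc.IH by auto
      also have "\<dots> \<le> 1" by simp
      finally show ?thesis .
    qed
    have "norm (riccati B N (X (Suc i)) k - riccati B N (X i) k) \<le> (1 / 2) ^ Suc i / 2" if "k < N" for k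
      using le1 Suc.IH that by (intro riccati_contraction[OF N]) simp_all
    then show ?case
      using * by (simp add: X_def)
  qed
  have le1: "norm (X i k) \<le> 1" if "k < N" for i k
  proof -
    have "norm (X i k) \<le> 1 - (1 / 2) ^ i" using X that by blast
    also have "\<dots> \<le> 1" by simp
    finally show ?thesis .
  qed
  have "convergent (\<lambda>i. X i k)" if "k < N" for k
  proof -
    have "summable (\<lambda>i. X (Suc i) k - X i k)"
    proof (rule summable_comparison_test[OF _ summable_mult[OF summable_geometric, of "1 / 2" "1 / 2"]])
      show "\<exists>n0. \<forall>i\<ge>n0. norm (X (Suc i) k - X i k) \<le> 1 / 2 * (1 / 2) ^ i"
        using X that by simp
    qed simp
    moreover have "(\<Sum>i<n. X (Suc i) k - X i k) = X n k" for n
      using sum_lessThan_telescope[of "\<lambda>i. X i k" n] by (simp add: X_def)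
    ultimately show ?thesis
      by (simp add: summable_iff_convergent)
  qed
  then have lim: "(\<lambda>i. X i k) \<longlonglongrightarrow> lim (\<lambda>i. X i k)" if "k < N" for k
    using that by (simp add: convergent_LIMSEQ_iff)
  define x where "x k = lim (\<lambda>i. X i k)" for k
  note lim = lim[folded x_def]
  have norm_x: "norm (x k) \<le> 1" if "k < N" for k
    using le1[OF that] by (intro LIMSEQ_le_const2[OF tendsto_norm[OF lim[OF that]]]) blast
  have "riccati B N x k = x k" if k: "k < N" for k
  proof -
    define d where "d i = (\<Sum>j<N. norm (X i j - x j))" for i
    have le: "norm (X (Suc i) k - riccati B N x k) \<le> d i / 2" for i
    proof -
      have "norm (riccati B N (X i) k - riccati B N x k) \<le> d i / 2"
        unfolding d_def using le1 norm_x
        by (intro riccati_contraction[OF N k] member_le_sum) auto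
      then show ?thesis by (simp add: X_def)
    qed
    have "(\<lambda>i. d i / 2) \<longlonglongrightarrow> (\<Sum>j<N. norm (x j - x j)) / 2"
      unfolding d_def by (intro tendsto_intros lim) auto
    then have "(\<lambda>i. d i / 2) \<longlonglongrightarrow> 0"
      by simp
    then have "(\<lambda>i. X (Suc i) k - riccati B N x k) \<longlonglongrightarrow> 0"
      by (rule Lim_null_comparison[rotated]) (rule always_eventually, intro allI le)
    then have "(\<lambda>i. X (Suc i) k) \<longlonglongrightarrow> riccati B N x k"
      by (rule LIM_zero_cancel)
    then show ?thesis
      using LIMSEQ_Suc[OF lim[OF k]] by (rule LIMSEQ_unique)
  qed
  then show thesis
    using norm_x by (rule that)
qed

end

text \<open>
  Fixed points of a contraction with factor 1/2 move by at most twice the defect of the old fixed point in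
  the new equation. This defect only involves the finitely many vectors to which \<open>riccati_rhs\<close> applies the
  perturbation, so convergence of the perturbations in the strong sense will make it small.
\<close>

lemma (in diagonal_operator) riccati_fixed_point_stable:
  assumes "perturbed_diagonal e \<mu> D A B' M" and N: "wide_gap M N"
    and x: "\<And>k. k < N \<Longrightarrow> riccati B N x k = x k" "\<And>k. k < N \<Longrightarrow> norm (x k) \<le> 1"
    and x': "\<And>k. k < N \<Longrightarrow> riccati B' N x' k = x' k" "\<And>k. k < N \<Longrightarrow> norm (x' k) \<le> 1"
    and \<delta>: "\<And>k. k < N \<Longrightarrow> norm (riccati_rhs B' N x k - riccati_rhs B N x k) \<le> \<delta>" and "k < N"
  shows "norm (x' k - x k) \<le> 2 * \<delta> / (\<mu> N - \<mu> (N - 1))"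
proof -
  interpret B': perturbed_diagonal e \<mu> D A B' M by fact
  note gap = wide_gap_pos[OF N B'.M_nonneg]
  define d where "d = Max ((\<lambda>k. norm (x' k - x k)) ` {..<N})"
  have d: "norm (x' j - x j) \<le> d" if "j < N" for j
    unfolding d_def using that by (intro Max_ge) auto
  have "d \<in> (\<lambda>k. norm (x' k - x k)) ` {..<N}"
    unfolding d_def using \<open>k < N\<close> by (intro Max_in) auto
  then obtain j where j: "j < N" "d = norm (x' j - x j)" by auto
  have "d = norm ((riccati B' N x' j - riccati B' N x j) + (riccati B' N x j - riccati B N x j))"
    using x(1) x'(1) j by simp
  also have "\<dots> \<le> norm (riccati B' N x' j - riccati B' N x j) + norm (riccati B' N x j - riccati B N x j)"
    by (rule norm_triangle_ineq)
  also have "norm (riccati B' N x' j - riccati B' N x j) \<le> d / 2"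
    by (rule B'.riccati_contraction[OF N j(1) x'(2) x(2) d])
  also have "norm (riccati B' N x j - riccati B N x j) \<le> \<delta> / (\<mu> N - \<mu> (N - 1))"
    using gap(1) \<delta>[OF j(1)] by (intro order_trans[OF norm_riccati_diff[OF gap(1) j(1)]] divide_right_mono) auto
  finally have "d \<le> 2 * \<delta> / (\<mu> N - \<mu> (N - 1))" by simp
  then show ?thesis using d[OF \<open>k < N\<close>] by linarith
qed

locale riccati_frame = perturbed_diagonal +
  fixes N :: nat and x :: "nat \<Rightarrow> 'a"
  assumes wide: "wide_gap M N"
    and fixed: "k < N \<Longrightarrow> riccati B N x k = x k"
    and norm_x: "k < N \<Longrightarrow> norm (x k) \<le> 1"
begin

definition y :: "nat \<Rightarrow> 'a" where
  "y k = e k + x k"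

definition m :: "nat \<Rightarrow> nat \<Rightarrow> complex" where
  "m j k = (if j = k then complex_of_real (\<mu> k) else 0) + coef j (B (y k))"

definition G :: "'a set" where
  "G = complex_vector.span (y ` {..<N})"

text \<open>
  In the half-plane up to this bound, \<open>A - z\<close> on the coefficients from \<open>N\<close> on dominates the perturbation
  that remains there, with a margin of 1.
\<close>

definition bd :: real where
  "bd = \<mu> N - M * (1 + sqrt (real N)) - 1"

lemmas gap_pos = wide_gap_pos(1)[OF wide M_nonneg]

lemma coef_x_low: "k < N \<Longrightarrow> n < N \<Longrightarrow> coef n (x k) = 0"
  using coef_riccati[OF gap_pos, of k n B x] by (simp add: fixed)

lemma coef_x_high:
  assumes "k < N" "N \<le> n"
  shows "complex_of_real (\<mu> n - \<mu> k) * coef n (x k) = (\<Sum>j<N. coef j (B (y k)) * coef n (x j)) - coef n (B (y k))"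
proof -
  have "\<mu> N \<le> \<mu> n" "\<mu> k \<le> \<mu> (N - 1)"
    using mono_mu assms by (auto simp: monoD)
  then have "\<mu> n - \<mu> k \<noteq> 0" using gap_pos by linarith
  then have "complex_of_real (\<mu> n - \<mu> k) \<noteq> 0"
    by (simp only: of_real_eq_0_iff not_False_eq_True)
  then show ?thesis
    using coef_riccati[OF gap_pos assms(1), of n B x] assms
    by (simp add: fixed riccati_rhs_def y_def[symmetric] del: of_real_diff)
qed

lemma coef_y_low: "k < N \<Longrightarrow> n < N \<Longrightarrow> coef n (y k) = (if k = n then 1 else 0)"
  by (simp add: y_def coef_x_low)

lemma coef_y_high: "k < N \<Longrightarrow> N \<le> n \<Longrightarrow> coef n (y k) = coef n (x k)"
  by (simp add: y_def)

text \<open>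
  This says \<open>H (y k) = (\<Sum>j<N. m j k *\<^sub>C y j)\<close> in terms of coefficients, in a form that makes sense before
  \<open>y k \<in> D\<close> is known; membership in \<open>D\<close> is a consequence.
\<close>

lemma coef_H_y_aux:
  assumes k: "k < N"
  shows "complex_of_real (\<mu> n) * coef n (y k) = coef n (\<Sum>j<N. m j k *\<^sub>C y j) - coef n (B (y k))"
proof (cases "n < N")
  case True
  have "coef n (\<Sum>j<N. m j k *\<^sub>C y j) = (\<Sum>j<N. m j k * (if j = n then 1 else 0))"
    using True by (simp add: coef_y_low)
  also have "\<dots> = m n k"
    using True by (simp add: mult_if_one)
  finally show ?thesis
    using True k by (simp add: coef_y_low m_def)
next
  case False
  then have n: "N \<le> n" by simp
  have "coef n (\<Sum>j<N. m j k *\<^sub>C y j) = (\<Sum>j<N. m j k * coef n (x j))"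
    using n by (simp add: coef_y_high)
  also have "\<dots> = (\<Sum>j<N. (if j = k then complex_of_real (\<mu> k) * coef n (x k) else 0)) + (\<Sum>j<N. coef j (B (y k)) * coef n (x j))"
    unfolding sum.distrib[symmetric] by (rule sum.cong) (auto simp: m_def algebra_simps)
  also have "(\<Sum>j<N. (if j = k then complex_of_real (\<mu> k) * coef n (x k) else 0)) = complex_of_real (\<mu> k) * coef n (x k)"
    using k by simp
  finally show ?thesis
    using coef_x_high[OF k n] k n by (simp add: coef_y_high algebra_simps)
qed

lemma y_in_domain: "k < N \<Longrightarrow> y k \<in> D"
  unfolding domain_iff_image
  by (intro exI[of _ "(\<Sum>j<N. m j k *\<^sub>C y j) - B (y k)"]) (simp only: coef_H_y_aux coef_diff simp_thms)

lemma H_y: "k < N \<Longrightarrow> H (y k) = (\<Sum>j<N. m j k *\<^sub>C y j)"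
proof (rule coef_eqI)
  fix n assume k: "k < N"
  show "coef n (H (y k)) = coef n (\<Sum>j<N. m j k *\<^sub>C y j)"
    unfolding coef_add coef_A[OF y_in_domain[OF k]] coef_H_y_aux[OF k] by simp
qed

lemma sum_in_G: "(\<Sum>j<N. a j *\<^sub>C y j) \<in> G"
  unfolding G_def by (intro complex_vector.span_sum complex_vector.span_scale complex_vector.span_base) auto

lemma in_G_iff: "u \<in> G \<longleftrightarrow> u = (\<Sum>j<N. coef j u *\<^sub>C y j)"
proof
  assume "u \<in> G"
  then show "u = (\<Sum>j<N. coef j u *\<^sub>C y j)"
    unfolding G_def
  proof (induction rule: complex_vector.span_induct_alt)
    case base
    show ?case by simp
  next
    case (step c z u)
    from step(1) obtain k where k: "k < N" "z = y k" by blast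
    have "(\<Sum>j<N. coef j (y k) *\<^sub>C y j) = (\<Sum>j<N. if j = k then y k else 0)"
      using k(1) by (intro sum.cong) (auto simp: coef_y_low)
    then have "(\<Sum>j<N. coef j (y k) *\<^sub>C y j) = y k"
      using k(1) by simp
    moreover have "(\<Sum>j<N. coef j (c *\<^sub>C y k + u) *\<^sub>C y j)
        = c *\<^sub>C (\<Sum>j<N. coef j (y k) *\<^sub>C y j) + (\<Sum>j<N. coef j u *\<^sub>C y j)"
      by (simp add: scaleC_add_left sum.distrib complex_vector.scale_sum_right scaleC_scaleC)
    ultimately show ?case
      using step(2) k(2) by metis
  qed
qed (metis sum_in_G)

lemma independent_y: "complex_vector.independent (y ` {..<N})" "card (y ` {..<N}) = N"
proof -
  have notin: "y k \<notin> complex_vector.span (y ` {..<k})" if "k < N" for k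
  proof
    assume "y k \<in> complex_vector.span (y ` {..<k})"
    moreover have "coef k u = 0" if "u \<in> complex_vector.span (y ` {..<k})" for u
      using that
    proof (induction rule: complex_vector.span_induct_alt)
      case (step c z u)
      then obtain j where "j < k" "z = y j" by blast
      then show ?case using step(2) \<open>k < N\<close> by (simp add: coef_y_low)
    qed simp
    ultimately have "coef k (y k) = 0" by blast
    then show False using that by (simp add: coef_y_low)
  qed
  have "complex_vector.independent (y ` {..<n}) \<and> card (y ` {..<n}) = n" if "n \<le> N" for n
    using that
  proof (induction n)
    case (Suc n)
    have "y n \<notin> complex_vector.span (y ` {..<n})" using notin[of n] Suc.prems by simp
    moreover from this have "y n \<notin> y ` {..<n}"
      using complex_vector.span_base[of "y n" "y ` {..<n}"] by blast
    ultimately show ?case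
      using Suc.IH Suc.prems by (simp add: lessThan_Suc complex_vector.independent_insert)
  qed (simp add: complex_vector.independent_empty)
  then show "complex_vector.independent (y ` {..<N})" "card (y ` {..<N}) = N" by blast+
qed

lemma dim_G: "complex_vector.dim G = N"
  unfolding G_def using independent_y by (simp add: complex_vector.dim_eq_card_independent)

lemma G_subset_domain: "G \<subseteq> D"
  unfolding G_def using y_in_domain subspace_domain by (intro complex_vector.span_minimal) auto

end

section \<open>Spectrum and root subspaces\<close>

context riccati_frame begin

lemma coef_low_tail: "j < N \<Longrightarrow> coef j (u - (\<Sum>k<N. coef k u *\<^sub>C y k)) = 0"
proof -
  assume j: "j < N"
  have "(\<Sum>k<N. coef k u * coef j (y k)) = (\<Sum>k<N. if k = j then coef j u else 0)"
    using j by (intro sum.cong) (auto simp: coef_y_low)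
  then show ?thesis using j by simp
qed

text \<open>The part of \<open>B\<close> that acts modulo \<open>G\<close>.\<close>

definition C :: "'a \<Rightarrow> 'a" where
  "C w = B w - (\<Sum>j<N. coef j (B w) *\<^sub>C y j)"

lemma C_diff: "C (u - v) = C u - C v"
  by (simp add: C_def B_diff complex_vector.scale_left_diff_distrib sum_subtractf)

lemma C_bound: "norm (C w) \<le> M * (1 + sqrt (real N)) * norm w"
proof -
  have "C w = (B w - (\<Sum>j<N. coef j (B w) *\<^sub>C e j)) - (\<Sum>j<N. coef j (B w) *\<^sub>C x j)"
    unfolding C_def y_def by (simp add: scaleC_add_right sum.distrib algebra_simps)
  also have "norm \<dots> \<le> norm (B w - (\<Sum>j<N. coef j (B w) *\<^sub>C e j)) + norm (\<Sum>j<N. coef j (B w) *\<^sub>C x j)"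
    by (rule norm_triangle_ineq4)
  also have "\<dots> \<le> norm (B w) + 1 * sqrt (real N) * norm (B w)"
    by (intro add_mono norm_diff_partial_sum_le norm_sum_coef_le norm_x) auto
  also have "\<dots> = (1 + sqrt (real N)) * norm (B w)"
    by (simp add: algebra_simps)
  also have "\<dots> \<le> (1 + sqrt (real N)) * (M * norm w)"
    by (intro mult_left_mono B_bound) (simp add: add_nonneg_nonneg)
  finally show ?thesis by (simp add: mult_ac)
qed

lemma tail_bound:
  assumes w: "w \<in> D" "\<And>n. n < N \<Longrightarrow> coef n w = 0" and z: "Re z \<le> bd"
  shows "norm w \<le> norm (A w + C w - z *\<^sub>C w)"
proof -
  have c: "M * (1 + sqrt (real N)) + 1 \<le> \<mu> N - Re z"
    using z by (simp add: bd_def)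
  have c0: "0 \<le> M * (1 + sqrt (real N))"
    by (intro mult_nonneg_nonneg M_nonneg) (simp add: add_nonneg_nonneg)
  let ?f = "A w + C w - z *\<^sub>C w"
  have "(\<mu> N - Re z) * norm w \<le> norm (?f - C w)"
    using w c c0 by (intro tail_estimate) (auto simp: algebra_simps)
  also have "\<dots> \<le> norm ?f + M * (1 + sqrt (real N)) * norm w"
    using norm_triangle_ineq4[of ?f "C w"] C_bound[of w] by linarith
  finally have "(\<mu> N - Re z - M * (1 + sqrt (real N))) * norm w \<le> norm ?f"
    by (simp add: algebra_simps)
  moreover have "1 * norm w \<le> (\<mu> N - Re z - M * (1 + sqrt (real N))) * norm w"
    using c by (intro mult_right_mono) auto
  ultimately show ?thesis by simp
qed

lemma linear_operator_H_sum:
  "H (\<Sum>k<N. a k *\<^sub>C y k) = (\<Sum>k<N. a k *\<^sub>C H (y k))"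
  using y_in_domain by (intro linear_operator_sum[OF linear_operator_H]) auto

lemma H_invariant_G: "u \<in> G \<Longrightarrow> H u - z *\<^sub>C u \<in> G"
proof -
  assume u: "u \<in> G"
  have "H u = (\<Sum>k<N. coef k u *\<^sub>C H (y k))"
    using u linear_operator_H_sum[of "\<lambda>k. coef k u"] unfolding in_G_iff by simp
  also have "\<dots> \<in> G"
    unfolding G_def
  proof (intro complex_vector.span_sum complex_vector.span_scale)
    fix k assume "k \<in> {..<N}"
    then show "H (y k) \<in> complex_vector.span (y ` {..<N})"
      using sum_in_G[of "\<lambda>j. m j k"] by (simp add: H_y G_def)
  qed
  finally show ?thesis
    using u unfolding G_def by (intro complex_vector.span_diff complex_vector.span_scale)
qed

lemma H_minus_C_in_G: "(H w - z *\<^sub>C w) - (A w + C w - z *\<^sub>C w) \<in> G"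
  using sum_in_G[of "\<lambda>j. coef j (B w)"] by (simp add: C_def)

text \<open>
  This makes \<open>G\<close> contain all root subspaces of the half-plane. The component \<open>w\<close> of \<open>u\<close> with vanishing first
  \<open>N\<close> coefficients satisfies \<open>A w + C w - z *\<^sub>C w \<in> G\<close>; an element of \<open>G\<close> is determined by its first \<open>N\<close>
  coefficients, which are zero here, and above them \<open>A + C - z\<close> is injective.
\<close>

lemma preimage_of_G:
  assumes u: "u \<in> D" and Hu: "H u - z *\<^sub>C u \<in> G" and z: "Re z \<le> bd"
  shows "u \<in> G"
proof -
  define g where "g = (\<Sum>k<N. coef k u *\<^sub>C y k)"
  define w where "w = u - g"
  have g: "g \<in> G" unfolding g_def by (rule sum_in_G)
  then have gD: "g \<in> D" using G_subset_domain by blast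
  have wD: "w \<in> D" unfolding w_def using u gD by (rule complex_vector.subspace_diff[OF subspace_domain])
  have low: "coef n w = 0" if "n < N" for n
    unfolding w_def g_def using that by (rule coef_low_tail)
  let ?f = "A w + C w - z *\<^sub>C w"
  have "H w - z *\<^sub>C w = (H u - z *\<^sub>C u) - (H g - z *\<^sub>C g)"
    unfolding w_def linear_operator_diff[OF linear_operator_H u gD]
    by (simp add: complex_vector.scale_right_diff_distrib)
  also have "\<dots> \<in> G"
    using Hu H_invariant_G[OF g] unfolding G_def by (rule complex_vector.span_diff)
  finally have "(H w - z *\<^sub>C w) - ((H w - z *\<^sub>C w) - ?f) \<in> G"
    using H_minus_C_in_G[of w z] unfolding G_def by (rule complex_vector.span_diff)
  then have "?f \<in> G" by (simp add: algebra_simps)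
  then have "?f = (\<Sum>j<N. coef j ?f *\<^sub>C y j)"
    unfolding in_G_iff .
  also have "\<dots> = (\<Sum>j<N. 0)"
  proof (rule sum.cong)
    fix j assume "j \<in> {..<N}"
    then have j: "j < N" by simp
    have "coef j (C w) = 0" unfolding C_def using j by (rule coef_low_tail)
    then have "coef j ?f = 0" using low[OF j] wD by simp
    then show "coef j ?f *\<^sub>C y j = 0" by simp
  qed simp
  finally have "?f = 0" by simp
  then have "norm w \<le> 0"
    using tail_bound[OF wD low z] by simp
  then show ?thesis
    using g by (simp add: w_def)
qed

lemma iterated_kernel_subset_G:
  assumes "Re z \<le> bd"
  shows "iterated_kernel D H z n \<subseteq> G"
proof (induction n)
  case 0
  then show ?case by (simp add: G_def complex_vector.span_zero)
next
  case (Suc n)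
  then show ?case using preimage_of_G[OF _ _ assms] by auto
qed

lemma root_subspace_subset_G: "Re z \<le> bd \<Longrightarrow> root_subspace D H z \<subseteq> G"
  unfolding root_subspace_def using iterated_kernel_subset_G by blast

text \<open>
  Solvability modulo \<open>G\<close>, with a bound on the solution that will become a bound on the resolvent.
\<close>

lemma surj_mod_G:
  assumes z: "Re z \<le> bd"
  obtains w where "w \<in> D" "norm w \<le> norm (f - (\<Sum>j<N. coef j f *\<^sub>C y j))"
    "H w - z *\<^sub>C w = f - (\<Sum>j<N. (coef j f - coef j (B w)) *\<^sub>C y j)"
proof -
  let ?f = "f - (\<Sum>j<N. coef j f *\<^sub>C y j)"
  have c: "M * (1 + sqrt (real N)) < \<mu> N - Re z"
    using z by (simp add: bd_def)
  have c0: "0 \<le> M * (1 + sqrt (real N))"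
    by (intro mult_nonneg_nonneg M_nonneg) (simp add: add_nonneg_nonneg)
  obtain w where w: "w \<in> D" "\<And>n. n < N \<Longrightarrow> coef n w = 0"
    "\<And>n. N \<le> n \<Longrightarrow> coef n (A w + C w - z *\<^sub>C w) = coef n ?f"
    by (rule tail_solvable[of C "M * (1 + sqrt (real N))" N z ?f, OF C_diff C_bound c c0]) (rule that)
  have eq: "A w + C w - z *\<^sub>C w = ?f"
  proof (rule coef_eqI)
    fix n show "coef n (A w + C w - z *\<^sub>C w) = coef n ?f"
    proof (cases "n < N")
      case True
      have "coef n (C w) = 0" unfolding C_def using True by (rule coef_low_tail)
      then show ?thesis
        unfolding coef_low_tail[OF True] using w(1) w(2)[OF True] by simp
    next
      case False
      then show ?thesis using w(3) by simp
    qed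
  qed
  have "H w - z *\<^sub>C w = (A w + C w - z *\<^sub>C w) + (\<Sum>j<N. coef j (B w) *\<^sub>C y j)"
    by (simp add: C_def)
  also have "\<dots> = f - (\<Sum>j<N. (coef j f - coef j (B w)) *\<^sub>C y j)"
    unfolding eq by (simp add: complex_vector.scale_left_diff_distrib sum_subtractf)
  finally show thesis
    using w(1) tail_bound[OF w(1,2) z] unfolding eq by (intro that[of w])
qed

definition cp :: "complex poly" where
  "cp = char_poly (mat N N (\<lambda>(i, j). m i j))"

lemma cp_nonzero: "cp \<noteq> 0"
  using degree_monic_char_poly[of "mat N N (\<lambda>(i, j). m i j)" N] by (auto simp: cp_def)

lemma triangular_frame:
  assumes "cp = (\<Prod>a\<leftarrow>ts. [:- a, 1:])"
  obtains v where "flag D H v (\<lambda>i. ts ! i) N" "complex_vector.span (v ` {..<N}) = G"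
  unfolding G_def
  by (rule flag_exists[OF linear_operator_H y_in_domain H_y independent_y assms[unfolded cp_def]])

lemma cp_splits:
  obtains ts where "cp = (\<Prod>a\<leftarrow>ts. [:- a, 1:])" "length ts = N"
  using char_poly_factorized[of "mat N N (\<lambda>(i, j). m i j)" N] unfolding cp_def by auto

lemma poly_prod_list_linear: "poly (\<Prod>a\<leftarrow>ts. [:- a, 1:]) z = (\<Prod>a\<leftarrow>ts. - a + z)"
  by (induction ts) (simp_all del: mult_pCons_left)

lemma root_cp_iff:
  assumes "cp = (\<Prod>a\<leftarrow>ts. [:- a, 1:])"
  shows "poly cp z = 0 \<longleftrightarrow> z \<in> set ts"
  unfolding assms poly_prod_list_linear by (auto simp: prod_list_zero_iff image_iff)

lemma eigenvalue_iff_root: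
  assumes "Re z \<le> bd"
  shows "z \<in> eigenvalues D H \<longleftrightarrow> poly cp z = 0"
proof -
  obtain ts where ts: "cp = (\<Prod>a\<leftarrow>ts. [:- a, 1:])" "length ts = N"
    by (rule cp_splits)
  obtain v where v: "flag D H v (\<lambda>i. ts ! i) N" "complex_vector.span (v ` {..<N}) = G"
    by (rule triangular_frame[OF ts(1)])
  show ?thesis
    unfolding root_cp_iff[OF ts(1)]
  proof
    assume "z \<in> set ts"
    then obtain i where "i < N" "ts ! i = z"
      using ts(2) by (auto simp: in_set_conv_nth)
    then show "z \<in> eigenvalues D H"
      using flag_eigenvalue[OF linear_operator_H v(1)] by blast
  next
    assume "z \<in> eigenvalues D H"
    then obtain u where u: "u \<in> D" "u \<noteq> 0" "H u = z *\<^sub>C u"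
      unfolding eigenvalues_def by blast
    have "u \<in> iterated_kernel D H z 1" using u by simp
    then have "u \<in> complex_vector.span (v ` {..<N})"
      using iterated_kernel_subset_G[OF assms] v(2) by blast
    then show "z \<in> set ts"
      using flag_injective[OF linear_operator_H v(1) _ _ u(3)] u(2) ts(2) nth_mem by metis
  qed
qed

text \<open>
  Both sides count the occurrences of \<open>z\<close> on the diagonal of a triangular form of the restriction to \<open>G\<close>.
\<close>

lemma dim_root_subspace:
  assumes z: "Re z \<le> bd"
  shows "complex_vector.dim (root_subspace D H z) = Polynomial.order z cp"
proof -
  obtain ts where ts: "cp = (\<Prod>a\<leftarrow>ts. [:- a, 1:])" "length ts = N"
    by (rule cp_splits)
  \<comment> \<open>list the occurrences of \<open>z\<close> first\<close>
  define k where "k = count_list ts z"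
  define ts' where "ts' = filter (\<lambda>a. a = z) ts @ filter (\<lambda>a. a \<noteq> z) ts"
  have "(\<Prod>a\<leftarrow>ts'. f a) = (\<Prod>a\<leftarrow>ts. f a)" for f :: "complex \<Rightarrow> complex poly"
    unfolding ts'_def by (induction ts) (auto simp: mult_ac)
  then have ts': "cp = (\<Prod>a\<leftarrow>ts'. [:- a, 1:])" using ts by simp
  have len: "length (filter (\<lambda>a. a = z) ts) = k"
    unfolding k_def by (induction ts) auto
  have len': "length ts' = N"
    unfolding ts'_def using ts(2) sum_length_filter_compl[of "\<lambda>a. a = z" ts] by simp
  then have "k \<le> N" using len by (auto simp: ts'_def)
  obtain v where v: "flag D H v (\<lambda>i. ts' ! i) N" "complex_vector.span (v ` {..<N}) = G"
    by (rule triangular_frame[OF ts'])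
  have "complex_vector.dim (root_subspace D H z) = k"
  proof (rule flag_root_subspace(2)[OF linear_operator_H v(1) \<open>k \<le> N\<close>])
    show "ts' ! i = z" if "i < k" for i
    proof -
      have "ts' ! i = filter (\<lambda>a. a = z) ts ! i"
        using that len by (simp add: ts'_def nth_append)
      also have "\<dots> \<in> set (filter (\<lambda>a. a = z) ts)"
        using that len by (intro nth_mem) simp
      finally show ?thesis by simp
    qed
    show "ts' ! i \<noteq> z" if "k \<le> i" "i < N" for i
    proof -
      have "ts' ! i = filter (\<lambda>a. a \<noteq> z) ts ! (i - k)"
        using that len by (simp add: ts'_def nth_append)
      also have "\<dots> \<in> set (filter (\<lambda>a. a \<noteq> z) ts)"
        using that len len' by (intro nth_mem) (simp add: ts'_def)
      finally show ?thesis by simp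
    qed
    show "root_subspace D H z \<subseteq> complex_vector.span (v ` {..<N})"
      unfolding v(2) by (rule root_subspace_subset_G[OF z])
  qed
  moreover have "Polynomial.order z cp = k"
  proof -
    have ne: "(\<Prod>a\<leftarrow>ts. [:- a, 1:]) \<noteq> (0 :: complex poly)" for ts
      by (auto simp: prod_list_zero_iff)
    have "Polynomial.order z (\<Prod>a\<leftarrow>ts. [:- a, 1:]) = count_list ts z" for ts
    proof (induction ts)
      case (Cons a ts)
      have "Polynomial.order z (\<Prod>a\<leftarrow>a # ts. [:- a, 1:])
          = Polynomial.order z [:- a, 1:] + Polynomial.order z (\<Prod>a\<leftarrow>ts. [:- a, 1:])"
        using ne[of "a # ts"] by (simp add: order_mult del: mult_pCons_left)
      moreover have "Polynomial.order z [:- a, 1:] = (if a = z then 1 else 0)"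
        using order_power_n_n[of z 1] by (auto intro: order_0I)
      ultimately show ?case using Cons by simp
    qed simp
    then show ?thesis using ts(1) k_def by simp
  qed
  ultimately show ?thesis by simp
qed

lemma has_eigenvalue_count:
  assumes U: "\<And>z. z \<in> U \<Longrightarrow> Re z \<le> bd"
  shows "has_eigenvalue_count D H U (root_count cp U)"
proof -
  have eq: "eigenvalues D H \<inter> U = {z. poly cp z = 0 \<and> z \<in> U}"
    using U eigenvalue_iff_root by blast
  have "finite {z. poly cp z = 0 \<and> z \<in> U}"
    by (rule finite_subset[OF _ poly_roots_finite[OF cp_nonzero]]) blast
  moreover have "\<exists>S. finite S \<and> root_subspace D H z \<subseteq> complex_vector.span S" if "z \<in> U" for z
    using root_subspace_subset_G[OF U[OF that]] unfolding G_def by (intro exI[of _ "y ` {..<N}"]) simp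
  moreover have "root_count cp U = (\<Sum>z | poly cp z = 0 \<and> z \<in> U. complex_vector.dim (root_subspace D H z))"
    unfolding root_count_def using U by (intro sum.cong) (simp_all add: dim_root_subspace)
  ultimately show ?thesis
    unfolding has_eigenvalue_count_def eq by simp
qed

lemma finite_eigenvalues: "finite (eigenvalues D H \<inter> {z. Re z \<le> bd})"
  using has_eigenvalue_count[of "{z. Re z \<le> bd}"] by (simp add: has_eigenvalue_count_def)

text \<open>
  The equation is first solved modulo \<open>G\<close>; the rest is then removed within \<open>G\<close>, where injectivity of
  \<open>H - z\<close> implies surjectivity.
\<close>

lemma not_eigenvalue_in_resolvent_set:
  assumes z: "Re z \<le> bd" and "z \<notin> eigenvalues D H"
  shows "z \<in> resolvent_set D H"
proof -
  obtain ts where ts: "cp = (\<Prod>a\<leftarrow>ts. [:- a, 1:])" "length ts = N"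
    by (rule cp_splits)
  obtain v where v: "flag D H v (\<lambda>i. ts ! i) N" "complex_vector.span (v ` {..<N}) = G"
    by (rule triangular_frame[OF ts(1)])
  have ts_ne: "ts ! i \<noteq> z" if "i < N" for i
    using assms(2) flag_eigenvalue[OF linear_operator_H v(1) that] by auto
  have "\<exists>\<rho>\<in>G. H \<rho> - z *\<^sub>C \<rho> = y j" if "j < N" for j
    using flag_surj[OF linear_operator_H v(1) ts_ne] that unfolding v(2) G_def
    by (auto intro: complex_vector.span_base)
  then obtain \<rho> where \<rho>: "\<And>j. j < N \<Longrightarrow> \<rho> j \<in> G" "\<And>j. j < N \<Longrightarrow> H (\<rho> j) - z *\<^sub>C \<rho> j = y j"
    by metis
  have \<rho>D: "\<rho> j \<in> D" if "j < N" for j using \<rho>(1)[OF that] G_subset_domain by blast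
  have comb: "(\<Sum>j<N. a j *\<^sub>C \<rho> j) \<in> D"
    "H (\<Sum>j<N. a j *\<^sub>C \<rho> j) - z *\<^sub>C (\<Sum>j<N. a j *\<^sub>C \<rho> j) = (\<Sum>j<N. a j *\<^sub>C y j)" for a
  proof -
    show "(\<Sum>j<N. a j *\<^sub>C \<rho> j) \<in> D"
      using \<rho>D by (intro complex_vector.subspace_sum[OF subspace_domain] complex_vector.subspace_scale[OF subspace_domain]) auto
    have "H (\<Sum>j<N. a j *\<^sub>C \<rho> j) = (\<Sum>j<N. a j *\<^sub>C H (\<rho> j))"
      using \<rho>D by (intro linear_operator_sum[OF linear_operator_H]) auto
    then have "H (\<Sum>j<N. a j *\<^sub>C \<rho> j) - z *\<^sub>C (\<Sum>j<N. a j *\<^sub>C \<rho> j) = (\<Sum>j<N. a j *\<^sub>C (H (\<rho> j) - z *\<^sub>C \<rho> j))"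
      by (simp add: complex_vector.scale_sum_right complex_vector.scale_right_diff_distrib
          sum_subtractf scaleC_scaleC mult.commute)
    also have "\<dots> = (\<Sum>j<N. a j *\<^sub>C y j)"
      using \<rho>(2) by (intro sum.cong) auto
    finally show "H (\<Sum>j<N. a j *\<^sub>C \<rho> j) - z *\<^sub>C (\<Sum>j<N. a j *\<^sub>C \<rho> j) = (\<Sum>j<N. a j *\<^sub>C y j)" .
  qed
  define q where "q = (\<Sum>j<N. norm (y j))"
  define K where "K = (1 + q) + (\<Sum>j<N. (1 + M * (1 + q)) * norm (\<rho> j))"
  have q: "0 \<le> q" unfolding q_def by (intro sum_nonneg) simp
  have "0 \<le> K"
    unfolding K_def using q M_nonneg by (intro add_nonneg_nonneg sum_nonneg mult_nonneg_nonneg) auto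
  have solve: "\<exists>u\<in>D. H u - z *\<^sub>C u = f \<and> norm u \<le> K * norm f" for f
  proof -
    obtain w where w: "w \<in> D" "norm w \<le> norm (f - (\<Sum>j<N. coef j f *\<^sub>C y j))"
      "H w - z *\<^sub>C w = f - (\<Sum>j<N. (coef j f - coef j (B w)) *\<^sub>C y j)"
      by (rule surj_mod_G[OF z])
    let ?r = "\<Sum>j<N. (coef j f - coef j (B w)) *\<^sub>C \<rho> j"
    have "norm (\<Sum>j<N. coef j f *\<^sub>C y j) \<le> (\<Sum>j<N. norm f * norm (y j))"
      by (intro sum_norm_le) (simp add: norm_scaleC mult_right_mono cmod_coef_le)
    then have "norm (\<Sum>j<N. coef j f *\<^sub>C y j) \<le> norm f * q"
      by (simp add: q_def sum_distrib_left)
    then have w': "norm w \<le> (1 + q) * norm f"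
      using w(2) norm_triangle_ineq4[of f "\<Sum>j<N. coef j f *\<^sub>C y j"] by (simp add: algebra_simps)
    have "cmod (coef j f - coef j (B w)) \<le> (1 + M * (1 + q)) * norm f" for j
    proof -
      have "cmod (coef j f - coef j (B w)) \<le> norm f + norm (B w)"
        by (intro order_trans[OF norm_triangle_ineq4] add_mono cmod_coef_le)
      also have "norm (B w) \<le> M * ((1 + q) * norm f)"
        by (intro order_trans[OF B_bound] mult_left_mono w' M_nonneg)
      finally show ?thesis by (simp add: algebra_simps)
    qed
    then have "norm ?r \<le> (\<Sum>j<N. (1 + M * (1 + q)) * norm f * norm (\<rho> j))"
      by (intro sum_norm_le) (simp add: norm_scaleC mult_right_mono)
    also have "\<dots> = (\<Sum>j<N. (1 + M * (1 + q)) * norm (\<rho> j)) * norm f"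
      by (simp add: sum_distrib_left mult_ac)
    finally have r: "norm ?r \<le> (\<Sum>j<N. (1 + M * (1 + q)) * norm (\<rho> j)) * norm f" .
    have "norm (w + ?r) \<le> K * norm f"
      using norm_triangle_ineq[of w ?r] w' r by (simp add: K_def distrib_right)
    moreover have "w + ?r \<in> D"
      by (rule complex_vector.subspace_add[OF subspace_domain w(1) comb(1)])
    moreover have "H (w + ?r) - z *\<^sub>C (w + ?r) = (H w - z *\<^sub>C w) + (H ?r - z *\<^sub>C ?r)"
      unfolding linear_operatorD(2)[OF linear_operator_H w(1) comb(1)] by (simp add: scaleC_add_right)
    then have "H (w + ?r) - z *\<^sub>C (w + ?r) = f"
      unfolding w(3) comb(2) by simp
    ultimately show ?thesis by blast
  qed
  show ?thesis
  proof (rule resolvent_setI(1)[OF linear_operator_H \<open>0 \<le> K\<close>])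
    show "\<exists>u\<in>D. H u - z *\<^sub>C u = f" for f using solve by blast
    fix u assume u: "u \<in> D"
    obtain u' where u': "u' \<in> D" "H u' - z *\<^sub>C u' = H u - z *\<^sub>C u" "norm u' \<le> K * norm (H u - z *\<^sub>C u)"
      using solve by blast
    have "H (u - u') = z *\<^sub>C (u - u')"
      unfolding linear_operator_diff[OF linear_operator_H u u'(1)] using u'(2)
      by (simp add: complex_vector.scale_right_diff_distrib algebra_simps)
    moreover have "u - u' \<in> D" by (rule complex_vector.subspace_diff[OF subspace_domain u u'(1)])
    ultimately have "u - u' = 0"
      using assms(2) unfolding eigenvalues_def by blast
    then show "norm u \<le> K * norm (H u - z *\<^sub>C u)" using u'(3) by simp
  qed
qed

end

context perturbed_diagonal begin

lemma frame_exists: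
  assumes "wide_gap M N"
  obtains x where "riccati_frame e \<mu> D A B M N x"
proof (rule riccati_fixed_point[OF assms])
  fix x assume "\<And>k. k < N \<Longrightarrow> riccati B N x k = x k" "\<And>k. k < N \<Longrightarrow> norm (x k) \<le> 1"
  then show thesis
    using assms by (intro that[of x], unfold_locales)
qed

lemma eventually_frame_bound:
  "\<forall>\<^sub>F N in sequentially. wide_gap M N \<and> r \<le> \<mu> N - M * (1 + sqrt (real N)) - 1"
  using eventually_wide_gap[of M] gap[of "M + \<bar>r\<bar> + 1"]
proof eventually_elim
  fix N assume N: "wide_gap M N" "(M + \<bar>r\<bar> + 1) * (1 + sqrt (real N)) \<le> \<mu> N - \<mu> (N - 1)"
  have "(\<bar>r\<bar> + 1) * 1 \<le> (\<bar>r\<bar> + 1) * (1 + sqrt (real N))"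
    by (intro mult_left_mono) auto
  then have "r \<le> \<mu> N - M * (1 + sqrt (real N)) - 1"
    using N(2) mu_nonneg[of "N - 1"] by (simp add: distrib_right)
  then show "wide_gap M N \<and> r \<le> \<mu> N - M * (1 + sqrt (real N)) - 1"
    using N(1) by simp
qed

lemma spectrum_eq_eigenvalues: "spectrum D H = eigenvalues D H"
proof
  show "spectrum D H \<subseteq> eigenvalues D H"
  proof
    fix z assume z: "z \<in> spectrum D H"
    obtain N where N: "wide_gap M N" "Re z \<le> \<mu> N - M * (1 + sqrt (real N)) - 1"
      using eventually_happens[OF eventually_frame_bound[of "Re z"]] by auto
    obtain x where "riccati_frame e \<mu> D A B M N x" by (rule frame_exists[OF N(1)])
    then interpret riccati_frame e \<mu> D A B M N x .
    show "z \<in> eigenvalues D H"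
      using not_eigenvalue_in_resolvent_set[of z] z N(2) by (auto simp: bd_def spectrum_def)
  qed
  show "eigenvalues D H \<subseteq> spectrum D H"
  proof
    fix z assume "z \<in> eigenvalues D H"
    then obtain u where u: "u \<in> D" "u \<noteq> 0" "H u = z *\<^sub>C u"
      unfolding eigenvalues_def by blast
    have "H 0 = 0" by (rule linear_operator_zero[OF linear_operator_H])
    have "z \<notin> resolvent_set D H"
    proof
      assume "z \<in> resolvent_set D H"
      then have "resolvent D H z 0 = u" "resolvent D H z 0 = 0"
        using resolvent_left_inverse[of z D H u] resolvent_left_inverse[of z D H 0] u
          complex_vector.subspace_0[OF subspace_domain] \<open>H 0 = 0\<close> by auto
      then show False using u(2) by simp
    qed
    then show "z \<in> spectrum D H" by (simp add: spectrum_def)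
  qed
qed

lemma finite_eigenvalues_half_plane: "finite (eigenvalues D H \<inter> {z. Re z \<le> r})"
proof -
  obtain N where N: "wide_gap M N" "r \<le> \<mu> N - M * (1 + sqrt (real N)) - 1"
    using eventually_happens[OF eventually_frame_bound[of r]] by auto
  obtain x where "riccati_frame e \<mu> D A B M N x" by (rule frame_exists[OF N(1)])
  then interpret riccati_frame e \<mu> D A B M N x .
  show ?thesis
    using N(2) by (intro finite_subset[OF _ finite_eigenvalues]) (auto simp: bd_def)
qed

lemma countable_spectrum: "countable (spectrum D H)"
proof -
  have "countable (\<Union>k::nat. eigenvalues D H \<inter> {z. Re z \<le> real k})"
    by (intro countable_UN countableI_type countable_finite finite_eigenvalues_half_plane)
  moreover have "eigenvalues D H \<subseteq> (\<Union>k::nat. eigenvalues D H \<inter> {z. Re z \<le> real k})"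
  proof
    fix z assume "z \<in> eigenvalues D H"
    moreover obtain k :: nat where "Re z \<le> real k"
      using real_arch_simple by blast
    ultimately show "z \<in> (\<Union>k::nat. eigenvalues D H \<inter> {z. Re z \<le> real k})"
      by blast
  qed
  ultimately show ?thesis
    unfolding spectrum_eq_eigenvalues by (rule countable_subset[rotated])
qed

lemma no_limit_point_spectrum: "\<not> z islimpt spectrum D H"
proof
  assume "z islimpt spectrum D H"
  then have *: "\<forall>\<epsilon>>0. infinite (eigenvalues D H \<inter> ball z \<epsilon>)"
    unfolding spectrum_eq_eigenvalues islimpt_eq_infinite_ball .
  have "infinite (eigenvalues D H \<inter> ball z 1)"
    by (rule *[rule_format]) simp
  moreover have "ball z 1 \<subseteq> {w. Re w \<le> Re z + 1}"
  proof
    fix w assume "w \<in> ball z 1"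
    then show "w \<in> {w. Re w \<le> Re z + 1}"
      using abs_Re_le_cmod[of "w - z"] by (simp add: dist_norm norm_minus_commute)
  qed
  then have "finite (eigenvalues D H \<inter> ball z 1)"
    by (intro finite_subset[OF _ finite_eigenvalues_half_plane[of "Re z + 1"]]) blast
  ultimately show False by blast
qed

text \<open>
  If all eigenvalues had real part at most \<open>r\<close>, then the invariant subspaces of all large dimensions
  would be contained in a fixed one: each is spanned by a triangular basis for eigenvalues of \<open>H\<close>.
\<close>

lemma infinite_spectrum: "infinite (spectrum D H)"
  unfolding spectrum_eq_eigenvalues
proof
  assume fin: "finite (eigenvalues D H)"
  define r where "r = Max (insert 0 (Re ` eigenvalues D H))"
  have r: "Re z \<le> r" if "z \<in> eigenvalues D H" for z
    unfolding r_def using fin that by (intro Max_ge) auto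
  obtain N0 where N0: "wide_gap M N0" "r \<le> \<mu> N0 - M * (1 + sqrt (real N0)) - 1"
    using eventually_happens[OF eventually_frame_bound[of r]] by auto
  obtain x0 where "riccati_frame e \<mu> D A B M N0 x0" by (rule frame_exists[OF N0(1)])
  then interpret F0: riccati_frame e \<mu> D A B M N0 x0 .
  obtain N where N: "wide_gap M N" "N0 < N"
    using eventually_happens[OF eventually_conj[OF eventually_wide_gap[of M] eventually_gt_at_top[of N0]]] by auto
  obtain x where "riccati_frame e \<mu> D A B M N x" by (rule frame_exists[OF N(1)])
  then interpret F: riccati_frame e \<mu> D A B M N x .
  obtain ts where ts: "F.cp = (\<Prod>a\<leftarrow>ts. [:- a, 1:])" "length ts = N"
    by (rule F.cp_splits)
  obtain v where v: "flag D H v (\<lambda>i. ts ! i) N" "complex_vector.span (v ` {..<N}) = F.G"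
    by (rule F.triangular_frame[OF ts(1)])
  have v_in: "v i \<in> F0.G" if "i < N" for i
    using that
  proof (induction i rule: less_induct)
    case (less i)
    have "v ` {..<i} \<subseteq> F0.G" using less by auto
    then have "complex_vector.span (v ` {..<i}) \<subseteq> F0.G"
      unfolding F0.G_def by (intro complex_vector.span_minimal complex_vector.subspace_span)
    moreover have "v i \<in> D" "H (v i) - ts ! i *\<^sub>C v i \<in> complex_vector.span (v ` {..<i})"
      using v(1) less.prems by (simp_all add: flag_def)
    moreover have "Re (ts ! i) \<le> F0.bd"
      using r[OF flag_eigenvalue[OF linear_operator_H v(1) less.prems]] N0(2) by (simp add: F0.bd_def)
    ultimately show ?case
      using F0.preimage_of_G by blast
  qed
  have "F.G \<subseteq> F0.G"
    unfolding v(2)[symmetric] unfolding F0.G_def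
    using v_in by (intro complex_vector.span_minimal complex_vector.subspace_span) (auto simp: F0.G_def)
  then have "complex_vector.dim F.G \<le> card (F0.y ` {..<N0})"
    unfolding F0.G_def by (intro complex_vector.dim_le_card) auto
  then show False
    using N(2) F.dim_G F0.independent_y(2) by simp
qed

end

section \<open>Continuity of the eigenvalues\<close>

text \<open>
  As the perturbations have a common bound, one \<open>N\<close> serves for all parameters. Strong continuity of \<open>B\<close> at \<open>p\<close>
  implies that the fixed points of the Riccati equations converge, hence also the matrices of the operators
  on their \<open>N\<close>-dimensional invariant subspaces, and the characteristic polynomials.
\<close>

lemma (in diagonal_operator) eigenvalues_continuous:
  fixes B :: "'p::metric_space \<Rightarrow> 'a \<Rightarrow> 'a"
  assumes B: "\<And>p. p \<in> P \<Longrightarrow> perturbed_diagonal e \<mu> D A (B p) M"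
    and cont: "\<And>p u. p \<in> P \<Longrightarrow> ((\<lambda>q. B q u) \<longlongrightarrow> B p u) (at p within P)"
  shows "eigenvalues_continuous_on P (\<lambda>_. D) (\<lambda>p u. A u + B p u)"
  unfolding eigenvalues_continuous_on_def
proof (intro ballI allI impI)
  fix p c r assume p: "p \<in> P" and cr: "0 < r \<and> eigenvalues D (\<lambda>u. A u + B p u) \<inter> sphere c r = {}"
  interpret Bp: perturbed_diagonal e \<mu> D A "B p" M by (rule B[OF p])
  obtain N where N: "wide_gap M N" "Re c + r \<le> \<mu> N - M * (1 + sqrt (real N)) - 1"
    using eventually_happens[OF Bp.eventually_frame_bound[of "Re c + r"]] by auto
  have "\<exists>x. riccati_frame e \<mu> D A (B q) M N x" if "q \<in> P" for q
    using perturbed_diagonal.frame_exists[OF B[OF that] N(1)] by blast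
  then obtain X where X: "\<And>q. q \<in> P \<Longrightarrow> riccati_frame e \<mu> D A (B q) M N (X q)"
    by metis
  interpret Fp: riccati_frame e \<mu> D A "B p" M N "X p" by (rule X[OF p])
  define F where "F = at p within P"
  have inP: "\<forall>\<^sub>F q in F. q \<in> P"
    unfolding F_def by (simp add: eventually_at_topological) (use open_UNIV in blast)
  define \<delta> where "\<delta> q = (\<Sum>k<N. norm (riccati_rhs (B q) N (X p) k - riccati_rhs (B p) N (X p) k))" for q
  have "(\<delta> \<longlongrightarrow> (\<Sum>k<N. norm (riccati_rhs (B p) N (X p) k - riccati_rhs (B p) N (X p) k))) F"
    unfolding \<delta>_def riccati_rhs_def F_def
    by (intro tendsto_intros cont[OF p] bounded_linear.tendsto[OF bounded_linear_scaleC_left])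
  then have \<delta>: "(\<delta> \<longlongrightarrow> 0) F" by simp
  have X_lim: "((\<lambda>q. X q k) \<longlongrightarrow> X p k) F" if k: "k < N" for k
  proof -
    have "\<forall>\<^sub>F q in F. norm (X q k - X p k) \<le> 2 * \<delta> q / (\<mu> N - \<mu> (N - 1))"
      using inP
    proof eventually_elim
      fix q assume q: "q \<in> P"
      interpret Fq: riccati_frame e \<mu> D A "B q" M N "X q" by (rule X[OF q])
      show "norm (X q k - X p k) \<le> 2 * \<delta> q / (\<mu> N - \<mu> (N - 1))"
      proof (rule riccati_fixed_point_stable[OF B[OF q] N(1) Fp.fixed Fp.norm_x Fq.fixed Fq.norm_x _ k])
        show "norm (riccati_rhs (B q) N (X p) j - riccati_rhs (B p) N (X p) j) \<le> \<delta> q" if "j < N" for j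
          unfolding \<delta>_def using that by (intro member_le_sum) auto
      qed
    qed
    moreover have "((\<lambda>q. 2 * \<delta> q / (\<mu> N - \<mu> (N - 1))) \<longlongrightarrow> 2 * 0 / (\<mu> N - \<mu> (N - 1))) F"
      using Fp.gap_pos by (intro tendsto_intros \<delta>) auto
    then have "((\<lambda>q. 2 * \<delta> q / (\<mu> N - \<mu> (N - 1))) \<longlongrightarrow> 0) F" by simp
    ultimately have "((\<lambda>q. X q k - X p k) \<longlongrightarrow> 0) F"
      by (rule Lim_null_comparison)
    then show ?thesis by (rule LIM_zero_cancel)
  qed
  have By_lim: "((\<lambda>q. B q (e k + X q k)) \<longlongrightarrow> B p (e k + X p k)) F" if k: "k < N" for k
  proof -
    have "\<forall>\<^sub>F q in F. norm (B q (e k + X q k) - B p (e k + X p k))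
        \<le> M * norm (X q k - X p k) + norm (B q (e k + X p k) - B p (e k + X p k))"
      using inP
    proof eventually_elim
      fix q assume q: "q \<in> P"
      interpret Bq: perturbed_diagonal e \<mu> D A "B q" M by (rule B[OF q])
      have "B q (e k + X q k) - B p (e k + X p k) = B q (X q k - X p k) + (B q (e k + X p k) - B p (e k + X p k))"
        by (simp add: Bq.B_add Bq.B_diff)
      also have "norm \<dots> \<le> norm (B q (X q k - X p k)) + norm (B q (e k + X p k) - B p (e k + X p k))"
        by (rule norm_triangle_ineq)
      also have "norm (B q (X q k - X p k)) \<le> M * norm (X q k - X p k)"
        by (rule Bq.B_bound)
      finally show "norm (B q (e k + X q k) - B p (e k + X p k))
        \<le> M * norm (X q k - X p k) + norm (B q (e k + X p k) - B p (e k + X p k))" by simp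
    qed
    moreover have "((\<lambda>q. M * norm (X q k - X p k) + norm (B q (e k + X p k) - B p (e k + X p k)))
        \<longlongrightarrow> M * norm (X p k - X p k) + norm (B p (e k + X p k) - B p (e k + X p k))) F"
      unfolding F_def by (intro tendsto_intros cont[OF p] X_lim[OF k, unfolded F_def])
    then have "((\<lambda>q. M * norm (X q k - X p k) + norm (B q (e k + X p k) - B p (e k + X p k))) \<longlongrightarrow> 0) F"
      by simp
    ultimately have "((\<lambda>q. B q (e k + X q k) - B p (e k + X p k)) \<longlongrightarrow> 0) F"
      by (rule Lim_null_comparison)
    then show ?thesis by (rule LIM_zero_cancel)
  qed
  define m where "m q j k = (if j = k then complex_of_real (\<mu> k) else 0) + coef j (B q (e k + X q k))" for q j k
  define cp where "cp q = char_poly (mat N N (\<lambda>(i, j). m q i j))" for q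
  have chi: "riccati_frame.cp e \<mu> (B q) N (X q) = cp q" if "q \<in> P" for q
  proof -
    interpret Fq: riccati_frame e \<mu> D A "B q" M N "X q" by (rule X[OF that])
    show ?thesis
      unfolding Fq.cp_def cp_def Fq.m_def m_def Fq.y_def ..
  qed
  have "coeffs_tendsto cp (cp p) F"
    unfolding cp_def
  proof (rule coeffs_tendsto_char_poly)
    show "((\<lambda>q. m q i j) \<longlongrightarrow> m p i j) F" if "i < N" "j < N" for i j
      unfolding m_def by (intro tendsto_intros By_lim that)
  qed
  moreover have deg: "degree (cp q) \<le> N" for q
    using degree_monic_char_poly[of "mat N N (\<lambda>(i, j). m q i j)" N] by (simp add: cp_def)
  moreover have disc: "Re z \<le> \<mu> N - M * (1 + sqrt (real N)) - 1" if "z \<in> cball c r" for z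
    using that abs_Re_le_cmod[of "z - c"] N(2) by (simp add: dist_norm norm_minus_commute)
  have ev: "z \<in> eigenvalues D (\<lambda>u. A u + B q u) \<longleftrightarrow> poly (cp q) z = 0" if "q \<in> P" "z \<in> cball c r" for q z
  proof -
    interpret Fq: riccati_frame e \<mu> D A "B q" M N "X q" by (rule X[OF that(1)])
    show ?thesis
      unfolding chi[OF that(1), symmetric]
      by (rule Fq.eigenvalue_iff_root) (use disc[OF that(2)] in \<open>simp add: Fq.bd_def\<close>)
  qed
  have "poly (cp p) z \<noteq> 0" if "z \<in> sphere c r" for z
    using ev[OF p, of z] cr that sphere_cball[of c r] by blast
  ultimately have ev_F: "\<forall>\<^sub>F q in F. (\<forall>z\<in>sphere c r. poly (cp q) z \<noteq> 0) \<and>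
      root_count (cp q) (ball c r) = root_count (cp p) (ball c r)"
    using cr by (intro root_count_continuous[where n = N]) auto
  have count: "has_eigenvalue_count D (\<lambda>u. A u + B q u) (ball c r) (root_count (cp q) (ball c r))" if "q \<in> P" for q
  proof -
    interpret Fq: riccati_frame e \<mu> D A "B q" M N "X q" by (rule X[OF that])
    show ?thesis
      unfolding chi[OF that, symmetric]
      by (rule Fq.has_eigenvalue_count) (use disc ball_subset_cball in \<open>auto simp: Fq.bd_def\<close>)
  qed
  show "\<exists>n. has_eigenvalue_count D (\<lambda>u. A u + B p u) (ball c r) n \<and>
      (\<forall>\<^sub>F q in at p within P. eigenvalues D (\<lambda>u. A u + B q u) \<inter> sphere c r = {} \<and>
        has_eigenvalue_count D (\<lambda>u. A u + B q u) (ball c r) n)"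
  proof (intro exI conjI)
    show "has_eigenvalue_count D (\<lambda>u. A u + B p u) (ball c r) (root_count (cp p) (ball c r))"
      by (rule count[OF p])
    show "\<forall>\<^sub>F q in at p within P. eigenvalues D (\<lambda>u. A u + B q u) \<inter> sphere c r = {} \<and>
        has_eigenvalue_count D (\<lambda>u. A u + B q u) (ball c r) (root_count (cp p) (ball c r))"
      using ev_F inP unfolding F_def[symmetric]
    proof eventually_elim
      fix q assume q: "(\<forall>z\<in>sphere c r. poly (cp q) z \<noteq> 0) \<and>
          root_count (cp q) (ball c r) = root_count (cp p) (ball c r)" "q \<in> P"
      have "z \<notin> eigenvalues D (\<lambda>u. A u + B q u)" if "z \<in> sphere c r" for z
        using ev[OF q(2), of z] q(1) that sphere_cball[of c r] by blast
      then show "eigenvalues D (\<lambda>u. A u + B q u) \<inter> sphere c r = {} \<and>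
          has_eigenvalue_count D (\<lambda>u. A u + B q u) (ball c r) (root_count (cp p) (ball c r))"
        using count[OF q(2)] q(1) by auto
    qed
  qed
qed

section \<open>Square integrable functions\<close>

lemma cr_L2_iff: "cr_L2 f u \<longleftrightarrow> square_integrable TYPE('r::region) f \<and> abs_L2 f = (u :: 'r L2)"
  by (simp add: cr_L2_def L2_rel_def)

lemma cr_L2_rep: "cr_L2 (rep_L2 u) u"
  using Quotient_L2 unfolding Quotient_def cr_L2_def by blast

lemma cr_L2_abs: "square_integrable TYPE('r::region) f \<Longrightarrow> cr_L2 f (abs_L2 f :: 'r L2)"
  by (simp add: cr_L2_iff)

lemma cr_L2_square_integrable: "cr_L2 f (u :: 'r::region L2) \<Longrightarrow> square_integrable TYPE('r) f"
  by (simp add: cr_L2_iff)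

lemma cr_L2_eq_iff:
  assumes "cr_L2 f (u :: 'r::region L2)" "cr_L2 g v"
  shows "u = v \<longleftrightarrow> (AE x in region_measure TYPE('r). f x = g x)"
proof -
  have "L2_rel TYPE('r) f g \<longleftrightarrow> (abs_L2 f :: 'r L2) = abs_L2 g"
    using assms Quotient_L2[where 'r = 'r] unfolding Quotient_def cr_L2_def by blast
  then show ?thesis
    using assms by (simp add: cr_L2_iff L2_rel_def)
qed

lemma cr_L2_cong_AE:
  assumes "cr_L2 f (u :: 'r::region L2)" "square_integrable TYPE('r) g" "AE x in region_measure TYPE('r). f x = g x"
  shows "cr_L2 g u"
proof -
  have "cr_L2 g (abs_L2 g :: 'r L2)" by (rule cr_L2_abs[OF assms(2)])
  moreover from this have "u = abs_L2 g" using assms by (simp add: cr_L2_eq_iff)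
  ultimately show ?thesis by simp
qed

lemma cr_L2_add: "cr_L2 f u \<Longrightarrow> cr_L2 g v \<Longrightarrow> cr_L2 (\<lambda>x. f x + g x) (u + v)"
  by (auto simp: cr_L2_def plus_L2.abs_eq L2_rel_def square_integrable_add)

lemma cr_L2_diff: "cr_L2 f u \<Longrightarrow> cr_L2 g v \<Longrightarrow> cr_L2 (\<lambda>x. f x - g x) (u - v)"
  by (auto simp: cr_L2_def minus_L2.abs_eq L2_rel_def square_integrable_diff)

lemma cr_L2_scaleC: "cr_L2 f u \<Longrightarrow> cr_L2 (\<lambda>x. c * f x) (c *\<^sub>C u)"
  by (auto simp: cr_L2_def scaleC_L2.abs_eq L2_rel_def square_integrable_cmult)

lemma cr_L2_zero: "cr_L2 (\<lambda>_. 0) 0"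
  by (auto simp: cr_L2_def zero_L2.abs_eq L2_rel_def square_integrable_zero)

lemma cr_L2_cinner:
  assumes "cr_L2 f (u :: 'r::region L2)" "cr_L2 g v"
  shows "cinner u v = (\<integral>x. f x * cnj (g x) \<partial>region_measure TYPE('r))"
  using assms by (auto simp: cr_L2_def cinner_L2.abs_eq)

lemma cr_L2_norm:
  assumes "cr_L2 f (u :: 'r::region L2)"
  shows "(norm u)\<^sup>2 = (\<integral>x. (cmod (f x))\<^sup>2 \<partial>region_measure TYPE('r))"
proof -
  have "complex_of_real ((norm u)\<^sup>2) = (\<integral>x. complex_of_real ((cmod (f x))\<^sup>2) \<partial>region_measure TYPE('r))"
    unfolding cinner_self[symmetric] cr_L2_cinner[OF assms assms] by (simp add: mult_cnj_cmod)
  then show ?thesis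
    by (simp only: integral_complex_of_real of_real_eq_iff)
qed

lemma square_integrableD:
  assumes "square_integrable r f"
  shows "f \<in> borel_measurable (region_measure r)" "integrable (region_measure r) (\<lambda>x. (cmod (f x))\<^sup>2)"
  using assms by (auto simp: square_integrable_def)

lemma cr_L2_nn_norm:
  assumes "cr_L2 f (u :: 'r::region L2)"
  shows "(\<integral>\<^sup>+x. ennreal ((cmod (f x))\<^sup>2) \<partial>region_measure TYPE('r)) = ennreal ((norm u)\<^sup>2)"
  unfolding cr_L2_norm[OF assms]
  by (rule nn_integral_eq_integral) (use square_integrableD[OF cr_L2_square_integrable[OF assms]] in auto)

subsection \<open>Completeness\<close>

lemma Cauchy_fast_subsequence:
  fixes X :: "nat \<Rightarrow> 'a::metric_space"
  assumes "Cauchy X"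
  obtains r where "strict_mono r" "\<And>k n. n \<ge> r k \<Longrightarrow> dist (X n) (X (r k)) < (1 / 2) ^ k"
proof -
  have "\<exists>N. \<forall>m\<ge>N. \<forall>n\<ge>N. dist (X m) (X n) < (1 / 2) ^ k" for k
    by (rule assms[unfolded Cauchy_def, rule_format]) simp
  then obtain N where N: "\<And>k m n. m \<ge> N k \<Longrightarrow> n \<ge> N k \<Longrightarrow> dist (X m) (X n) < (1 / 2) ^ k"
    by metis
  define r where "r k = (\<Sum>i\<le>k. Suc (N i))" for k
  have Nr: "N k \<le> r k" for k
  proof -
    have "Suc (N k) \<le> r k" unfolding r_def by (rule member_le_sum) auto
    then show ?thesis by simp
  qed
  have "strict_mono r"
    by (rule strict_mono_Suc_iff[THEN iffD2]) (simp add: r_def)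
  moreover have "dist (X n) (X (r k)) < (1 / 2) ^ k" if "n \<ge> r k" for n k
    using Nr[of k] that by (intro N) simp_all
  ultimately show thesis
    using that by blast
qed

text \<open>
  For a fast Cauchy sequence these weights are admissible: the integral of the weighted squares of its
  consecutive differences is finite, so pointwise summability holds almost everywhere.
\<close>

lemma summable_of_weighted_squares:
  fixes d :: "nat \<Rightarrow> real"
  assumes "summable (\<lambda>k. 2 ^ k * (d k)\<^sup>2)" and "\<And>k. 0 \<le> d k"
  shows "summable d"
proof (rule summable_comparison_test)
  show "summable (\<lambda>k. (1 / 2) ^ k + 2 ^ k * (d k)\<^sup>2)"
    using assms(1) by (intro summable_add summable_geometric) auto
  \<comment> \<open>\<open>d k\<close> is bounded by the geometric mean of the two terms\<close>
  have "d k \<le> (1 / 2) ^ k + 2 ^ k * (d k)\<^sup>2" for k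
  proof -
    have "2 * (sqrt ((1 / 2) ^ k) * (sqrt (2 ^ k) * d k)) \<le> (sqrt ((1 / 2) ^ k))\<^sup>2 + (sqrt (2 ^ k) * d k)\<^sup>2"
      using sum_squares_bound[of "sqrt ((1 / 2) ^ k)" "sqrt (2 ^ k) * d k"] by (simp add: mult.assoc)
    moreover have "sqrt ((1 / 2) ^ k) * sqrt (2 ^ k) = 1"
      by (simp add: real_sqrt_mult[symmetric] power_mult_distrib[symmetric])
    ultimately have "2 * d k \<le> (1 / 2) ^ k + 2 ^ k * (d k)\<^sup>2"
      by (simp add: power_mult_distrib mult.assoc[symmetric])
    then show ?thesis using assms(2)[of k] by linarith
  qed
  then show "\<exists>N. \<forall>k\<ge>N. norm (d k) \<le> (1 / 2) ^ k + 2 ^ k * (d k)\<^sup>2"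
    using assms(2) by auto
qed

text \<open>
  A fast Cauchy subsequence converges almost everywhere, and by the lemma of Fatou the pointwise limit is
  a limit in the norm.
\<close>

instance L2 :: (region) banach
proof
  fix X :: "nat \<Rightarrow> 'a L2" assume "Cauchy X"
  then obtain r where r: "strict_mono r" "\<And>k n. n \<ge> r k \<Longrightarrow> dist (X n) (X (r k)) < (1 / 2) ^ k"
    by (rule Cauchy_fast_subsequence) (rule that)
  let ?M = "region_measure TYPE('a)"
  define f where "f k = rep_L2 (X (r k))" for k
  have f: "cr_L2 (f k) (X (r k))" for k unfolding f_def by (rule cr_L2_rep)
  have [measurable]: "f k \<in> borel_measurable ?M" for k
    by (rule square_integrableD[OF cr_L2_square_integrable[OF f]])
  define d where "d k x = cmod (f (Suc k) x - f k x)" for k x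
  have [measurable]: "d k \<in> borel_measurable ?M" for k unfolding d_def by measurable
  have d: "(\<integral>\<^sup>+x. ennreal (2 ^ k * (d k x)\<^sup>2) \<partial>?M) \<le> ennreal ((1 / 2) ^ k)" for k
  proof -
    have "norm (X (r (Suc k)) - X (r k)) < (1 / 2) ^ k"
      using r(2)[of k "r (Suc k)"] r(1) by (simp add: dist_norm strict_mono_less_eq)
    then have "(norm (X (r (Suc k)) - X (r k)))\<^sup>2 \<le> ((1 / 2) ^ k)\<^sup>2"
      by (intro power_mono) auto
    then have "2 ^ k * (norm (X (r (Suc k)) - X (r k)))\<^sup>2 \<le> 2 ^ k * ((1 / 2) ^ k)\<^sup>2"
      by simp
    also have "\<dots> = (1 / 2) ^ k"
      by (simp add: power2_eq_square power_mult_distrib[symmetric] mult.assoc[symmetric])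
    finally have *: "2 ^ k * (norm (X (r (Suc k)) - X (r k)))\<^sup>2 \<le> (1 / 2) ^ k" .
    have "(\<integral>\<^sup>+x. ennreal (2 ^ k * (d k x)\<^sup>2) \<partial>?M) = ennreal (2 ^ k) * (\<integral>\<^sup>+x. ennreal ((d k x)\<^sup>2) \<partial>?M)"
      by (subst nn_integral_cmult[symmetric]) (auto simp: ennreal_mult)
    also have "(\<integral>\<^sup>+x. ennreal ((d k x)\<^sup>2) \<partial>?M) = ennreal ((norm (X (r (Suc k)) - X (r k)))\<^sup>2)"
      unfolding d_def by (rule cr_L2_nn_norm[OF cr_L2_diff[OF f f]])
    also have "ennreal (2 ^ k) * \<dots> = ennreal (2 ^ k * (norm (X (r (Suc k)) - X (r k)))\<^sup>2)"
      by (simp add: ennreal_mult)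
    also have "\<dots> \<le> ennreal ((1 / 2) ^ k)"
      using * by (rule ennreal_leI)
    finally show ?thesis .
  qed
  have "(\<integral>\<^sup>+x. (\<Sum>k. ennreal (2 ^ k * (d k x)\<^sup>2)) \<partial>?M) = (\<Sum>k. \<integral>\<^sup>+x. ennreal (2 ^ k * (d k x)\<^sup>2) \<partial>?M)"
    by (rule nn_integral_suminf) measurable
  also have "\<dots> \<le> (\<Sum>k. ennreal ((1 / 2) ^ k))"
    by (intro suminf_le d) auto
  also have "\<dots> = ennreal (\<Sum>k. (1 / 2) ^ k)"
    by (rule suminf_ennreal2) (auto intro: summable_geometric)
  also have "\<dots> < \<infinity>" by simp
  finally have "AE x in ?M. (\<Sum>k. ennreal (2 ^ k * (d k x)\<^sup>2)) \<noteq> \<infinity>"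
    by (intro nn_integral_PInf_AE) auto
  then have "AE x in ?M. convergent (\<lambda>k. f k x)"
  proof eventually_elim
    fix x assume "(\<Sum>k. ennreal (2 ^ k * (d k x)\<^sup>2)) \<noteq> \<infinity>"
    then have "summable (\<lambda>k. 2 ^ k * (d k x)\<^sup>2)"
      by (intro summable_suminf_not_top) auto
    then have "summable (\<lambda>k. d k x)"
      by (rule summable_of_weighted_squares) (simp add: d_def)
    then have "summable (\<lambda>k. f (Suc k) x - f k x)"
      unfolding d_def by (rule summable_norm_cancel)
    then have "convergent (\<lambda>n. (\<Sum>k<n. f (Suc k) x - f k x) + f 0 x)"
      by (intro convergent_add convergent_const) (simp add: summable_iff_convergent)
    then show "convergent (\<lambda>k. f k x)"
      by (simp add: sum_lessThan_telescope[of "\<lambda>k. f k x"])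
  qed
  then have lim: "AE x in ?M. (\<lambda>k. f k x) \<longlonglongrightarrow> lim (\<lambda>k. f k x)"
    by (simp add: convergent_LIMSEQ_iff)
  define g where "g x = lim (\<lambda>k. f k x)" for x
  note lim = lim[folded g_def]
  have g_meas [measurable]: "g \<in> borel_measurable ?M"
    unfolding g_def by measurable
  have est: "(\<integral>\<^sup>+x. ennreal ((cmod (g x - f k x))\<^sup>2) \<partial>?M) \<le> ennreal (((1 / 2) ^ k)\<^sup>2)" for k
  proof -
    have "AE x in ?M. ennreal ((cmod (g x - f k x))\<^sup>2) = liminf (\<lambda>j. ennreal ((cmod (f j x - f k x))\<^sup>2))"
      using lim
    proof eventually_elim
      fix x assume "(\<lambda>k. f k x) \<longlonglongrightarrow> g x"
      then have "(\<lambda>j. ennreal ((cmod (f j x - f k x))\<^sup>2)) \<longlonglongrightarrow> ennreal ((cmod (g x - f k x))\<^sup>2)"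
        by (intro tendsto_intros)
      then show "ennreal ((cmod (g x - f k x))\<^sup>2) = liminf (\<lambda>j. ennreal ((cmod (f j x - f k x))\<^sup>2))"
        using lim_imp_Liminf[OF sequentially_bot] by metis
    qed
    then have "(\<integral>\<^sup>+x. ennreal ((cmod (g x - f k x))\<^sup>2) \<partial>?M)
        = (\<integral>\<^sup>+x. liminf (\<lambda>j. ennreal ((cmod (f j x - f k x))\<^sup>2)) \<partial>?M)"
      by (rule nn_integral_cong_AE)
    also have "\<dots> \<le> liminf (\<lambda>j. \<integral>\<^sup>+x. ennreal ((cmod (f j x - f k x))\<^sup>2) \<partial>?M)"
      by (rule nn_integral_liminf) measurable
    also have "\<dots> \<le> ennreal (((1 / 2) ^ k)\<^sup>2)"
    proof (rule Liminf_le[OF sequentially_bot])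
      have "(\<integral>\<^sup>+x. ennreal ((cmod (f j x - f k x))\<^sup>2) \<partial>?M) \<le> ennreal (((1 / 2) ^ k)\<^sup>2)" if "k \<le> j" for j
      proof -
        have "norm (X (r j) - X (r k)) < (1 / 2) ^ k"
          using r(2)[of k "r j"] r(1) that by (simp add: dist_norm strict_mono_less_eq)
        then have "(norm (X (r j) - X (r k)))\<^sup>2 \<le> ((1 / 2) ^ k)\<^sup>2"
          by (intro power_mono) auto
        then show ?thesis
          unfolding cr_L2_nn_norm[OF cr_L2_diff[OF f f]] by (rule ennreal_leI)
      qed
      then show "\<forall>\<^sub>F j in sequentially. (\<integral>\<^sup>+x. ennreal ((cmod (f j x - f k x))\<^sup>2) \<partial>?M) \<le> ennreal (((1 / 2) ^ k)\<^sup>2)"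
        unfolding eventually_sequentially by blast
    qed
    finally show ?thesis .
  qed
  have diff_sq: "square_integrable TYPE('a) (\<lambda>x. g x - f k x)" for k
    unfolding square_integrable_def
  proof
    show "integrable ?M (\<lambda>x. (cmod (g x - f k x))\<^sup>2)"
    proof (rule integrableI_bounded)
      have "(\<integral>\<^sup>+x. ennreal (norm ((cmod (g x - f k x))\<^sup>2)) \<partial>?M) \<le> ennreal (((1 / 2) ^ k)\<^sup>2)"
        using est[of k] by simp
      also have "\<dots> < \<infinity>" by simp
      finally show "(\<integral>\<^sup>+x. ennreal (norm ((cmod (g x - f k x))\<^sup>2)) \<partial>?M) < \<infinity>" .
    qed measurable
  qed measurable
  have "square_integrable TYPE('a) (\<lambda>x. (g x - f 0 x) + f 0 x)"
    by (rule square_integrable_add[OF diff_sq cr_L2_square_integrable[OF f]])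
  then have g: "cr_L2 g (abs_L2 g :: 'a L2)"
    by (intro cr_L2_abs) simp
  have "ennreal ((norm (abs_L2 g - X (r k)))\<^sup>2) \<le> ennreal (((1 / 2) ^ k)\<^sup>2)" for k
    using est[of k] unfolding cr_L2_nn_norm[OF cr_L2_diff[OF g f]] .
  then have le: "norm (abs_L2 g - X (r k)) \<le> (1 / 2) ^ k" for k
    by (simp add: abs_le_square_iff[symmetric])
  have "(\<lambda>k. norm (X (r k) - abs_L2 g)) \<longlonglongrightarrow> 0"
  proof (rule tendsto_sandwich[of "\<lambda>_. 0" _ _ "\<lambda>k. (1 / 2) ^ k"])
    show "(\<lambda>k. (1 / 2 :: real) ^ k) \<longlonglongrightarrow> 0" by (rule LIMSEQ_realpow_zero) auto
    show "\<forall>\<^sub>F k in sequentially. norm (X (r k) - abs_L2 g) \<le> (1 / 2) ^ k"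
      using le by (simp add: norm_minus_commute)
  qed auto
  then have "(\<lambda>k. X (r k)) \<longlonglongrightarrow> abs_L2 g"
    by (simp add: tendsto_norm_zero_iff LIM_zero_iff)
  then show "convergent X"
    using \<open>Cauchy X\<close> r(1) Cauchy_converges_subseq[of X r "abs_L2 g"] by (auto simp: o_def convergent_def)
qed

section \<open>Test functions\<close>

text \<open>
  For \<open>p = 1\<close> this is the usual smooth function that vanishes on the negative half-line. The
  polynomial factor makes the family closed under differentiation.
\<close>

definition exp_poly :: "real poly \<Rightarrow> real \<Rightarrow> real" where
  "exp_poly p x = (if 0 < x then poly p (1 / x) * exp (- (1 / x)) else 0)"

lemma poly_times_exp_minus_tendsto_0: "((\<lambda>t::real. poly p t * exp (- t)) \<longlongrightarrow> 0) at_top"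
proof -
  have "((\<lambda>t::real. \<Sum>i\<le>degree p. coeff p i * (t ^ i / exp t)) \<longlongrightarrow> (\<Sum>i\<le>degree p. coeff p i * 0)) at_top"
    by (intro tendsto_sum tendsto_mult tendsto_const tendsto_power_div_exp_0)
  then show ?thesis
    by (simp add: poly_altdef sum_distrib_right exp_minus divide_inverse mult.assoc)
qed

lemma DERIV_exp_poly:
  "(exp_poly p has_real_derivative exp_poly ([:0, 0, 1:] * (p - pderiv p)) x) (at x)"
proof -
  consider "0 < x" | "x < 0" | "x = 0" by linarith
  then show ?thesis
  proof cases
    case 1
    have inv: "((\<lambda>x. 1 / x) has_real_derivative - (1 / x\<^sup>2)) (at x)"
      using 1 by (auto intro!: derivative_eq_intros simp: power2_eq_square)
    have "((\<lambda>x. poly p (1 / x)) has_real_derivative poly (pderiv p) (1 / x) * - (1 / x\<^sup>2)) (at x)"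
      by (rule DERIV_chain2[OF poly_DERIV inv])
    moreover have "((\<lambda>x. exp (- (1 / x))) has_real_derivative exp (- (1 / x)) * (1 / x\<^sup>2)) (at x)"
      using DERIV_chain2[OF DERIV_exp DERIV_minus[OF inv]] by simp
    ultimately have "((\<lambda>x. poly p (1 / x) * exp (- (1 / x))) has_real_derivative
        poly (pderiv p) (1 / x) * - (1 / x\<^sup>2) * exp (- (1 / x)) + exp (- (1 / x)) * (1 / x\<^sup>2) * poly p (1 / x)) (at x)"
      by (rule DERIV_mult)
    also have "poly (pderiv p) (1 / x) * - (1 / x\<^sup>2) * exp (- (1 / x)) + exp (- (1 / x)) * (1 / x\<^sup>2) * poly p (1 / x)
        = exp_poly ([:0, 0, 1:] * (p - pderiv p)) x"
      using 1 by (simp add: exp_poly_def power2_eq_square algebra_simps)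
    finally have D: "((\<lambda>x. poly p (1 / x) * exp (- (1 / x))) has_real_derivative exp_poly ([:0, 0, 1:] * (p - pderiv p)) x) (at x)" .
    show ?thesis
      by (rule has_field_derivative_transform_within_open[OF D, of "{0<..}"]) (use 1 in \<open>auto simp: exp_poly_def\<close>)
  next
    case 2
    have D: "((\<lambda>_. 0) has_real_derivative exp_poly ([:0, 0, 1:] * (p - pderiv p)) x) (at x)"
      using 2 by (simp add: exp_poly_def)
    show ?thesis
      by (rule has_field_derivative_transform_within_open[OF D, of "{..<0}"]) (use 2 in \<open>auto simp: exp_poly_def\<close>)
  next
    case 3
    have "((\<lambda>h. exp_poly p h / h) \<longlongrightarrow> 0) (at 0)"
    proof (rule filterlim_split_at)
      have "\<forall>\<^sub>F h in at_left (0::real). exp_poly p h / h = 0"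
        unfolding eventually_at_filter by (auto simp: exp_poly_def)
      then show "((\<lambda>h. exp_poly p h / h) \<longlongrightarrow> 0) (at_left 0)"
        by (rule tendsto_eventually)
      have "\<forall>\<^sub>F t in at_top. poly (pCons 0 p) t * exp (- t) = exp_poly p (inverse t) / inverse t"
        using eventually_gt_at_top[of "0::real"] by eventually_elim (simp add: exp_poly_def inverse_eq_divide)
      then have "((\<lambda>t. exp_poly p (inverse t) / inverse t) \<longlongrightarrow> 0) at_top"
        using poly_times_exp_minus_tendsto_0[of "pCons 0 p"] by (rule Lim_transform_eventually[rotated])
      then show "((\<lambda>h. exp_poly p h / h) \<longlongrightarrow> 0) (at_right 0)"
        unfolding filterlim_at_right_to_top .
    qed
    then show ?thesis
      using 3 by (simp add: has_field_derivative_iff exp_poly_def[of _ 0])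
  qed
qed

text \<open>
  Every member is smooth because the class is closed under derivatives. Products are needed for bumps with
  compact support, and constants for linear combinations of them.
\<close>

inductive bump_algebra :: "(real \<Rightarrow> real) \<Rightarrow> bool" where
  exp_poly: "bump_algebra (\<lambda>x. exp_poly p (a * x + b))"
| const: "bump_algebra (\<lambda>_. c)"
| add: "bump_algebra \<phi> \<Longrightarrow> bump_algebra \<psi> \<Longrightarrow> bump_algebra (\<lambda>x. \<phi> x + \<psi> x)"
| mult: "bump_algebra \<phi> \<Longrightarrow> bump_algebra \<psi> \<Longrightarrow> bump_algebra (\<lambda>x. \<phi> x * \<psi> x)"

lemma bump_algebra_derivative:
  "bump_algebra \<phi> \<Longrightarrow> \<exists>\<phi>'. bump_algebra \<phi>' \<and> (\<forall>x. (\<phi> has_real_derivative \<phi>' x) (at x))"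
proof (induction rule: bump_algebra.induct)
  case (exp_poly p a b)
  let ?q = "[:0, 0, 1:] * (p - pderiv p)"
  have "((\<lambda>x. exp_poly p (a * x + b)) has_real_derivative exp_poly ?q (a * x + b) * a) (at x)" for x
    by (rule DERIV_chain2[OF DERIV_exp_poly]) (auto intro!: derivative_eq_intros)
  moreover have "bump_algebra (\<lambda>x. exp_poly ?q (a * x + b) * a)"
    by (intro bump_algebra.intros)
  ultimately show ?case by blast
next
  case (const c)
  show ?case by (rule exI[of _ "\<lambda>_. 0"]) (auto intro: bump_algebra.const)
next
  case (add \<phi> \<psi>)
  then obtain \<phi>' \<psi>' where "bump_algebra \<phi>'" "bump_algebra \<psi>'"
    "\<And>x. (\<phi> has_real_derivative \<phi>' x) (at x)" "\<And>x. (\<psi> has_real_derivative \<psi>' x) (at x)"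
    by blast
  then show ?case
    by (intro exI[of _ "\<lambda>x. \<phi>' x + \<psi>' x"] conjI allI bump_algebra.add DERIV_add)
next
  case (mult \<phi> \<psi>)
  then obtain \<phi>' \<psi>' where "bump_algebra \<phi>'" "bump_algebra \<psi>'"
    "\<And>x. (\<phi> has_real_derivative \<phi>' x) (at x)" "\<And>x. (\<psi> has_real_derivative \<psi>' x) (at x)"
    by blast
  with mult.hyps show ?case
    by (intro exI[of _ "\<lambda>x. \<phi>' x * \<psi> x + \<psi>' x * \<phi> x"] conjI allI bump_algebra.add bump_algebra.mult DERIV_mult)
qed

lemma bump_algebra_deriv:
  assumes "bump_algebra \<phi>"
  shows "bump_algebra (deriv \<phi>)" "(\<phi> has_real_derivative deriv \<phi> x) (at x)"
proof -
  obtain \<phi>' where \<phi>': "bump_algebra \<phi>'" "\<And>x. (\<phi> has_real_derivative \<phi>' x) (at x)"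
    using bump_algebra_derivative[OF assms] by blast
  then have "deriv \<phi> = \<phi>'" by (intro ext DERIV_imp_deriv)
  then show "bump_algebra (deriv \<phi>)" "(\<phi> has_real_derivative deriv \<phi> x) (at x)" using \<phi>' by auto
qed

lemma bump_algebra_differentiable:
  assumes "bump_algebra \<phi>"
  shows "\<phi> differentiable_on UNIV"
  unfolding differentiable_on_def real_differentiable_def using bump_algebra_deriv(2)[OF assms] by auto

lemma bump_algebra_continuous: "bump_algebra \<phi> \<Longrightarrow> continuous_on S \<phi>"
  using continuous_on_subset[OF differentiable_imp_continuous_on[OF bump_algebra_differentiable]] by blast

lemma bump_algebra_test_function:
  assumes "bump_algebra \<phi>" "compact K" "K \<subseteq> U" "\<And>x. x \<notin> K \<Longrightarrow> \<phi> x = 0"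
  shows "test_function U \<phi>"
proof -
  have "bump_algebra ((deriv ^^ n) \<phi>)" for n
    by (induction n) (use assms(1) bump_algebra_deriv(1) in auto)
  then show ?thesis
    unfolding test_function_def using assms(2-4) bump_algebra_differentiable by blast
qed

text \<open>As \<open>n\<close> grows, these bumps increase to the indicator function of the interval from \<open>a\<close> to \<open>b\<close>.\<close>

definition bump :: "real \<Rightarrow> real \<Rightarrow> nat \<Rightarrow> real \<Rightarrow> real" where
  "bump a b n x = exp_poly 1 (real (Suc n) * x + (- real (Suc n) * a - 1)) *
     exp_poly 1 (- real (Suc n) * x + (real (Suc n) * b - 1))"

lemma bump_algebra_bump: "bump_algebra (bump a b n)"
  unfolding bump_def[abs_def] by (intro bump_algebra.intros)

lemma exp_poly_1_bounds: "0 \<le> exp_poly 1 x" "exp_poly 1 x \<le> 1"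
  by (auto simp: exp_poly_def)

lemma bump_bounds: "0 \<le> bump a b n x" "bump a b n x \<le> 1"
  unfolding bump_def using exp_poly_1_bounds by (auto intro!: mult_nonneg_nonneg mult_le_one)

lemma bump_outside:
  assumes "x \<notin> {a + 1 / real (Suc n)..b - 1 / real (Suc n)}"
  shows "bump a b n x = 0"
proof -
  have pos: "0 < real (Suc n)" by simp
  have "x < a + 1 / real (Suc n) \<or> b - 1 / real (Suc n) < x"
    using assms by auto
  then show ?thesis
  proof
    assume "x < a + 1 / real (Suc n)"
    then have "real (Suc n) * x < real (Suc n) * (a + 1 / real (Suc n))"
      by (rule mult_strict_left_mono) (rule pos)
    then have "\<not> 0 < real (Suc n) * x + (- real (Suc n) * a - 1)"
      by (simp add: distrib_left del: of_nat_Suc)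
    then show ?thesis by (simp add: bump_def exp_poly_def del: of_nat_Suc)
  next
    assume "b - 1 / real (Suc n) < x"
    then have "real (Suc n) * (b - 1 / real (Suc n)) < real (Suc n) * x"
      by (rule mult_strict_left_mono) (rule pos)
    then have "\<not> 0 < - real (Suc n) * x + (real (Suc n) * b - 1)"
      by (simp add: right_diff_distrib del: of_nat_Suc)
    then show ?thesis by (simp add: bump_def exp_poly_def del: of_nat_Suc)
  qed
qed

lemma bump_tendsto_indicator: "(\<lambda>n. bump a b n x) \<longlonglongrightarrow> indicator {a<..<b} x"
proof (cases "x \<in> {a<..<b}")
  case True
  have exp1: "((exp_poly 1) \<longlongrightarrow> 1) at_top"
  proof (rule Lim_transform_eventually)
    have "((\<lambda>y::real. exp (- (1 / y))) \<longlongrightarrow> exp (- 0)) at_top"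
      by (intro tendsto_intros tendsto_divide_0[OF tendsto_const filterlim_at_top_imp_at_infinity] filterlim_ident)
    then show "((\<lambda>y::real. exp (- (1 / y))) \<longlongrightarrow> 1) at_top" by simp
    show "\<forall>\<^sub>F y in at_top. exp (- (1 / y)) = exp_poly 1 y"
      using eventually_gt_at_top[of "0::real"] by eventually_elim (simp add: exp_poly_def)
  qed
  have lin: "filterlim (\<lambda>n. real (Suc n) * c + (- 1)) at_top sequentially" if "0 < c" for c
  proof -
    have "filterlim (\<lambda>n. c * real (Suc n)) at_top sequentially"
      using that by (intro filterlim_tendsto_pos_mult_at_top[OF tendsto_const]
          filterlim_compose[OF filterlim_real_sequentially filterlim_Suc])
    then have "filterlim (\<lambda>n. - 1 + real (Suc n) * c) at_top sequentially"
      by (intro filterlim_tendsto_add_at_top[OF tendsto_const]) (simp add: mult.commute del: of_nat_Suc)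
    then show ?thesis by (simp add: add.commute del: of_nat_Suc)
  qed
  have "(\<lambda>n. exp_poly 1 (real (Suc n) * (x - a) + (- 1)) * exp_poly 1 (real (Suc n) * (b - x) + (- 1))) \<longlonglongrightarrow> 1 * 1"
    using True by (intro tendsto_mult filterlim_compose[OF exp1 lin]) auto
  moreover have "bump a b n x = exp_poly 1 (real (Suc n) * (x - a) + (- 1)) * exp_poly 1 (real (Suc n) * (b - x) + (- 1))" for n
    unfolding bump_def by (intro arg_cong2[where f = "(*)"] arg_cong[where f = "exp_poly 1"])
      (simp_all add: algebra_simps del: of_nat_Suc)
  ultimately show ?thesis using True by simp
next
  case False
  have "bump a b n x = 0" for n
  proof (rule bump_outside)
    have "0 < 1 / real (Suc n)" by simp
    then show "x \<notin> {a + 1 / real (Suc n)..b - 1 / real (Suc n)}"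
      using False unfolding greaterThanLessThan_iff atLeastAtMost_iff by linarith
  qed
  then show ?thesis using False by simp
qed

lemma region_unit_interval [simp]: "region TYPE(unit_interval) = {0<..<1}"
  by (simp add: region_unit_interval_def)

lemma finite_measure_unit_interval: "finite_measure (lebesgue_on {0<..<1::real})"
  by (rule finite_measureI) (simp add: emeasure_restrict_space)

lemma bump_test_function:
  assumes "0 \<le> a" "b \<le> 1"
  shows "test_function {0<..<1} (bump a b n)"
proof (rule bump_algebra_test_function[OF bump_algebra_bump compact_Icc _ bump_outside])
  have "0 < 1 / real (Suc n)" by simp
  with assms show "{a + 1 / real (Suc n)..b - 1 / real (Suc n)} \<subseteq> {0<..<1}"
    unfolding subset_iff greaterThanLessThan_iff atLeastAtMost_iff by (intro allI impI conjI) linarith+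
qed

lemma measurable_continuous_unit_interval:
  assumes "continuous_on UNIV (f :: real \<Rightarrow> 'b::topological_space)"
  shows "f \<in> borel_measurable (lebesgue_on S)"
  using borel_measurable_continuous_onI[OF assms]
  by (intro measurable_restrict_space1) (simp add: measurable_completion)

lemma integrable_mult_bump:
  fixes f :: "real \<Rightarrow> complex"
  assumes "integrable (lebesgue_on {0<..<1}) f"
  shows "integrable (lebesgue_on {0<..<1}) (\<lambda>x. f x * complex_of_real (bump a b n x))"
proof (rule Bochner_Integration.integrable_bound[OF assms])
  have "(\<lambda>x. complex_of_real (bump a b n x)) \<in> borel_measurable (lebesgue_on {0<..<1})"
    by (intro measurable_continuous_unit_interval continuous_intros bump_algebra_continuous bump_algebra_bump)
  then show "(\<lambda>x. f x * complex_of_real (bump a b n x)) \<in> borel_measurable (lebesgue_on {0<..<1})"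
    using assms by measurable
  show "AE x in lebesgue_on {0<..<1}. norm (f x * complex_of_real (bump a b n x)) \<le> norm (f x)"
    using bump_bounds by (auto simp: norm_mult intro!: mult_left_le)
qed

lemma integral_mult_bump_tendsto:
  fixes f :: "real \<Rightarrow> complex"
  assumes "integrable (lebesgue_on {0<..<1}) f"
  shows "(\<lambda>n. \<integral>x. f x * complex_of_real (bump a b n x) \<partial>lebesgue_on {0<..<1})
    \<longlonglongrightarrow> (\<integral>x. indicator {a<..<b} x *\<^sub>R f x \<partial>lebesgue_on {0<..<1})"
proof (rule integral_dominated_convergence[where w = "\<lambda>x. norm (f x)"])
  show "AE x in lebesgue_on {0<..<1}. (\<lambda>n. f x * complex_of_real (bump a b n x)) \<longlonglongrightarrow> indicator {a<..<b} x *\<^sub>R f x"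
  proof (rule AE_I2)
    fix x
    have "(\<lambda>n. f x * complex_of_real (bump a b n x)) \<longlonglongrightarrow> f x * complex_of_real (indicator {a<..<b} x)"
      by (intro tendsto_intros bump_tendsto_indicator)
    then show "(\<lambda>n. f x * complex_of_real (bump a b n x)) \<longlonglongrightarrow> indicator {a<..<b} x *\<^sub>R f x"
      by (simp add: scaleR_conv_of_real mult.commute)
  qed
  have "(\<lambda>x. indicator {a<..<b} x :: real) \<in> borel_measurable (lebesgue_on {0<..<1})"
    by (intro measurable_restrict_space1 measurable_completion) measurable
  then show "(\<lambda>x. indicator {a<..<b} x *\<^sub>R f x) \<in> borel_measurable (lebesgue_on {0<..<1})"
    using assms by measurable
  show "(\<lambda>x. f x * complex_of_real (bump a b n x)) \<in> borel_measurable (lebesgue_on {0<..<1})" for n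
    using integrable_mult_bump[OF assms] by (rule borel_measurable_integrable)
  show "AE x in lebesgue_on {0<..<1}. norm (f x * complex_of_real (bump a b n x)) \<le> norm (f x)" for n
    using bump_bounds by (auto simp: norm_mult intro!: mult_left_le)
qed (use assms in \<open>rule integrable_norm\<close>)

text \<open>
  The Borel sets over which \<open>f\<close> has integral zero form a Dynkin system, and the open intervals generate the
  Borel sets and are stable under intersection.
\<close>

lemma AE_zero_of_interval_integrals:
  fixes f :: "real \<Rightarrow> complex"
  assumes f: "integrable (lebesgue_on {0<..<1}) f"
    and zero: "\<And>a b. 0 \<le> a \<Longrightarrow> b \<le> 1 \<Longrightarrow> (\<integral>x. indicator {a<..<b} x *\<^sub>R f x \<partial>lebesgue_on {0<..<1}) = 0"
  shows "AE x in lebesgue_on {0<..<1}. f x = 0"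
proof -
  let ?M = "lebesgue_on {0<..<1::real}"
  interpret finite_measure ?M by (rule finite_measure_unit_interval)
  have box: "(\<integral>x. indicator {a<..<b} x *\<^sub>R f x \<partial>?M) = 0" for a b
  proof -
    have "(\<integral>x. indicator {a<..<b} x *\<^sub>R f x \<partial>?M) = (\<integral>x. indicator {max a 0<..<min b 1} x *\<^sub>R f x \<partial>?M)"
      by (intro Bochner_Integration.integral_cong) (auto simp: indicator_def)
    also have "\<dots> = 0" by (rule zero) auto
    finally show ?thesis .
  qed
  have meas: "S \<inter> {0<..<1} \<in> sets ?M" if "S \<in> sets borel" for S
    using that by (auto simp: sets_restrict_space)
  have int: "integrable ?M (\<lambda>x. indicator S x *\<^sub>R f x)" if "S \<in> sets borel" for S
  proof -
    have "integrable ?M (\<lambda>x. indicator (S \<inter> {0<..<1}) x *\<^sub>R f x)"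
      by (rule integrable_mult_indicator[OF meas[OF that] f])
    also have "integrable ?M (\<lambda>x. indicator (S \<inter> {0<..<1}) x *\<^sub>R f x) \<longleftrightarrow> integrable ?M (\<lambda>x. indicator S x *\<^sub>R f x)"
      by (intro Bochner_Integration.integrable_cong) (auto simp: indicator_def)
    finally show ?thesis .
  qed
  have total: "(\<integral>x. f x \<partial>?M) = 0"
  proof -
    have "(\<integral>x. f x \<partial>?M) = (\<integral>x. indicator {0<..<1} x *\<^sub>R f x \<partial>?M)"
      by (intro Bochner_Integration.integral_cong) auto
    then show ?thesis using box by simp
  qed
  have gen: "sets borel = sigma_sets UNIV (range (\<lambda>(a, b). {a<..<b::real}))"
  proof -
    have *: "(\<lambda>(a, b). box a b) = (\<lambda>(a, b). {a<..<b::real})"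
      by (simp add: fun_eq_iff box_real)
    show ?thesis
      by (subst borel_eq_box) (simp only: * sets_measure_of_conv subset_UNIV Pow_UNIV top_greatest if_True)
  qed
  have borel: "(\<integral>x. indicator S x *\<^sub>R f x \<partial>?M) = 0" if "S \<in> sets borel" for S
  proof -
    have "Int_stable (range (\<lambda>(a, b). {a<..<b::real}))"
    proof (rule Int_stableI)
      fix A A' assume "A \<in> range (\<lambda>(a, b). {a<..<b::real})" "A' \<in> range (\<lambda>(a, b). {a<..<b::real})"
      then obtain a b c d where "A = {a<..<b}" "A' = {c<..<d}" by auto
      then have "A \<inter> A' = (\<lambda>(a, b). {a<..<b}) (max a c, min b d)" by auto
      then show "A \<inter> A' \<in> range (\<lambda>(a, b). {a<..<b::real})" by (rule range_eqI)
    qed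
    moreover have "range (\<lambda>(a, b). {a<..<b::real}) \<subseteq> Pow UNIV" by simp
    moreover have "S \<in> sigma_sets UNIV (range (\<lambda>(a, b). {a<..<b::real}))"
      using that unfolding gen .
    ultimately show ?thesis
    proof (induction rule: sigma_sets_induct_disjoint)
      case (basic A)
      then show ?case using box by auto
    next
      case empty
      show ?case by simp
    next
      case (compl A)
      then have A: "A \<in> sets borel" unfolding gen by simp
      have "(\<integral>x. indicator (UNIV - A) x *\<^sub>R f x \<partial>?M) = (\<integral>x. f x - indicator A x *\<^sub>R f x \<partial>?M)"
        by (intro Bochner_Integration.integral_cong) (auto simp: indicator_def)
      also have "\<dots> = (\<integral>x. f x \<partial>?M) - (\<integral>x. indicator A x *\<^sub>R f x \<partial>?M)"
        by (rule Bochner_Integration.integral_diff[OF f int[OF A]])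
      finally show ?case using total compl.IH by simp
    next
      case (union A)
      then have A: "A i \<in> sets borel" for i unfolding gen by auto
      have A': "A i \<inter> {0<..<1} \<in> sets ?M" for i by (rule meas[OF A])
      have *: "(\<integral>x. indicator (S \<inter> {0<..<1}) x *\<^sub>R f x \<partial>?M) = (\<integral>x. indicator S x *\<^sub>R f x \<partial>?M)" for S
        by (intro Bochner_Integration.integral_cong) (auto simp: indicator_def)
      have "(\<Union>i. A i \<inter> {0<..<1}) \<in> sets ?M" using A' by blast
      then have "set_integrable ?M (\<Union>i. A i \<inter> {0<..<1}) f"
        unfolding set_integrable_def using f by (rule integrable_mult_indicator)
      then have "(LINT x:(\<Union>i. A i \<inter> {0<..<1})|?M. f x) = (\<Sum>i. (LINT x:(A i \<inter> {0<..<1})|?M. f x))"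
        using union.hyps(1) A' by (intro lebesgue_integral_countable_add) (auto simp: disjoint_family_on_def)
      also have "\<dots> = 0"
        unfolding set_lebesgue_integral_def * using union.IH by simp
      finally have "(\<integral>x. indicator ((\<Union>i. A i) \<inter> {0<..<1}) x *\<^sub>R f x \<partial>?M) = 0"
        unfolding set_lebesgue_integral_def by simp
      then show ?case unfolding * .
    qed
  qed
  show ?thesis
  proof (rule density_zero[OF f])
    fix A assume "A \<in> sets ?M"
    then obtain A' where A': "A' \<in> sets lebesgue" "A = {0<..<1} \<inter> A'"
      by (auto simp: sets_restrict_space)
    obtain S N N' where N: "A' = S \<union> N" "N \<subseteq> N'" "N' \<in> null_sets lborel" "S \<in> sets lborel"
      using A'(1) by (rule sets_completionE)
    have "AE x in lebesgue. x \<notin> N'"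
      using N(3) by (intro AE_not_in null_sets_completionI)
    then have "AE x in ?M. x \<notin> N'"
      by (simp add: AE_restrict_space_iff) (auto elim: AE_mp)
    then have ae: "AE x in ?M. indicator A x *\<^sub>R f x = indicator S x *\<^sub>R f x"
      using AE_space
    proof eventually_elim
      case (elim x)
      then show ?case using N(1,2) A'(2) by (auto simp: indicator_def)
    qed
    have "set_lebesgue_integral ?M A f = (\<integral>x. indicator S x *\<^sub>R f x \<partial>?M)"
      unfolding set_lebesgue_integral_def
      using f \<open>A \<in> sets ?M\<close> int[of S] N(4) ae by (intro integral_cong_AE) (auto intro!: borel_measurable_integrable integrable_mult_indicator)
    also have "\<dots> = 0" using N(4) by (intro borel) simp
    finally show "set_lebesgue_integral ?M A f = 0" .
  qed
qed

lemma AE_zero_of_bump_integrals: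
  fixes f :: "real \<Rightarrow> complex"
  assumes f: "integrable (lebesgue_on {0<..<1}) f"
    and zero: "\<And>a b n. 0 \<le> a \<Longrightarrow> b \<le> 1 \<Longrightarrow> (\<integral>x. f x * complex_of_real (bump a b n x) \<partial>lebesgue_on {0<..<1}) = 0"
  shows "AE x in lebesgue_on {0<..<1}. f x = 0"
proof (rule AE_zero_of_interval_integrals[OF f])
  fix a b :: real assume "0 \<le> a" "b \<le> 1"
  then show "(\<integral>x. indicator {a<..<b} x *\<^sub>R f x \<partial>lebesgue_on {0<..<1}) = 0"
    using integral_mult_bump_tendsto[OF f, of a b] LIMSEQ_unique[OF _ tendsto_const[of 0]] by (simp add: zero)
qed

section \<open>Weak derivatives on the unit interval\<close>

lemma cr_L2_unit_cinner:
  "cr_L2 f (u :: unit_interval L2) \<Longrightarrow> cr_L2 g v \<Longrightarrow> cinner u v = (\<integral>x. f x * cnj (g x) \<partial>lebesgue_on {0<..<1})"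
  using cr_L2_cinner[of f u g v] by simp

lemma cr_L2_unit_norm:
  "cr_L2 f (u :: unit_interval L2) \<Longrightarrow> (norm u)\<^sup>2 = (\<integral>x. (cmod (f x))\<^sup>2 \<partial>lebesgue_on {0<..<1})"
  using cr_L2_norm[of f u] by simp

lemma square_integrable_unitI:
  assumes "f \<in> borel_measurable (lebesgue_on {0<..<1})" "\<And>x. x \<in> {0<..<1} \<Longrightarrow> cmod (f x) \<le> K"
  shows "square_integrable TYPE(unit_interval) f"
  unfolding square_integrable_def region_unit_interval
proof
  interpret finite_measure "lebesgue_on {0<..<1::real}" by (rule finite_measure_unit_interval)
  have "(cmod (f x))\<^sup>2 \<le> K\<^sup>2" if "x \<in> {0<..<1}" for x
    by (rule power_mono[OF assms(2)[OF that]]) simp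
  then show "integrable (lebesgue_on {0<..<1}) (\<lambda>x. (cmod (f x))\<^sup>2)"
    using assms(1) by (intro integrable_const_bound[where B = "K\<^sup>2"] AE_I2) (auto simp: space_restrict_space)
qed (rule assms(1))

lemma square_integrable_unit_continuous:
  assumes "continuous_on UNIV f"
  shows "square_integrable TYPE(unit_interval) f"
proof -
  have "compact (f ` {0..1})"
    by (rule compact_continuous_image[OF continuous_on_subset[OF assms] compact_Icc]) simp
  then obtain K where K: "\<forall>y\<in>f ` {0..1}. norm y \<le> K"
    using compact_imp_bounded[of "f ` {0..1}"] unfolding bounded_iff by blast
  show ?thesis
    by (rule square_integrable_unitI[OF measurable_continuous_unit_interval[OF assms], of K]) (use K in auto)
qed

lemma integrable_unit_mult:
  assumes "square_integrable TYPE(unit_interval) f" "square_integrable TYPE(unit_interval) g"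
  shows "integrable (lebesgue_on {0<..<1}) (\<lambda>x. f x * g x)"
proof -
  have "(\<lambda>x. cnj (g x)) \<in> borel_measurable (lebesgue_on {0<..<1})"
    by (rule measurable_compose[OF _ borel_measurable_continuous_onI])
      (use square_integrableD(1)[OF assms(2)] in \<open>auto intro!: continuous_intros\<close>)
  then have "square_integrable TYPE(unit_interval) (\<lambda>x. cnj (g x))"
    using assms(2) by (simp add: square_integrable_def)
  from integrable_cnj_mult[OF assms(1) this] show ?thesis by simp
qed

lemma integrable_unit:
  assumes "square_integrable TYPE(unit_interval) f"
  shows "integrable (lebesgue_on {0<..<1}) f"
  using integrable_unit_mult[OF assms square_integrable_unit_continuous[OF continuous_on_const[of _ 1]]] by simp

lemma unit_interval_FTC:
  fixes F f :: "real \<Rightarrow> real"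
  assumes F: "\<And>x. (F has_real_derivative f x) (at x)" and f: "continuous_on UNIV f"
    and ab: "0 \<le> a" "a \<le> b" "b \<le> 1"
  shows "(\<integral>x. indicator {a<..<b} x * f x \<partial>lebesgue_on {0<..<1}) = F b - F a"
proof -
  have [measurable]: "f \<in> borel_measurable borel" by (rule borel_measurable_continuous_onI[OF f])
  have "(\<integral>x. indicator {a<..<b} x * f x \<partial>lebesgue_on {0<..<1})
      = (\<integral>x. indicator {0<..<1} x *\<^sub>R (indicator {a<..<b} x * f x) \<partial>lebesgue)"
    by (rule integral_restrict_space) simp
  also have "\<dots> = (\<integral>x. indicator {0<..<1} x *\<^sub>R (indicator {a<..<b} x * f x) \<partial>lborel)"
    by (rule integral_completion) measurable
  also have "\<dots> = (\<integral>x. f x * indicator {a..b} x \<partial>lborel)"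
  proof (rule integral_cong_AE)
    have "AE x in lborel. x \<noteq> a" "AE x in lborel. x \<noteq> b" by (rule AE_lborel_singleton)+
    then show "AE x in lborel. indicator {0<..<1} x *\<^sub>R (indicator {a<..<b} x * f x) = f x * indicator {a..b} x"
      by eventually_elim (use ab in \<open>auto simp: indicator_def\<close>)
  qed measurable
  also have "\<dots> = F b - F a"
    by (rule integral_FTC_Icc_real[OF ab(2)]) (use F f in \<open>auto simp: continuous_on_eq_continuous_at\<close>)
  finally show ?thesis .
qed

lemma unit_interval_FTC_all:
  fixes F f :: "real \<Rightarrow> real"
  assumes F: "\<And>x. (F has_real_derivative f x) (at x)" and f: "continuous_on UNIV f"
  shows "(\<integral>x. f x \<partial>lebesgue_on {0<..<1}) = F 1 - F 0"
proof -
  have "(\<integral>x. f x \<partial>lebesgue_on {0<..<1}) = (\<integral>x. indicator {0<..<1} x * f x \<partial>lebesgue_on {0<..<1})"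
    by (intro Bochner_Integration.integral_cong) auto
  then show ?thesis using unit_interval_FTC[OF F f, of 0 1] by simp
qed

text \<open>
  The primitive itself need not belong to the bump algebra, but its derivatives do.
\<close>

lemma test_function_antiderivative:
  assumes \<theta>: "bump_algebra \<theta>" and cd: "{c..d} \<subseteq> {0<..<1}" "c \<le> d"
    and out: "\<And>x. x \<notin> {c..d} \<Longrightarrow> \<theta> x = 0" and zero: "(\<integral>x. \<theta> x \<partial>lebesgue_on {0<..<1}) = 0"
  obtains \<phi> where "test_function {0<..<1} \<phi>" "deriv \<phi> = \<theta>"
proof -
  have "0 < c" "d < 1" using cd by auto
  have cont: "continuous_on S \<theta>" for S by (rule bump_algebra_continuous[OF \<theta>])
  define \<phi> where "\<phi> x = integral {- 1..x} \<theta>" for x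
  have zero_left: "\<phi> x = 0" if "x < c" for x
  proof -
    have "integral {- 1..x} \<theta> = integral {- 1..x} (\<lambda>_. 0)"
      by (rule Henstock_Kurzweil_Integration.integral_cong) (use that out in auto)
    then show ?thesis by (simp add: \<phi>_def)
  qed
  have D: "(\<phi> has_real_derivative \<theta> x) (at x)" for x
  proof (cases "- 1 < x")
    case True
    have "(\<phi> has_real_derivative \<theta> x) (at x within {- 1..x + 1})"
      unfolding \<phi>_def using True by (intro integral_has_real_derivative cont) auto
    moreover have "at x within {- 1..x + 1} = at x"
      using True by (intro at_within_interior) (simp add: interior_atLeastAtMost_real)
    ultimately show ?thesis by simp
  next
    case False
    then have x: "x < c" using \<open>0 < c\<close> by simp
    have "((\<lambda>_. 0) has_real_derivative \<theta> x) (at x)"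
      using out[of x] x by simp
    then show ?thesis
      by (rule has_field_derivative_transform_within_open[of _ _ _ "{..<c}"]) (use x zero_left in auto)
  qed
  have deriv: "deriv \<phi> = \<theta>"
    by (intro ext DERIV_imp_deriv D)
  have zero_right: "\<phi> x = 0" if "d < x" for x
  proof -
    have const: "\<exists>k. \<forall>x\<in>{d<..}. \<phi> x = k"
    proof (rule has_field_derivative_zero_constant)
      show "(\<phi> has_field_derivative 0) (at x within {d<..})" if "x \<in> {d<..}" for x
        using has_field_derivative_at_within[OF D[of x]] out[of x] that by simp
    qed simp
    have "\<phi> 1 - \<phi> 0 = 0"
      using unit_interval_FTC_all[OF D cont] zero by simp
    then have "\<phi> 1 = 0" using zero_left[OF \<open>0 < c\<close>] by simp
    then show ?thesis using const that \<open>d < 1\<close> by (metis greaterThan_iff)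
  qed
  have smooth: "(deriv ^^ n) \<phi> differentiable_on UNIV" for n
  proof (cases n)
    case 0
    then show ?thesis
      unfolding differentiable_on_def real_differentiable_def using D by auto
  next
    case (Suc k)
    have "bump_algebra ((deriv ^^ k) \<theta>)"
      by (induction k) (use \<theta> bump_algebra_deriv(1) in auto)
    then show ?thesis
      unfolding Suc funpow_Suc_right o_def deriv by (rule bump_algebra_differentiable)
  qed
  have "test_function {0<..<1} \<phi>"
    unfolding test_function_def
  proof (intro conjI allI smooth exI[of _ "{c..d}"])
    show "x \<notin> {c..d} \<longrightarrow> \<phi> x = 0" for x using zero_left zero_right by auto
  qed (use cd in auto)
  then show thesis using deriv by (rule that)
qed

lemma integrable_complex_of_real_bump:
  "integrable (lebesgue_on {0<..<1}) (\<lambda>x. complex_of_real (bump a b n x))"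
  by (intro integrable_unit square_integrable_unit_continuous continuous_intros
      bump_algebra_continuous bump_algebra_bump)

text \<open>
  Subtracting a multiple of one fixed bump turns every bump into the derivative of a test function. Hence
  \<open>h - c\<close> is orthogonal to all bumps if \<open>c\<close> is the mean of \<open>h\<close> weighted with the fixed one.
\<close>

lemma du_Bois_Reymond:
  fixes h :: "real \<Rightarrow> complex"
  assumes h: "integrable (lebesgue_on {0<..<1}) h"
    and zero: "\<And>\<phi>. test_function {0<..<1} \<phi> \<Longrightarrow> (\<integral>x. h x * complex_of_real (deriv \<phi> x) \<partial>lebesgue_on {0<..<1}) = 0"
  obtains c where "AE x in lebesgue_on {0<..<1}. h x = c"
proof -
  let ?M = "lebesgue_on {0<..<1::real}"
  interpret finite_measure ?M by (rule finite_measure_unit_interval)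
  let ?I = "\<lambda>a b n. \<integral>x. bump a b n x \<partial>?M"
  have int_bump: "integrable ?M (bump a b n)" for a b n
    by (rule integrable_const_bound[of _ 1])
      (auto intro!: measurable_continuous_unit_interval bump_algebra_continuous bump_algebra_bump simp: bump_bounds)
  have I: "(\<integral>x. complex_of_real (bump a b n x) \<partial>?M) = complex_of_real (?I a b n)" for a b n
    by (rule integral_complex_of_real)
  obtain k where k: "?I 0 1 k \<noteq> 0"
  proof -
    have "(\<lambda>n. \<integral>x. 1 * complex_of_real (bump 0 1 n x) \<partial>?M) \<longlonglongrightarrow> (\<integral>x. indicator {0<..<1} x *\<^sub>R 1 \<partial>?M)"
      by (rule integral_mult_bump_tendsto) (rule integrable_const)
    also have "(\<integral>x. indicator {0<..<1} x *\<^sub>R (1::complex) \<partial>?M) = (\<integral>x. 1 \<partial>?M)"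
      by (intro Bochner_Integration.integral_cong) auto
    also have "\<dots> = 1" by (simp add: measure_restrict_space)
    finally have "(\<lambda>n. complex_of_real (?I 0 1 n)) \<longlonglongrightarrow> 1"
      by (simp add: I)
    then have "\<exists>n. ?I 0 1 n \<noteq> 0"
      using LIMSEQ_unique[of "\<lambda>_. 0 :: complex" 0 1] by (metis of_real_0 tendsto_const zero_neq_one ext)
    then show thesis using that by blast
  qed
  define c where "c = (\<integral>x. h x * complex_of_real (bump 0 1 k x) \<partial>?M) / complex_of_real (?I 0 1 k)"
  have "AE x in ?M. h x - c = 0"
  proof (rule AE_zero_of_bump_integrals)
    show "integrable ?M (\<lambda>x. h x - c)" using h by simp
    fix a b :: real and n assume ab: "0 \<le> a" "b \<le> 1"
    define \<theta> where "\<theta> x = bump a b n x + (- ?I a b n / ?I 0 1 k) * bump 0 1 k x" for x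
    have alg: "bump_algebra \<theta>"
      unfolding \<theta>_def[abs_def] by (intro bump_algebra.add bump_algebra.mult bump_algebra.const bump_algebra_bump)
    let ?m = "min (1 / real (Suc n)) (1 / real (Suc k))"
    have m: "0 < ?m" "?m \<le> 1 / real (Suc n)" "?m \<le> 1 / real (Suc k)" by auto
    define m where "m = min (1 / 2) ?m"
    have m': "0 < m" "m \<le> 1 / real (Suc n)" "m \<le> 1 / real (Suc k)" "m \<le> 1 / 2"
      using m unfolding m_def by linarith+
    have out: "\<theta> x = 0" if "x \<notin> {m..1 - m}" for x
    proof -
      have "x \<notin> {a + 1 / real (Suc n)..b - 1 / real (Suc n)}" "x \<notin> {0 + 1 / real (Suc k)..1 - 1 / real (Suc k)}"
        using that ab m' unfolding atLeastAtMost_iff by linarith+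
      then have "bump a b n x = 0 \<and> bump 0 1 k x = 0"
        by (intro conjI bump_outside)
      then show ?thesis by (simp add: \<theta>_def)
    qed
    have "(\<integral>x. \<theta> x \<partial>?M) = ?I a b n + (- ?I a b n / ?I 0 1 k) * ?I 0 1 k"
      unfolding \<theta>_def using int_bump by (subst Bochner_Integration.integral_add) simp_all
    then have int0: "(\<integral>x. \<theta> x \<partial>?M) = 0" using k by simp
    have sub: "{m..1 - m} \<subseteq> {0<..<1}" "m \<le> 1 - m" using m' by auto
    obtain \<phi> where \<phi>: "test_function {0<..<1} \<phi>" "deriv \<phi> = \<theta>"
      by (rule test_function_antiderivative[OF alg sub out int0])
    have "0 = (\<integral>x. h x * complex_of_real (\<theta> x) \<partial>?M)"
      using zero[OF \<phi>(1)] unfolding \<phi>(2) by simp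
    also have "\<dots> = (\<integral>x. h x * complex_of_real (bump a b n x) +
        complex_of_real (- ?I a b n / ?I 0 1 k) * (h x * complex_of_real (bump 0 1 k x)) \<partial>?M)"
      by (intro Bochner_Integration.integral_cong) (simp_all add: \<theta>_def algebra_simps)
    also have "\<dots> = (\<integral>x. h x * complex_of_real (bump a b n x) \<partial>?M) +
        complex_of_real (- ?I a b n / ?I 0 1 k) * (\<integral>x. h x * complex_of_real (bump 0 1 k x) \<partial>?M)"
      using integrable_mult_bump[OF h] by (subst Bochner_Integration.integral_add) simp_all
    also have "\<dots> = (\<integral>x. h x * complex_of_real (bump a b n x) \<partial>?M) - c * complex_of_real (?I a b n)"
      by (simp add: c_def)
    finally have eq: "(\<integral>x. h x * complex_of_real (bump a b n x) \<partial>?M) = c * complex_of_real (?I a b n)"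
      by simp
    have "(\<integral>x. (h x - c) * complex_of_real (bump a b n x) \<partial>?M) =
        (\<integral>x. h x * complex_of_real (bump a b n x) - c * complex_of_real (bump a b n x) \<partial>?M)"
      by (simp add: left_diff_distrib)
    also have "\<dots> = (\<integral>x. h x * complex_of_real (bump a b n x) \<partial>?M) - c * complex_of_real (?I a b n)"
      using integrable_mult_bump[OF h] integrable_complex_of_real_bump
      by (subst Bochner_Integration.integral_diff) (simp_all add: I)
    finally show "(\<integral>x. (h x - c) * complex_of_real (bump a b n x) \<partial>?M) = 0"
      using eq by simp
  qed
  then have "AE x in ?M. h x = c" by simp
  then show thesis by (rule that)
qed

subsection \<open>Primitives\<close>

definition step :: "real \<Rightarrow> unit_interval L2" where
  "step x = abs_L2 (\<lambda>t. indicator {0<..<x} t)"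

text \<open>The primitive of \<open>w\<close> that vanishes at 0, written as an inner product.\<close>

definition prim :: "unit_interval L2 \<Rightarrow> real \<Rightarrow> complex" where
  "prim w x = cinner w (step x)"

lemma measurable_indicator_unit:
  "(\<lambda>t. indicator {a<..<b::real} t :: complex) \<in> borel_measurable (lebesgue_on {0<..<1})"
  by (intro measurable_restrict_space1 measurable_completion) measurable

lemma cr_L2_step: "cr_L2 (\<lambda>t. indicator {0<..<x} t) (step x)"
  unfolding step_def
  by (intro cr_L2_abs square_integrable_unitI[where K = 1] measurable_indicator_unit) (simp add: indicator_def)

lemma norm_step_diff: "(norm (step x - step y))\<^sup>2 \<le> \<bar>x - y\<bar>"
proof -
  interpret finite_measure "lebesgue_on {0<..<1::real}" by (rule finite_measure_unit_interval)
  define S where "S = {min x y..max x y} \<inter> {0<..<1}"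
  have S: "S \<in> sets (lebesgue_on {0<..<1})" by (auto simp: S_def sets_restrict_space)
  have SM: "S \<inter> space (lebesgue_on {0<..<1}) = S"
    by (auto simp: S_def space_restrict_space)
  have "(norm (step x - step y))\<^sup>2 = (\<integral>t. (cmod (indicator {0<..<x} t - indicator {0<..<y} t))\<^sup>2 \<partial>lebesgue_on {0<..<1})"
    by (rule cr_L2_unit_norm[OF cr_L2_diff[OF cr_L2_step cr_L2_step]])
  also have "\<dots> \<le> (\<integral>t. indicator S t \<partial>lebesgue_on {0<..<1})"
  proof (rule integral_mono_AE)
    have "square_integrable TYPE(unit_interval) (\<lambda>t. indicator {0<..<x} t - indicator {0<..<y} t)"
      by (rule cr_L2_square_integrable[OF cr_L2_diff[OF cr_L2_step cr_L2_step]])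
    then show "integrable (lebesgue_on {0<..<1}) (\<lambda>t. (cmod (indicator {0<..<x} t - indicator {0<..<y} t))\<^sup>2)"
      by (simp add: square_integrable_def)
    show "integrable (lebesgue_on {0<..<1}) (\<lambda>t. indicator S t :: real)"
      using S by (intro integrable_real_indicator) (simp_all add: less_top[symmetric])
    show "AE t in lebesgue_on {0<..<1}. (cmod (indicator {0<..<x} t - indicator {0<..<y} t))\<^sup>2 \<le> (indicator S t :: real)"
      by (rule AE_I2) (auto simp: indicator_def S_def space_restrict_space)
  qed
  also have "\<dots> = measure (lebesgue_on {0<..<1}) S"
    using SM by simp
  also have "\<dots> = measure lebesgue S"
    by (rule measure_restrict_space) (auto simp: S_def)
  also have "\<dots> \<le> measure lebesgue {min x y..max x y}"
    by (rule measure_mono_fmeasurable) (auto simp: S_def)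
  also have "\<dots> = \<bar>x - y\<bar>" by (auto simp: min_def max_def)
  finally show ?thesis .
qed

lemma prim_Hoelder: "cmod (prim w x - prim w y) \<le> norm w * sqrt \<bar>x - y\<bar>"
proof -
  have "cmod (prim w x - prim w y) \<le> norm w * norm (step x - step y)"
    unfolding prim_def cinner_diff_right[symmetric] by (rule cinner_Cauchy_Schwarz)
  also have "norm (step x - step y) \<le> sqrt \<bar>x - y\<bar>"
    by (rule real_le_rsqrt[OF norm_step_diff])
  then have "norm w * norm (step x - step y) \<le> norm w * sqrt \<bar>x - y\<bar>"
    by (rule mult_left_mono) simp
  finally show ?thesis .
qed

lemma prim_0 [simp]: "prim w 0 = 0"
proof -
  have "step 0 = 0"
    using cr_L2_eq_iff[OF cr_L2_step cr_L2_zero] by simp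
  then show ?thesis by (simp add: prim_def)
qed

lemma continuous_on_prim: "continuous_on S (prim w)"
proof (rule continuous_on_subset[of UNIV])
  have "prim w \<midarrow>x\<rightarrow> prim w x" for x
  proof -
    have "((\<lambda>y. norm w * sqrt \<bar>y - x\<bar>) \<longlongrightarrow> norm w * sqrt \<bar>x - x\<bar>) (at x)"
      by (intro tendsto_intros)
    then have "((\<lambda>y. norm w * sqrt \<bar>y - x\<bar>) \<longlongrightarrow> 0) (at x)" by simp
    then have "((\<lambda>y. prim w y - prim w x) \<longlongrightarrow> 0) (at x)"
      by (rule Lim_null_comparison[rotated]) (intro always_eventually allI prim_Hoelder)
    then show ?thesis by (rule LIM_zero_cancel)
  qed
  then show "continuous_on UNIV (prim w)"
    by (simp add: continuous_on_eq_continuous_at isCont_def)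
qed simp

lemma prim_integral:
  assumes "cr_L2 g w"
  shows "prim w x = (\<integral>t. indicator {0<..<x} t * g t \<partial>lebesgue_on {0<..<1})"
  unfolding prim_def cr_L2_unit_cinner[OF assms cr_L2_step]
  by (intro Bochner_Integration.integral_cong) (simp_all add: indicator_def)

lemma prim_integral_1:
  assumes "cr_L2 g w"
  shows "prim w 1 = (\<integral>t. g t \<partial>lebesgue_on {0<..<1})"
  unfolding prim_integral[OF assms] by (intro Bochner_Integration.integral_cong) auto

lemma prim_add: "prim (v + w) x = prim v x + prim w x"
  and prim_scaleC: "prim (c *\<^sub>C w) x = c * prim w x"
  by (simp_all add: prim_def cinner_add_left cinner_scaleC_left)

text \<open>Integration by parts, by Fubini's theorem on the triangle \<open>t < x\<close>.\<close>

lemma prim_integration_by_parts: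
  assumes g: "cr_L2 g w" and \<phi>: "\<And>x. (\<phi> has_real_derivative \<phi>' x) (at x)" and \<phi>': "continuous_on UNIV \<phi>'"
  shows "(\<integral>x. prim w x * complex_of_real (\<phi>' x) \<partial>lebesgue_on {0<..<1})
    = prim w 1 * complex_of_real (\<phi> 1) - (\<integral>t. g t * complex_of_real (\<phi> t) \<partial>lebesgue_on {0<..<1})"
proof -
  let ?M = "lebesgue_on {0<..<1::real}"
  interpret finite_measure ?M by (rule finite_measure_unit_interval)
  interpret pair_sigma_finite ?M ?M ..
  have cont_\<phi>: "continuous_on UNIV \<phi>"
    using \<phi> by (intro continuous_at_imp_continuous_on) (blast intro: DERIV_isCont)
  have [measurable]: "g \<in> borel_measurable ?M"
    using square_integrableD(1)[OF cr_L2_square_integrable[OF g]] by simp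
  have [measurable]: "\<phi>' \<in> borel_measurable ?M"
    by (rule measurable_continuous_unit_interval[OF \<phi>'])
  have [measurable]: "(\<lambda>x. x) \<in> borel_measurable ?M"
    by (rule measurable_continuous_unit_interval) (intro continuous_intros)
  have int_g: "integrable ?M g"
    using cr_L2_square_integrable[OF g] by (rule integrable_unit)
  have sq_\<phi>: "square_integrable TYPE(unit_interval) (\<lambda>x. complex_of_real (\<phi> x))"
    by (intro square_integrable_unit_continuous continuous_intros cont_\<phi>)
  have "compact (\<phi>' ` {0..1})"
    by (rule compact_continuous_image[OF continuous_on_subset[OF \<phi>'] compact_Icc]) simp
  then obtain K where "\<forall>y\<in>\<phi>' ` {0..1}. norm y \<le> K"
    using compact_imp_bounded[of "\<phi>' ` {0..1}"] unfolding bounded_iff by blast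
  then have K: "\<bar>\<phi>' x\<bar> \<le> K" if "x \<in> {0..1}" for x
    using that by auto
  define f where "f x t = (if t < x then g t * complex_of_real (\<phi>' x) else 0)" for x t
  have [measurable]: "case_prod f \<in> borel_measurable (?M \<Otimes>\<^sub>M ?M)"
    unfolding f_def by measurable
  have bound: "norm (f x t) \<le> K * norm (g t)" if "x \<in> {0<..<1}" for x t
  proof -
    have "\<bar>\<phi>' x\<bar> \<le> K" using K[of x] that by simp
    then have "norm (g t) * \<bar>\<phi>' x\<bar> \<le> norm (g t) * K" by (rule mult_left_mono) simp
    moreover from \<open>\<bar>\<phi>' x\<bar> \<le> K\<close> have "0 \<le> K" by linarith
    ultimately show ?thesis by (simp add: f_def norm_mult mult.commute)
  qed
  have int_f: "integrable ?M (f x)" if x: "x \<in> {0<..<1}" for x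
  proof (rule Bochner_Integration.integrable_bound[where f = "\<lambda>t. K * norm (g t)"])
    show "f x \<in> borel_measurable ?M" unfolding f_def by measurable
    show "AE t in ?M. norm (f x t) \<le> norm (K * norm (g t))"
      using order_trans[OF bound[OF x] abs_ge_self] by (intro AE_I2) simp
  qed (use int_g in simp)
  have int_prod: "integrable (?M \<Otimes>\<^sub>M ?M) (case_prod f)"
  proof (rule Fubini_integrable)
    show "integrable ?M (\<lambda>x. \<integral>t. norm (case_prod f (x, t)) \<partial>?M)"
    proof (rule integrable_const_bound)
      show "AE x in ?M. norm (\<integral>t. norm (case_prod f (x, t)) \<partial>?M) \<le> (\<integral>t. K * norm (g t) \<partial>?M)"
      proof (rule AE_I2)
        fix x assume "x \<in> space ?M"
        then have x: "x \<in> {0<..<1}" by (simp add: space_restrict_space)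
        have "(\<integral>t. norm (f x t) \<partial>?M) \<le> (\<integral>t. K * norm (g t) \<partial>?M)"
          by (rule integral_mono) (use int_f[OF x] int_g bound[OF x] in auto)
        then show "norm (\<integral>t. norm (case_prod f (x, t)) \<partial>?M) \<le> (\<integral>t. K * norm (g t) \<partial>?M)"
          by (simp add: integral_nonneg_AE)
      qed
    qed measurable
    show "AE x in ?M. integrable ?M (\<lambda>t. case_prod f (x, t))"
      by (rule AE_I2) (use int_f in \<open>simp add: space_restrict_space\<close>)
  qed measurable
  have "(\<integral>x. prim w x * complex_of_real (\<phi>' x) \<partial>?M) = (\<integral>x. \<integral>t. f x t \<partial>?M \<partial>?M)"
  proof (rule Bochner_Integration.integral_cong)
    fix x assume "x \<in> space ?M"
    have "prim w x * complex_of_real (\<phi>' x) = (\<integral>t. indicator {0<..<x} t * g t * complex_of_real (\<phi>' x) \<partial>?M)"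
      unfolding prim_integral[OF g] by simp
    also have "\<dots> = (\<integral>t. f x t \<partial>?M)"
      by (intro Bochner_Integration.integral_cong) (auto simp: f_def indicator_def space_restrict_space)
    finally show "prim w x * complex_of_real (\<phi>' x) = (\<integral>t. f x t \<partial>?M)" .
  qed simp
  also have "\<dots> = (\<integral>t. \<integral>x. f x t \<partial>?M \<partial>?M)"
    by (rule Fubini_integral[OF int_prod, symmetric])
  also have "\<dots> = (\<integral>t. g t * complex_of_real (\<phi> 1) - g t * complex_of_real (\<phi> t) \<partial>?M)"
  proof (rule Bochner_Integration.integral_cong)
    fix t assume "t \<in> space ?M"
    then have t: "0 < t" "t < 1" by (auto simp: space_restrict_space)
    have "(\<integral>x. f x t \<partial>?M) = (\<integral>x. g t * complex_of_real (indicator {t<..<1} x * \<phi>' x) \<partial>?M)"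
      by (intro Bochner_Integration.integral_cong) (auto simp: f_def indicator_def space_restrict_space)
    also have "\<dots> = g t * complex_of_real (\<integral>x. indicator {t<..<1} x * \<phi>' x \<partial>?M)"
      unfolding integral_mult_right_zero by (subst integral_complex_of_real) (rule refl)
    also have "(\<integral>x. indicator {t<..<1} x * \<phi>' x \<partial>?M) = \<phi> 1 - \<phi> t"
      using t by (intro unit_interval_FTC[OF \<phi> \<phi>']) auto
    finally show "(\<integral>x. f x t \<partial>?M) = g t * complex_of_real (\<phi> 1) - g t * complex_of_real (\<phi> t)"
      by (simp add: algebra_simps)
  qed simp
  also have "\<dots> = (\<integral>t. g t * complex_of_real (\<phi> 1) \<partial>?M) - (\<integral>t. g t * complex_of_real (\<phi> t) \<partial>?M)"
    using int_g integrable_unit_mult[OF cr_L2_square_integrable[OF g] sq_\<phi>]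
    by (intro Bochner_Integration.integral_diff) auto
  also have "(\<integral>t. g t * complex_of_real (\<phi> 1) \<partial>?M) = prim w 1 * complex_of_real (\<phi> 1)"
    unfolding prim_integral_1[OF g] by simp
  finally show ?thesis .
qed

subsection \<open>Functions with a weak derivative\<close>

lemma test_functionD:
  assumes "test_function {0<..<1} \<phi>"
  shows "(\<phi> has_real_derivative deriv \<phi> x) (at x)" "continuous_on UNIV \<phi>" "continuous_on UNIV (deriv \<phi>)"
    and "\<phi> 0 = 0" "\<phi> 1 = 0"
proof -
  have *: "(deriv ^^ n) \<phi> differentiable_on UNIV" for n
    using assms by (simp add: test_function_def)
  have d: "\<phi> differentiable_on UNIV" "deriv \<phi> differentiable_on UNIV"
    using *[of 0] *[of 1] by simp_all
  then show "continuous_on UNIV \<phi>" "continuous_on UNIV (deriv \<phi>)"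
    by (simp_all add: differentiable_imp_continuous_on)
  show "(\<phi> has_real_derivative deriv \<phi> x) (at x)"
    using d(1) by (simp add: differentiable_on_def real_differentiable_def DERIV_deriv_iff_real_differentiable)
  show "\<phi> 0 = 0" "\<phi> 1 = 0"
    using assms unfolding test_function_def by (metis greaterThanLessThan_iff less_irrefl subsetD)+
qed

lemma has_weak_derivative_cr:
  assumes "cr_L2 f (u :: unit_interval L2)" "cr_L2 g w"
  shows "has_weak_derivative u w \<longleftrightarrow> (\<forall>\<phi>. test_function {0<..<1} \<phi> \<longrightarrow>
    (\<integral>x. f x * complex_of_real (deriv \<phi> x) \<partial>lebesgue_on {0<..<1}) =
    - (\<integral>x. g x * complex_of_real (\<phi> x) \<partial>lebesgue_on {0<..<1}))"
  using assms by (auto simp: cr_L2_def has_weak_derivative.abs_eq)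

lemma cr_L2_abs_prim: "cr_L2 (\<lambda>x. c + prim w x) (abs_L2 (\<lambda>x. c + prim w x) :: unit_interval L2)"
  by (intro cr_L2_abs square_integrable_unit_continuous continuous_intros continuous_on_prim)

lemma has_weak_derivative_primitive:
  assumes "cr_L2 (\<lambda>x. c + prim w x) u"
  shows "has_weak_derivative u w"
  unfolding has_weak_derivative_cr[OF assms cr_L2_rep]
proof (intro allI impI)
  fix \<phi> assume \<phi>: "test_function {0<..<1} \<phi>"
  note D = test_functionD[OF \<phi>]
  have sq: "square_integrable TYPE(unit_interval) (\<lambda>x. complex_of_real (deriv \<phi> x))"
    by (intro square_integrable_unit_continuous continuous_intros D)
  have "(\<integral>x. (c + prim w x) * complex_of_real (deriv \<phi> x) \<partial>lebesgue_on {0<..<1})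
      = c * (\<integral>x. complex_of_real (deriv \<phi> x) \<partial>lebesgue_on {0<..<1}) +
        (\<integral>x. prim w x * complex_of_real (deriv \<phi> x) \<partial>lebesgue_on {0<..<1})"
    using integrable_unit[OF sq] integrable_unit_mult[OF square_integrable_unit_continuous[OF continuous_on_prim] sq]
    by (simp add: distrib_right)
  also have "(\<integral>x. complex_of_real (deriv \<phi> x) \<partial>lebesgue_on {0<..<1}) = 0"
    using unit_interval_FTC_all[OF D(1,3)] D(4,5) by simp
  also have "(\<integral>x. prim w x * complex_of_real (deriv \<phi> x) \<partial>lebesgue_on {0<..<1})
      = - (\<integral>x. rep_L2 w x * complex_of_real (\<phi> x) \<partial>lebesgue_on {0<..<1})"
    using prim_integration_by_parts[OF cr_L2_rep D(1,3)] D(5) by simp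
  finally show "(\<integral>x. (c + prim w x) * complex_of_real (deriv \<phi> x) \<partial>lebesgue_on {0<..<1})
      = - (\<integral>x. rep_L2 w x * complex_of_real (\<phi> x) \<partial>lebesgue_on {0<..<1})" by simp
qed

text \<open>
  In one dimension the functions with a weak derivative are the primitives: \<open>u\<close> minus the primitive of \<open>w\<close>
  has weak derivative zero and is therefore constant.
\<close>

lemma has_weak_derivative_iff: "has_weak_derivative u w \<longleftrightarrow> (\<exists>c. cr_L2 (\<lambda>x. c + prim w x) u)"
proof
  assume weak: "has_weak_derivative u w"
  let ?f = "rep_L2 u" and ?M = "lebesgue_on {0<..<1::real}"
  have sq: "square_integrable TYPE(unit_interval) ?f" "square_integrable TYPE(unit_interval) (prim w)"
    using cr_L2_square_integrable[OF cr_L2_rep] square_integrable_unit_continuous[OF continuous_on_prim] by auto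
  obtain c where c: "AE x in ?M. ?f x - prim w x = c"
  proof (rule du_Bois_Reymond[of "\<lambda>x. ?f x - prim w x"])
    show "integrable ?M (\<lambda>x. ?f x - prim w x)"
      using sq by (intro Bochner_Integration.integrable_diff integrable_unit)
    fix \<phi> assume \<phi>: "test_function {0<..<1} \<phi>"
    note D = test_functionD[OF \<phi>]
    have sq': "square_integrable TYPE(unit_interval) (\<lambda>x. complex_of_real (deriv \<phi> x))"
      by (intro square_integrable_unit_continuous continuous_intros D)
    have "(\<integral>x. (?f x - prim w x) * complex_of_real (deriv \<phi> x) \<partial>?M) =
        (\<integral>x. ?f x * complex_of_real (deriv \<phi> x) \<partial>?M) - (\<integral>x. prim w x * complex_of_real (deriv \<phi> x) \<partial>?M)"
      using integrable_unit_mult[OF sq(1) sq'] integrable_unit_mult[OF sq(2) sq'] by (simp add: left_diff_distrib)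
    also have "\<dots> = 0"
      using weak \<phi> prim_integration_by_parts[OF cr_L2_rep D(1,3), of w] D(5)
      unfolding has_weak_derivative_cr[OF cr_L2_rep cr_L2_rep] by simp
    finally show "(\<integral>x. (?f x - prim w x) * complex_of_real (deriv \<phi> x) \<partial>?M) = 0" .
  qed
  have "cr_L2 (\<lambda>x. c + prim w x) u"
  proof (rule cr_L2_cong_AE[OF cr_L2_rep cr_L2_square_integrable[OF cr_L2_abs_prim]])
    show "AE x in region_measure TYPE(unit_interval). ?f x = c + prim w x"
      unfolding region_unit_interval using c by eventually_elim (simp add: algebra_simps)
  qed
  then show "\<exists>c. cr_L2 (\<lambda>x. c + prim w x) u" by blast
qed (use has_weak_derivative_primitive in blast)

lemma has_weak_derivative_unique:
  assumes "has_weak_derivative u w" "has_weak_derivative (u :: unit_interval L2) w'"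
  shows "w = w'"
proof -
  let ?M = "lebesgue_on {0<..<1::real}" and ?g = "rep_L2 w" and ?g' = "rep_L2 w'"
  have sq: "square_integrable TYPE(unit_interval) ?g" "square_integrable TYPE(unit_interval) ?g'"
    by (rule cr_L2_square_integrable[OF cr_L2_rep])+
  have "AE x in ?M. ?g x - ?g' x = 0"
  proof (rule AE_zero_of_bump_integrals)
    show "integrable ?M (\<lambda>x. ?g x - ?g' x)"
      using sq by (intro Bochner_Integration.integrable_diff integrable_unit)
    fix a b :: real and n assume "0 \<le> a" "b \<le> 1"
    then have "test_function {0<..<1} (bump a b n)" by (rule bump_test_function)
    then have "- (\<integral>x. ?g x * complex_of_real (bump a b n x) \<partial>?M) = - (\<integral>x. ?g' x * complex_of_real (bump a b n x) \<partial>?M)"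
      using assms unfolding has_weak_derivative_cr[OF cr_L2_rep cr_L2_rep] by metis
    then show "(\<integral>x. (?g x - ?g' x) * complex_of_real (bump a b n x) \<partial>?M) = 0"
      using integrable_mult_bump[OF integrable_unit[OF sq(1)]] integrable_mult_bump[OF integrable_unit[OF sq(2)]]
      by (simp add: left_diff_distrib)
  qed
  then show ?thesis
    unfolding cr_L2_eq_iff[OF cr_L2_rep cr_L2_rep] region_unit_interval by simp
qed

lemma weak_deriv_eq: "has_weak_derivative u w \<Longrightarrow> weak_deriv (u :: unit_interval L2) = w"
  unfolding weak_deriv_def using has_weak_derivative_unique by (intro the_equality) auto

lemma sobolev_1_iff: "u \<in> sobolev 1 \<longleftrightarrow> (\<exists>w. has_weak_derivative u w)"
  by (simp add: sobolev_def)

lemma has_weak_derivative_weak_deriv: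
  "u \<in> sobolev 1 \<Longrightarrow> has_weak_derivative (u :: unit_interval L2) (weak_deriv u)"
  using weak_deriv_eq sobolev_1_iff by metis

lemma has_weak_derivative_tendsto:
  fixes u w :: "unit_interval L2"
  assumes U: "\<And>n::nat. has_weak_derivative (U n) (W n)" and u: "U \<longlonglongrightarrow> u" and w: "W \<longlonglongrightarrow> w"
  shows "has_weak_derivative u w"
  unfolding has_weak_derivative_cr[OF cr_L2_rep cr_L2_rep]
proof (intro allI impI)
  fix \<phi> assume \<phi>: "test_function {0<..<1} \<phi>"
  note D = test_functionD[OF \<phi>]
  define a b :: "unit_interval L2" where "a = abs_L2 (\<lambda>x. complex_of_real (deriv \<phi> x))" and "b = abs_L2 (\<lambda>x. complex_of_real (\<phi> x))"
  have ab: "cr_L2 (\<lambda>x. complex_of_real (deriv \<phi> x)) a" "cr_L2 (\<lambda>x. complex_of_real (\<phi> x)) b"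
    unfolding a_def b_def by (intro cr_L2_abs square_integrable_unit_continuous continuous_intros D)+
  have eq: "cinner u a = (\<integral>x. rep_L2 u x * complex_of_real (deriv \<phi> x) \<partial>lebesgue_on {0<..<1})"
    "cinner u b = (\<integral>x. rep_L2 u x * complex_of_real (\<phi> x) \<partial>lebesgue_on {0<..<1})" for u
    using cr_L2_unit_cinner[OF cr_L2_rep ab(1)] cr_L2_unit_cinner[OF cr_L2_rep ab(2)] by simp_all
  have "cinner (U n) a = - cinner (W n) b" for n
    using U[of n] \<phi> unfolding has_weak_derivative_cr[OF cr_L2_rep cr_L2_rep] eq by blast
  moreover have "(\<lambda>n. cinner (U n) a) \<longlonglongrightarrow> cinner u a"
    by (rule bounded_linear.tendsto[OF bounded_linear_cinner_left u])
  moreover have "(\<lambda>n. - cinner (W n) b) \<longlonglongrightarrow> - cinner w b"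
    by (intro tendsto_minus bounded_linear.tendsto[OF bounded_linear_cinner_left w])
  ultimately have "cinner u a = - cinner w b"
    using LIMSEQ_unique by (metis (no_types, lifting) ext)
  then show "(\<integral>x. rep_L2 u x * complex_of_real (deriv \<phi> x) \<partial>lebesgue_on {0<..<1}) =
      - (\<integral>x. rep_L2 w x * complex_of_real (\<phi> x) \<partial>lebesgue_on {0<..<1})"
    unfolding eq .
qed

lemma has_weak_derivative_add:
  assumes "has_weak_derivative u w" "has_weak_derivative (u' :: unit_interval L2) w'"
  shows "has_weak_derivative (u + u') (w + w')"
proof -
  obtain c c' where c: "cr_L2 (\<lambda>x. c + prim w x) u" "cr_L2 (\<lambda>x. c' + prim w' x) u'"
    using assms unfolding has_weak_derivative_iff by blast
  have "cr_L2 (\<lambda>x. (c + c') + prim (w + w') x) (u + u')"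
    using cr_L2_add[OF c] by (simp add: prim_add algebra_simps)
  then show ?thesis by (rule has_weak_derivative_primitive)
qed

lemma has_weak_derivative_scaleC:
  assumes "has_weak_derivative (u :: unit_interval L2) w"
  shows "has_weak_derivative (a *\<^sub>C u) (a *\<^sub>C w)"
proof -
  obtain c where c: "cr_L2 (\<lambda>x. c + prim w x) u"
    using assms unfolding has_weak_derivative_iff by blast
  have "cr_L2 (\<lambda>x. a * c + prim (a *\<^sub>C w) x) (a *\<^sub>C u)"
    using cr_L2_scaleC[OF c, of a] by (simp add: prim_scaleC algebra_simps)
  then show ?thesis by (rule has_weak_derivative_primitive)
qed

lemma has_weak_derivative_zero: "has_weak_derivative (0 :: unit_interval L2) 0"
  using has_weak_derivative_primitive[of 0 0 0] cr_L2_zero by (simp add: prim_def)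

lemma has_weak_derivative_sum:
  "(\<And>i. i \<in> I \<Longrightarrow> has_weak_derivative (u i) (w i :: unit_interval L2)) \<Longrightarrow>
    has_weak_derivative (\<Sum>i\<in>I. u i) (\<Sum>i\<in>I. w i)"
  by (induction I rule: infinite_finite_induct) (auto intro: has_weak_derivative_zero has_weak_derivative_add)

lemma subspace_sobolev_1: "complex_vector.subspace (sobolev 1 :: unit_interval L2 set)"
proof (rule complex_vector.subspaceI)
  show "(0 :: unit_interval L2) \<in> sobolev 1"
    unfolding sobolev_1_iff by (rule exI, rule has_weak_derivative_zero)
  show "u + v \<in> sobolev 1" if "u \<in> sobolev 1" "v \<in> sobolev 1" for u v :: "unit_interval L2"
    unfolding sobolev_1_iff
    by (rule exI, rule has_weak_derivative_add[OF that[THEN has_weak_derivative_weak_deriv]])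
  show "c *\<^sub>C u \<in> sobolev 1" if "u \<in> sobolev 1" for c and u :: "unit_interval L2"
    unfolding sobolev_1_iff
    by (rule exI, rule has_weak_derivative_scaleC[OF that[THEN has_weak_derivative_weak_deriv]])
qed

section \<open>The cosine basis\<close>

definition cos_fun :: "nat \<Rightarrow> real \<Rightarrow> real" where
  "cos_fun n x = (if n = 0 then 1 else sqrt 2 * cos (real n * pi * x))"

definition sin_fun :: "nat \<Rightarrow> real \<Rightarrow> real" where
  "sin_fun n x = sqrt 2 * sin (real n * pi * x)"

definition cosv :: "nat \<Rightarrow> unit_interval L2" where
  "cosv n = abs_L2 (\<lambda>x. complex_of_real (cos_fun n x))"

definition sinv :: "nat \<Rightarrow> unit_interval L2" where
  "sinv n = abs_L2 (\<lambda>x. complex_of_real (sin_fun n x))"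

lemma continuous_cos_fun: "continuous_on S (cos_fun n)"
  by (cases "n = 0") (auto simp: cos_fun_def[abs_def] intro!: continuous_intros)

lemma continuous_sin_fun: "continuous_on S (sin_fun n)"
  by (auto simp: sin_fun_def[abs_def] intro!: continuous_intros)

lemma DERIV_cos_fun: "(cos_fun n has_real_derivative - (real n * pi) * sin_fun n x) (at x)"
proof (cases "n = 0")
  case False
  have "((\<lambda>x. sqrt 2 * cos (real n * pi * x)) has_real_derivative - (real n * pi) * (sqrt 2 * sin (real n * pi * x))) (at x)"
    by (auto intro!: derivative_eq_intros)
  then show ?thesis
    using False by (simp add: cos_fun_def[abs_def] sin_fun_def)
qed (simp add: cos_fun_def[abs_def])

lemma DERIV_sin_fun: "(sin_fun n has_real_derivative (real n * pi) * cos_fun n x) (at x)"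
proof -
  have "((\<lambda>x. sqrt 2 * sin (real n * pi * x)) has_real_derivative (real n * pi) * (sqrt 2 * cos (real n * pi * x))) (at x)"
    by (auto intro!: derivative_eq_intros)
  then show ?thesis
    by (cases "n = 0") (simp_all add: cos_fun_def sin_fun_def[abs_def])
qed

lemma sin_fun_boundary [simp]: "sin_fun n 0 = 0" "sin_fun n 1 = 0"
  by (simp_all add: sin_fun_def sin_npi)

lemma cr_cosv: "cr_L2 (\<lambda>x. complex_of_real (cos_fun n x)) (cosv n)"
  unfolding cosv_def
  by (intro cr_L2_abs square_integrable_unit_continuous continuous_intros continuous_cos_fun)

lemma cr_sinv: "cr_L2 (\<lambda>x. complex_of_real (sin_fun n x)) (sinv n)"
  unfolding sinv_def
  by (intro cr_L2_abs square_integrable_unit_continuous continuous_intros continuous_sin_fun)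

lemma cinner_cosv: "cr_L2 f u \<Longrightarrow> cinner u (cosv n) = (\<integral>x. f x * complex_of_real (cos_fun n x) \<partial>lebesgue_on {0<..<1})"
  using cr_L2_unit_cinner[OF _ cr_cosv] by simp

lemma cinner_sinv: "cr_L2 f u \<Longrightarrow> cinner u (sinv n) = (\<integral>x. f x * complex_of_real (sin_fun n x) \<partial>lebesgue_on {0<..<1})"
  using cr_L2_unit_cinner[OF _ cr_sinv] by simp

lemma primitive_integration_by_parts:
  assumes u: "cr_L2 (\<lambda>x. c + prim w x) u" and g: "cr_L2 g w"
    and \<phi>: "\<And>x. (\<phi> has_real_derivative \<phi>' x) (at x)" and \<phi>': "continuous_on UNIV \<phi>'"
  shows "(\<integral>x. (c + prim w x) * complex_of_real (\<phi>' x) \<partial>lebesgue_on {0<..<1}) =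
    c * complex_of_real (\<phi> 1 - \<phi> 0) + prim w 1 * complex_of_real (\<phi> 1)
      - (\<integral>t. g t * complex_of_real (\<phi> t) \<partial>lebesgue_on {0<..<1})"
proof -
  have sq: "square_integrable TYPE(unit_interval) (\<lambda>x. complex_of_real (\<phi>' x))"
    by (intro square_integrable_unit_continuous continuous_intros \<phi>')
  have "(\<integral>x. (c + prim w x) * complex_of_real (\<phi>' x) \<partial>lebesgue_on {0<..<1}) =
      c * (\<integral>x. complex_of_real (\<phi>' x) \<partial>lebesgue_on {0<..<1}) +
      (\<integral>x. prim w x * complex_of_real (\<phi>' x) \<partial>lebesgue_on {0<..<1})"
    using integrable_unit[OF sq] integrable_unit_mult[OF square_integrable_unit_continuous[OF continuous_on_prim] sq]
    by (simp add: distrib_right)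
  then show ?thesis
    using unit_interval_FTC_all[OF \<phi> \<phi>'] prim_integration_by_parts[OF g \<phi> \<phi>'] by simp
qed

text \<open>The boundary terms vanish because the sines do.\<close>

lemma cinner_weak_derivative_sinv:
  assumes "has_weak_derivative u w"
  shows "cinner w (sinv n) = - complex_of_real (real n * pi) * cinner u (cosv n)"
proof -
  obtain c where u: "cr_L2 (\<lambda>x. c + prim w x) u"
    using assms unfolding has_weak_derivative_iff by blast
  have "(\<integral>x. (c + prim w x) * complex_of_real (real n * pi * cos_fun n x) \<partial>lebesgue_on {0<..<1}) =
      c * complex_of_real (sin_fun n 1 - sin_fun n 0) + prim w 1 * complex_of_real (sin_fun n 1)
      - (\<integral>t. rep_L2 w t * complex_of_real (sin_fun n t) \<partial>lebesgue_on {0<..<1})"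
    by (rule primitive_integration_by_parts[OF u cr_L2_rep DERIV_sin_fun])
      (intro continuous_intros continuous_cos_fun)
  then have "(\<integral>x. (c + prim w x) * complex_of_real (real n * pi * cos_fun n x) \<partial>lebesgue_on {0<..<1}) = - cinner w (sinv n)"
    unfolding cinner_sinv[OF cr_L2_rep] by simp
  moreover have "(\<integral>x. (c + prim w x) * complex_of_real (real n * pi * cos_fun n x) \<partial>lebesgue_on {0<..<1})
      = complex_of_real (real n * pi) * cinner u (cosv n)"
    unfolding cinner_cosv[OF u] integral_mult_right_zero[symmetric]
    by (intro Bochner_Integration.integral_cong) (simp_all add: mult_ac)
  ultimately have *: "complex_of_real (real n * pi) * cinner u (cosv n) = - cinner w (sinv n)"
    by (simp only:)
  show ?thesis
    unfolding mult_minus_left * by simp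
qed

text \<open>
  The boundary terms do not vanish here; they will encode the Neumann boundary conditions when \<open>u\<close> is itself
  a derivative.
\<close>

lemma cinner_primitive_sinv:
  assumes u: "cr_L2 (\<lambda>x. c + prim w x) u"
  shows "complex_of_real (real n * pi) * cinner u (sinv n) = cinner w (cosv n)
    - c * complex_of_real (cos_fun n 1 - cos_fun n 0) - prim w 1 * complex_of_real (cos_fun n 1)"
proof -
  have "(\<integral>x. (c + prim w x) * complex_of_real (- (real n * pi) * sin_fun n x) \<partial>lebesgue_on {0<..<1}) =
      c * complex_of_real (cos_fun n 1 - cos_fun n 0) + prim w 1 * complex_of_real (cos_fun n 1)
      - (\<integral>t. rep_L2 w t * complex_of_real (cos_fun n t) \<partial>lebesgue_on {0<..<1})"
    by (rule primitive_integration_by_parts[OF u cr_L2_rep DERIV_cos_fun])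
      (intro continuous_intros continuous_sin_fun)
  moreover have "(\<integral>x. (c + prim w x) * complex_of_real (- (real n * pi) * sin_fun n x) \<partial>lebesgue_on {0<..<1})
      = - complex_of_real (real n * pi) * cinner u (sinv n)"
    unfolding cinner_sinv[OF u] integral_mult_right_zero[symmetric]
    by (intro Bochner_Integration.integral_cong) (simp_all add: mult_ac)
  ultimately show ?thesis
    unfolding cinner_cosv[OF cr_L2_rep] by (simp add: algebra_simps)
qed

lemma has_weak_derivative_smooth:
  assumes F: "\<And>x. (F has_real_derivative f x) (at x)" and f: "continuous_on UNIV f"
    and w: "cr_L2 (\<lambda>x. complex_of_real (f x)) w" and u: "cr_L2 (\<lambda>x. complex_of_real (F x)) (u :: unit_interval L2)"
  shows "has_weak_derivative u w"
proof (rule has_weak_derivative_primitive)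
  have "complex_of_real (F x) = complex_of_real (F 0) + prim w x" if "x \<in> {0<..<1}" for x
  proof -
    have "prim w x = (\<integral>t. complex_of_real (indicator {0<..<x} t * f t) \<partial>lebesgue_on {0<..<1})"
      unfolding prim_integral[OF w] by (intro Bochner_Integration.integral_cong) (simp_all add: indicator_def)
    also have "\<dots> = complex_of_real (F x - F 0)"
      unfolding integral_complex_of_real using that by (subst unit_interval_FTC[OF F f]) auto
    finally show ?thesis by simp
  qed
  then have "AE x in lebesgue_on {0<..<1}. complex_of_real (F x) = complex_of_real (F 0) + prim w x"
    by (intro AE_I2) (simp add: space_restrict_space)
  then show "cr_L2 (\<lambda>x. complex_of_real (F 0) + prim w x) u"
    by (intro cr_L2_cong_AE[OF u cr_L2_square_integrable[OF cr_L2_abs_prim]]) (simp only: region_unit_interval)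
qed

lemma has_weak_derivative_cosv: "has_weak_derivative (cosv n) (- complex_of_real (real n * pi) *\<^sub>C sinv n)"
proof (rule has_weak_derivative_smooth[OF DERIV_cos_fun _ _ cr_cosv])
  show "cr_L2 (\<lambda>x. complex_of_real (- (real n * pi) * sin_fun n x)) (- complex_of_real (real n * pi) *\<^sub>C sinv n)"
    using cr_L2_scaleC[OF cr_sinv, of "- complex_of_real (real n * pi)" n] by simp
qed (intro continuous_intros continuous_sin_fun)

lemma has_weak_derivative_sinv: "has_weak_derivative (sinv n) (complex_of_real (real n * pi) *\<^sub>C cosv n)"
proof (rule has_weak_derivative_smooth[OF DERIV_sin_fun _ _ cr_sinv])
  show "cr_L2 (\<lambda>x. complex_of_real (real n * pi * cos_fun n x)) (complex_of_real (real n * pi) *\<^sub>C cosv n)"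
    using cr_L2_scaleC[OF cr_cosv, of "complex_of_real (real n * pi)" n] by simp
qed (intro continuous_intros continuous_cos_fun)

text \<open>
  The relation between both systems already forces orthogonality, exchanging the roles of \<open>m\<close> and \<open>n\<close>.
\<close>

lemma cinner_sinv_cosv: "real m * cinner (sinv m) (sinv n) = real n * cinner (cosv m) (cosv n)"
proof -
  have "- complex_of_real (real m * pi) * cinner (sinv m) (sinv n) = - complex_of_real (real n * pi) * cinner (cosv m) (cosv n)"
    using cinner_weak_derivative_sinv[OF has_weak_derivative_cosv, of m n] by (simp only: cinner_scaleC_left)
  then show ?thesis
    by (simp add: mult.assoc mult.left_commute[of _ "complex_of_real pi"])
qed

lemma cinner_cosv_orthogonal:
  assumes "m \<noteq> n"
  shows "cinner (cosv m) (cosv n) = 0"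
proof -
  have 1: "real m * cinner (sinv m) (sinv n) = real n * cinner (cosv m) (cosv n)"
    by (rule cinner_sinv_cosv)
  have "cnj (real n * cinner (sinv n) (sinv m)) = cnj (real m * cinner (cosv n) (cosv m))"
    by (simp only: cinner_sinv_cosv)
  then have 2: "real n * cinner (sinv m) (sinv n) = real m * cinner (cosv m) (cosv n)"
    by (simp add: cinner_commute[symmetric])
  have "complex_of_real (real n) * (complex_of_real (real n) * cinner (cosv m) (cosv n)) =
      complex_of_real (real m) * (complex_of_real (real m) * cinner (cosv m) (cosv n))"
    unfolding 1[symmetric] 2[symmetric] by (rule mult.left_commute)
  then have "complex_of_real ((real n)\<^sup>2 - (real m)\<^sup>2) * cinner (cosv m) (cosv n) = 0"
    by (simp add: power2_eq_square left_diff_distrib mult.assoc)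
  moreover have "(real n)\<^sup>2 - (real m)\<^sup>2 \<noteq> 0"
    using assms by simp
  ultimately show ?thesis
    unfolding mult_eq_0_iff of_real_eq_0_iff by blast
qed

text \<open>
  The squares of cosine and sine have the same integral, because the two systems are related by
  differentiation, and their sum is constant.
\<close>

lemma cinner_cosv_self: "cinner (cosv n) (cosv n) = 1"
proof (cases "n = 0")
  case True
  have "cinner (cosv n) (cosv n) = (\<integral>x. 1 \<partial>lebesgue_on {0<..<1::real})"
    using True unfolding cinner_cosv[OF cr_cosv] by (simp add: cos_fun_def)
  then show ?thesis by (simp add: measure_restrict_space)
next
  case False
  have "cinner (cosv n) (cosv n) + cinner (sinv n) (sinv n) =
      (\<integral>x. complex_of_real (cos_fun n x) * complex_of_real (cos_fun n x) +
        complex_of_real (sin_fun n x) * complex_of_real (sin_fun n x) \<partial>lebesgue_on {0<..<1})"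
    unfolding cinner_cosv[OF cr_cosv] cinner_sinv[OF cr_sinv]
    by (intro Bochner_Integration.integral_add[symmetric] integrable_unit_mult cr_L2_square_integrable[OF cr_cosv] cr_L2_square_integrable[OF cr_sinv])
  also have "\<dots> = (\<integral>x. 2 \<partial>lebesgue_on {0<..<1::real})"
  proof (rule Bochner_Integration.integral_cong)
    fix x
    have sq: "(sqrt 2 * t) * (sqrt 2 * t) = 2 * t\<^sup>2" for t
    proof -
      have "(sqrt 2 * t) * (sqrt 2 * t) = (sqrt 2 * sqrt 2) * (t * t)" by (simp only: mult_ac)
      then show ?thesis by (simp add: power2_eq_square)
    qed
    have "cos_fun n x * cos_fun n x + sin_fun n x * sin_fun n x = 2 * ((cos (real n * pi * x))\<^sup>2 + (sin (real n * pi * x))\<^sup>2)"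
      using False by (simp only: cos_fun_def sin_fun_def sq if_False distrib_left)
    then have "cos_fun n x * cos_fun n x + sin_fun n x * sin_fun n x = 2"
      by simp
    then show "complex_of_real (cos_fun n x) * complex_of_real (cos_fun n x) +
        complex_of_real (sin_fun n x) * complex_of_real (sin_fun n x) = 2"
      by (metis of_real_add of_real_mult of_real_numeral)
  qed simp
  also have "\<dots> = 2" by (simp add: measure_restrict_space)
  finally show ?thesis
    using cinner_sinv_cosv[of n n] False by simp
qed

lemma cinner_sinv_Suc: "cinner (sinv (Suc m)) (sinv (Suc n)) = (if m = n then 1 else 0)"
  using cinner_sinv_cosv[of "Suc m" "Suc n"] cinner_cosv_orthogonal[of "Suc m" "Suc n"] cinner_cosv_self[of "Suc n"]
  by (cases "m = n") (auto simp: add_eq_0_iff simp del: of_nat_Suc)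

lemma sinv_0 [simp]: "sinv 0 = 0"
proof -
  have "cr_L2 (\<lambda>x. complex_of_real (sin_fun 0 x)) (0 :: unit_interval L2)"
    using cr_L2_zero by (simp add: sin_fun_def)
  then show ?thesis
    using cr_sinv[of 0] by (simp add: cr_L2_iff)
qed

text \<open>
  The product formula for cosines lowers the power \<open>k\<close>.
\<close>

lemma cosine_power_integral_zero:
  fixes f :: "real \<Rightarrow> complex"
  assumes f: "square_integrable TYPE(unit_interval) f"
    and zero: "\<And>n. (\<integral>x. f x * complex_of_real (cos (real n * pi * x)) \<partial>lebesgue_on {0<..<1}) = 0"
  shows "(\<integral>x. f x * complex_of_real (cos (pi * x) ^ k * cos (real n * pi * x)) \<partial>lebesgue_on {0<..<1}) = 0"
proof (induction k arbitrary: n)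
  case 0
  show ?case using zero by simp
next
  case (Suc k)
  have int: "integrable (lebesgue_on {0<..<1}) (\<lambda>x. f x * complex_of_real (cos (pi * x) ^ k * cos (real n * pi * x)))" for n
    by (intro integrable_unit_mult f square_integrable_unit_continuous continuous_intros)
  show ?case
  proof (cases n)
    case 0
    show ?thesis using Suc.IH[of 1] 0 by (simp add: mult_ac)
  next
    case (Suc n')
    have trig: "cos (pi * x) * cos (real n * pi * x) = (cos (real (Suc n) * pi * x) + cos (real n' * pi * x)) / 2" for x
    proof -
      have "cos (real (Suc n) * pi * x) = cos (real n * pi * x + pi * x)"
        "cos (real n' * pi * x) = cos (real n * pi * x - pi * x)"
        by (simp_all add: Suc algebra_simps)
      then show ?thesis by (simp add: cos_add cos_diff)
    qed
    have "f x * complex_of_real (cos (pi * x) ^ Suc k * cos (real n * pi * x)) =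
        (f x * complex_of_real (cos (pi * x) ^ k * cos (real (Suc n) * pi * x)) +
         f x * complex_of_real (cos (pi * x) ^ k * cos (real n' * pi * x))) / 2" for x
    proof -
      have "cos (pi * x) ^ Suc k * cos (real n * pi * x) = cos (pi * x) ^ k * (cos (pi * x) * cos (real n * pi * x))"
        by (simp add: mult_ac)
      also have "\<dots> = (cos (pi * x) ^ k * cos (real (Suc n) * pi * x) + cos (pi * x) ^ k * cos (real n' * pi * x)) / 2"
        unfolding trig by (simp only: times_divide_eq_right distrib_left)
      finally have *: "cos (pi * x) ^ Suc k * cos (real n * pi * x) = \<dots>" .
      show ?thesis
        unfolding * by (simp only: of_real_divide of_real_add of_real_numeral times_divide_eq_right distrib_left)
    qed
    then have "(\<integral>x. f x * complex_of_real (cos (pi * x) ^ Suc k * cos (real n * pi * x)) \<partial>lebesgue_on {0<..<1}) =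
        (\<integral>x. (f x * complex_of_real (cos (pi * x) ^ k * cos (real (Suc n) * pi * x)) +
         f x * complex_of_real (cos (pi * x) ^ k * cos (real n' * pi * x))) / 2 \<partial>lebesgue_on {0<..<1})"
      by (simp only:)
    also have "\<dots> = ((\<integral>x. f x * complex_of_real (cos (pi * x) ^ k * cos (real (Suc n) * pi * x)) \<partial>lebesgue_on {0<..<1}) +
         (\<integral>x. f x * complex_of_real (cos (pi * x) ^ k * cos (real n' * pi * x)) \<partial>lebesgue_on {0<..<1})) / 2"
      unfolding Bochner_Integration.integral_add[OF int int, symmetric] by (rule integral_divide_zero)
    also have "\<dots> = 0" unfolding Suc.IH by simp
    finally show ?thesis .
  qed
qed

text \<open>
  Polynomials in \<open>cos (pi * x)\<close> are linear combinations of the cosines, and by the theorem of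
  Weierstrass they are uniformly dense in the continuous functions on the interval.
\<close>

lemma cosv_complete:
  assumes "\<And>n. cinner u (cosv n) = 0"
  shows "u = 0"
proof -
  let ?M = "lebesgue_on {0<..<1::real}" and ?f = "rep_L2 u"
  have f: "square_integrable TYPE(unit_interval) ?f" by (rule cr_L2_square_integrable[OF cr_L2_rep])
  have int_f: "integrable ?M ?f" by (rule integrable_unit[OF f])
  have zero: "(\<integral>x. ?f x * complex_of_real (cos (real n * pi * x)) \<partial>?M) = 0" for n
  proof -
    have *: "(\<integral>x. ?f x * complex_of_real (cos_fun n x) \<partial>?M) = 0"
      using assms[of n] unfolding cinner_cosv[OF cr_L2_rep] .
    define r where "r = (if n = 0 then 1 else sqrt 2)"
    have "?f x * complex_of_real (cos_fun n x) = complex_of_real r * (?f x * complex_of_real (cos (real n * pi * x)))" for x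
      by (simp add: cos_fun_def r_def)
    then have "complex_of_real r * (\<integral>x. ?f x * complex_of_real (cos (real n * pi * x)) \<partial>?M) = 0"
      using * by (simp only: integral_mult_right_zero)
    then show ?thesis by (simp add: r_def split: if_splits)
  qed
  have pow: "(\<integral>x. ?f x * complex_of_real (cos (pi * x) ^ k) \<partial>?M) = 0" for k
    using cosine_power_integral_zero[OF f zero, of k 0] by simp
  have "AE x in ?M. ?f x = 0"
  proof (rule AE_zero_of_bump_integrals[OF int_f])
    fix a b :: real and n assume "0 \<le> a" "b \<le> 1"
    let ?I = "\<integral>x. ?f x * complex_of_real (bump a b n x) \<partial>?M"
    have small: "cmod ?I \<le> \<epsilon> * (\<integral>x. norm (?f x) \<partial>?M)" if "0 < \<epsilon>" for \<epsilon>
    proof -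
      have "continuous_on {-1..1} (\<lambda>y. bump a b n (arccos y / pi))"
        by (intro continuous_on_compose2[OF bump_algebra_continuous[OF bump_algebra_bump, of UNIV]] continuous_intros) auto
      then obtain g where g: "real_polynomial_function g" "\<And>y. y \<in> {-1..1} \<Longrightarrow> \<bar>bump a b n (arccos y / pi) - g y\<bar> < \<epsilon>"
        using Stone_Weierstrass_real_polynomial_function[OF compact_Icc _ \<open>0 < \<epsilon>\<close>] by metis
      obtain c N where gs: "g = (\<lambda>y. \<Sum>i\<le>N::nat. c i * y ^ i)"
        using g(1) unfolding real_polynomial_function_iff_sum by blast
      have approx: "\<bar>bump a b n x - g (cos (pi * x))\<bar> \<le> \<epsilon>" if "x \<in> {0<..<1}" for x
      proof -
        have "arccos (cos (pi * x)) = pi * x"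
          using that by (intro arccos_cos) (auto simp: mult_le_cancel_left1)
        then show ?thesis using g(2)[of "cos (pi * x)"] by simp
      qed
      have int_pow: "integrable ?M (\<lambda>x. ?f x * complex_of_real (cos (pi * x) ^ k))" for k
        by (intro integrable_unit_mult f square_integrable_unit_continuous continuous_intros)
      have "?f x * complex_of_real (g (cos (pi * x))) = (\<Sum>i\<le>N. complex_of_real (c i) * (?f x * complex_of_real (cos (pi * x) ^ i)))" for x
        unfolding gs of_real_sum sum_distrib_left by (intro sum.cong) (simp_all add: mult_ac)
      then have int_g: "integrable ?M (\<lambda>x. ?f x * complex_of_real (g (cos (pi * x))))"
        and g0: "(\<integral>x. ?f x * complex_of_real (g (cos (pi * x))) \<partial>?M) = 0"
        using int_pow by (simp_all only: Bochner_Integration.integral_sum Bochner_Integration.integrable_sum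
            integrable_mult_right integral_mult_right_zero pow mult_zero_right sum.neutral_const)
      have "?I = ?I - (\<integral>x. ?f x * complex_of_real (g (cos (pi * x))) \<partial>?M)"
        unfolding g0 by simp
      also have "\<dots> = (\<integral>x. ?f x * complex_of_real (bump a b n x) - ?f x * complex_of_real (g (cos (pi * x))) \<partial>?M)"
        by (rule Bochner_Integration.integral_diff[symmetric, OF integrable_mult_bump[OF int_f] int_g])
      also have "cmod \<dots> \<le> (\<integral>x. \<epsilon> * norm (?f x) \<partial>?M)"
      proof (rule Bochner_Integration.integral_norm_bound_integral)
        show "integrable ?M (\<lambda>x. ?f x * complex_of_real (bump a b n x) - ?f x * complex_of_real (g (cos (pi * x))))"
          by (rule Bochner_Integration.integrable_diff[OF integrable_mult_bump[OF int_f] int_g])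
        show "integrable ?M (\<lambda>x. \<epsilon> * norm (?f x))" using int_f by simp
        fix x assume "x \<in> space ?M"
        then have "x \<in> {0<..<1}" by (simp add: space_restrict_space)
        have "?f x * complex_of_real (bump a b n x) - ?f x * complex_of_real (g (cos (pi * x))) = ?f x * complex_of_real (bump a b n x - g (cos (pi * x)))"
          by (simp only: of_real_diff right_diff_distrib)
        also have "norm \<dots> = norm (?f x) * \<bar>bump a b n x - g (cos (pi * x))\<bar>"
          by (simp only: norm_mult norm_of_real)
        also have "\<dots> \<le> norm (?f x) * \<epsilon>"
          by (intro mult_left_mono approx \<open>x \<in> {0<..<1}\<close>) simp
        finally show "norm (?f x * complex_of_real (bump a b n x) - ?f x * complex_of_real (g (cos (pi * x)))) \<le> \<epsilon> * norm (?f x)"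
          by (simp only: mult.commute)
      qed
      finally show ?thesis by simp
    qed
    have "cmod ?I \<le> 0"
    proof (rule field_le_epsilon)
      fix \<delta> :: real assume "0 < \<delta>"
      let ?n = "\<integral>x. norm (?f x) \<partial>?M"
      have n: "0 \<le> ?n" by (rule integral_nonneg_AE) simp
      have n1: "0 < ?n + 1" using n by linarith
      have q: "?n / (?n + 1) \<le> 1" using n1 by simp
      have "cmod ?I \<le> \<delta> / (?n + 1) * ?n"
        by (intro small divide_pos_pos \<open>0 < \<delta>\<close> n1)
      also have "\<dots> = \<delta> * (?n / (?n + 1))" by simp
      also have "\<dots> \<le> \<delta> * 1"
        by (rule mult_left_mono[OF q]) (use \<open>0 < \<delta>\<close> in simp)
      finally show "cmod ?I \<le> 0 + \<delta>" by simp
    qed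
    then show "?I = 0" by simp
  qed
  then show ?thesis
    unfolding cr_L2_eq_iff[OF cr_L2_rep cr_L2_zero] region_unit_interval .
qed

interpretation cosb: orthonormal_basis cosv
proof
  show "cinner (cosv m) (cosv n) = (if m = n then 1 else 0)" for m n
    using cinner_cosv_self cinner_cosv_orthogonal by simp
qed (rule cosv_complete)

interpretation sinb: orthonormal "\<lambda>n. sinv (Suc n)"
  by standard (rule cinner_sinv_Suc)

section \<open>Sobolev spaces in terms of cosine coefficients\<close>

abbreviation cos_coef :: "nat \<Rightarrow> unit_interval L2 \<Rightarrow> complex" where
  "cos_coef \<equiv> cosb.coef"

lemma cmod_real_mult:
  assumes "0 \<le> r"
  shows "cmod (complex_of_real r * z) = r * cmod z" "cmod (- complex_of_real r * z) = r * cmod z"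
  unfolding norm_mult norm_minus_cancel norm_of_real using assms by simp_all

lemma npi_nonneg: "0 \<le> real n * pi"
  by simp

text \<open>
  The cosine series may be differentiated term by term because the graph of the weak derivative is closed.
\<close>

lemma has_weak_derivative_series:
  assumes summ: "summable (\<lambda>n. (real n * pi * cmod (cos_coef n u))\<^sup>2)"
  obtains w where "has_weak_derivative u w" "(\<lambda>n. (- complex_of_real (real n * pi) * cos_coef n u) *\<^sub>C sinv n) sums w"
proof -
  let ?a = "\<lambda>n. - complex_of_real (real n * pi) * cos_coef n u"
  have "summable (\<lambda>n. (cmod (?a (Suc n)))\<^sup>2)"
    using summ unfolding cmod_real_mult[OF npi_nonneg] by (subst (asm) summable_Suc_iff[symmetric])
  then obtain w where w: "(\<lambda>n. ?a (Suc n) *\<^sub>C sinv (Suc n)) sums w"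
    using sinb.Riesz_Fischer by metis
  then have sums: "(\<lambda>n. ?a n *\<^sub>C sinv n) sums w"
    by (subst (asm) sums_Suc_iff) simp
  have "has_weak_derivative (\<Sum>n<k. cos_coef n u *\<^sub>C cosv n) (\<Sum>n<k. ?a n *\<^sub>C sinv n)" for k
  proof (rule has_weak_derivative_sum)
    fix n
    have "has_weak_derivative (cos_coef n u *\<^sub>C cosv n) (cos_coef n u *\<^sub>C (- complex_of_real (real n * pi) *\<^sub>C sinv n))"
      by (rule has_weak_derivative_scaleC[OF has_weak_derivative_cosv])
    then show "has_weak_derivative (cos_coef n u *\<^sub>C cosv n) (?a n *\<^sub>C sinv n)"
      unfolding scaleC_scaleC mult.commute[of "cos_coef n u"] .
  qed
  moreover have "(\<lambda>k. \<Sum>n<k. cos_coef n u *\<^sub>C cosv n) \<longlonglongrightarrow> u"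
    using cosb.sums_basis[of u] unfolding sums_def .
  moreover have "(\<lambda>k. \<Sum>n<k. ?a n *\<^sub>C sinv n) \<longlonglongrightarrow> w"
    using sums unfolding sums_def .
  ultimately have "has_weak_derivative u w"
    by (rule has_weak_derivative_tendsto)
  then show thesis using sums by (rule that)
qed

lemma has_weak_derivative_coef:
  assumes "has_weak_derivative u w"
  shows "cinner w (sinv n) = - complex_of_real (real n * pi) * cos_coef n u"
  using cinner_weak_derivative_sinv[OF assms] by (simp add: cosb.coef_def)

lemma weak_derivative_sums:
  assumes "has_weak_derivative u w"
  shows "(\<lambda>n. (- complex_of_real (real n * pi) * cos_coef n u) *\<^sub>C sinv n) sums w"
proof -
  have "summable (\<lambda>n. (cmod (cinner w (sinv (Suc n))))\<^sup>2)"
    using sinb.Bessel_summable[of w] by (simp add: sinb.coef_def)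
  then have "summable (\<lambda>n. (real n * pi * cmod (cos_coef n u))\<^sup>2)"
    unfolding has_weak_derivative_coef[OF assms] cmod_real_mult[OF npi_nonneg]
    by (subst summable_Suc_iff[symmetric])
  then obtain w' where "has_weak_derivative u w'" "(\<lambda>n. (- complex_of_real (real n * pi) * cos_coef n u) *\<^sub>C sinv n) sums w'"
    by (rule has_weak_derivative_series)
  then show ?thesis
    using has_weak_derivative_unique[OF assms] by simp
qed

lemma AE_zero_continuous_imp_zero:
  fixes f :: "real \<Rightarrow> complex"
  assumes f: "continuous_on {0..1} f" and ae: "AE x in lebesgue_on {0<..<1}. f x = 0" and x: "x \<in> {0..1}"
  shows "f x = 0"
proof -
  let ?S = "{0<..<1} \<inter> f -` (- {0})"
  have "open ?S"
    by (rule continuous_open_preimage) (use f in \<open>auto intro: continuous_on_subset\<close>)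
  have "AE x in lebesgue. x \<notin> ?S"
    using ae by (simp add: AE_restrict_space_iff) (auto elim!: AE_mp)
  then have "?S \<in> null_sets lebesgue"
    using \<open>open ?S\<close> by (subst AE_iff_null_sets) auto
  then have "?S = {}"
    using open_not_negligible[OF \<open>open ?S\<close>] unfolding negligible_iff_null_sets by blast
  then have "f y = 0" if "y \<in> {0<..<1}" for y
    using that by auto
  moreover have cl: "closure {0<..<1::real} = {0..1}"
    by (rule closure_greaterThanLessThan) simp
  ultimately show ?thesis
    using continuous_constant_on_closure[of "{0<..<1}" f 0 x] f x by simp
qed

lemma has_boundary_value_primitive:
  assumes u: "cr_L2 (\<lambda>x. c + prim w x) u" and a: "a \<in> {0..1}"
  shows "has_boundary_value u a z \<longleftrightarrow> z = c + prim w a"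
proof -
  have "has_boundary_value u a z \<longleftrightarrow> (\<exists>g. continuous_on {0..1} g \<and>
      (AE x in lebesgue_on {0<..<1}. c + prim w x = g x) \<and> g a = z)"
  proof -
    have L: "L2_rel TYPE(unit_interval) (\<lambda>x. c + prim w x) (\<lambda>x. c + prim w x)" and eq: "abs_L2 (\<lambda>x. c + prim w x) = u"
      using u by (auto simp: cr_L2_def)
    show ?thesis
      unfolding eq[symmetric] has_boundary_value.abs_eq[OF L] region_unit_interval ..
  qed
  also have "\<dots> \<longleftrightarrow> z = c + prim w a"
  proof
    assume "z = c + prim w a"
    then show "\<exists>g. continuous_on {0..1} g \<and> (AE x in lebesgue_on {0<..<1}. c + prim w x = g x) \<and> g a = z"
      by (intro exI[of _ "\<lambda>x. c + prim w x"]) (auto intro!: continuous_intros continuous_on_prim)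
  next
    assume "\<exists>g. continuous_on {0..1} g \<and> (AE x in lebesgue_on {0<..<1}. c + prim w x = g x) \<and> g a = z"
    then obtain g where g: "continuous_on {0..1} g" "AE x in lebesgue_on {0<..<1}. c + prim w x = g x" "g a = z"
      by blast
    have "g a - (c + prim w a) = 0"
    proof (rule AE_zero_continuous_imp_zero[OF _ _ a])
      show "continuous_on {0..1} (\<lambda>x. g x - (c + prim w x))"
        by (intro continuous_intros g(1) continuous_on_prim)
      show "AE x in lebesgue_on {0<..<1}. g x - (c + prim w x) = 0"
        using g(2) by eventually_elim simp
    qed
    then show "z = c + prim w a" using g(3) by simp
  qed
  finally show ?thesis .
qed

definition neumann_mu :: "nat \<Rightarrow> real" where
  "neumann_mu n = (real n * pi)\<^sup>2"

lemma neumann_mu_nonneg: "0 \<le> neumann_mu n"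
  by (simp add: neumann_mu_def)

lemma sobolev_2_iff: "u \<in> sobolev 2 \<longleftrightarrow> (\<exists>w v. has_weak_derivative u w \<and> has_weak_derivative w (v :: unit_interval L2))"
proof -
  have "u \<in> sobolev 2 \<longleftrightarrow> (\<exists>w. has_weak_derivative u w) \<and> (\<exists>v. has_weak_derivative (weak_deriv u) v)"
    by (auto simp: sobolev_def less_2_cases_iff)
  then show ?thesis using weak_deriv_eq by metis
qed

lemma dom_A_coef:
  assumes "u \<in> dom_A"
  shows "cos_coef n (A_op u) = complex_of_real (neumann_mu n) * cos_coef n u"
proof -
  have "u \<in> sobolev 2" and bv: "has_boundary_value (weak_deriv u) 0 0" "has_boundary_value (weak_deriv u) 1 0"
    using assms by (auto simp: dom_A_def)
  then obtain w v where w: "has_weak_derivative u w" and v: "has_weak_derivative w v"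
    unfolding sobolev_2_iff by blast
  obtain c where c: "cr_L2 (\<lambda>x. c + prim v x) w"
    using v unfolding has_weak_derivative_iff by blast
  have "c = 0" "prim v 1 = 0"
    using bv unfolding weak_deriv_eq[OF w] by (simp_all add: has_boundary_value_primitive[OF c])
  then have "cinner v (cosv n) = complex_of_real (real n * pi) * cinner w (sinv n)"
    using cinner_primitive_sinv[OF c, of n] by simp
  also have "\<dots> = - complex_of_real (neumann_mu n) * cos_coef n u"
    unfolding has_weak_derivative_coef[OF w] by (simp add: neumann_mu_def power2_eq_square mult_ac)
  finally have "cos_coef n v = - complex_of_real (neumann_mu n) * cos_coef n u"
    by (simp add: cosb.coef_def)
  then show ?thesis
    unfolding A_op_def weak_deriv_eq[OF w] weak_deriv_eq[OF v] by simp
qed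

text \<open>
  Summability allows the cosine series to be differentiated twice. The coefficients of the result then
  force the boundary values of the derivative to be zero.
\<close>

lemma dom_A_iff: "u \<in> dom_A \<longleftrightarrow> summable (\<lambda>n. (neumann_mu n * cmod (cos_coef n u))\<^sup>2)"
proof
  assume "u \<in> dom_A"
  show "summable (\<lambda>n. (neumann_mu n * cmod (cos_coef n u))\<^sup>2)"
    using cosb.Bessel_summable[of "A_op u"]
    unfolding dom_A_coef[OF \<open>u \<in> dom_A\<close>] cmod_real_mult[OF neumann_mu_nonneg] .
next
  assume summ: "summable (\<lambda>n. (neumann_mu n * cmod (cos_coef n u))\<^sup>2)"
  have "summable (\<lambda>n. (real n * pi * cmod (cos_coef n u))\<^sup>2)"
  proof (rule summable_comparison_test[OF _ summ], intro exI allI impI)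
    fix n
    have "real n * pi \<le> neumann_mu n"
    proof (cases "n = 0")
      case False
      then have "1 * 1 \<le> real n * pi"
        using pi_gt3 by (intro mult_mono) auto
      then show ?thesis
        unfolding neumann_mu_def power2_eq_square by (simp add: mult_le_cancel_left1)
    qed (simp add: neumann_mu_def)
    then have "(real n * pi * cmod (cos_coef n u))\<^sup>2 \<le> (neumann_mu n * cmod (cos_coef n u))\<^sup>2"
      by (intro power_mono mult_right_mono) auto
    then show "norm ((real n * pi * cmod (cos_coef n u))\<^sup>2) \<le> (neumann_mu n * cmod (cos_coef n u))\<^sup>2"
      by simp
  qed
  then obtain w where w: "has_weak_derivative u w" "(\<lambda>n. (- complex_of_real (real n * pi) * cos_coef n u) *\<^sub>C sinv n) sums w"
    by (rule has_weak_derivative_series)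
  let ?b = "\<lambda>n. - complex_of_real (neumann_mu n) * cos_coef n u"
  have "summable (\<lambda>n. (cmod (?b n))\<^sup>2)"
    using summ unfolding cmod_real_mult[OF neumann_mu_nonneg] .
  from cosb.Riesz_Fischer[OF this] obtain v
    where v: "\<And>n. cos_coef n v = ?b n" "(\<lambda>n. ?b n *\<^sub>C cosv n) sums v"
    by blast
  have "has_weak_derivative (\<Sum>n<k. (- complex_of_real (real n * pi) * cos_coef n u) *\<^sub>C sinv n) (\<Sum>n<k. ?b n *\<^sub>C cosv n)" for k
  proof (rule has_weak_derivative_sum)
    fix n
    have "has_weak_derivative ((- complex_of_real (real n * pi) * cos_coef n u) *\<^sub>C sinv n)
        ((- complex_of_real (real n * pi) * cos_coef n u) *\<^sub>C (complex_of_real (real n * pi) *\<^sub>C cosv n))"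
      by (rule has_weak_derivative_scaleC[OF has_weak_derivative_sinv])
    also have "(- complex_of_real (real n * pi) * cos_coef n u) *\<^sub>C (complex_of_real (real n * pi) *\<^sub>C cosv n) = ?b n *\<^sub>C cosv n"
      unfolding scaleC_scaleC by (rule arg_cong[where f = "\<lambda>c. c *\<^sub>C cosv n"]) (simp add: neumann_mu_def power2_eq_square mult_ac)
    finally show "has_weak_derivative ((- complex_of_real (real n * pi) * cos_coef n u) *\<^sub>C sinv n) (?b n *\<^sub>C cosv n)" .
  qed
  from has_weak_derivative_tendsto[OF this w(2)[unfolded sums_def] v(2)[unfolded sums_def]]
  have wv: "has_weak_derivative w v" .
  obtain c where c: "cr_L2 (\<lambda>x. c + prim v x) w"
    using wv unfolding has_weak_derivative_iff by blast
  \<comment> \<open>the coefficients of \<open>w\<close> and \<open>v\<close> leave no room for boundary terms; the cases 0 and 1 determine them\<close>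
  have "c * complex_of_real (cos_fun n 1 - cos_fun n 0) + prim v 1 * complex_of_real (cos_fun n 1) = 0" for n
  proof -
    have "complex_of_real (real n * pi) * cinner w (sinv n) = cinner v (cosv n)"
      unfolding has_weak_derivative_coef[OF w(1)] using v(1)[of n]
      by (simp add: cosb.coef_def neumann_mu_def power2_eq_square mult_ac)
    then show ?thesis
      using cinner_primitive_sinv[OF c, of n] by (simp add: algebra_simps)
  qed
  from this[of 0] this[of 1] have p1: "prim v 1 = 0" and "c * complex_of_real (sqrt 2 * (- 1) - sqrt 2) = 0"
    by (simp_all add: cos_fun_def)
  moreover have "sqrt 2 * (- 1) - sqrt 2 \<noteq> 0"
    by simp
  ultimately have "c = 0"
    unfolding mult_eq_0_iff of_real_eq_0_iff by blast
  then show "u \<in> dom_A"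
    unfolding dom_A_def using sobolev_2_iff w(1) wv p1 weak_deriv_eq[OF w(1)]
    by (auto simp: has_boundary_value_primitive[OF c])
qed

text \<open>
  The gaps grow linearly.
\<close>

lemma neumann_gap: "\<forall>\<^sub>F N in sequentially. K * (1 + sqrt (real N)) \<le> neumann_mu N - neumann_mu (N - 1)"
  using eventually_ge_at_top[of "max 1 (nat \<lceil>(2 * \<bar>K\<bar>)\<^sup>2\<rceil>)"]
proof eventually_elim
  fix N assume "max 1 (nat \<lceil>(2 * \<bar>K\<bar>)\<^sup>2\<rceil>) \<le> N"
  then have N: "1 \<le> N" "(2 * \<bar>K\<bar>)\<^sup>2 \<le> real N"
    by (auto simp: nat_le_iff ceiling_le_iff)
  then have s: "2 * \<bar>K\<bar> \<le> sqrt (real N)" "1 \<le> sqrt (real N)"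
    by (auto intro: real_le_rsqrt)
  have "K * (1 + sqrt (real N)) \<le> \<bar>K\<bar> * (2 * sqrt (real N))"
    using s(2) by (intro mult_mono) auto
  also have "\<dots> = (2 * \<bar>K\<bar>) * sqrt (real N)" by simp
  also have "\<dots> \<le> sqrt (real N) * sqrt (real N)"
    using s(1) by (intro mult_right_mono) auto
  also have "\<dots> = real N" by simp
  also have "\<dots> \<le> 1 * (2 * real N - 1)" using N(1) by simp
  also have "\<dots> \<le> pi\<^sup>2 * (2 * real N - 1)"
  proof (rule mult_right_mono)
    have "1 \<le> pi" using pi_gt3 by simp
    then show "1 \<le> pi\<^sup>2" by (rule one_le_power)
  qed (use N(1) in simp)
  also have "\<dots> = neumann_mu N - neumann_mu (N - 1)"
    using N(1) by (simp add: neumann_mu_def of_nat_diff power2_eq_square algebra_simps)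
  finally show "K * (1 + sqrt (real N)) \<le> neumann_mu N - neumann_mu (N - 1)" .
qed

interpretation neumann: diagonal_operator cosv neumann_mu dom_A A_op
proof
  show "0 \<le> neumann_mu n" for n by (simp add: neumann_mu_def)
  show "mono neumann_mu"
    by (rule monoI) (simp add: neumann_mu_def power_mono mult_right_mono)
qed (fact neumann_gap dom_A_iff dom_A_coef)+

lemma sobolev_1_I: "u \<in> dom_A \<Longrightarrow> u \<in> sobolev 1"
  using sobolev_2_iff unfolding sobolev_1_iff dom_A_def by blast

text \<open>Green's formula, by comparing coefficients.\<close>

lemma cinner_weak_deriv_dom_A:
  assumes u: "u \<in> dom_A" and v: "v \<in> sobolev 1"
  shows "cinner (weak_deriv u) (weak_deriv v) = cinner (A_op u) v"
proof -
  have wu: "has_weak_derivative u (weak_deriv u)" and wv: "has_weak_derivative v (weak_deriv v)"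
    using has_weak_derivative_weak_deriv sobolev_1_I[OF u] v by auto
  have "cinner ((- complex_of_real (real n * pi) * cos_coef n u) *\<^sub>C sinv n) (weak_deriv v) =
      cinner (cos_coef n (A_op u) *\<^sub>C cosv n) v" for n
  proof -
    have "cinner (sinv n) (weak_deriv v) = cnj (- complex_of_real (real n * pi) * cos_coef n v)"
      unfolding has_weak_derivative_coef[OF wv, symmetric] by (rule cinner_commute)
    moreover have "cinner (cosv n) v = cnj (cos_coef n v)"
      unfolding cosb.coef_def by (rule cinner_commute)
    ultimately show ?thesis
      by (simp only: cinner_scaleC_left dom_A_coef[OF u]) (simp add: neumann_mu_def power2_eq_square mult_ac)
  qed
  moreover have "(\<lambda>n. cinner ((- complex_of_real (real n * pi) * cos_coef n u) *\<^sub>C sinv n) (weak_deriv v)) sums cinner (weak_deriv u) (weak_deriv v)"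
    by (rule bounded_linear.sums[OF bounded_linear_cinner_left weak_derivative_sums[OF wu]])
  moreover have "(\<lambda>n. cinner (cos_coef n (A_op u) *\<^sub>C cosv n) v) sums cinner (A_op u) v"
    by (rule bounded_linear.sums[OF bounded_linear_cinner_left cosb.sums_basis])
  ultimately show ?thesis
    using sums_unique2 by simp
qed

lemma norm_weak_deriv_dom_A:
  assumes "u \<in> dom_A"
  shows "(norm (weak_deriv u))\<^sup>2 \<le> norm (A_op u) * norm u"
proof -
  have "complex_of_real ((norm (weak_deriv u))\<^sup>2) = cinner (A_op u) u"
    unfolding cinner_self[symmetric] by (rule cinner_weak_deriv_dom_A[OF assms sobolev_1_I[OF assms]])
  then have "(norm (weak_deriv u))\<^sup>2 = cmod (cinner (A_op u) u)"
    by (metis norm_of_real abs_of_nonneg zero_le_power2)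
  then show ?thesis
    using cinner_Cauchy_Schwarz[of "A_op u" u] by simp
qed

lemma sobolev_norm_2_le:
  assumes "u \<in> dom_A"
  shows "sobolev_norm 2 u \<le> norm u + norm (A_op u)"
proof -
  have "sobolev_norm 2 u = sqrt ((norm u)\<^sup>2 + (norm (weak_deriv u))\<^sup>2 + (norm (A_op u))\<^sup>2)"
    by (simp add: sobolev_norm_def A_op_def numeral_2_eq_2)
  also have "\<dots> \<le> norm u + norm (A_op u)"
  proof (rule real_le_lsqrt)
    show "(norm u)\<^sup>2 + (norm (weak_deriv u))\<^sup>2 + (norm (A_op u))\<^sup>2 \<le> (norm u + norm (A_op u))\<^sup>2"
      using norm_weak_deriv_dom_A[OF assms] mult_nonneg_nonneg[OF norm_ge_zero norm_ge_zero, of "A_op u" u]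
      unfolding power2_sum by (simp only: mult.commute[of "norm u"] mult.assoc)
  qed simp
  finally show ?thesis .
qed

section \<open>Multiplications and translations\<close>

lemma cr_L2_fun_eq: "cr_L2 f u \<Longrightarrow> cr_L2 f v \<Longrightarrow> u = v"
  by (simp add: cr_L2_iff)

lemma cr_L2_norm_le:
  assumes u: "cr_L2 f (u :: 'r::region L2)" and v: "cr_L2 g (v :: 'r L2)"
    and le: "AE x in region_measure TYPE('r). cmod (f x) \<le> K * cmod (g x)" and "0 \<le> K"
  shows "norm u \<le> K * norm v"
proof -
  have "(norm u)\<^sup>2 \<le> (\<integral>x. K\<^sup>2 * (cmod (g x))\<^sup>2 \<partial>region_measure TYPE('r))"
    unfolding cr_L2_norm[OF u]
  proof (rule integral_mono_AE)
    show "AE x in region_measure TYPE('r). (cmod (f x))\<^sup>2 \<le> K\<^sup>2 * (cmod (g x))\<^sup>2"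
      using le by eventually_elim (auto simp: power_mult_distrib[symmetric] intro!: power_mono)
  qed (use square_integrableD(2)[OF cr_L2_square_integrable[OF u]] square_integrableD(2)[OF cr_L2_square_integrable[OF v]] in auto)
  also have "\<dots> = (K * norm v)\<^sup>2"
    unfolding power_mult_distrib cr_L2_norm[OF v] by simp
  finally show ?thesis
    by (rule power2_le_imp_le) (use \<open>0 \<le> K\<close> in simp)
qed

lemma cr_L2_relD: "cr_L2 f (u :: 'r::region L2) \<Longrightarrow> L2_rel TYPE('r) f f \<and> u = abs_L2 f"
  by (auto simp: cr_L2_def)

lemma cr_L2_mult_op:
  fixes V :: "'r::region Linf"
  obtains v K where "\<And>f u. cr_L2 f u \<Longrightarrow> cr_L2 (\<lambda>x. v x * f x) (mult_op V u)"
    "AE x in region_measure TYPE('r). cmod (v x) \<le> K" "0 \<le> K"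
proof -
  let ?v = "rep_Linf V"
  have V: "Linf_rel TYPE('r) ?v ?v" "abs_Linf ?v = V"
    using Quotient_Linf[where 'r = 'r] unfolding Quotient_def by blast+
  have eb: "essentially_bounded TYPE('r) ?v"
    using V(1) by (simp add: Linf_rel_def)
  then obtain K where K: "AE x in region_measure TYPE('r). cmod (?v x) \<le> K"
    by (auto simp: essentially_bounded_def)
  have "cr_L2 (\<lambda>x. ?v x * f x) (mult_op V u)" if "cr_L2 f u" for f u
    using mult_op.abs_eq[OF V(1), of f] V(2) cr_L2_relD[OF that]
      square_integrable_mult_bounded[OF eb cr_L2_square_integrable[OF that]] by (simp add: cr_L2_iff)
  moreover have "AE x in region_measure TYPE('r). cmod (?v x) \<le> max K 0"
    using K by eventually_elim simp
  moreover have "0 \<le> max K 0" by (rule max.cobounded2)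
  ultimately show thesis by (rule that)
qed

lemma mult_op_bounded:
  obtains K where "0 \<le> K" "\<And>u. norm (mult_op (V :: 'r::region Linf) u) \<le> K * norm u"
    "\<And>u w. mult_op V (u + w) = mult_op V u + mult_op V w" "\<And>c u. mult_op V (c *\<^sub>C u) = c *\<^sub>C mult_op V u"
proof (rule cr_L2_mult_op[of V])
  fix v K
  assume cr: "\<And>f u. cr_L2 f u \<Longrightarrow> cr_L2 (\<lambda>x. v x * f x) (mult_op V u)"
    and K: "AE x in region_measure TYPE('r). cmod (v x) \<le> K" "0 \<le> K"
  show thesis
  proof (rule that[OF K(2)])
    fix u w :: "'r L2" and c :: complex
    note u = cr_L2_rep[of u] and w = cr_L2_rep[of w]
    show "norm (mult_op V u) \<le> K * norm u"
      by (rule cr_L2_norm_le[OF cr[OF u] u _ K(2)])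
        (use K(1) in eventually_elim, simp add: norm_mult mult_right_mono)
    show "mult_op V (u + w) = mult_op V u + mult_op V w"
      using cr[OF cr_L2_add[OF u w]] cr_L2_add[OF cr[OF u] cr[OF w]]
      by (intro cr_L2_fun_eq[of "\<lambda>x. v x * (rep_L2 u x + rep_L2 w x)"]) (simp_all add: distrib_left)
    show "mult_op V (c *\<^sub>C u) = c *\<^sub>C mult_op V u"
      using cr[OF cr_L2_scaleC[OF u]] cr_L2_scaleC[OF cr[OF u]]
      by (intro cr_L2_fun_eq[of "\<lambda>x. v x * (c * rep_L2 u x)"]) (simp_all add: mult.left_commute)
  qed
qed

definition shift :: "real \<Rightarrow> unit_interval L2 \<Rightarrow> unit_interval L2" where
  "shift a u = restriction (translation a (continuation u))"

lemma cr_L2_continuation: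
  "cr_L2 f u \<Longrightarrow> cr_L2 (\<lambda>x. if x \<in> {0<..<1} then f x else 0) (continuation u)"
  using continuation.abs_eq[of f] continuation.rsp[THEN rel_funD, of f f] by (auto simp: cr_L2_def)

lemma cr_L2_restriction: "cr_L2 f u \<Longrightarrow> cr_L2 f (restriction u)"
  using restriction.abs_eq[of f] restriction.rsp[THEN rel_funD, of f f] by (auto simp: cr_L2_def)

lemma cr_L2_translation: "cr_L2 f u \<Longrightarrow> cr_L2 (\<lambda>x. f (x + a)) (translation a u)"
  using translation.abs_eq[of f a] translation.rsp[THEN rel_funD, THEN rel_funD, of a a f f] by (auto simp: cr_L2_def)

lemma cr_L2_shift: "cr_L2 f u \<Longrightarrow> cr_L2 (\<lambda>x. if x + a \<in> {0<..<1} then f (x + a) else 0) (shift a u)"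
  unfolding shift_def by (rule cr_L2_restriction[OF cr_L2_translation[OF cr_L2_continuation]])

lemma region_real [simp]: "lebesgue_on (region TYPE(real)) = lebesgue"
  by (simp add: region_real_def lebesgue_on_UNIV_eq)

lemma norm_continuation: "norm (continuation u) = norm u"
proof -
  note u = cr_L2_rep[of u]
  have "(norm (continuation u))\<^sup>2 = (\<integral>x. (cmod (if x \<in> {0<..<1} then rep_L2 u x else 0))\<^sup>2 \<partial>lebesgue)"
    using cr_L2_norm[OF cr_L2_continuation[OF u]] by simp
  also have "\<dots> = (\<integral>x. indicator {0<..<1} x *\<^sub>R (cmod (rep_L2 u x))\<^sup>2 \<partial>lebesgue)"
    by (intro Bochner_Integration.integral_cong) (auto simp: indicator_def)
  also have "\<dots> = (norm u)\<^sup>2"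
    unfolding cr_L2_unit_norm[OF u] by (rule integral_restrict_space[symmetric]) simp
  finally show ?thesis by (simp add: power2_eq_iff_nonneg)
qed

lemma norm_translation: "norm (translation a u) = norm u"
proof -
  note u = cr_L2_rep[of u]
  have meas: "(\<lambda>x. (cmod (rep_L2 u x))\<^sup>2) \<in> borel_measurable lebesgue"
    using square_integrableD(2)[OF cr_L2_square_integrable[OF u]] by (auto dest: borel_measurable_integrable)
  have "(norm (translation a u))\<^sup>2 = (\<integral>x. (cmod (rep_L2 u (x + a)))\<^sup>2 \<partial>lebesgue)"
    using cr_L2_norm[OF cr_L2_translation[OF u]] by simp
  also have "\<dots> = (\<integral>x. (cmod (rep_L2 u x))\<^sup>2 \<partial>distr lebesgue lebesgue (\<lambda>x. x + a))"
    by (rule integral_distr[symmetric, OF measurable_translate meas])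
  also have "\<dots> = (norm u)\<^sup>2"
    unfolding distr_translate using cr_L2_norm[OF u] by simp
  finally show ?thesis by (simp add: power2_eq_iff_nonneg)
qed

lemma norm_restriction_le: "norm (restriction u) \<le> norm u"
proof -
  note u = cr_L2_rep[of u]
  have int: "integrable lebesgue (\<lambda>x. (cmod (rep_L2 u x))\<^sup>2)"
    using square_integrableD(2)[OF cr_L2_square_integrable[OF u]] by simp
  have "(norm (restriction u))\<^sup>2 = (\<integral>x. (cmod (rep_L2 u x))\<^sup>2 \<partial>lebesgue_on {0<..<1})"
    by (rule cr_L2_unit_norm[OF cr_L2_restriction[OF u]])
  also have "\<dots> = (\<integral>x. indicator {0<..<1} x *\<^sub>R (cmod (rep_L2 u x))\<^sup>2 \<partial>lebesgue)"
    by (rule integral_restrict_space) simp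
  also have "\<dots> \<le> (\<integral>x. (cmod (rep_L2 u x))\<^sup>2 \<partial>lebesgue)"
  proof (rule integral_mono)
    show "integrable lebesgue (\<lambda>x. indicator {0<..<1} x *\<^sub>R (cmod (rep_L2 u x))\<^sup>2)"
      by (rule integrable_mult_indicator[OF _ int]) simp
  qed (use int in \<open>auto simp: indicator_def\<close>)
  also have "\<dots> = (norm u)\<^sup>2"
    using cr_L2_norm[OF u] by simp
  finally show ?thesis by (rule power2_le_imp_le) simp
qed

lemma norm_shift_le: "norm (shift a u) \<le> norm u"
  using norm_restriction_le[of "translation a (continuation u)"]
  by (simp add: shift_def norm_translation norm_continuation)

lemma shift_add: "shift a (u + v) = shift a u + shift a v"
proof (rule cr_L2_fun_eq)
  note u = cr_L2_rep[of u] and v = cr_L2_rep[of v]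
  show "cr_L2 (\<lambda>x. if x + a \<in> {0<..<1} then rep_L2 u (x + a) + rep_L2 v (x + a) else 0) (shift a (u + v))"
    by (rule cr_L2_shift[OF cr_L2_add[OF u v]])
  have "(\<lambda>x. if x + a \<in> {0<..<1} then rep_L2 u (x + a) + rep_L2 v (x + a) else 0) =
      (\<lambda>x. (if x + a \<in> {0<..<1} then rep_L2 u (x + a) else 0) + (if x + a \<in> {0<..<1} then rep_L2 v (x + a) else 0))"
    by auto
  then show "cr_L2 (\<lambda>x. if x + a \<in> {0<..<1} then rep_L2 u (x + a) + rep_L2 v (x + a) else 0) (shift a u + shift a v)"
    using cr_L2_add[OF cr_L2_shift[OF u] cr_L2_shift[OF v]] by (simp only:)
qed

lemma shift_scaleC: "shift a (c *\<^sub>C u) = c *\<^sub>C shift a u"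
proof (rule cr_L2_fun_eq)
  note u = cr_L2_rep[of u]
  show "cr_L2 (\<lambda>x. if x + a \<in> {0<..<1} then c * rep_L2 u (x + a) else 0) (shift a (c *\<^sub>C u))"
    by (rule cr_L2_shift[OF cr_L2_scaleC[OF u]])
  have "(\<lambda>x. if x + a \<in> {0<..<1} then c * rep_L2 u (x + a) else 0) =
      (\<lambda>x. c * (if x + a \<in> {0<..<1} then rep_L2 u (x + a) else 0))"
    by auto
  then show "cr_L2 (\<lambda>x. if x + a \<in> {0<..<1} then c * rep_L2 u (x + a) else 0) (c *\<^sub>C shift a u)"
    using cr_L2_scaleC[OF cr_L2_shift[OF u]] by (simp only:)
qed

lemma integral_indicator_Icc_le:
  fixes a b :: real
  shows "integrable (lebesgue_on {0<..<1}) (\<lambda>x. indicator {a..b} x :: real)"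
  "(\<integral>x. indicator {a..b} x \<partial>lebesgue_on {0<..<1}) \<le> max 0 (b - a)"
proof -
  interpret finite_measure "lebesgue_on {0<..<1::real}" by (rule finite_measure_unit_interval)
  have "(\<lambda>x. indicator {a..b} x :: real) \<in> borel_measurable (lebesgue_on {0<..<1})"
    by (intro measurable_restrict_space1 measurable_completion borel_measurable_indicator) simp
  then show "integrable (lebesgue_on {0<..<1}) (\<lambda>x. indicator {a..b} x :: real)"
    by (rule integrable_const_bound[of _ 1, rotated]) (simp add: indicator_def)
  have "(\<integral>x. indicator {a..b} x \<partial>lebesgue_on {0<..<1}) = measure (lebesgue_on {0<..<1}) ({a..b} \<inter> {0<..<1})"
    by simp
  also have "\<dots> = measure lebesgue ({a..b} \<inter> {0<..<1})"
    by (rule measure_restrict_space) auto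
  also have "\<dots> \<le> measure lebesgue {a..b}"
    by (rule measure_mono_fmeasurable) auto
  also have "\<dots> \<le> max 0 (b - a)" by (cases "a \<le> b") auto
  finally show "(\<integral>x. indicator {a..b} x \<partial>lebesgue_on {0<..<1}) \<le> max 0 (b - a)" .
qed

text \<open>
  Where both translates of the interval overlap, the Hoelder estimate of exponent 1/2 applies; the
  remaining set has measure at most \<open>2 * \<bar>a - b\<bar>\<close>, and there the supremum bound suffices.
\<close>

lemma shift_difference:
  assumes "has_weak_derivative u w"
  shows "norm (shift a u - shift b u) \<le> 3 * sqrt \<bar>a - b\<bar> * (norm u + norm w)"
proof -
  interpret finite_measure "lebesgue_on {0<..<1::real}" by (rule finite_measure_unit_interval)
  obtain c where c: "cr_L2 (\<lambda>x. c + prim w x) u"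
    using assms unfolding has_weak_derivative_iff by blast
  define U where "U x = c + prim w x" for x
  have U: "cr_L2 U u" unfolding U_def[abs_def] by (rule c)
  define E where "E = (norm u)\<^sup>2 + (norm w)\<^sup>2"
  have "0 \<le> E" by (simp add: E_def)
  have Hoelder: "(cmod (U x - U y))\<^sup>2 \<le> E * \<bar>x - y\<bar>" for x y
  proof -
    have "(cmod (U x - U y))\<^sup>2 \<le> (norm w * sqrt \<bar>x - y\<bar>)\<^sup>2"
      using prim_Hoelder[of w x y] by (intro power_mono) (simp_all add: U_def)
    also have "\<dots> = (norm w)\<^sup>2 * \<bar>x - y\<bar>" by (simp add: power_mult_distrib)
    also have "\<dots> \<le> E * \<bar>x - y\<bar>" by (intro mult_right_mono) (simp_all add: E_def)
    finally show ?thesis .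
  qed
  have bound: "(cmod (U x))\<^sup>2 \<le> 2 * E" if x: "x \<in> {0<..<1}" for x
  proof -
    have intU: "integrable (lebesgue_on {0<..<1}) (\<lambda>y. (cmod (U y))\<^sup>2)"
      using square_integrableD(2)[OF cr_L2_square_integrable[OF U]] by simp
    have "(cmod (U x))\<^sup>2 = (\<integral>y. (cmod (U x))\<^sup>2 \<partial>lebesgue_on {0<..<1::real})"
      by (simp add: measure_restrict_space)
    also have "\<dots> \<le> (\<integral>y. 2 * (cmod (U y))\<^sup>2 + 2 * (norm w)\<^sup>2 \<partial>lebesgue_on {0<..<1})"
    proof (rule integral_mono)
      show "integrable (lebesgue_on {0<..<1}) (\<lambda>y. 2 * (cmod (U y))\<^sup>2 + 2 * (norm w)\<^sup>2)"
        using intU by simp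
      fix y :: real assume "y \<in> space (lebesgue_on {0<..<1})"
      then have y: "y \<in> {0<..<1}" by (simp add: space_restrict_space)
      have "cmod (U x - U y) \<le> norm w * sqrt \<bar>x - y\<bar>"
        using prim_Hoelder[of w x y] by (simp add: U_def)
      also have "\<dots> \<le> norm w * 1"
        using x y by (intro mult_left_mono) auto
      finally have "cmod (U x) \<le> cmod (U y) + norm w"
        using norm_triangle_sub[of "U x" "U y"] by simp
      then have "(cmod (U x))\<^sup>2 \<le> (cmod (U y) + norm w)\<^sup>2"
        by (intro power_mono) auto
      also have "\<dots> \<le> 2 * (cmod (U y))\<^sup>2 + 2 * (norm w)\<^sup>2"
        using sum_squares_bound[of "cmod (U y)" "norm w"] by (simp add: power2_sum)
      finally show "(cmod (U x))\<^sup>2 \<le> 2 * (cmod (U y))\<^sup>2 + 2 * (norm w)\<^sup>2" .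
    qed simp
    also have "\<dots> = 2 * (norm u)\<^sup>2 + 2 * (norm w)\<^sup>2"
      using intU by (simp add: cr_L2_unit_norm[OF U] measure_restrict_space)
    finally show ?thesis by (simp add: E_def)
  qed
  let ?S = "\<lambda>a x. if x + a \<in> {0<..<1} then U (x + a) else 0"
  let ?J = "{min (- a) (- b)..max (- a) (- b)}" and ?J' = "{min (1 - a) (1 - b)..max (1 - a) (1 - b)}"
  have J: "max 0 (max (- a) (- b) - min (- a) (- b)) = \<bar>a - b\<bar>" "max 0 (max (1 - a) (1 - b) - min (1 - a) (1 - b)) = \<bar>a - b\<bar>"
    by (auto simp: max_def min_def)
  have pw: "(cmod (?S a x - ?S b x))\<^sup>2 \<le> E * \<bar>a - b\<bar> + 2 * E * indicator ?J x + 2 * E * indicator ?J' x" for x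
  proof -
    have pos: "0 \<le> E * \<bar>a - b\<bar>" "0 \<le> 2 * E * indicator ?J x" "0 \<le> 2 * E * indicator ?J' x"
      using \<open>0 \<le> E\<close> by simp_all
    consider "x + a \<in> {0<..<1}" "x + b \<in> {0<..<1}" | "x + a \<in> {0<..<1}" "x + b \<notin> {0<..<1}"
      | "x + a \<notin> {0<..<1}" "x + b \<in> {0<..<1}" | "x + a \<notin> {0<..<1}" "x + b \<notin> {0<..<1}"
      by blast
    then show ?thesis
    proof cases
      case 1
      then show ?thesis using Hoelder[of "x + a" "x + b"] pos by simp
    next
      case 2
      then have "x \<in> ?J \<or> x \<in> ?J'" by (auto simp: max_def min_def)
      then have "2 * E \<le> 2 * E * indicator ?J x + 2 * E * indicator ?J' x"
        using \<open>0 \<le> E\<close> by (auto simp: indicator_def)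
      then show ?thesis
        unfolding if_P[OF 2(1)] if_not_P[OF 2(2)] using bound[OF 2(1)] pos(1) by simp
    next
      case 3
      then have "x \<in> ?J \<or> x \<in> ?J'" by (auto simp: max_def min_def)
      then have "2 * E \<le> 2 * E * indicator ?J x + 2 * E * indicator ?J' x"
        using \<open>0 \<le> E\<close> by (auto simp: indicator_def)
      then show ?thesis
        unfolding if_not_P[OF 3(1)] if_P[OF 3(2)] using bound[OF 3(2)] pos(1) by simp
    next
      case 4
      have "(cmod (?S a x - ?S b x))\<^sup>2 = 0"
        unfolding if_not_P[OF 4(1)] if_not_P[OF 4(2)] by simp
      then show ?thesis using pos by linarith
    qed
  qed
  note intJ = integral_indicator_Icc_le(1)
  have sq: "cr_L2 (\<lambda>x. ?S a x - ?S b x) (shift a u - shift b u)"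
    by (rule cr_L2_diff[OF cr_L2_shift[OF U] cr_L2_shift[OF U]])
  have "(norm (shift a u - shift b u))\<^sup>2 = (\<integral>x. (cmod (?S a x - ?S b x))\<^sup>2 \<partial>lebesgue_on {0<..<1})"
    by (rule cr_L2_unit_norm[OF sq])
  also have "\<dots> \<le> (\<integral>x. E * \<bar>a - b\<bar> + 2 * E * indicator ?J x + 2 * E * indicator ?J' x \<partial>lebesgue_on {0<..<1})"
  proof (rule integral_mono)
    show "integrable (lebesgue_on {0<..<1}) (\<lambda>x. (cmod (?S a x - ?S b x))\<^sup>2)"
      using square_integrableD(2)[OF cr_L2_square_integrable[OF sq]] unfolding region_unit_interval .
    show "integrable (lebesgue_on {0<..<1}) (\<lambda>x. E * \<bar>a - b\<bar> + 2 * E * indicator ?J x + 2 * E * indicator ?J' x)"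
      by (intro Bochner_Integration.integrable_add integrable_mult_right intJ integrable_const)
  qed (rule pw)
  also have "\<dots> = E * \<bar>a - b\<bar> + 2 * E * (\<integral>x. indicator ?J x \<partial>lebesgue_on {0<..<1}) + 2 * E * (\<integral>x. indicator ?J' x \<partial>lebesgue_on {0<..<1})"
    by (simp only: Bochner_Integration.integral_add Bochner_Integration.integrable_add integrable_mult_right intJ
        integrable_const integral_mult_right_zero lebesgue_integral_const) (simp add: measure_restrict_space)
  also have "\<dots> \<le> E * \<bar>a - b\<bar> + 2 * E * \<bar>a - b\<bar> + 2 * E * \<bar>a - b\<bar>"
    using integral_indicator_Icc_le(2)[of "min (- a) (- b)" "max (- a) (- b)"]
      integral_indicator_Icc_le(2)[of "min (1 - a) (1 - b)" "max (1 - a) (1 - b)"] \<open>0 \<le> E\<close>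
    unfolding J by (intro add_mono mult_left_mono) auto
  also have "\<dots> = 5 * (\<bar>a - b\<bar> * E)" by simp
  also have "\<dots> \<le> 9 * (\<bar>a - b\<bar> * E)" using \<open>0 \<le> E\<close> by (intro mult_right_mono) simp_all
  also have "\<dots> \<le> 9 * (\<bar>a - b\<bar> * (norm u + norm w)\<^sup>2)"
    by (intro mult_left_mono) (simp_all add: E_def power2_sum)
  also have "\<dots> = (3 * sqrt \<bar>a - b\<bar> * (norm u + norm w))\<^sup>2"
    by (simp add: power_mult_distrib)
  finally show ?thesis
    by (rule power2_le_imp_le) simp
qed

section \<open>The operator with translations\<close>

lemma B_op_shift: "B_op V Q \<alpha> \<beta> u = mult_op V (shift \<alpha> u) + mult_op Q (shift (- \<beta>) u)"
  by (simp add: B_op_def shift_def)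

lemma h_form_B_op: "h_form V Q \<alpha> \<beta> u v = cinner (weak_deriv u) (weak_deriv v) + cinner (B_op V Q \<alpha> \<beta> u) v"
  by (simp add: h_form_def B_op_def cinner_add_left)

lemma H_op_eq: "H_op V Q \<alpha> \<beta> = (\<lambda>u. A_op u + B_op V Q \<alpha> \<beta> u)"
  by (simp add: H_op_def fun_eq_iff)

lemma B_op_properties:
  obtains M where "\<And>\<alpha> \<beta>. perturbed_diagonal cosv neumann_mu dom_A A_op (B_op V Q \<alpha> \<beta>) M"
    "\<And>\<alpha> \<beta> \<alpha>' \<beta>' u w. has_weak_derivative u w \<Longrightarrow> norm (B_op V Q \<alpha> \<beta> u - B_op V Q \<alpha>' \<beta>' u)
      \<le> 3 * M * (sqrt \<bar>\<alpha> - \<alpha>'\<bar> + sqrt \<bar>\<beta> - \<beta>'\<bar>) * (norm u + norm w)"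
proof -
  obtain K where K: "0 \<le> K" "\<And>u. norm (mult_op V u) \<le> K * norm u"
    "\<And>u w. mult_op V (u + w) = mult_op V u + mult_op V w" "\<And>c u. mult_op V (c *\<^sub>C u) = c *\<^sub>C mult_op V u"
    by (rule mult_op_bounded[of V]) (rule that)
  obtain L where L: "0 \<le> L" "\<And>u. norm (mult_op Q u) \<le> L * norm u"
    "\<And>u w. mult_op Q (u + w) = mult_op Q u + mult_op Q w" "\<And>c u. mult_op Q (c *\<^sub>C u) = c *\<^sub>C mult_op Q u"
    by (rule mult_op_bounded[of Q]) (rule that)
  have diff: "mult_op V u - mult_op V w = mult_op V (u - w)" "mult_op Q u - mult_op Q w = mult_op Q (u - w)" for u w
    using K(3)[of "u - w" w] L(3)[of "u - w" w] by simp_all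
  show thesis
  proof (rule that[of "K + L"])
    show "perturbed_diagonal cosv neumann_mu dom_A A_op (B_op V Q \<alpha> \<beta>) (K + L)" for \<alpha> \<beta>
    proof
      show "B_op V Q \<alpha> \<beta> (u + v) = B_op V Q \<alpha> \<beta> u + B_op V Q \<alpha> \<beta> v" for u v
        by (simp add: B_op_shift shift_add K(3) L(3))
      show "B_op V Q \<alpha> \<beta> (c *\<^sub>C u) = c *\<^sub>C B_op V Q \<alpha> \<beta> u" for c u
        by (simp add: B_op_shift shift_scaleC K(4) L(4) scaleC_add_right)
      show "norm (B_op V Q \<alpha> \<beta> u) \<le> (K + L) * norm u" for u
      proof -
        have "norm (mult_op V (shift \<alpha> u)) \<le> K * norm u" "norm (mult_op Q (shift (- \<beta>) u)) \<le> L * norm u"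
          by (rule order_trans[OF K(2) mult_left_mono[OF norm_shift_le K(1)]],
              rule order_trans[OF L(2) mult_left_mono[OF norm_shift_le L(1)]])
        then show ?thesis
          unfolding B_op_shift distrib_right by (intro norm_triangle_le add_mono)
      qed
    qed
    fix \<alpha> \<beta> \<alpha>' \<beta>' and u w :: "unit_interval L2" assume uw: "has_weak_derivative u w"
    let ?n = "norm u + norm w"
    have "B_op V Q \<alpha> \<beta> u - B_op V Q \<alpha>' \<beta>' u =
        mult_op V (shift \<alpha> u - shift \<alpha>' u) + mult_op Q (shift (- \<beta>) u - shift (- \<beta>') u)"
      unfolding B_op_shift diff[symmetric] by simp
    also have "norm \<dots> \<le> K * (3 * sqrt \<bar>\<alpha> - \<alpha>'\<bar> * ?n) + L * (3 * sqrt \<bar>- \<beta> - - \<beta>'\<bar> * ?n)"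
      by (intro norm_triangle_le add_mono order_trans[OF K(2)] order_trans[OF L(2)] mult_left_mono
          shift_difference[OF uw] K(1) L(1))
    also have "- \<beta> - - \<beta>' = - (\<beta> - \<beta>')"
      by simp
    also have "\<bar>- (\<beta> - \<beta>')\<bar> = \<bar>\<beta> - \<beta>'\<bar>"
      by (rule abs_minus_cancel)
    also have "K * (3 * sqrt \<bar>\<alpha> - \<alpha>'\<bar> * ?n) + L * (3 * sqrt \<bar>\<beta> - \<beta>'\<bar> * ?n)
        \<le> (K + L) * (3 * sqrt \<bar>\<alpha> - \<alpha>'\<bar> * ?n) + (K + L) * (3 * sqrt \<bar>\<beta> - \<beta>'\<bar> * ?n)"
      using K(1) L(1) by (intro add_mono mult_right_mono) simp_all
    also have "\<dots> = 3 * (K + L) * (sqrt \<bar>\<alpha> - \<alpha>'\<bar> + sqrt \<bar>\<beta> - \<beta>'\<bar>) * ?n"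
      by (simp add: algebra_simps)
    finally show "norm (B_op V Q \<alpha> \<beta> u - B_op V Q \<alpha>' \<beta>' u) \<le> 3 * (K + L) * (sqrt \<bar>\<alpha> - \<alpha>'\<bar> + sqrt \<bar>\<beta> - \<beta>'\<bar>) * ?n" .
  qed
qed

section \<open>The sesquilinear form\<close>

lemma sobolev_1_dense: "closure (sobolev 1 :: unit_interval L2 set) = UNIV"
proof -
  have "u \<in> closure (sobolev 1)" for u :: "unit_interval L2"
    unfolding closure_sequential
  proof (intro exI conjI allI)
    show "(\<lambda>k. \<Sum>n<k. cos_coef n u *\<^sub>C cosv n) \<longlonglongrightarrow> u"
      using cosb.sums_basis[of u] unfolding sums_def .
    show "(\<Sum>n<k. cos_coef n u *\<^sub>C cosv n) \<in> sobolev 1" for k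
      by (intro complex_vector.subspace_sum complex_vector.subspace_scale subspace_sobolev_1 sobolev_1_I
          neumann.basis_in_domain)
  qed
  then show ?thesis by blast
qed

lemma weak_deriv_linear:
  assumes "u \<in> sobolev 1" "v \<in> sobolev 1"
  shows "weak_deriv (u + v) = weak_deriv u + weak_deriv (v :: unit_interval L2)"
    and "weak_deriv (c *\<^sub>C u) = c *\<^sub>C weak_deriv u"
    and "weak_deriv (u - v) = weak_deriv u - weak_deriv v"
proof -
  note u = has_weak_derivative_weak_deriv[OF assms(1)] and v = has_weak_derivative_weak_deriv[OF assms(2)]
  show "weak_deriv (u + v) = weak_deriv u + weak_deriv v"
    by (rule weak_deriv_eq[OF has_weak_derivative_add[OF u v]])
  show "weak_deriv (c *\<^sub>C u) = c *\<^sub>C weak_deriv u"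
    by (rule weak_deriv_eq[OF has_weak_derivative_scaleC[OF u]])
  show "weak_deriv (u - v) = weak_deriv u - weak_deriv v"
    using weak_deriv_eq[OF has_weak_derivative_add[OF u has_weak_derivative_scaleC[OF v, of "- 1"]]] by simp
qed

context
  fixes B :: "unit_interval L2 \<Rightarrow> unit_interval L2" and M :: real
  assumes pert: "perturbed_diagonal cosv neumann_mu dom_A A_op B M"
begin

interpretation perturbed_diagonal cosv neumann_mu dom_A A_op B M
  by (rule pert)

abbreviation form :: "unit_interval L2 \<Rightarrow> unit_interval L2 \<Rightarrow> complex" where
  "form u v \<equiv> cinner (weak_deriv u) (weak_deriv v) + cinner (B u) v"

lemma sectorial_form_sobolev_1: "sectorial_form (sobolev 1) form"
  unfolding sectorial_form_def
proof
  show "sesquilinear_form (sobolev 1) form"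
    unfolding sesquilinear_form_def
    by (intro conjI ballI allI subspace_sobolev_1)
      (simp_all add: weak_deriv_linear cinner_add_left cinner_add_right cinner_scaleC_left cinner_scaleC_right
        B_add B_scaleC algebra_simps)
  have "form u u \<in> sector (- 2 * M - 1) (pi / 4)" if "norm u = 1" for u
    unfolding cinner_self[of "weak_deriv u"]
  proof (rule nonneg_plus_bounded_in_sector)
    show "cmod (cinner (B u) u) \<le> M"
      using cinner_Cauchy_Schwarz[of "B u" u] B_bound[of u] that by simp
  qed simp
  then show "\<exists>\<gamma> \<theta>. 0 \<le> \<theta> \<and> \<theta> < pi / 2 \<and> (\<forall>u\<in>sobolev 1. norm u = 1 \<longrightarrow> form u u \<in> sector \<gamma> \<theta>)"
    using pi_gt_zero by (intro exI[of _ "- 2 * M - 1"] exI[of _ "pi / 4"]) auto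
qed

lemma norm_weak_deriv_le_form: "(norm (weak_deriv u))\<^sup>2 \<le> cmod (form u u) + M * (norm u)\<^sup>2"
proof -
  have "complex_of_real ((norm (weak_deriv u))\<^sup>2) = form u u - cinner (B u) u"
    by (simp add: cinner_self)
  then have "(norm (weak_deriv u))\<^sup>2 = cmod (form u u - cinner (B u) u)"
    by (metis norm_of_real abs_of_nonneg zero_le_power2)
  also have "\<dots> \<le> cmod (form u u) + cmod (cinner (B u) u)"
    by (rule norm_triangle_ineq4)
  also have "cmod (cinner (B u) u) \<le> norm (B u) * norm u"
    by (rule cinner_Cauchy_Schwarz)
  also have "norm (B u) * norm u \<le> M * norm u * norm u"
    by (intro mult_right_mono B_bound) simp
  finally show ?thesis by (simp add: power2_eq_square mult.assoc)
qed

text \<open>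
  The form controls the norm of the derivative up to a multiple of the norm of the function, so a Cauchy
  sequence for the form is one for the weak derivatives too, and the weak derivative is closed.
\<close>

lemma closed_form_sobolev_1: "closed_form (sobolev 1) form"
  unfolding closed_form_def
proof (intro allI impI, elim conjE)
  fix X :: "nat \<Rightarrow> unit_interval L2" and u
  assume X: "\<forall>n. X n \<in> sobolev 1" and lim: "X \<longlonglongrightarrow> u"
    and small: "\<forall>e>0. \<exists>N. \<forall>m\<ge>N. \<forall>n\<ge>N. cmod (form (X n - X m) (X n - X m)) < e"
  have "Cauchy (\<lambda>n. weak_deriv (X n))"
  proof (rule metric_CauchyI)
    fix e :: real assume "0 < e"
    then have "0 < e\<^sup>2 / 2" by simp
    then obtain N1 where N1: "\<And>m n. N1 \<le> m \<Longrightarrow> N1 \<le> n \<Longrightarrow> cmod (form (X n - X m) (X n - X m)) < e\<^sup>2 / 2"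
      using small by blast
    define \<delta> where "\<delta> = e / (2 * sqrt (M + 1))"
    have M1: "0 < M + 1" using M_nonneg by simp
    then have "0 < \<delta>" using \<open>0 < e\<close> by (simp add: \<delta>_def)
    then obtain N2 where N2: "\<And>m n. N2 \<le> m \<Longrightarrow> N2 \<le> n \<Longrightarrow> dist (X m) (X n) < \<delta>"
      using LIMSEQ_imp_Cauchy[OF lim] unfolding Cauchy_def by blast
    have "dist (weak_deriv (X m)) (weak_deriv (X n)) < e" if mn: "max N1 N2 \<le> m" "max N1 N2 \<le> n" for m n
    proof -
      have "(norm (X m - X n))\<^sup>2 \<le> \<delta>\<^sup>2"
        using N2[of m n] mn by (intro power_mono) (simp_all add: dist_norm less_imp_le)
      also have "\<delta>\<^sup>2 = e\<^sup>2 / (4 * (M + 1))"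
        using M1 by (simp add: \<delta>_def power_divide power_mult_distrib)
      finally have "M * (norm (X m - X n))\<^sup>2 \<le> (M + 1) * (e\<^sup>2 / (4 * (M + 1)))"
        using M_nonneg by (intro mult_mono) auto
      also have "\<dots> = e\<^sup>2 / 4" using M1 by (simp add: field_simps)
      finally have "(norm (weak_deriv (X m - X n)))\<^sup>2 < e\<^sup>2 / 2 + e\<^sup>2 / 4"
        using norm_weak_deriv_le_form[of "X m - X n"] N1[of n m] mn by simp
      also have "\<dots> \<le> e\<^sup>2" by simp
      finally have "norm (weak_deriv (X m - X n)) < e"
        by (rule power_less_imp_less_base) (use \<open>0 < e\<close> in simp)
      then show ?thesis using X by (simp add: dist_norm weak_deriv_linear(3))
    qed
    then show "\<exists>N. \<forall>m\<ge>N. \<forall>n\<ge>N. dist (weak_deriv (X m)) (weak_deriv (X n)) < e" by blast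
  qed
  then obtain w where w: "(\<lambda>n. weak_deriv (X n)) \<longlonglongrightarrow> w"
    using Cauchy_convergent convergent_def by blast
  have uw: "has_weak_derivative u w"
    by (rule has_weak_derivative_tendsto[OF _ lim w]) (use X has_weak_derivative_weak_deriv in blast)
  then have uW: "u \<in> sobolev 1" unfolding sobolev_1_iff by blast
  have "(\<lambda>n. norm (weak_deriv (X n) - w) * norm (weak_deriv (X n) - w) + M * norm (X n - u) * norm (X n - u))
      \<longlonglongrightarrow> norm (w - w) * norm (w - w) + M * norm (u - u) * norm (u - u)"
    by (intro tendsto_intros w lim)
  then have bound: "(\<lambda>n. norm (weak_deriv (X n) - w) * norm (weak_deriv (X n) - w) + M * norm (X n - u) * norm (X n - u)) \<longlonglongrightarrow> 0"
    by simp
  have "(\<lambda>n. form (X n - u) (X n - u)) \<longlonglongrightarrow> 0"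
  proof (rule Lim_null_comparison[OF always_eventually bound], rule allI)
    fix n
    have wd: "weak_deriv (X n - u) = weak_deriv (X n) - w"
      using X uW weak_deriv_eq[OF uw] by (simp add: weak_deriv_linear(3))
    show "cmod (form (X n - u) (X n - u)) \<le> norm (weak_deriv (X n) - w) * norm (weak_deriv (X n) - w) + M * norm (X n - u) * norm (X n - u)"
      unfolding wd
      by (intro norm_triangle_le add_mono cinner_Cauchy_Schwarz order_trans[OF cinner_Cauchy_Schwarz] mult_right_mono B_bound) simp
  qed
  then show "u \<in> sobolev 1 \<and> (\<lambda>n. form (X n - u) (X n - u)) \<longlonglongrightarrow> 0"
    using uW by blast
qed

text \<open>
  If the form of \<open>u\<close> is represented by \<open>f\<close>, testing it with the cosines shows that \<open>f - B u\<close> has the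
  coefficients required of \<open>A u\<close>; so \<open>u\<close> has two derivatives and satisfies the boundary conditions.
\<close>

lemma associated_form_sobolev_1: "associated_form dom_A H (sobolev 1) form"
  unfolding associated_form_def
proof (intro conjI sectorial_form_sobolev_1 closed_form_sobolev_1 sobolev_1_dense)
  show green: "\<forall>u\<in>dom_A. \<forall>v\<in>sobolev 1. form u v = cinner (H u) v"
    by (simp add: cinner_weak_deriv_dom_A cinner_add_left)
  show "dom_A = {u \<in> sobolev 1. \<exists>f. \<forall>v\<in>sobolev 1. form u v = cinner f v}"
  proof (intro antisym subsetI)
    fix u assume "u \<in> dom_A"
    then show "u \<in> {u \<in> sobolev 1. \<exists>f. \<forall>v\<in>sobolev 1. form u v = cinner f v}"
      using green sobolev_1_I by blast
  next
    fix u assume "u \<in> {u \<in> sobolev 1. \<exists>f. \<forall>v\<in>sobolev 1. form u v = cinner f v}"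
    then obtain f where u: "u \<in> sobolev 1" and f: "\<And>v. v \<in> sobolev 1 \<Longrightarrow> form u v = cinner f v"
      by blast
    have "cos_coef n (f - B u) = complex_of_real (neumann_mu n) * cos_coef n u" for n
    proof -
      have "cinner (weak_deriv u) (weak_deriv (cosv n)) = complex_of_real (neumann_mu n) * cos_coef n u"
        unfolding weak_deriv_eq[OF has_weak_derivative_cosv] cinner_scaleC_right
          has_weak_derivative_coef[OF has_weak_derivative_weak_deriv[OF u]]
        by (simp add: neumann_mu_def power2_eq_square mult_ac)
      then show ?thesis
        using f[OF sobolev_1_I[OF neumann.basis_in_domain[of n]]] unfolding cosb.coef_diff
        by (simp add: cosb.coef_def algebra_simps)
    qed
    then show "u \<in> dom_A"
      unfolding neumann.domain_iff_image by blast
  qed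
qed

end

section \<open>Estimates for resolvents\<close>

lemma onorm_sobolev_le:
  assumes "\<And>f. sobolev_norm k (R f) \<le> C * norm f" "0 \<le> C"
  shows "onorm_sobolev k R \<le> C"
  unfolding onorm_sobolev_def
proof (rule cSUP_least)
  show "sobolev_norm k (R f) / norm f \<le> C" for f
    using assms(1)[of f] assms(2) by (cases "f = 0") (simp_all add: divide_le_eq)
qed simp

text \<open>
  On the dense subspace \<open>sobolev 1\<close> the dependence on the shifts is Hoelder continuous, and the operators are
  uniformly bounded.
\<close>

lemma B_op_strongly_continuous:
  "((\<lambda>q. B_op V Q (fst q) (snd q) u) \<longlongrightarrow> B_op V Q (fst p) (snd p) u) (at p within P)"
proof (rule tendstoI)
  obtain M where pert: "\<And>\<alpha> \<beta>. perturbed_diagonal cosv neumann_mu dom_A A_op (B_op V Q \<alpha> \<beta>) M"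
    and Lipschitz: "\<And>\<alpha> \<beta> \<alpha>' \<beta>' u w. has_weak_derivative u w \<Longrightarrow> norm (B_op V Q \<alpha> \<beta> u - B_op V Q \<alpha>' \<beta>' u)
      \<le> 3 * M * (sqrt \<bar>\<alpha> - \<alpha>'\<bar> + sqrt \<bar>\<beta> - \<beta>'\<bar>) * (norm u + norm w)"
    by (rule B_op_properties[of V Q]) (rule that)
  have "0 \<le> M" by (rule perturbed_diagonal.M_nonneg[OF pert])
  let ?B = "\<lambda>q. B_op V Q (fst q) (snd q)"
  fix \<epsilon> :: real assume "0 < \<epsilon>"
  then have "0 < \<epsilon> / (4 * (M + 1))" using \<open>0 \<le> M\<close> by simp
  then obtain s where s: "s \<in> sobolev 1" "dist s u < \<epsilon> / (4 * (M + 1))"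
    using sobolev_1_dense closure_approachable[of u "sobolev 1"] by blast
  obtain w where w: "has_weak_derivative s w"
    using s(1) unfolding sobolev_1_iff by blast
  have "norm (s - u) * (4 * (M + 1)) < \<epsilon>"
    using s(2) \<open>0 \<le> M\<close> by (simp add: dist_norm pos_less_divide_eq)
  moreover have "norm (s - u) * (4 * (M + 1)) = 4 * (M * norm (s - u)) + 4 * norm (s - u)"
    by (simp add: algebra_simps)
  ultimately have near: "4 * (M * norm (s - u)) \<le> \<epsilon>"
    using norm_ge_zero[of "s - u"] by linarith
  let ?L = "\<lambda>q. 3 * M * (sqrt \<bar>fst q - fst p\<bar> + sqrt \<bar>snd q - snd p\<bar>) * (norm s + norm w)"
  have "(?L \<longlongrightarrow> ?L p) (at p within P)"
    by (intro tendsto_intros)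
  then have "(?L \<longlongrightarrow> 0) (at p within P)"
    by simp
  then have "\<forall>\<^sub>F q in at p within P. ?L q < \<epsilon> / 2"
    by (rule order_tendstoD(2)) (use \<open>0 < \<epsilon>\<close> in simp)
  then show "\<forall>\<^sub>F q in at p within P. dist (?B q u) (?B p u) < \<epsilon>"
  proof eventually_elim
    case (elim q)
    have bound: "norm (?B r v) \<le> M * norm v" for r v
      by (rule perturbed_diagonal.B_bound[OF pert])
    have diff: "?B r (v - v') = ?B r v - ?B r v'" for r v v'
      by (rule perturbed_diagonal.B_diff[OF pert])
    have "?B q u - ?B p u = (?B q s - ?B p s) + ?B p (s - u) - ?B q (s - u)"
      unfolding diff by simp
    also have "norm \<dots> \<le> norm (?B q s - ?B p s) + norm (?B p (s - u)) + norm (?B q (s - u))"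
      by (rule order_trans[OF norm_triangle_ineq4 add_right_mono[OF norm_triangle_ineq]])
    also have "\<dots> \<le> ?L q + M * norm (s - u) + M * norm (s - u)"
      by (intro add_mono bound Lipschitz[OF w])
    also have "\<dots> < \<epsilon>"
      using elim near by linarith
    finally show ?case by (simp add: dist_norm)
  qed
qed

lemma resolvent_estimates:
  assumes pert: "perturbed_diagonal cosv neumann_mu dom_A A_op B M" and z: "Re z \<le> - M - 1"
  defines "R \<equiv> resolvent dom_A (\<lambda>u. A_op u + B u) z"
  shows "z \<in> resolvent_set dom_A (\<lambda>u. A_op u + B u)"
    and "R f \<in> dom_A" "norm (R f) \<le> norm f"
    and "sobolev_norm 2 (R f) \<le> (2 + cmod z + M) * norm f"
    and "norm (weak_deriv (R f)) \<le> (2 + cmod z + M) * norm f"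
proof -
  interpret perturbed_diagonal cosv neumann_mu dom_A A_op B M by (rule pert)
  have z': "Re z < - M" using z by simp
  show res: "z \<in> resolvent_set dom_A H" by (rule half_plane(1)[OF z'])
  show dom: "R f \<in> dom_A"
    unfolding R_def by (rule resolvent_in_domain[OF res])
  have f: "H (R f) - z *\<^sub>C R f = f"
    unfolding R_def by (rule resolvent_right_inverse[OF res])
  have "norm (R f) \<le> 1 / (- Re z - M) * norm f"
    using half_plane(3)[OF z' dom] unfolding f .
  also have "\<dots> \<le> 1 * norm f"
    using z by (intro mult_right_mono) (simp_all add: divide_le_eq)
  finally show le: "norm (R f) \<le> norm f" by simp
  have "norm (A_op (R f)) \<le> norm f + (cmod z + M) * norm (R f)"
    using norm_A_le[OF dom, of z] unfolding f .
  also have "(cmod z + M) * norm (R f) \<le> (cmod z + M) * norm f"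
    using M_nonneg by (intro mult_left_mono le) simp
  finally have A: "norm (R f) + norm (A_op (R f)) \<le> (2 + cmod z + M) * norm f"
    using le by (simp add: algebra_simps)
  show "sobolev_norm 2 (R f) \<le> (2 + cmod z + M) * norm f"
    by (rule order_trans[OF sobolev_norm_2_le[OF dom] A])
  have "(norm (weak_deriv (R f)))\<^sup>2 \<le> (norm (R f) + norm (A_op (R f)))\<^sup>2"
    unfolding power2_sum
    by (rule order_trans[OF norm_weak_deriv_dom_A[OF dom]]) (simp add: mult.commute)
  then have "norm (weak_deriv (R f)) \<le> norm (R f) + norm (A_op (R f))"
    by (rule power2_le_imp_le) simp
  then show "norm (weak_deriv (R f)) \<le> (2 + cmod z + M) * norm f"
    using A by (rule order_trans)
qed

text \<open>The second resolvent identity.\<close>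

lemma resolvent_diff:
  assumes "perturbed_diagonal cosv neumann_mu dom_A A_op B M" "perturbed_diagonal cosv neumann_mu dom_A A_op B' M"
    and z: "Re z \<le> - M - 1"
  defines "R \<equiv> resolvent dom_A (\<lambda>u. A_op u + B u) z" and "R' \<equiv> resolvent dom_A (\<lambda>u. A_op u + B' u) z"
  shows "R f - R' f = R (B' (R' f) - B (R' f))"
proof -
  note res = resolvent_estimates(1)[OF assms(1) z] and res' = resolvent_estimates(1)[OF assms(2) z]
  let ?u = "R' f"
  have "R (A_op ?u + B ?u - z *\<^sub>C ?u) = ?u"
    unfolding R_def by (rule resolvent_left_inverse[OF res]) (unfold R'_def, rule resolvent_in_domain[OF res'])
  then have "R f - ?u = R f - R (A_op ?u + B ?u - z *\<^sub>C ?u)"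
    by simp
  also have "\<dots> = R (f - (A_op ?u + B ?u - z *\<^sub>C ?u))"
    unfolding R_def by (rule linear_diff[OF bounded_linear.linear[OF bounded_linear_resolvent[OF res]], symmetric])
  also have "f - (A_op ?u + B ?u - z *\<^sub>C ?u) = (A_op ?u + B' ?u - z *\<^sub>C ?u) - (A_op ?u + B ?u - z *\<^sub>C ?u)"
    unfolding R'_def resolvent_right_inverse[OF res'] ..
  also have "\<dots> = B' ?u - B ?u" by simp
  finally show ?thesis .
qed

lemma resolvent_bounded_into_sobolev:
  assumes "perturbed_diagonal cosv neumann_mu dom_A A_op B M" and z: "Re z \<le> - M - 1"
  shows "bounded_into_sobolev 2 (resolvent dom_A (\<lambda>u. A_op u + B u) z)"
  unfolding bounded_into_sobolev_def
proof (intro conjI exI allI)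
  note est = resolvent_estimates[OF assms]
  show "linear (resolvent dom_A (\<lambda>u. A_op u + B u) z)"
    by (rule bounded_linear.linear[OF bounded_linear_resolvent[OF est(1)]])
  show "range (resolvent dom_A (\<lambda>u. A_op u + B u) z) \<subseteq> sobolev 2"
    using est(2) by (auto simp: dom_A_def)
  show "sobolev_norm 2 (resolvent dom_A (\<lambda>u. A_op u + B u) z f) \<le> (2 + cmod z + M) * norm f" for f
    by (rule est(4))
qed

theorem theorem1:
  fixes V Q :: "unit_interval Linf"
  shows
    "(\<forall>\<alpha>\<in>{0..1}. \<forall>\<beta>\<in>{0..1}.
        m_sectorial dom_A (H_op V Q \<alpha> \<beta>) \<and>
        associated_form dom_A (H_op V Q \<alpha> \<beta>) (sobolev 1) (h_form V Q \<alpha> \<beta>)) \<and>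
     (\<exists>\<Lambda>::real.
        (\<forall>\<alpha>\<in>{0..1}. \<forall>\<beta>\<in>{0..1}. {z. Re z \<le> \<Lambda>} \<subseteq> resolvent_set dom_A (H_op V Q \<alpha> \<beta>)) \<and>
        (\<forall>z. Re z \<le> \<Lambda> \<longrightarrow> (\<exists>C.
           (\<forall>\<alpha>\<in>{0..1}. \<forall>\<beta>\<in>{0..1}.
              bounded_into_sobolev 2 (resolvent dom_A (H_op V Q \<alpha> \<beta>) z) \<and>
              onorm_sobolev 2 (resolvent dom_A (H_op V Q \<alpha> \<beta>) z) \<le> C) \<and>
           (\<forall>\<alpha>\<^sub>1\<in>{0..1}. \<forall>\<beta>\<^sub>1\<in>{0..1}. \<forall>\<alpha>\<^sub>2\<in>{0..1}. \<forall>\<beta>\<^sub>2\<in>{0..1}.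
              onorm_sobolev 2 (\<lambda>f. resolvent dom_A (H_op V Q \<alpha>\<^sub>1 \<beta>\<^sub>1) z f -
                                   resolvent dom_A (H_op V Q \<alpha>\<^sub>2 \<beta>\<^sub>2) z f)
                \<le> C * (sqrt \<bar>\<alpha>\<^sub>1 - \<alpha>\<^sub>2\<bar> + sqrt \<bar>\<beta>\<^sub>1 - \<beta>\<^sub>2\<bar>))))) \<and>
     (\<forall>\<alpha>\<in>{0..1}. \<forall>\<beta>\<in>{0..1}.
        compact_resolvent dom_A (H_op V Q \<alpha> \<beta>) \<and>
        spectrum dom_A (H_op V Q \<alpha> \<beta>) = eigenvalues dom_A (H_op V Q \<alpha> \<beta>) \<and>
        countable (spectrum dom_A (H_op V Q \<alpha> \<beta>)) \<and>
        infinite (spectrum dom_A (H_op V Q \<alpha> \<beta>)) \<and>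
        (\<forall>z. \<not> z islimpt spectrum dom_A (H_op V Q \<alpha> \<beta>))) \<and>
     eigenvalues_continuous_on ({0..1} \<times> {0..1}) (\<lambda>_. dom_A) (\<lambda>(\<alpha>, \<beta>). H_op V Q \<alpha> \<beta>)"
proof -
  obtain M where pert: "\<And>\<alpha> \<beta>. perturbed_diagonal cosv neumann_mu dom_A A_op (B_op V Q \<alpha> \<beta>) M"
    and Lipschitz: "\<And>\<alpha> \<beta> \<alpha>' \<beta>' u w. has_weak_derivative u w \<Longrightarrow> norm (B_op V Q \<alpha> \<beta> u - B_op V Q \<alpha>' \<beta>' u)
      \<le> 3 * M * (sqrt \<bar>\<alpha> - \<alpha>'\<bar> + sqrt \<bar>\<beta> - \<beta>'\<bar>) * (norm u + norm w)"
    by (rule B_op_properties[of V Q]) (rule that)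
  have "0 \<le> M" by (rule perturbed_diagonal.M_nonneg[OF pert])
  have msec: "m_sectorial dom_A (H_op V Q \<alpha> \<beta>)" for \<alpha> \<beta>
    unfolding H_op_eq by (rule perturbed_diagonal.m_sectorial[OF pert])
  have form: "associated_form dom_A (H_op V Q \<alpha> \<beta>) (sobolev 1) (h_form V Q \<alpha> \<beta>)" for \<alpha> \<beta>
    using associated_form_sobolev_1[OF pert] by (simp add: H_op_eq h_form_B_op[abs_def])
  have half_plane: "{z. Re z \<le> - M - 1} \<subseteq> resolvent_set dom_A (H_op V Q \<alpha> \<beta>)" for \<alpha> \<beta>
    unfolding H_op_eq using resolvent_estimates(1)[OF pert] by blast
  have estimates: "\<exists>C. (\<forall>\<alpha>\<in>{0..1}. \<forall>\<beta>\<in>{0..1}.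
        bounded_into_sobolev 2 (resolvent dom_A (H_op V Q \<alpha> \<beta>) z) \<and>
        onorm_sobolev 2 (resolvent dom_A (H_op V Q \<alpha> \<beta>) z) \<le> C) \<and>
      (\<forall>\<alpha>\<in>{0..1}. \<forall>\<beta>\<in>{0..1}. \<forall>\<alpha>'\<in>{0..1}. \<forall>\<beta>'\<in>{0..1}.
        onorm_sobolev 2 (\<lambda>f. resolvent dom_A (H_op V Q \<alpha> \<beta>) z f - resolvent dom_A (H_op V Q \<alpha>' \<beta>') z f)
        \<le> C * (sqrt \<bar>\<alpha> - \<alpha>'\<bar> + sqrt \<bar>\<beta> - \<beta>'\<bar>))" if z: "Re z \<le> - M - 1" for z
  proof -
    \<comment> \<open>bounds both the resolvents and the derivatives of their values\<close>
    define K where "K = 2 + cmod z + M"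
    have "0 \<le> K" using \<open>0 \<le> M\<close> by (simp add: K_def)
    let ?R = "\<lambda>\<alpha> \<beta>. resolvent dom_A (H_op V Q \<alpha> \<beta>) z"
    note est = resolvent_estimates[OF pert z, folded H_op_eq K_def]
    have bound: "onorm_sobolev 2 (?R \<alpha> \<beta>) \<le> K" for \<alpha> \<beta>
      by (rule onorm_sobolev_le[OF est(4) \<open>0 \<le> K\<close>])
    have diff: "onorm_sobolev 2 (\<lambda>f. ?R \<alpha> \<beta> f - ?R \<alpha>' \<beta>' f)
        \<le> K * (3 * M * (1 + K)) * (sqrt \<bar>\<alpha> - \<alpha>'\<bar> + sqrt \<bar>\<beta> - \<beta>'\<bar>)" (is "_ \<le> ?C * ?d") for \<alpha> \<beta> \<alpha>' \<beta>'
    proof (rule onorm_sobolev_le)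
      show "0 \<le> ?C * ?d" using \<open>0 \<le> M\<close> \<open>0 \<le> K\<close> by simp
      fix f
      let ?u = "?R \<alpha>' \<beta>' f"
      have "has_weak_derivative ?u (weak_deriv ?u)"
        by (rule has_weak_derivative_weak_deriv[OF sobolev_1_I[OF est(2)]])
      then have "norm (B_op V Q \<alpha>' \<beta>' ?u - B_op V Q \<alpha> \<beta> ?u) \<le> 3 * M * ?d * (norm ?u + norm (weak_deriv ?u))"
        by (subst norm_minus_commute) (rule Lipschitz)
      also have "\<dots> \<le> 3 * M * ?d * (norm f + K * norm f)"
        using \<open>0 \<le> M\<close> by (intro mult_left_mono add_mono est(3) est(5)) simp
      finally have B: "norm (B_op V Q \<alpha>' \<beta>' ?u - B_op V Q \<alpha> \<beta> ?u) \<le> 3 * M * ?d * (norm f + K * norm f)" .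
      have "?R \<alpha> \<beta> f - ?u = ?R \<alpha> \<beta> (B_op V Q \<alpha>' \<beta>' ?u - B_op V Q \<alpha> \<beta> ?u)"
        by (rule resolvent_diff[OF pert pert z, folded H_op_eq])
      then have "sobolev_norm 2 (?R \<alpha> \<beta> f - ?u) \<le> K * norm (B_op V Q \<alpha>' \<beta>' ?u - B_op V Q \<alpha> \<beta> ?u)"
        using est(4) by simp
      also have "\<dots> \<le> K * (3 * M * ?d * (norm f + K * norm f))"
        by (rule mult_left_mono[OF B \<open>0 \<le> K\<close>])
      also have "\<dots> = ?C * ?d * norm f"
        by (simp add: algebra_simps)
      finally show "sobolev_norm 2 (?R \<alpha> \<beta> f - ?u) \<le> ?C * ?d * norm f" .
    qed
    have "0 \<le> K * (3 * M * (1 + K))" using \<open>0 \<le> M\<close> \<open>0 \<le> K\<close> by simp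
    show ?thesis
    proof (intro exI conjI ballI)
      show "bounded_into_sobolev 2 (?R \<alpha> \<beta>)" for \<alpha> \<beta>
        unfolding H_op_eq by (rule resolvent_bounded_into_sobolev[OF pert z])
      \<comment> \<open>the sum serves as the common constant of both estimates\<close>
      show "onorm_sobolev 2 (?R \<alpha> \<beta>) \<le> K + K * (3 * M * (1 + K))" for \<alpha> \<beta>
        using bound[of \<alpha> \<beta>] \<open>0 \<le> K * (3 * M * (1 + K))\<close> by linarith
      show "onorm_sobolev 2 (\<lambda>f. ?R \<alpha> \<beta> f - ?R \<alpha>' \<beta>' f)
        \<le> (K + K * (3 * M * (1 + K))) * (sqrt \<bar>\<alpha> - \<alpha>'\<bar> + sqrt \<bar>\<beta> - \<beta>'\<bar>)" for \<alpha> \<beta> \<alpha>' \<beta>'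
        by (rule order_trans[OF diff mult_right_mono]) (use \<open>0 \<le> K\<close> in simp_all)
    qed
  qed
  have spec: "compact_resolvent dom_A (H_op V Q \<alpha> \<beta>)"
      "spectrum dom_A (H_op V Q \<alpha> \<beta>) = eigenvalues dom_A (H_op V Q \<alpha> \<beta>)"
      "countable (spectrum dom_A (H_op V Q \<alpha> \<beta>))" "infinite (spectrum dom_A (H_op V Q \<alpha> \<beta>))"
      "\<not> z islimpt spectrum dom_A (H_op V Q \<alpha> \<beta>)" for \<alpha> \<beta> z
    unfolding H_op_eq
    by (rule perturbed_diagonal.compact_resolvent[OF pert] perturbed_diagonal.spectrum_eq_eigenvalues[OF pert]
        perturbed_diagonal.countable_spectrum[OF pert] perturbed_diagonal.infinite_spectrum[OF pert]
        perturbed_diagonal.no_limit_point_spectrum[OF pert])+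
  have "eigenvalues_continuous_on ({0..1} \<times> {0..1}) (\<lambda>_. dom_A) (\<lambda>p u. A_op u + B_op V Q (fst p) (snd p) u)"
    by (rule neumann.eigenvalues_continuous[OF pert B_op_strongly_continuous])
  then have cont: "eigenvalues_continuous_on ({0..1} \<times> {0..1}) (\<lambda>_. dom_A) (\<lambda>(\<alpha>, \<beta>). H_op V Q \<alpha> \<beta>)"
    by (simp only: H_op_eq case_prod_beta')
  show ?thesis
    by (intro conjI ballI allI msec form spec cont, rule exI[of _ "- M - 1"],
        intro conjI ballI allI impI half_plane estimates)
qed

end
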